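(* Let $\mu$ be a Radon measure over $\mathbb{R}^n$ such that $$0 < \Theta_*^m(\mu,x) \le \Theta^{m*}(\mu,x) < \infty \quad \text{for } \mu \text{ almost all } x, \qquad (\mathrm{D})$$ and let $l \in \{1,2,\ldots,m+2\}$, $\alpha \in (0,1]$, and $p \in [1,\infty)$. Assume $\mathcal{K}^{l,p,\alpha}_{\mu}(a,1) < \infty$ for $\mu$ almost all $a$. Then $\mathbb{R}^n$ is countably $(\mu,m)$ rectifiable of class $\mathscr{C}^{1,\alpha}$ and $\mu$ is absolutely continuous with respect to $\mathcal{H}^m$. Moreover, if $\alpha < 1$, then for any $\varepsilon \in (0,1-\alpha)$ there exists a measure $\mu$ over $\mathbb{R}^n$ satisfying (D) and $\mathcal{K}^{l,p,\alpha}_{\mu}(a,1) < \infty$ for $\mu$ almost all $a$ and such that $\mathbb{R}^n$ is not countably $(\mu,m)$ rectifiable of class $\mathscr{C}^{1,\alpha+\varepsilon}$.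
   Context: Throughout, $n,m$ are integers with $1 \le m < n$; $\mathbf{B}(a,r)$ is the closed ball in $\mathbb{R}^n$; $\mathcal{H}^m$ is the $m$-dimensional Hausdorff measure; $\boldsymbol{\alpha}(m)$ is the Lebesgue measure of the unit ball in $\mathbb{R}^m$. "Measure" means outer measure in the sense of Federer. Densities: $\Theta_*^m(\mu,x) = \liminf_{r\downarrow 0} \frac{\mu(\mathbf{B}(x,r))}{\boldsymbol{\alpha}(m) r^m}$ and $\Theta^{m*}(\mu,x) = \limsup_{r\downarrow 0} \frac{\mu(\mathbf{B}(x,r))}{\boldsymbol{\alpha}(m) r^m}$. Rectifiability: a set $E \subseteq \mathbb{R}^n$ is countably $(\mu,m)$ rectifiable of class $\mathscr{C}^{1,\beta}$ if there exists a countable family $\mathcal{A}$ of $m$-dimensional submanifolds of $\mathbb{R}^n$ of class $\mathscr{C}^{1,\beta}$ such that $\mu(E \setminus \bigcup \mathcal{A}) = 0$. (A map is of class $\mathscr{C}^{1,\beta}$ if it is continuously differentiable and its derivative satisfies the Hölder condition with exponent $\beta$.) Discrete curvature: for $T=(a_0,\ldots,a_{m+1}) \in (\mathbb{R}^n)^{m+2}$ let $\triangle T$ be the convex hull of $\{a_0,\ldots,a_{m+1}\}$ and $$\kappa(T) = \frac{\mathcal{H}^{m+1}(\triangle T)}{\operatorname{diam}(\triangle T)^{m+1}} \text{ if } \operatorname{diam}(\triangle T)>0, \qquad \kappa(T)=0 \text{ otherwise.}$$ For $a \in \mathbb{R}^n$, $r \in (0,\infty]$, $l\in\{1,\dots,m+2\}$,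 $\alpha\in[0,1]$, $p\in[1,\infty)$ put $$\kappa^{l,p,\alpha}_{\mu,a,r}(a_1,\ldots,a_{l-1}) = (\mu^{m+2-l})\operatorname*{ess\,sup}_{a_l,\ldots,a_{m+1} \in \mathbf{B}(a,r)} \frac{\kappa(a,a_1,\ldots,a_{m+1})^p}{\operatorname{diam}(\{a,a_1,\ldots,a_{m+1}\})^{m(l-1)+\alpha p}},$$ $$\mathcal{K}^{l,p,\alpha}_{\mu}(a,r) = \int_{\mathbf{B}(a,r)} \cdots \int_{\mathbf{B}(a,r)} \kappa^{l,p,\alpha}_{\mu,a,r}(b_1,\ldots,b_{l-1}) \, d\mu(b_1)\cdots d\mu(b_{l-1}),$$ with the understanding that there is no essential supremum in case $l=m+2$ and no integral in case $l=1$. Here $\mu^{k}$ is the product of $k$ copies of $\mu$, and the quotient is read as $0$ when the diameter is $0$. *)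

theory Defs
  imports "HOL-Analysis.Analysis" "HOL-Probability.Essential_Supremum"
begin

text \<open>
  Measures in the sense of Federer are outer measures, that is, functions
  \<^typ>\<open>'a set \<Rightarrow> ennreal\<close> with \<^prop>\<open>outer_measure_space UNIV \<mu>\<close>.
\<close>

abbreviation caratheodory_sets :: "('a set \<Rightarrow> ennreal) \<Rightarrow> 'a set set" where
  "caratheodory_sets \<mu> \<equiv> lambda_system UNIV UNIV \<mu>"

definition radon_measure :: "('a::topological_space set \<Rightarrow> ennreal) \<Rightarrow> bool" where
  "radon_measure \<mu> \<longleftrightarrow>
     outer_measure_space UNIV \<mu> \<and>
     (\<forall>K. compact K \<longrightarrow> \<mu> K < \<infinity>) \<and>
     (\<forall>V. open V \<longrightarrow> V \<in> caratheodory_sets \<mu> \<and> \<mu> V = (SUP K\<in>{K. compact K \<and> K \<subseteq> V}. \<mu> K)) \<and>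
     (\<forall>A. \<mu> A = (INF V\<in>{V. open V \<and> A \<subseteq> V}. \<mu> V))"

definition almost_all :: "('a set \<Rightarrow> ennreal) \<Rightarrow> ('a \<Rightarrow> bool) \<Rightarrow> bool" where
  "almost_all \<mu> P \<longleftrightarrow> \<mu> {x. \<not> P x} = 0"

definition abs_continuous :: "('a set \<Rightarrow> ennreal) \<Rightarrow> ('a set \<Rightarrow> ennreal) \<Rightarrow> bool" where
  "abs_continuous \<mu> \<nu> \<longleftrightarrow> (\<forall>A. \<nu> A = 0 \<longrightarrow> \<mu> A = 0)"

text \<open>
  The restriction of an outer measure to its Caratheodory measurable sets, with respect to
  which integrals and products are taken.
\<close>

definition measure_space_of :: "('a set \<Rightarrow> ennreal) \<Rightarrow> 'a measure" where
  "measure_space_of \<mu> = measure_of UNIV (caratheodory_sets \<mu>) \<mu>"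

lemma
  assumes "outer_measure_space UNIV \<mu>"
  shows space_measure_space_of [simp]: "space (measure_space_of \<mu>) = UNIV"
    and sets_measure_space_of: "sets (measure_space_of \<mu>) = caratheodory_sets \<mu>"
    and emeasure_measure_space_of: "A \<in> caratheodory_sets \<mu> \<Longrightarrow> emeasure (measure_space_of \<mu>) A = \<mu> A"
proof -
  interpret sigma_algebra UNIV "UNIV :: 'a set set"
    using sigma_algebra_Pow[of "UNIV :: 'a set"] by simp
  have ms: "measure_space UNIV (caratheodory_sets \<mu>) \<mu>"
    using caratheodory_lemma[OF assms] .
  then have sa: "sigma_algebra UNIV (caratheodory_sets \<mu>)"
    by (simp add: measure_space_def)
  show "space (measure_space_of \<mu>) = UNIV"
    by (simp add: measure_space_of_def space_measure_of_conv)
  show s: "sets (measure_space_of \<mu>) = caratheodory_sets \<mu>"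
    unfolding measure_space_of_def using sigma_algebra.sets_measure_of_eq[OF sa] .
  show "emeasure (measure_space_of \<mu>) A = \<mu> A" if "A \<in> caratheodory_sets \<mu>"
    using that ms s
    by (intro emeasure_measure_of[OF measure_space_of_def]) (auto simp: measure_space_def)
qed


text \<open>
  Hausdorff measure, normalised by the volume \<^term>\<open>unit_ball_vol (real d)\<close> of the unit
  ball in dimension \<open>d\<close>. The covering sets are required to be bounded because
  \<^const>\<open>diameter\<close> is unspecified on unbounded sets, and the case distinction on the empty
  set matters only for \<open>d = 0\<close>, where \<open>0 ^ 0 = 1\<close>.
\<close>

definition hausdorff_premeasure :: "nat \<Rightarrow> real \<Rightarrow> 'a::metric_space set \<Rightarrow> ennreal" where
  "hausdorff_premeasure d \<delta> A =
     (INF S \<in> {S :: nat \<Rightarrow> 'a set. A \<subseteq> (\<Union>i. S i) \<and> (\<forall>i. bounded (S i) \<and> diameter (S i) \<le> \<delta>)}.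
        \<Sum>i. if S i = {} then 0 else ennreal (unit_ball_vol (real d) * (diameter (S i) / 2) ^ d))"

definition hausdorff_measure :: "nat \<Rightarrow> 'a::metric_space set \<Rightarrow> ennreal" where
  "hausdorff_measure d A = (SUP \<delta>\<in>{0<..}. hausdorff_premeasure d \<delta> A)"


definition lower_density :: "nat \<Rightarrow> ('a::metric_space set \<Rightarrow> ennreal) \<Rightarrow> 'a \<Rightarrow> ennreal" where
  "lower_density m \<mu> x =
     Liminf (at_right 0) (\<lambda>r. \<mu> (cball x r) / ennreal (unit_ball_vol (real m) * r ^ m))"

definition upper_density :: "nat \<Rightarrow> ('a::metric_space set \<Rightarrow> ennreal) \<Rightarrow> 'a \<Rightarrow> ennreal" where
  "upper_density m \<mu> x =
     Limsup (at_right 0) (\<lambda>r. \<mu> (cball x r) / ennreal (unit_ball_vol (real m) * r ^ m))"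

definition density_condition :: "nat \<Rightarrow> ('a::metric_space set \<Rightarrow> ennreal) \<Rightarrow> bool" where
  "density_condition m \<mu> \<longleftrightarrow>
     almost_all \<mu> (\<lambda>x. 0 < lower_density m \<mu> x \<and> lower_density m \<mu> x \<le> upper_density m \<mu> x \<and>
                       upper_density m \<mu> x < \<infinity>)"


definition C1_hoelder_on ::
  "real \<Rightarrow> 'a::real_normed_vector set \<Rightarrow> ('a \<Rightarrow> 'b::real_normed_vector) \<Rightarrow> bool" where
  "C1_hoelder_on \<beta> U f \<longleftrightarrow>
     (\<exists>f' :: 'a \<Rightarrow> 'a \<Rightarrow>\<^sub>L 'b.
        (\<forall>x\<in>U. (f has_derivative blinfun_apply (f' x)) (at x)) \<and>
        continuous_on U f' \<and>
        (\<exists>C. \<forall>x\<in>U. \<forall>y\<in>U. norm (f' x - f' y) \<le> C * dist x y powr \<beta>))"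

text \<open>
  Submanifolds are embedded: locally they are straightened to a linear subspace by a
  diffeomorphism \<open>\<sigma>\<close> of class \<open>C\<^sup>1\<^sup>,\<^sup>\<beta>\<close> between open sets of the ambient space, with inverse
  \<open>\<tau>\<close>. As the neighbourhood \<open>U\<close> may be shrunk, a local Hoelder condition on the
  derivatives would give the same notion.
\<close>

definition C1_hoelder_submanifold :: "nat \<Rightarrow> real \<Rightarrow> 'a::euclidean_space set \<Rightarrow> bool" where
  "C1_hoelder_submanifold m \<beta> S \<longleftrightarrow>
     (\<forall>a\<in>S. \<exists>U V \<sigma> \<tau>. \<exists>Z :: 'a set.
        open U \<and> a \<in> U \<and> open V \<and> homeomorphism U V \<sigma> \<tau> \<and>
        C1_hoelder_on \<beta> U \<sigma> \<and> C1_hoelder_on \<beta> V \<tau> \<and>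
        subspace Z \<and> dim Z = m \<and> \<sigma> ` (S \<inter> U) = Z \<inter> V)"

definition countably_rectifiable ::
  "('a::euclidean_space set \<Rightarrow> ennreal) \<Rightarrow> nat \<Rightarrow> real \<Rightarrow> 'a set \<Rightarrow> bool" where
  "countably_rectifiable \<mu> m \<beta> E \<longleftrightarrow>
     (\<exists>\<A>. countable \<A> \<and> (\<forall>S\<in>\<A>. C1_hoelder_submanifold m \<beta> S) \<and> \<mu> (E - \<Union>\<A>) = 0)"


text \<open>
  A tuple \<open>(a\<^sub>0, \<dots>, a\<^sub>m\<^sub>+\<^sub>1)\<close> is a function on \<^typ>\<open>nat\<close> of which only the values at
  \<open>0, \<dots>, m + 1\<close> are used. The Hausdorff measure below is that of a simplex of dimension at
  most \<open>m + 1\<close>, hence finite, so \<^const>\<open>enn2real\<close> loses nothing.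
\<close>

definition discrete_curvature :: "nat \<Rightarrow> (nat \<Rightarrow> 'a::euclidean_space) \<Rightarrow> real" where
  "discrete_curvature m T =
     (let \<Delta> = convex hull (T ` {0..m + 1})
      in if diameter \<Delta> > 0 then enn2real (hausdorff_measure (m + 1) \<Delta>) / diameter \<Delta> ^ (m + 1)
         else 0)"

text \<open>The quotient is \<open>0\<close> if the diameter is, since \<open>0 powr s = 0\<close> and \<open>t / 0 = 0\<close>.\<close>

definition curvature_quotient ::
  "nat \<Rightarrow> nat \<Rightarrow> real \<Rightarrow> real \<Rightarrow> (nat \<Rightarrow> 'a::euclidean_space) \<Rightarrow> ennreal" where
  "curvature_quotient m l p \<alpha> T =
     ennreal (discrete_curvature m T powr p /
              diameter (T ` {0..m + 1}) powr (real m * (real l - 1) + \<alpha> * p))"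

text \<open>
  The points \<open>a\<^sub>1, \<dots>, a\<^sub>l\<^sub>-\<^sub>1\<close> are given by \<open>b\<close>, and \<open>a\<^sub>l, \<dots>, a\<^sub>m\<^sub>+\<^sub>1\<close> by the variable \<open>c\<close>
  of the essential supremum. For \<open>l = m + 2\<close> the product measure is over the empty index
  set, a unit mass on one point, and the essential supremum is just the value of the quotient.
\<close>

definition curvature_esssup ::
  "nat \<Rightarrow> nat \<Rightarrow> real \<Rightarrow> real \<Rightarrow> ('a::euclidean_space set \<Rightarrow> ennreal) \<Rightarrow> 'a \<Rightarrow> real \<Rightarrow>
     (nat \<Rightarrow> 'a) \<Rightarrow> ennreal" where
  "curvature_esssup m l p \<alpha> \<mu> a r b =
     esssup (Pi\<^sub>M {l..m + 1} (\<lambda>_. restrict_space (measure_space_of \<mu>) (cball a r)))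
       (\<lambda>c. curvature_quotient m l p \<alpha> (\<lambda>i. if i = 0 then a else if i < l then b i else c i))"

text \<open>
  The \<open>k\<close>-fold iterated integral of \<open>F\<close> in the variables \<open>b\<^sub>1, \<dots>, b\<^sub>k\<close> over a set \<open>B\<close>, with
  \<open>b\<^sub>1\<close> innermost.
\<close>

primrec iterated_integral ::
  "'a measure \<Rightarrow> 'a set \<Rightarrow> nat \<Rightarrow> ((nat \<Rightarrow> 'a) \<Rightarrow> ennreal) \<Rightarrow> (nat \<Rightarrow> 'a) \<Rightarrow> ennreal" where
  "iterated_integral M B 0 F b = F b"
| "iterated_integral M B (Suc k) F b =
     (\<integral>\<^sup>+x\<in>B. iterated_integral M B k F (b(Suc k := x)) \<partial>M)"

text \<open>
  The initial value of the tuple of integration variables is irrelevant, because exactly the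
  values at \<open>1, \<dots>, l - 1\<close> are used and all of them are overwritten.
\<close>

definition curvature_integral ::
  "nat \<Rightarrow> nat \<Rightarrow> real \<Rightarrow> real \<Rightarrow> ('a::euclidean_space set \<Rightarrow> ennreal) \<Rightarrow> 'a \<Rightarrow> real \<Rightarrow> ennreal" where
  "curvature_integral m l p \<alpha> \<mu> a r =
     iterated_integral (measure_space_of \<mu>) (cball a r) (l - 1) (curvature_esssup m l p \<alpha> \<mu> a r)
       (\<lambda>_. a)"

end

theory Submission
  imports Defs
begin

text \<open>
  Rectifiability: by (D) and a density argument, at almost every point \<open>a\<close> and every small scale
  \<open>r\<close> the measure is not concentrated near planes of dimension less than \<open>m\<close>. One can therefore
  choose points \<open>a\<^sub>1, \<dots>, a\<^sub>m\<close> in \<open>\<^bold>B(a, r)\<close> spanning a fat simplex for which the remaining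
  integrals and essential suprema are controlled; finiteness of the curvature then puts most of
  \<open>\<mu>\<close> in \<open>\<^bold>B(a, r)\<close> within \<open>C r\<^sup>1\<^sup>+\<^sup>\<alpha>\<close> of an \<open>m\<close>-plane. Comparing these planes for different
  scales and base points yields tangent planes depending Hoelder continuously on the point, hence
  jets to which Whitney's extension theorem of class \<open>C\<^sup>1\<^sup>,\<^sup>\<alpha>\<close> applies; the submanifolds are
  level sets of the extension.

  Sharpness: \<open>\<mu>\<close> is the image of Lebesgue measure under the graph map of a lacunary cosine series
  \<open>u\<close> of one variable, of class \<open>C\<^sup>1\<^sup>,\<^sup>\<alpha>\<^sup>'\<close> with \<open>\<alpha> < \<alpha>' < \<gamma> < \<alpha> + \<epsilon>\<close>. The Taylor estimate makes
  the integrand of the curvature integrable. On the other hand the second differences of \<open>u\<close> at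
  suitable steps \<open>h\<close> are nowhere smaller than \<open>c h\<^sup>1\<^sup>+\<^sup>\<gamma>\<close>, whereas a submanifold of class
  \<open>C\<^sup>1\<^sup>,\<^sup>\<alpha>\<^sup>+\<^sup>\<epsilon>\<close> meeting the graph in positive measure contains, by Steinhaus' argument, the graph
  points over all small translates needed to bound such a second difference by \<open>C h\<^sup>1\<^sup>+\<^sup>\<alpha>\<^sup>+\<^sup>\<epsilon>\<close>.
\<close>

section \<open>Whitney extension of class \<open>C\<^sup>1\<^sup>,\<^sup>\<alpha>\<close>\<close>

text \<open>The exponents balance as follows. In a ball of radius \<open>r\<close> the curvature of
  a fat simplex dominates the distance of its last vertex from the \<open>m\<close>-plane of the
  others, divided by \<open>r\<close>. Each integrated vertex ranges over a set of mass comparable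
  to \<open>r ^ m\<close> and costs a factor of order \<open>1 / r ^ m\<close>; the part
  \<open>m * (l - 1)\<close> of the exponent of the diameter absorbs these factors, and the part
  \<open>\<alpha> * p\<close> turns a bounded quotient into a distance of order
  \<open>r powr (1 + \<alpha>)\<close>. The obstacle is that a plane fits only outside a set of
  small mass, so that no single point is known to be close to it. Planes of two scales or two base
  points are therefore compared through points that are good for both, and this also places the
  second base point near the limit plane of the first. The jet to be extended is then zero with
  derivative the limit of the normal projections. In the sharpness part, upper bounds for
  \<open>esssup\<close> need Borel measurability of the curvature, although Hausdorff measure is
  defined by coverings with arbitrary sets.\<close>

text \<open>Bounds for a function and its derivative that are invariant under rescaling a ball of
  radius \<open>t\<close> to the unit ball.\<close>

definition scaled_C11 ::
  "'a::real_normed_vector \<Rightarrow> real \<Rightarrow> real \<Rightarrow> ('a \<Rightarrow> 'b::real_normed_vector) \<Rightarrow> ('a \<Rightarrow> 'a \<Rightarrow>\<^sub>L 'b) \<Rightarrow> bool" where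
  "scaled_C11 x0 t A g g' \<longleftrightarrow>
     (\<forall>x\<in>ball x0 t. (g has_derivative blinfun_apply (g' x)) (at x)) \<and>
     (\<forall>x\<in>ball x0 t. norm (g x) \<le> A) \<and>
     (\<forall>x\<in>ball x0 t. norm (g' x) \<le> A / t) \<and>
     (\<forall>x\<in>ball x0 t. \<forall>y\<in>ball x0 t. norm (g' x - g' y) \<le> A / t\<^sup>2 * norm (x - y))"

section \<open>Sums, products and inverses under scale-invariant bounds\<close>

lemma scaled_C11_lipschitz:
  assumes "scaled_C11 x0 t A g g'" "x \<in> ball x0 t" "y \<in> ball x0 t"
  shows "norm (g x - g y) \<le> A / t * norm (x - y)"
proof (rule differentiable_bound[of "ball x0 t" g "\<lambda>x. blinfun_apply (g' x)"])
  show "(g has_derivative blinfun_apply (g' x)) (at x within ball x0 t)" if "x \<in> ball x0 t" for x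
    using assms(1) that unfolding scaled_C11_def by (auto intro: has_derivative_at_withinI)
  show "onorm (blinfun_apply (g' x)) \<le> A / t" if "x \<in> ball x0 t" for x
    using assms(1) that unfolding scaled_C11_def by (simp add: norm_blinfun.rep_eq)
qed (use assms in auto)

lemma scaled_C11_nonneg: "scaled_C11 x0 t A g g' \<Longrightarrow> 0 < t \<Longrightarrow> 0 \<le> A"
  unfolding scaled_C11_def by (meson centre_in_ball norm_ge_zero order_trans)

lemma scaled_C11_mono:
  assumes "scaled_C11 x0 t A g g'" "A \<le> B" "0 < t"
  shows "scaled_C11 x0 t B g g'"
proof -
  have "A / t \<le> B / t" "A / t\<^sup>2 \<le> B / t\<^sup>2"
    using assms by (simp_all add: divide_right_mono)
  then show ?thesis
    using assms(1,2) unfolding scaled_C11_def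
    by (meson mult_right_mono norm_ge_zero order_trans)
qed

lemma scaled_C11_shrink:
  assumes "scaled_C11 x0 s A g g'" "0 < t" "t \<le> s"
  shows "scaled_C11 x0 t A g g'"
proof -
  have A: "0 \<le> A"
    using assms scaled_C11_nonneg by fastforce
  have "A / s \<le> A / t" "A / s\<^sup>2 \<le> A / t\<^sup>2"
    using assms A by (auto intro!: divide_left_mono power_mono)
  then show ?thesis
    using assms(1) subset_ball[OF assms(3), of x0] unfolding scaled_C11_def
    by (meson mult_right_mono norm_ge_zero order_trans subsetD)
qed

lemma scaled_C11_zero: "0 \<le> A \<Longrightarrow> 0 < t \<Longrightarrow> scaled_C11 x0 t A (\<lambda>_. 0) (\<lambda>_. 0)"
  unfolding scaled_C11_def by (auto simp: zero_blinfun.rep_eq fun_eq_iff)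

lemma scaled_C11_add:
  assumes "scaled_C11 x0 t A g g'" "scaled_C11 x0 t B h h'"
  shows "scaled_C11 x0 t (A + B) (\<lambda>x. g x + h x) (\<lambda>x. g' x + h' x)"
  unfolding scaled_C11_def
proof (intro conjI ballI)
  note G = assms(1)[unfolded scaled_C11_def] and H = assms(2)[unfolded scaled_C11_def]
  fix x assume x: "x \<in> ball x0 t"
  show "((\<lambda>x. g x + h x) has_derivative blinfun_apply (g' x + h' x)) (at x)"
    using G H x by (auto simp: plus_blinfun.rep_eq intro!: has_derivative_add)
  show "norm (g x + h x) \<le> A + B"
    using G H x by (meson add_mono norm_triangle_ineq order_trans)
  show "norm (g' x + h' x) \<le> (A + B) / t"
    using G H x unfolding add_divide_distrib by (meson add_mono norm_triangle_ineq order_trans)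
  fix y assume y: "y \<in> ball x0 t"
  have "norm (g' x + h' x - (g' y + h' y)) \<le> norm (g' x - g' y) + norm (h' x - h' y)"
    by (metis add_diff_add norm_triangle_ineq)
  also have "\<dots> \<le> A / t\<^sup>2 * norm (x - y) + B / t\<^sup>2 * norm (x - y)"
    using G H x y by (intro add_mono) auto
  finally show "norm (g' x + h' x - (g' y + h' y)) \<le> (A + B) / t\<^sup>2 * norm (x - y)"
    by (simp add: add_divide_distrib distrib_right)
qed

lemma scaled_C11_sum:
  assumes "finite I" "\<And>i. i \<in> I \<Longrightarrow> scaled_C11 x0 t A (g i) (g' i)" "0 < t"
  shows "scaled_C11 x0 t (real (card I) * A) (\<lambda>x. \<Sum>i\<in>I. g i x) (\<lambda>x. \<Sum>i\<in>I. g' i x)"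
  using assms(1,2)
proof (induction I rule: finite_induct)
  case empty
  then show ?case using assms(3) by (simp add: scaled_C11_zero)
next
  case (insert i I)
  have "scaled_C11 x0 t (A + real (card I) * A) (\<lambda>x. g i x + (\<Sum>i\<in>I. g i x)) (\<lambda>x. g' i x + (\<Sum>i\<in>I. g' i x))"
    using insert by (intro scaled_C11_add) auto
  moreover have "A + real (card I) * A = real (card (insert i I)) * A"
    using insert.hyps by (simp add: algebra_simps)
  ultimately show ?case using insert.hyps by simp
qed

text \<open>The increment of the product's derivative splits into four terms, each at most
  \<open>A * B / t\<^sup>2 * norm (x - y)\<close>; this is the \<open>4\<close>.\<close>

lemma scaled_C11_scaleR:
  fixes g :: "'a::real_normed_vector \<Rightarrow> real" and h :: "'a \<Rightarrow> 'b::real_normed_vector"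
  assumes g: "scaled_C11 x0 t A g g'" and h: "scaled_C11 x0 t B h h'" and t: "0 < t"
  shows "\<exists>k'. scaled_C11 x0 t (4 * A * B) (\<lambda>x. g x *\<^sub>R h x) k'"
proof -
  \<comment> \<open>\<open>T L v\<close> sends \<open>w\<close> to \<open>L w *\<^sub>R v\<close>:
    the contribution of the scalar factor's derivative to the product rule, made a bounded linear
    map.\<close>
  define T :: "('a \<Rightarrow>\<^sub>L real) \<Rightarrow> 'b \<Rightarrow> ('a \<Rightarrow>\<^sub>L 'b)" where "T L v = (blinfun_scaleR_left v) o\<^sub>L L" for L v
  have T: "blinfun_apply (T L v) w = blinfun_apply L w *\<^sub>R v" for L v w
    by (simp add: T_def)
  have nT: "norm (T L v) \<le> norm L * norm v" for L v
  proof (rule norm_blinfun_bound)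
    fix w
    have "norm (blinfun_apply L w) * norm v \<le> (norm L * norm w) * norm v"
      by (intro mult_right_mono norm_blinfun) auto
    then show "norm (blinfun_apply (T L v) w) \<le> norm L * norm v * norm w"
      by (simp add: T mult_ac)
  qed auto
  have Td: "T L v - T L' v' = T (L - L') v + T L' (v - v')" for L L' v v'
    by (rule blinfun_eqI) (simp add: T minus_blinfun.rep_eq plus_blinfun.rep_eq algebra_simps)
  define k' where "k' x = g x *\<^sub>R h' x + T (g' x) (h x)" for x
  note G = g[unfolded scaled_C11_def] and H = h[unfolded scaled_C11_def]
  have A: "0 \<le> A" and B: "0 \<le> B" using g h t scaled_C11_nonneg by blast+
  have "scaled_C11 x0 t (4 * A * B) (\<lambda>x. g x *\<^sub>R h x) k'"
    unfolding scaled_C11_def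
  proof (intro conjI ballI)
    fix x assume x: "x \<in> ball x0 t"
    show "((\<lambda>x. g x *\<^sub>R h x) has_derivative blinfun_apply (k' x)) (at x)"
      using has_derivative_scaleR[of g _ x UNIV h] G H x
      by (auto simp: k'_def plus_blinfun.rep_eq scaleR_blinfun.rep_eq T fun_eq_iff elim!: has_derivative_eq_rhs)
    have gx: "norm (g x) \<le> A" and g'x: "norm (g' x) \<le> A / t" and hx: "norm (h x) \<le> B"
      and h'x: "norm (h' x) \<le> B / t" using G H x by auto
    have "norm (g x) * norm (h x) \<le> A * B" using gx hx A by (intro mult_mono) auto
    also have "\<dots> \<le> 4 * A * B" using A B by simp
    finally show "norm (g x *\<^sub>R h x) \<le> 4 * A * B" by simp
    have "norm (k' x) \<le> norm (g x) * norm (h' x) + norm (g' x) * norm (h x)"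
      unfolding k'_def by (rule norm_triangle_le, rule add_mono) (use nT in auto)
    also have "\<dots> \<le> A * (B / t) + A / t * B"
      using gx hx g'x h'x A B t by (intro add_mono mult_mono) auto
    also have "\<dots> \<le> 4 * A * B / t" using A B t by (simp add: field_simps)
    finally show "norm (k' x) \<le> 4 * A * B / t" .
    fix y assume y: "y \<in> ball x0 t"
    have gy: "norm (g' y) \<le> A / t" and gy': "norm (g y) \<le> A" using G y by auto
    have eq: "k' x - k' y = (g x - g y) *\<^sub>R h' x + g y *\<^sub>R (h' x - h' y) + (T (g' x - g' y) (h x) + T (g' y) (h x - h y))"
      unfolding k'_def Td[symmetric] by (simp add: algebra_simps)
    have "norm (k' x - k' y) \<le> norm (g x - g y) * norm (h' x) + norm (g y) * norm (h' x - h' y)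
      + (norm (g' x - g' y) * norm (h x) + norm (g' y) * norm (h x - h y))"
      unfolding eq by (intro norm_triangle_le add_mono nT) auto
    also have "\<dots> \<le> (A / t * norm (x - y)) * (B / t) + A * (B / t\<^sup>2 * norm (x - y))
      + ((A / t\<^sup>2 * norm (x - y)) * B + A / t * (B / t * norm (x - y)))"
      using gy gy' h'x hx A B t G H x y scaled_C11_lipschitz[OF g x y] scaled_C11_lipschitz[OF h x y]
      by (intro add_mono mult_mono) auto
    also have "\<dots> = 4 * A * B / t\<^sup>2 * norm (x - y)"
      by (simp add: field_simps power2_eq_square)
    finally show "norm (k' x - k' y) \<le> 4 * A * B / t\<^sup>2 * norm (x - y)" .
  qed
  then show ?thesis by blast
qed

text \<open>The three summands of the constant come from the value \<open>1 / g\<close>, from the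
  derivative \<open>g' / g\<^sup>2\<close>, and from the variation of \<open>1 / g\<^sup>2\<close>
  inside the increment of that derivative.\<close>

lemma scaled_C11_inverse:
  fixes g :: "'a::real_normed_vector \<Rightarrow> real"
  assumes g: "scaled_C11 x0 t A g g'" and t: "0 < t" and c: "0 < c" and gc: "\<And>x. x \<in> ball x0 t \<Longrightarrow> c \<le> g x"
  shows "\<exists>k'. scaled_C11 x0 t (1 / c + A / c\<^sup>2 + 2 * A * A\<^sup>2 / c^4) (\<lambda>x. inverse (g x)) k'"
proof -
  let ?B = "1 / c + A / c\<^sup>2 + 2 * A * A\<^sup>2 / c^4"
  have A: "0 \<le> A" using g t scaled_C11_nonneg by blast
  define k' where "k' x = (- inverse ((g x)\<^sup>2)) *\<^sub>R g' x" for x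
  note G = g[unfolded scaled_C11_def]
  have "scaled_C11 x0 t ?B (\<lambda>x. inverse (g x)) k'"
    unfolding scaled_C11_def
  proof (intro conjI ballI)
    fix x assume x: "x \<in> ball x0 t"
    have gx: "c \<le> g x" "\<bar>g x\<bar> \<le> A" "norm (g' x) \<le> A / t" using G gc x by auto
    show "((\<lambda>x. inverse (g x)) has_derivative blinfun_apply (k' x)) (at x)"
      using Deriv.has_derivative_inverse[where f=g and x=x and f'="blinfun_apply (g' x)" and S=UNIV] G x c gx
      by (auto simp: k'_def scaleR_blinfun.rep_eq uminus_blinfun.rep_eq power2_eq_square fun_eq_iff mult_ac elim!: has_derivative_eq_rhs)
    have ix: "inverse (g x) \<le> 1 / c" "0 < inverse (g x)"
      using gx c by (simp_all add: field_simps)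
    then show "norm (inverse (g x)) \<le> ?B"
      using A by (simp add: add_increasing2)
    have i2: "inverse ((g x)\<^sup>2) \<le> 1 / c\<^sup>2" "0 \<le> inverse ((g x)\<^sup>2)"
      using power_mono[OF ix(1), of 2] ix(2) by (simp_all add: power_inverse power_divide)
    have "norm (k' x) = inverse ((g x)\<^sup>2) * norm (g' x)"
      by (simp add: k'_def)
    also have "\<dots> \<le> 1 / c\<^sup>2 * (A / t)"
      using i2 gx by (intro mult_mono) auto
    also have "\<dots> = (A / c\<^sup>2) / t"
      by simp
    also have "\<dots> \<le> ?B / t"
      using A c t by (intro divide_right_mono) auto
    finally show "norm (k' x) \<le> ?B / t" .
    fix y assume y: "y \<in> ball x0 t"
    have gy: "c \<le> g y" "\<bar>g y\<bar> \<le> A" "norm (g' y) \<le> A / t" using G gc y by auto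
    have eq: "k' x - k' y = (- inverse ((g x)\<^sup>2)) *\<^sub>R (g' x - g' y) + (inverse ((g y)\<^sup>2) - inverse ((g x)\<^sup>2)) *\<^sub>R g' y"
      unfolding k'_def by (simp add: algebra_simps)
    have pos: "0 < g x" "0 < g y" using gx gy c by auto
    have "inverse ((g y)\<^sup>2) - inverse ((g x)\<^sup>2) = (g x - g y) * (g x + g y) * (inverse ((g x)\<^sup>2) * inverse ((g y)\<^sup>2))"
      using pos by (simp add: field_simps power2_eq_square)
    then have "\<bar>inverse ((g y)\<^sup>2) - inverse ((g x)\<^sup>2)\<bar> = \<bar>g x - g y\<bar> * (g x + g y) * (inverse ((g x)\<^sup>2) * inverse ((g y)\<^sup>2))"
      using pos by (simp add: abs_mult)
    also have "\<dots> \<le> (A / t * norm (x - y)) * (2 * A) * ((1 / c\<^sup>2) * (1 / c\<^sup>2))"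
    proof -
      have "inverse ((g y)\<^sup>2) \<le> 1 / c\<^sup>2"
        using power_mono[of "inverse (g y)" "1/c" 2] pos gy c by (simp add: power_inverse power_divide field_simps)
      then show ?thesis
        using scaled_C11_lipschitz[OF g x y] i2 gx gy pos A t by (intro mult_mono) auto
    qed
    also have "\<dots> = (2 * A\<^sup>2 / c^4) / t * norm (x - y)"
      by (simp add: field_simps power2_eq_square eval_nat_numeral)
    finally have d: "\<bar>inverse ((g y)\<^sup>2) - inverse ((g x)\<^sup>2)\<bar> \<le> (2 * A\<^sup>2 / c^4) / t * norm (x - y)" .
    have "norm (k' x - k' y) \<le> inverse ((g x)\<^sup>2) * norm (g' x - g' y) + \<bar>inverse ((g y)\<^sup>2) - inverse ((g x)\<^sup>2)\<bar> * norm (g' y)"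
      unfolding eq by (rule norm_triangle_le) simp
    also have "\<dots> \<le> 1 / c\<^sup>2 * (A / t\<^sup>2 * norm (x - y)) + ((2 * A\<^sup>2 / c^4) / t * norm (x - y)) * (A / t)"
      using i2 d gy G x y A t by (intro add_mono mult_mono) auto
    also have "\<dots> = (A / c\<^sup>2 + 2 * A * A\<^sup>2 / c^4) / t\<^sup>2 * norm (x - y)"
      using c t by (simp add: field_simps power2_eq_square)
    also have "\<dots> \<le> ?B / t\<^sup>2 * norm (x - y)"
      using c by (intro mult_right_mono divide_right_mono) auto
    finally show "norm (k' x - k' y) \<le> ?B / t\<^sup>2 * norm (x - y)" .
  qed
  then show ?thesis by blast
qed

text \<open>Up to a factor this vector field is the gradient of \<open>bump\<close> in the rescaled
  variable, so its Lipschitz constant bounds the second order behaviour of the cutoff. If one point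
  lies outside the unit ball, the value at the other is controlled by its distance
  \<open>1 - norm y\<close> to the sphere; inside the ball the field is a polynomial.\<close>

lemma norm_cutoff_diff_le:
  fixes y z :: "'a::real_inner"
  shows "norm (max 0 (1 - (norm y)\<^sup>2) *\<^sub>R y - max 0 (1 - (norm z)\<^sup>2) *\<^sub>R z) \<le> 4 * norm (y - z)"
proof -
  have out: "norm (max 0 (1 - (norm y)\<^sup>2) *\<^sub>R y) \<le> 4 * norm (y - z)" if "norm z \<ge> 1" for y z :: 'a
  proof (cases "norm y \<le> 1")
    case True
    have "norm (max 0 (1 - (norm y)\<^sup>2) *\<^sub>R y) = (1 - norm y) * ((1 + norm y) * norm y)"
    proof -
      have "(norm y)\<^sup>2 \<le> 1" using True by (simp add: power_le_one)
      then show ?thesis unfolding norm_scaleR by (simp add: algebra_simps power2_eq_square max_def)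
    qed
    also have "\<dots> \<le> norm (y - z) * (2 * 1)"
    proof (intro mult_mono)
      show "1 - norm y \<le> norm (y - z)"
        using that norm_triangle_ineq2[of z y] by (simp add: norm_minus_commute)
    qed (use True in auto)
    finally show ?thesis
      using norm_ge_zero[of "y - z"] by linarith
  next
    case False
    then have "(norm y)\<^sup>2 \<ge> 1" by simp
    then show ?thesis by (simp add: max_def)
  qed
  consider "norm z \<ge> 1" | "norm y \<ge> 1" | "norm y \<le> 1" "norm z \<le> 1" by linarith
  then show ?thesis
  proof cases
    case 1
    then have "(norm z)\<^sup>2 \<ge> 1" by simp
    then show ?thesis using out[OF 1, of y] by (simp add: max_def)
  next
    case 2
    then have "(norm y)\<^sup>2 \<ge> 1" by simp
    then have e: "max 0 (1 - (norm y)\<^sup>2) = 0" by (simp add: max_def)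
    show ?thesis
      using out[OF 2, of z] unfolding e scaleR_zero_left diff_0 norm_minus_cancel norm_minus_commute[of y] .
  next
    case 3
    have 4: "(norm y)\<^sup>2 \<le> 1" "(norm z)\<^sup>2 \<le> 1" using 3 by (auto simp: power_le_one)
    have "(norm y)\<^sup>2 - (norm z)\<^sup>2 = (norm y - norm z) * (norm y + norm z)"
      by (simp add: power2_eq_square algebra_simps)
    then have "\<bar>(norm y)\<^sup>2 - (norm z)\<^sup>2\<bar> = \<bar>norm y - norm z\<bar> * (norm y + norm z)"
      by (simp add: abs_mult)
    also have "\<dots> \<le> norm (y - z) * 2"
      using 3 norm_triangle_ineq3[of y z] by (intro mult_mono) auto
    finally have d: "\<bar>(norm y)\<^sup>2 - (norm z)\<^sup>2\<bar> \<le> norm (y - z) * 2" .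
    have "max 0 (1 - (norm y)\<^sup>2) *\<^sub>R y - max 0 (1 - (norm z)\<^sup>2) *\<^sub>R z
        = (1 - (norm z)\<^sup>2) *\<^sub>R (y - z) - ((norm y)\<^sup>2 - (norm z)\<^sup>2) *\<^sub>R y"
      using 4 by (simp add: algebra_simps)
    also have "norm \<dots> \<le> \<bar>1 - (norm z)\<^sup>2\<bar> * norm (y - z) + \<bar>(norm y)\<^sup>2 - (norm z)\<^sup>2\<bar> * norm y"
      by (rule norm_triangle_le_diff) simp
    also have "\<dots> \<le> 1 * norm (y - z) + (norm (y - z) * 2) * 1"
      using 3 4 d by (intro add_mono mult_mono) auto
    finally show ?thesis
      using norm_ge_zero[of "y - z"] by linarith
  qed
qed

text \<open>Squaring the truncated paraboloid makes the derivative Lipschitz across the sphere of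
  radius \<open>s\<close>, which is exactly the regularity that \<open>scaled_C11\<close>
  records.\<close>

definition bump :: "'a::real_inner \<Rightarrow> real \<Rightarrow> 'a \<Rightarrow> real" where
  "bump c s x = (max 0 (1 - (norm ((x - c) /\<^sub>R s))\<^sup>2))\<^sup>2"

lemma bump_nonneg: "0 \<le> bump c s x"
  by (simp add: bump_def)

lemma bump_outside: "0 < s \<Longrightarrow> s \<le> dist x c \<Longrightarrow> bump c s x = 0"
proof -
  assume s: "0 < s" "s \<le> dist x c"
  then have "1 \<le> norm ((x - c) /\<^sub>R s)"
    unfolding norm_scaleR by (simp add: dist_norm field_simps)
  then have "1 \<le> (norm ((x - c) /\<^sub>R s))\<^sup>2" by simp
  then show ?thesis unfolding bump_def by (simp add: max_def del: norm_scaleR)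
qed

lemma bump_inside:
  assumes s: "0 < s" and "dist x c \<le> s / 2"
  shows "1 / 2 \<le> bump c s x"
proof -
  have "norm ((x - c) /\<^sub>R s) \<le> 1/2"
    using assms unfolding norm_scaleR by (simp add: dist_norm field_simps)
  then have "(norm ((x - c) /\<^sub>R s))\<^sup>2 \<le> (1/2)\<^sup>2" by (intro power_mono) auto
  moreover have "(1/2)\<^sup>2 = (1/4::real)" by (simp add: power2_eq_square)
  ultimately have "3/4 \<le> max 0 (1 - (norm ((x - c) /\<^sub>R s))\<^sup>2)" by linarith
  then have "(3/4)\<^sup>2 \<le> bump c s x" unfolding bump_def by (rule power_mono) simp
  then show ?thesis by (simp add: power2_eq_square)
qed

lemma has_derivative_max0_square:
  "((\<lambda>u::real. (max 0 u)\<^sup>2) has_real_derivative 2 * max 0 u) (at u)"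
proof -
  consider "u > 0" | "u < 0" | "u = 0" by linarith
  then show ?thesis
  proof cases
    case 1
    have "((\<lambda>u::real. u\<^sup>2) has_real_derivative 2 * max 0 u) (at u)"
      using 1 by (auto intro!: derivative_eq_intros)
    then show ?thesis
      by (rule has_field_derivative_transform_within_open[where S="{0<..}"]) (use 1 in auto)
  next
    case 2
    have "((\<lambda>u::real. 0) has_real_derivative 2 * max 0 u) (at u)"
      using 2 by (auto intro!: derivative_eq_intros)
    then show ?thesis
      by (rule has_field_derivative_transform_within_open[where S="{..<0}"]) (use 2 in auto)
  next
    case 3
    have "((\<lambda>h. (max 0 h)\<^sup>2 / h) \<longlongrightarrow> 0) (at (0::real))"
    proof (rule Lim_null_comparison[where g="\<lambda>h. \<bar>h\<bar>"])
      show "\<forall>\<^sub>F h in at (0::real). norm ((max 0 h)\<^sup>2 / h) \<le> \<bar>h\<bar>"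
        by (rule always_eventually) (auto simp: max_def power2_eq_square)
      show "((\<lambda>h. \<bar>h\<bar>) \<longlongrightarrow> 0) (at (0::real))" by (auto intro!: tendsto_eq_intros)
    qed
    then show ?thesis using 3 by (simp add: has_field_derivative_iff)
  qed
qed

text \<open>The natural scale of the bump is \<open>s\<close>; the smaller radius \<open>t\<close>
  comes from \<open>scaled_C11_shrink\<close>. The derivative is \<open>- 4 / s\<close> times a
  field with Lipschitz constant \<open>4 / s\<close>, hence \<open>16\<close>.\<close>

lemma scaled_C11_bump:
  fixes c :: "'a::real_inner"
  assumes t: "0 < t" and ts: "t \<le> s"
  shows "\<exists>k'. scaled_C11 x0 t 16 (bump c s) k'"
proof -
  have s: "0 < s" using assms by simp
  define q where "q x = (x - c) /\<^sub>R s" for x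
  define w where "w x = max 0 (1 - (norm (q x))\<^sup>2) *\<^sub>R q x" for x
  define k' where "k' x = (- 4 / s) *\<^sub>R blinfun_inner_left (w x)" for x :: 'a
  have w1: "norm (w x) \<le> 1" for x
  proof (cases "norm (q x) \<le> 1")
    case True
    then have "(norm (q x))\<^sup>2 \<le> 1" by (simp add: power_le_one)
    then show ?thesis using True by (simp add: w_def mult_le_one)
  next
    case False
    then have "(norm (q x))\<^sup>2 \<ge> 1" by simp
    then show ?thesis by (simp add: w_def max_def)
  qed
  have nil: "norm (blinfun_inner_left v) \<le> norm v" for v :: 'a
    by (rule norm_blinfun_bound) (auto simp: Cauchy_Schwarz_ineq2 mult.commute)
  have "scaled_C11 x0 s 16 (bump c s) k'"
    unfolding scaled_C11_def
  proof (intro conjI ballI)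
    fix x assume x: "x \<in> ball x0 s"
    have d1: "((\<lambda>x. 1 - q x \<bullet> q x) has_derivative (\<lambda>h. - (2 / s) * (q x \<bullet> h))) (at x)"
      unfolding q_def using s
      by (auto intro!: derivative_eq_intros simp: fun_eq_iff inner_commute field_simps)
    have d2: "((\<lambda>u::real. (max 0 u)\<^sup>2) has_derivative (\<lambda>h. h * (2 * max 0 (1 - q x \<bullet> q x)))) (at (1 - q x \<bullet> q x))"
      by (rule has_derivative_eq_rhs[OF has_derivative_max0_square[of "1 - q x \<bullet> q x", unfolded has_field_derivative_def]])
        (simp add: fun_eq_iff)
    have "(bump c s has_derivative (\<lambda>h. - (2 / s) * (q x \<bullet> h) * (2 * max 0 (1 - q x \<bullet> q x)))) (at x)"
      using has_derivative_compose[OF d1 d2]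
      by (simp add: bump_def[abs_def] q_def power2_norm_eq_inner del: norm_scaleR)
    moreover have "(\<lambda>h. - (2 / s) * (q x \<bullet> h) * (2 * max 0 (1 - q x \<bullet> q x))) = blinfun_apply (k' x)"
      using s by (auto simp: k'_def w_def scaleR_blinfun.rep_eq uminus_blinfun.rep_eq power2_norm_eq_inner fun_eq_iff inner_commute field_simps)
    ultimately show "(bump c s has_derivative blinfun_apply (k' x)) (at x)" by simp
    show "norm (bump c s x) \<le> 16"
    proof -
      have "(max 0 (1 - (norm ((x - c) /\<^sub>R s))\<^sup>2))\<^sup>2 \<le> 1\<^sup>2"
        by (intro power_mono) (auto simp del: norm_scaleR)
      then show ?thesis by (simp add: bump_def del: norm_scaleR)
    qed
    have "norm (k' x) \<le> 4 / s * 1"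
      unfolding k'_def using s order_trans[OF nil w1, of x] by (simp add: divide_right_mono)
    then show "norm (k' x) \<le> 16 / s" using s by (simp add: field_simps)
    fix y
    have "k' x - k' y = (- 4 / s) *\<^sub>R blinfun_inner_left (w x - w y)"
      by (rule blinfun_eqI)
        (simp add: k'_def minus_blinfun.rep_eq scaleR_blinfun.rep_eq uminus_blinfun.rep_eq inner_diff_right algebra_simps)
    then have "norm (k' x - k' y) \<le> 4 / s * norm (w x - w y)"
      using s nil[of "w x - w y"] by (simp add: divide_right_mono)
    also have "\<dots> \<le> 4 / s * (4 * norm (q x - q y))"
      using s norm_cutoff_diff_le[of "q x" "q y"] by (intro mult_left_mono) (auto simp: w_def)
    also have "norm (q x - q y) = norm (x - y) / s"
    proof -
      have "q x - q y = (x - y) /\<^sub>R s" by (simp add: q_def algebra_simps)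
      then show ?thesis using s by (simp add: divide_inverse_commute)
    qed
    finally show "norm (k' x - k' y) \<le> 16 / s\<^sup>2 * norm (x - y)"
      using s by (simp add: field_simps power2_eq_square)
  qed
  then show ?thesis using scaled_C11_shrink t ts by blast
qed

section \<open>Packing of balls, comparison of jets, and the Whitney sum\<close>

lemma card_disjoint_balls_le:
  fixes f :: "'i \<Rightarrow> 'a::euclidean_space"
  assumes r: "0 < r" and R: "0 \<le> R" and sub: "\<And>i. i \<in> I \<Longrightarrow> ball (f i) r \<subseteq> ball x0 R"
    and disj: "pairwise (\<lambda>i j. disjnt (ball (f i) r) (ball (f j) r)) I"
  shows "finite I" and "real (card I) * r ^ DIM('a) \<le> R ^ DIM('a)"
proof -
  have *: "real (card J) * r ^ DIM('a) \<le> R ^ DIM('a)" if J: "finite J" "J \<subseteq> I" "J \<noteq> {}" for J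
  proof -
    have "(\<Sum>j\<in>J. measure lborel (ball (f j) r)) = measure lborel (\<Union>j\<in>J. ball (f j) r)"
      using J disj
      by (intro measure_finite_Union[symmetric]) (auto simp: disjoint_family_on_def pairwise_def disjnt_def simp del: ball_eq_empty
          dest: emeasure_lborel_ball_finite[THEN less_imp_neq, unfolded infinity_ennreal_def, THEN notE])
    also have "\<dots> \<le> measure lborel (ball x0 R)"
      using sub J by (intro measure_mono_fmeasurable) (auto simp: fmeasurable_def emeasure_lborel_ball_finite[unfolded infinity_ennreal_def])
    finally have "real (card J) * (unit_ball_vol (DIM('a)) * r ^ DIM('a)) \<le> unit_ball_vol (DIM('a)) * R ^ DIM('a)"
      using r R by (simp add: content_ball)
    then show ?thesis
      by (simp add: mult.left_commute)
  qed
  have "finite I \<and> card I \<le> nat \<lfloor>(R / r) ^ DIM('a)\<rfloor>"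
  proof (rule finite_if_finite_subsets_card_bdd)
    fix J assume J: "J \<subseteq> I" "finite J"
    show "card J \<le> nat \<lfloor>(R / r) ^ DIM('a)\<rfloor>"
    proof (cases "J = {}")
      case False
      have "real (card J) \<le> (R / r) ^ DIM('a)"
        using *[OF J(2,1) False] r by (simp add: power_divide field_simps)
      then show ?thesis by (simp add: le_nat_floor)
    qed simp
  qed
  then show "finite I" ..
  then show "real (card I) * r ^ DIM('a) \<le> R ^ DIM('a)"
    using *[of I] R by (cases "I = {}") auto
qed

text \<open>Two Taylor polynomials differ near \<open>x0\<close> by no more than the Whitney error
  at distance \<open>d\<close>. Here \<open>dist a b \<le> 3 * d\<close>,
  \<open>3 powr (1 + \<alpha>) \<le> 9\<close>, points of the ball are within
  \<open>9 / 8 * d\<close> of \<open>b\<close>, and \<open>9 + 27 / 8\<close> is rounded up to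
  \<open>13\<close>.\<close>

lemma scaled_C11_jet_diff:
  fixes f :: "'a::real_normed_vector \<Rightarrow> 'b::real_normed_vector" and A :: "'a \<Rightarrow> 'a \<Rightarrow>\<^sub>L 'b"
  assumes C: "0 \<le> C" and \<alpha>: "0 < \<alpha>" "\<alpha> \<le> 1" and d: "0 < d"
    and fab: "norm (f b - f a - A a (b - a)) \<le> C * dist a b powr (1 + \<alpha>)"
    and Aab: "norm (A a - A b) \<le> C * dist a b powr \<alpha>"
    and xa: "dist x0 a \<le> 2 * d" and xb: "dist x0 b \<le> d"
  shows "scaled_C11 x0 (d / 8) (13 * C * d powr (1 + \<alpha>))
           (\<lambda>x. (f a + A a (x - a)) - (f b + A b (x - b))) (\<lambda>_. A a - A b)"
proof -
  have ab: "dist a b \<le> 3 * d"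
    using dist_triangle[of a b x0] xa xb by (simp add: dist_commute)
  have 3: "(3::real) powr \<alpha> \<le> 3" "(3::real) powr (1 + \<alpha>) \<le> 9"
  proof -
    have "(3::real) powr \<alpha> \<le> 3 powr 1" using \<alpha> by (intro powr_mono) auto
    then show "(3::real) powr \<alpha> \<le> 3" by simp
    then show "(3::real) powr (1 + \<alpha>) \<le> 9" by (simp add: powr_add)
  qed
  have p0: "dist a b powr \<alpha> \<le> (3 * d) powr \<alpha>" "dist a b powr (1 + \<alpha>) \<le> (3 * d) powr (1 + \<alpha>)"
    using ab \<alpha> by (auto intro!: powr_mono2)
  have p1: "dist a b powr \<alpha> \<le> 3 * d powr \<alpha>"
    using p0(1) 3 d by (auto simp: powr_mult intro: order_trans mult_right_mono)
  have p2: "dist a b powr (1 + \<alpha>) \<le> 9 * d powr (1 + \<alpha>)"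
    using p0(2) 3 d by (auto simp: powr_mult intro: order_trans mult_right_mono)
  have dd: "d powr (1 + \<alpha>) = d * d powr \<alpha>" using d by (simp add: powr_add)
  have nA: "norm (A a - A b) \<le> C * (3 * d powr \<alpha>)"
    using Aab p1 C by (meson mult_left_mono order_trans)
  show ?thesis
    unfolding scaled_C11_def
  proof (intro conjI ballI)
    fix x assume x: "x \<in> ball x0 (d / 8)"
    show "((\<lambda>x. (f a + A a (x - a)) - (f b + A b (x - b))) has_derivative blinfun_apply (A a - A b)) (at x)"
      by (auto intro!: derivative_eq_intros simp: minus_blinfun.rep_eq fun_eq_iff)
    have xb': "norm (x - b) \<le> 9 / 8 * d"
    proof -
      have "dist x b \<le> dist x x0 + dist x0 b" by (rule dist_triangle)
      then show ?thesis using x xb by (simp add: dist_norm norm_minus_commute)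
    qed
    have "(f a + A a (x - a)) - (f b + A b (x - b)) = - (f b - f a - A a (b - a)) + (A a - A b) (x - b)"
      by (simp add: minus_blinfun.rep_eq blinfun.diff_right)
    then have "norm ((f a + A a (x - a)) - (f b + A b (x - b))) \<le> norm (f b - f a - A a (b - a)) + norm (A a - A b) * norm (x - b)"
      by (metis norm_minus_cancel norm_triangle_le add_left_mono norm_blinfun)
    also have "\<dots> \<le> C * (9 * d powr (1 + \<alpha>)) + (C * (3 * d powr \<alpha>)) * (9 / 8 * d)"
      using fab p2 nA xb' C by (intro add_mono mult_mono order_trans[OF fab mult_left_mono]) auto
    also have "\<dots> = (9 + 27 / 8) * C * d powr (1 + \<alpha>)"
      by (simp add: dd algebra_simps)
    also have "\<dots> \<le> 13 * C * d powr (1 + \<alpha>)"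
      using C by (intro mult_right_mono) auto
    finally show "norm ((f a + A a (x - a)) - (f b + A b (x - b))) \<le> 13 * C * d powr (1 + \<alpha>)" .
    have "C * (3 * d powr \<alpha>) \<le> (8 * 13) * (C * d powr \<alpha>)"
      using C by (simp add: mult_left_mono)
    also have "\<dots> = 13 * C * d powr (1 + \<alpha>) / (d / 8)"
      using d by (simp add: dd)
    finally show "norm (A a - A b) \<le> 13 * C * d powr (1 + \<alpha>) / (d / 8)"
      using nA by linarith
  qed (use C d in auto)
qed

text \<open>Off \<open>K\<close> the extension averages the jets at nearest points of
  \<open>K\<close>, with weights adapted to the distance \<open>d\<close>. On a ball of radius
  \<open>d x0 / 8\<close> a bounded number of bumps act, and as the weights add up to one, the
  difference to a fixed jet is an average of jet differences. Stating the bound relative to the jet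
  at a nearest point lets it control both the extension and its derivative.\<close>

lemma whitney_partition:
  fixes K :: "'a::euclidean_space set" and f :: "'a \<Rightarrow> 'b::real_normed_vector" and A :: "'a \<Rightarrow> 'a \<Rightarrow>\<^sub>L 'b"
  assumes K: "closed K" "K \<noteq> {}" and C: "0 \<le> C" and \<alpha>: "0 < \<alpha>" "\<alpha> \<le> 1"
    and fK: "\<And>a b. a \<in> K \<Longrightarrow> b \<in> K \<Longrightarrow> norm (f b - f a - A a (b - a)) \<le> C * dist a b powr (1 + \<alpha>)"
    and AK: "\<And>a b. a \<in> K \<Longrightarrow> b \<in> K \<Longrightarrow> norm (A a - A b) \<le> C * dist a b powr \<alpha>"
  obtains F B where "0 \<le> B"
    "\<And>x0 y. x0 \<notin> K \<Longrightarrow> infdist x0 K < 1 \<Longrightarrow> y \<in> K \<Longrightarrow> dist x0 y = infdist x0 K \<Longrightarrow>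
      \<exists>g'. scaled_C11 x0 (infdist x0 K / 8) (B * infdist x0 K powr (1 + \<alpha>)) (\<lambda>x. F x - (f y + A y (x - y))) g'"
proof -
  define d where "d x = infdist x K" for x
  \<comment> \<open>The cutoff at \<open>2\<close> keeps the radii bounded, as the Vitali lemma
    asks, while a ball of radius \<open>d x0 / 8\<close> about a point with \<open>d x0 < 1\<close>
    still lies inside.\<close>
  define \<Omega> where "\<Omega> = {x. x \<notin> K \<and> d x < 2}"
  have dpos: "0 < d x" if "x \<notin> K" for x
    using that K by (simp add: d_def infdist_pos_not_in_closed)
  have dtri: "d x \<le> d y + dist x y" for x y
    unfolding d_def by (rule infdist_triangle)
  have "\<forall>c. \<exists>y. y \<in> K \<and> d c = dist c y"
    using infdist_attains_inf[OF K] unfolding d_def by metis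
  then obtain near where near: "\<And>c. near c \<in> K" "\<And>c. d c = dist c (near c)" by metis
  \<comment> \<open>Balls of radius \<open>d / 40\<close> are disjoint and their fivefold
    enlargements of radius \<open>d / 8\<close> cover, so at each point some bump of radius
    \<open>d / 4\<close> is at least \<open>1 / 2\<close>.\<close>
  obtain Cs where Cs: "Cs \<subseteq> \<Omega>"
    "pairwise (\<lambda>i j. disjnt (cball i (d i / 40)) (cball j (d j / 40))) Cs"
    "\<Omega> \<subseteq> (\<Union>i\<in>Cs. cball i (5 * (d i / 40)))"
  proof (rule Vitali_covering_lemma_cballs[where S=\<Omega> and K=\<Omega> and a="\<lambda>x. x" and r="\<lambda>x. d x / 40" and B=1])
    show "\<Omega> \<subseteq> (\<Union>i\<in>\<Omega>. cball i (d i / 40))"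
      using dpos by (force simp: \<Omega>_def)
    show "0 < d i / 40 \<and> d i / 40 \<le> 1" if "i \<in> \<Omega>" for i
      using that dpos[of i] by (auto simp: \<Omega>_def)
  qed blast
  define N where "N x = {c \<in> Cs. dist x c < d c / 4}" for x
  define D where "D x = (\<Sum>c\<in>N x. bump c (d c / 4) x)" for x
  define F where "F x = inverse (D x) *\<^sub>R (\<Sum>c\<in>N x. bump c (d c / 4) x *\<^sub>R (f (near c) + A (near c) (x - near c)))" for x
  \<comment> \<open>Centres acting near \<open>x0\<close> carry disjoint balls of radius
    \<open>d x0 / 60\<close> inside the ball of radius \<open>d x0\<close>; volume then bounds their
    number.\<close>
  define n :: real where "n = 60 ^ DIM('a)"
  define B1 where "B1 = 1 / (1/2) + (n * 16) / (1/2)\<^sup>2 + 2 * (n * 16) * (n * 16)\<^sup>2 / (1/2)^4"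
  define B where "B = 4 * B1 * (n * (4 * 16 * (13 * C)))"
  have n0: "0 \<le> n" by (simp add: n_def)
  have B10: "0 \<le> B1" unfolding B1_def using n0 by (intro add_nonneg_nonneg) auto
  show thesis
  proof (rule that[of B F])
    show "0 \<le> B" unfolding B_def using n0 B10 C by simp
    fix x0 y assume x0: "x0 \<notin> K" "infdist x0 K < 1" and y: "y \<in> K" "dist x0 y = infdist x0 K"
    define t where "t = d x0 / 8"
    have d0: "0 < d x0" "d x0 < 1" using x0 dpos by (auto simp: d_def)
    have t: "0 < t" using d0 by (simp add: t_def)
    \<comment> \<open>One finite index set for the whole ball, whereas \<open>N x\<close> varies
      with \<open>x\<close>; the additional bumps vanish at \<open>x\<close>, so the sums agree. In
      the next step the distances to \<open>K\<close> are comparable because \<open>d\<close> has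
      Lipschitz constant one and \<open>dist x0 c < d x0 / 8 + d c / 4\<close>.\<close>
    define I where "I = {c \<in> Cs. \<exists>x\<in>ball x0 t. dist x c < d c / 4}"
    have I: "d c \<le> 3 / 2 * d x0" "7 / 10 * d x0 \<le> d c" "dist x0 c \<le> d x0 / 2" "c \<in> Cs" "0 < d c"
      if cI: "c \<in> I" for c
    proof -
      obtain x where x: "dist x0 x < d x0 / 8" "dist x c < d c / 4"
        using cI by (auto simp: I_def t_def)
      have "dist x0 c < d x0 / 8 + d c / 4" using dist_triangle[of x0 c x] x by simp
      then show "d c \<le> 3 / 2 * d x0" "7 / 10 * d x0 \<le> d c" "dist x0 c \<le> d x0 / 2"
        using dtri[of x0 c] dtri[of c x0] d0 by (auto simp: dist_commute)
      then show "0 < d c" using d0 by simp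
      show "c \<in> Cs" using cI by (simp add: I_def)
    qed
    have NI: "N x \<subseteq> I" if "x \<in> ball x0 t" for x
      using that by (auto simp: N_def I_def)
    have finI: "finite I" and cardI: "real (card I) \<le> n"
    proof -
      have sub: "ball c (d x0 / 60) \<subseteq> ball x0 (d x0)" if "c \<in> I" for c
      proof
        fix z assume "z \<in> ball c (d x0 / 60)"
        then show "z \<in> ball x0 (d x0)"
          using I(3)[OF that] dist_triangle[of x0 z c] d0 by (simp add: dist_commute)
      qed
      have disj: "pairwise (\<lambda>i j. disjnt (ball i (d x0 / 60)) (ball j (d x0 / 60))) I"
      proof (rule pairwiseI)
        fix i j assume ij: "i \<in> I" "j \<in> I" "i \<noteq> j"
        have "disjnt (cball i (d i / 40)) (cball j (d j / 40))"
          using Cs(2) ij I(4) by (auto simp: pairwise_def)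
        moreover have "ball c (d x0 / 60) \<subseteq> cball c (d c / 40)" if "c \<in> I" for c
          using I(2)[OF that] d0 by auto
        ultimately show "disjnt (ball i (d x0 / 60)) (ball j (d x0 / 60))"
          using ij by (meson disjnt_subset1 disjnt_subset2)
      qed
      show "finite I"
        using card_disjoint_balls_le(1)[of "d x0 / 60" "d x0" I "\<lambda>c. c", OF _ _ sub disj] d0 by auto
      have "real (card I) * (d x0 / 60) ^ DIM('a) \<le> d x0 ^ DIM('a)"
        using card_disjoint_balls_le(2)[of "d x0 / 60" "d x0" I "\<lambda>c. c", OF _ _ sub disj] d0 by auto
      then show "real (card I) \<le> n"
        using d0 by (simp add: n_def power_divide field_simps)
    qed
    have out: "bump c (d c / 4) x = 0" if "c \<in> I - N x" for c x
      using that I(4,5)[of c] by (intro bump_outside) (auto simp: N_def not_less)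
    have DI: "D x = (\<Sum>c\<in>I. bump c (d c / 4) x)" if "x \<in> ball x0 t" for x
      unfolding D_def by (rule sum.mono_neutral_left[OF finI NI[OF that]]) (use out in auto)
    have D2: "1/2 \<le> D x" if x: "x \<in> ball x0 t" for x
    proof -
      have xd: "\<bar>d x - d x0\<bar> < d x0 / 8"
      proof -
        have "dist x0 x < d x0 / 8" using x by (simp add: t_def)
        then show ?thesis using dtri[of x x0] dtri[of x0 x] dist_commute[of x x0] by linarith
      qed
      then have "x \<notin> K" using d0 by (auto simp: d_def abs_if split: if_splits)
      moreover have "d x < 2" using xd d0 by linarith
      ultimately have "x \<in> \<Omega>" by (simp add: \<Omega>_def)
      then obtain c where c: "c \<in> Cs" "dist x c \<le> d c / 8"
        using Cs(3) by (auto simp: dist_commute)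
      then have dc: "0 < d c" using Cs(1) dpos by (auto simp: \<Omega>_def)
      then have cN: "c \<in> N x" using c by (auto simp: N_def)
      have "1/2 \<le> bump c (d c / 4) x" using c dc by (intro bump_inside) auto
      also have "\<dots> \<le> D x"
        unfolding D_def using finite_subset[OF NI[OF x] finI] cN bump_nonneg
        by (intro member_le_sum) auto
      finally show ?thesis .
    qed
    have ts: "t \<le> d c / 4" if "c \<in> I" for c
      using I(2)[OF that] d0 by (simp add: t_def)
    have "\<forall>c\<in>I. \<exists>k'. scaled_C11 x0 t 16 (bump c (d c / 4)) k'"
      using scaled_C11_bump[OF t ts] by blast
    then obtain b' where b': "\<And>c. c \<in> I \<Longrightarrow> scaled_C11 x0 t 16 (bump c (d c / 4)) (b' c)" by metis
    have "scaled_C11 x0 t (real (card I) * 16) (\<lambda>x. \<Sum>c\<in>I. bump c (d c / 4) x) (\<lambda>x. \<Sum>c\<in>I. b' c x)"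
      by (rule scaled_C11_sum[OF finI b' t])
    then have sD: "scaled_C11 x0 t (n * 16) (\<lambda>x. \<Sum>c\<in>I. bump c (d c / 4) x) (\<lambda>x. \<Sum>c\<in>I. b' c x)"
      by (rule scaled_C11_mono) (use cardI t in auto)
    obtain i' where i': "scaled_C11 x0 t B1 (\<lambda>x. inverse (\<Sum>c\<in>I. bump c (d c / 4) x)) i'"
      using scaled_C11_inverse[OF sD t, of "1/2"] D2 DI unfolding B1_def by auto
    define G where "G = 13 * C * d x0 powr (1 + \<alpha>)"
    define h where "h c x = (f (near c) + A (near c) (x - near c)) - (f y + A y (x - y))" for c x
    have jd: "scaled_C11 x0 t G (h c) (\<lambda>_. A (near c) - A y)"
      if "c \<in> I" for c
      unfolding G_def h_def t_def
    proof (rule scaled_C11_jet_diff)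
      have "dist x0 (near c) \<le> dist x0 c + dist c (near c)" by (rule dist_triangle)
      then show "dist x0 (near c) \<le> 2 * d x0"
        using I[OF that] near(2)[of c] by simp
      show "dist x0 y \<le> d x0" using y by (simp add: d_def)
    qed (use C \<alpha> d0 fK AK near y in auto)
    have "\<forall>c\<in>I. \<exists>k'. scaled_C11 x0 t (4 * 16 * G) (\<lambda>x. bump c (d c / 4) x *\<^sub>R h c x) k'"
      using scaled_C11_scaleR[OF b' jd t] by blast
    then obtain m' where m': "\<And>c. c \<in> I \<Longrightarrow> scaled_C11 x0 t (4 * 16 * G) (\<lambda>x. bump c (d c / 4) x *\<^sub>R h c x) (m' c)"
      by metis
    have "scaled_C11 x0 t (real (card I) * (4 * 16 * G)) (\<lambda>x. \<Sum>c\<in>I. bump c (d c / 4) x *\<^sub>R h c x) (\<lambda>x. \<Sum>c\<in>I. m' c x)"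
      by (rule scaled_C11_sum[OF finI m' t])
    then have sN: "scaled_C11 x0 t (n * (4 * 16 * G)) (\<lambda>x. \<Sum>c\<in>I. bump c (d c / 4) x *\<^sub>R h c x) (\<lambda>x. \<Sum>c\<in>I. m' c x)"
      by (rule scaled_C11_mono) (use cardI t C in \<open>auto simp: G_def intro!: mult_right_mono\<close>)
    obtain q' where q': "scaled_C11 x0 t (4 * B1 * (n * (4 * 16 * G)))
        (\<lambda>x. inverse (\<Sum>c\<in>I. bump c (d c / 4) x) *\<^sub>R (\<Sum>c\<in>I. bump c (d c / 4) x *\<^sub>R h c x)) q'"
      using scaled_C11_scaleR[OF i' sN t] by blast
    \<comment> \<open>Division by \<open>D x\<close> normalises the weights, so subtracting a fixed
      jet commutes with the averaging.\<close>
    have Feq: "inverse (\<Sum>c\<in>I. bump c (d c / 4) x) *\<^sub>R (\<Sum>c\<in>I. bump c (d c / 4) x *\<^sub>R h c x) = F x - (f y + A y (x - y))"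
      if x: "x \<in> ball x0 t" for x
    proof -
      have "(\<Sum>c\<in>I. bump c (d c / 4) x *\<^sub>R h c x) =
        (\<Sum>c\<in>I. bump c (d c / 4) x *\<^sub>R (f (near c) + A (near c) (x - near c))) - D x *\<^sub>R (f y + A y (x - y))"
        unfolding h_def DI[OF x] by (simp add: scaleR_diff_right sum_subtractf scaleR_sum_left)
      also have "(\<Sum>c\<in>I. bump c (d c / 4) x *\<^sub>R (f (near c) + A (near c) (x - near c)))
         = (\<Sum>c\<in>N x. bump c (d c / 4) x *\<^sub>R (f (near c) + A (near c) (x - near c)))"
        by (rule sum.mono_neutral_right[OF finI NI[OF x]]) (use out in auto)
      finally show ?thesis
        using D2[OF x] unfolding F_def DI[OF x, symmetric] by (simp add: scaleR_diff_right)
    qed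
    have "scaled_C11 x0 t (4 * B1 * (n * (4 * 16 * G))) (\<lambda>x. F x - (f y + A y (x - y))) q'"
      unfolding scaled_C11_def
    proof (intro conjI ballI)
      fix x assume x: "x \<in> ball x0 t"
      show "((\<lambda>x. F x - (f y + A y (x - y))) has_derivative blinfun_apply (q' x)) (at x)"
        by (rule has_derivative_transform_within_open[OF _ open_ball x Feq])
          (use q' x in \<open>auto simp: scaled_C11_def\<close>)
      show "norm (F x - (f y + A y (x - y))) \<le> 4 * B1 * (n * (4 * 16 * G))"
        unfolding Feq[OF x, symmetric] using q' x by (auto simp: scaled_C11_def)
    qed (use q' in \<open>auto simp: scaled_C11_def\<close>)
    moreover have "4 * B1 * (n * (4 * 16 * G)) = B * d x0 powr (1 + \<alpha>)"
      by (simp add: B_def G_def)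
    ultimately show "\<exists>g'. scaled_C11 x0 (infdist x0 K / 8) (B * infdist x0 K powr (1 + \<alpha>)) (\<lambda>x. F x - (f y + A y (x - y))) g'"
      unfolding t_def d_def by auto
  qed
qed

text \<open>Two points need care. Differentiability on \<open>K\<close> follows from the estimate
  against jets at arbitrary points of \<open>K\<close>. For the Hoelder bound, a pair closer
  together than an eighth of the distance to \<open>K\<close> is compared inside one ball; any other
  pair is compared through nearest points of \<open>K\<close>.\<close>

theorem whitney_extension:
  fixes K :: "'a::euclidean_space set" and f :: "'a \<Rightarrow> 'b::real_normed_vector" and A :: "'a \<Rightarrow> 'a \<Rightarrow>\<^sub>L 'b"
  assumes K: "closed K" "K \<noteq> {}" and C: "0 \<le> C" and \<alpha>: "0 < \<alpha>" "\<alpha> \<le> 1"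
    and fK: "\<And>a b. a \<in> K \<Longrightarrow> b \<in> K \<Longrightarrow> norm (f b - f a - A a (b - a)) \<le> C * dist a b powr (1 + \<alpha>)"
    and AK: "\<And>a b. a \<in> K \<Longrightarrow> b \<in> K \<Longrightarrow> norm (A a - A b) \<le> C * dist a b powr \<alpha>"
  obtains F :: "'a \<Rightarrow> 'b" and F' :: "'a \<Rightarrow> 'a \<Rightarrow>\<^sub>L 'b" and C' :: real where "0 \<le> C'"
    "\<And>x. infdist x K < 1 \<Longrightarrow> (F has_derivative F' x) (at x)"
    "\<And>a. a \<in> K \<Longrightarrow> F a = f a" "\<And>a. a \<in> K \<Longrightarrow> F' a = A a"
    "\<And>x y. infdist x K < 1 \<Longrightarrow> infdist y K < 1 \<Longrightarrow> norm (F' x - F' y) \<le> C' * dist x y powr \<alpha>"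
proof -
  define d where "d x = infdist x K" for x
  obtain F0 B where B: "0 \<le> B" and F0: "\<And>x0 y. x0 \<notin> K \<Longrightarrow> d x0 < 1 \<Longrightarrow> y \<in> K \<Longrightarrow> dist x0 y = d x0 \<Longrightarrow>
      \<exists>g'. scaled_C11 x0 (d x0 / 8) (B * d x0 powr (1 + \<alpha>)) (\<lambda>x. F0 x - (f y + A y (x - y))) g'"
  proof (rule whitney_partition[OF K C \<alpha> fK AK])
    fix F0 B
    assume a: "0 \<le> B" and b: "\<And>x0 y. x0 \<notin> K \<Longrightarrow> infdist x0 K < 1 \<Longrightarrow> y \<in> K \<Longrightarrow> dist x0 y = infdist x0 K \<Longrightarrow>
      \<exists>g'. scaled_C11 x0 (infdist x0 K / 8) (B * infdist x0 K powr (1 + \<alpha>)) (\<lambda>x. F0 x - (f y + A y (x - y))) g'"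
    show thesis
      by (rule that[OF a b[folded d_def]])
  qed
  have dpos: "0 < d x" if "x \<notin> K" for x
    using that K by (simp add: d_def infdist_pos_not_in_closed)
  have dK: "d x = 0" if "x \<in> K" for x using that by (simp add: d_def)
  have dle: "d x \<le> dist x b" if "b \<in> K" for x b using that by (simp add: d_def infdist_le)
  have "\<forall>c. \<exists>y. y \<in> K \<and> d c = dist c y"
    using infdist_attains_inf[OF K] unfolding d_def by metis
  then obtain near where near: "\<And>c. near c \<in> K" "\<And>c. dist c (near c) = d c" by metis
  define F where "F x = (if x \<in> K then f x else F0 x)" for x
  \<comment> \<open>The partition lemma gives derivatives ball by ball. Choosing one by
    \<open>SOME\<close> yields a single global map, which uniqueness of derivatives identifies with
    every local one.\<close>
  define F' where "F' x = (if x \<in> K then A x else (SOME L. (F0 has_derivative blinfun_apply L) (at x)))" for x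
  have ball_K: "x \<notin> K" if "x0 \<notin> K" "x \<in> ball x0 (d x0 / 8)" for x0 x
    using that dle[of x x0] dpos[of x0] by auto
  have loc: "(F has_derivative F' x0) (at x0) \<and> norm (F x0 - (f (near x0) + A (near x0) (x0 - near x0))) \<le> B * d x0 powr (1 + \<alpha>) \<and>
      norm (F' x0 - A (near x0)) \<le> 8 * B * d x0 powr \<alpha> \<and>
      (\<forall>x. dist x0 x < d x0 / 8 \<longrightarrow> norm (F' x0 - F' x) \<le> 64 * B * d x0 powr (\<alpha> - 1) * dist x0 x)"
    if x0: "x0 \<notin> K" "d x0 < 1" for x0
  proof -
    define y where "y = near x0"
    define t where "t = d x0 / 8"
    have d0: "0 < d x0" using dpos x0 by simp
    then have t: "0 < t" by (simp add: t_def)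
    obtain g' where g: "scaled_C11 x0 t (B * d x0 powr (1 + \<alpha>)) (\<lambda>x. F0 x - (f y + A y (x - y))) g'"
      using F0[OF x0 near(1) near(2)] unfolding t_def y_def by blast
    note G = g[unfolded scaled_C11_def]
    have der: "(F0 has_derivative blinfun_apply (g' x + A y)) (at x)" if x: "x \<in> ball x0 t" for x
    proof -
      have "((\<lambda>x. (F0 x - (f y + A y (x - y))) + (f y + A y (x - y))) has_derivative (\<lambda>h. g' x h + A y h)) (at x)"
        using G x by (intro has_derivative_add) (auto intro!: derivative_eq_intros)
      then show ?thesis by (simp add: plus_blinfun.rep_eq)
    qed
    have F'x: "F' x = g' x + A y" if x: "x \<in> ball x0 t" for x
    proof -
      have "(F0 has_derivative blinfun_apply (SOME L. (F0 has_derivative blinfun_apply L) (at x))) (at x)"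
        using der[OF x] by (rule someI)
      then have "blinfun_apply (SOME L. (F0 has_derivative blinfun_apply L) (at x)) = blinfun_apply (g' x + A y)"
        using der[OF x] by (rule has_derivative_unique)
      then show ?thesis
        using ball_K[OF x0(1)] x by (simp add: F'_def blinfun_apply_inject t_def)
    qed
    have x0t: "x0 \<in> ball x0 t" using t by simp
    have "(F has_derivative blinfun_apply (g' x0 + A y)) (at x0)"
      by (rule has_derivative_transform_within_open[OF der[OF x0t] open_ball x0t])
        (use ball_K[OF x0(1)] in \<open>auto simp: F_def t_def\<close>)
    moreover have "norm (F x0 - (f y + A y (x0 - y))) \<le> B * d x0 powr (1 + \<alpha>)"
      using G x0t x0 by (simp add: F_def)
    moreover have "norm (F' x0 - A y) \<le> 8 * B * d x0 powr \<alpha>"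
    proof -
      have "norm (F' x0 - A y) \<le> B * d x0 powr (1 + \<alpha>) / t"
        using G x0t by (simp add: F'x)
      then show ?thesis using d0 by (simp add: t_def powr_add)
    qed
    moreover have "norm (F' x0 - F' x) \<le> 64 * B * d x0 powr (\<alpha> - 1) * dist x0 x" if "dist x0 x < d x0 / 8" for x
    proof -
      have x: "x \<in> ball x0 t" using that by (simp add: t_def)
      have "norm (F' x0 - F' x) \<le> B * d x0 powr (1 + \<alpha>) / t\<^sup>2 * norm (x0 - x)"
        using G x x0t by (simp add: F'x)
      also have "B * d x0 powr (1 + \<alpha>) / t\<^sup>2 = 64 * B * d x0 powr (\<alpha> - 1)"
      proof -
        have "d x0 powr (1 + \<alpha>) = d x0 powr (\<alpha> - 1) * (d x0)\<^sup>2"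
          using d0 by (simp add: powr_numeral[symmetric] powr_add[symmetric] del: powr_numeral)
        then show ?thesis using d0 by (simp add: t_def power_divide)
      qed
      finally show ?thesis by (simp add: dist_norm)
    qed
    ultimately show ?thesis using F'x[OF x0t] by (simp add: y_def)
  qed
  have jet: "norm (F x - f b - A b (x - b)) \<le> (B + 6 * C) * dist x b powr (1 + \<alpha>)"
    if x: "d x < 1" and b: "b \<in> K" for x b
  proof (cases "x \<in> K")
    case True
    have "norm (F x - f b - A b (x - b)) \<le> C * dist x b powr (1 + \<alpha>)"
      using fK[OF b True] True by (simp add: F_def dist_commute)
    also have "\<dots> \<le> (B + 6 * C) * dist x b powr (1 + \<alpha>)"
      using B C by (intro mult_right_mono) auto
    finally show ?thesis .
  next
    case False
    define y where "y = near x"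
    have y: "y \<in> K" "dist x y = d x" using near by (auto simp: y_def)
    have yb: "dist y b \<le> 2 * dist x b"
      using dist_triangle[of y b x] y dle[OF b, of x] by (simp add: dist_commute)
    have p: "dist y b powr \<alpha> \<le> 2 * dist x b powr \<alpha>" "dist y b powr (1 + \<alpha>) \<le> 4 * dist x b powr (1 + \<alpha>)"
    proof -
      have 2: "(2::real) powr \<alpha> \<le> 2 powr 1" "(2::real) powr (1 + \<alpha>) \<le> 2 powr 2" using \<alpha> by (intro powr_mono; simp)+
      have "dist y b powr \<alpha> \<le> (2 * dist x b) powr \<alpha>" using yb \<alpha> by (intro powr_mono2) auto
      also have "\<dots> \<le> 2 * dist x b powr \<alpha>" using 2 by (simp add: powr_mult mult_right_mono)
      finally show "dist y b powr \<alpha> \<le> 2 * dist x b powr \<alpha>" .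
      have "dist y b powr (1 + \<alpha>) \<le> (2 * dist x b) powr (1 + \<alpha>)" using yb \<alpha> by (intro powr_mono2) auto
      also have "\<dots> \<le> 4 * dist x b powr (1 + \<alpha>)" using 2 by (simp add: powr_mult mult_right_mono)
      finally show "dist y b powr (1 + \<alpha>) \<le> 4 * dist x b powr (1 + \<alpha>)" .
    qed
    have "F x - f b - A b (x - b) = (F x - (f y + A y (x - y))) - (f b - f y - A y (b - y)) + (A y - A b) (x - b)"
      by (simp add: minus_blinfun.rep_eq blinfun.diff_right)
    then have "norm (F x - f b - A b (x - b)) \<le> norm (F x - (f y + A y (x - y))) + norm (f b - f y - A y (b - y)) + norm (A y - A b) * norm (x - b)"
      by (metis norm_triangle_le norm_triangle_ineq4 add_mono norm_blinfun)
    also have "\<dots> \<le> B * d x powr (1 + \<alpha>) + C * (4 * dist x b powr (1 + \<alpha>)) + C * (2 * dist x b powr \<alpha>) * dist x b"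
    proof (intro add_mono mult_mono)
      show "norm (F x - (f y + A y (x - y))) \<le> B * d x powr (1 + \<alpha>)" using loc[OF False x] by (simp add: y_def)
      show "norm (f b - f y - A y (b - y)) \<le> C * (4 * dist x b powr (1 + \<alpha>))"
        using order_trans[OF fK[OF y(1) b] mult_left_mono[OF p(2) C]] .
      show "norm (A y - A b) \<le> C * (2 * dist x b powr \<alpha>)"
        using order_trans[OF AK[OF y(1) b] mult_left_mono[OF p(1) C]] .
    qed (use C in \<open>auto simp: dist_norm\<close>)
    also have "\<dots> \<le> B * dist x b powr (1 + \<alpha>) + C * (4 * dist x b powr (1 + \<alpha>)) + C * (2 * dist x b powr \<alpha>) * dist x b"
      using dle[OF b, of x] dpos[OF False] B C \<alpha> by (intro add_mono mult_left_mono powr_mono2) auto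
    also have "\<dots> = (B + 6 * C) * dist x b powr (1 + \<alpha>)"
      using dle[OF b, of x] dpos[OF False] by (simp add: powr_add algebra_simps)
    finally show ?thesis .
  qed
  have derK: "(F has_derivative F' b) (at b)" if b: "b \<in> K" for b
    unfolding has_derivative_at_alt
  proof (intro conjI allI impI)
    show "bounded_linear (blinfun_apply (F' b))" by (rule blinfun.bounded_linear_right)
    fix e :: real assume e: "0 < e"
    define M where "M = B + 6 * C + 1"
    have M: "0 < M" using B C by (simp add: M_def)
    define r where "r = min 1 ((e / M) powr (1 / \<alpha>))"
    have r: "0 < r" using e M by (simp add: r_def)
    moreover have "norm (F x - F b - F' b (x - b)) \<le> e * norm (x - b)" if x: "norm (x - b) < r" for x
    proof -
      have "d x < 1" using dle[OF b, of x] x by (simp add: r_def dist_norm)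
      then have "norm (F x - f b - A b (x - b)) \<le> (B + 6 * C) * dist x b powr (1 + \<alpha>)"
        using jet b by blast
      also have "\<dots> \<le> M * dist x b powr (1 + \<alpha>)"
        by (intro mult_right_mono) (auto simp: M_def)
      also have "\<dots> = (M * dist x b powr \<alpha>) * dist x b"
        by (simp add: powr_add)
      also have "\<dots> \<le> e * dist x b"
      proof (rule mult_right_mono)
        have "dist x b powr \<alpha> \<le> ((e / M) powr (1 / \<alpha>)) powr \<alpha>"
          using x \<alpha> by (intro powr_mono2) (auto simp: r_def dist_norm)
        also have "\<dots> = e / M" using \<alpha> e M by (simp add: powr_powr)
        finally show "M * dist x b powr \<alpha> \<le> e" using M by (simp add: field_simps)
      qed simp
      finally show ?thesis using b by (simp add: F_def F'_def dist_norm)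
    qed
    ultimately show "\<exists>r>0. \<forall>x. norm (x - b) < r \<longrightarrow> norm (F x - F b - F' b (x - b)) \<le> e * norm (x - b)"
      by blast
  qed
  \<comment> \<open>The exponent \<open>\<alpha> - 1\<close> is not positive, so the power of
    \<open>d x\<close> may be replaced by the same power of the smaller
    \<open>dist x x'\<close>.\<close>
  have close: "norm (F' x - F' x') \<le> 64 * B * dist x x' powr \<alpha>" if x: "d x < 1" "dist x x' < d x / 8" for x x'
  proof (cases "x = x'")
    case False
    have xK: "x \<notin> K" using x dK by auto
    have "norm (F' x - F' x') \<le> 64 * B * d x powr (\<alpha> - 1) * dist x x'"
      using loc[OF xK x(1)] x(2) by blast
    also have "\<dots> \<le> 64 * B * dist x x' powr (\<alpha> - 1) * dist x x'"
      using False x B \<alpha> dpos[OF xK] by (intro mult_right_mono mult_left_mono powr_mono2') auto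
    also have "\<dots> = 64 * B * dist x x' powr \<alpha>"
      using False by (simp add: powr_diff)
    finally show ?thesis .
  qed simp
  have F'near: "norm (F' x - A (near x)) \<le> 8 * B * d x powr \<alpha>" if x: "d x < 1" for x
  proof (cases "x \<in> K")
    case True
    then have "near x = x" using near(2)[of x] dK by simp
    then show ?thesis using True dK by (simp add: F'_def)
  next
    case False
    then show ?thesis using loc x by blast
  qed
  have hoelder: "norm (F' x - F' x') \<le> (128 * B + 17 * C) * dist x x' powr \<alpha>" if x: "d x < 1" "d x' < 1" for x x'
  proof -
    define e where "e = dist x x'"
    consider "e < d x / 8" | "e < d x' / 8" | "d x / 8 \<le> e" "d x' / 8 \<le> e" by linarith
    then show ?thesis
    proof cases
      case 1
      have "norm (F' x - F' x') \<le> 64 * B * e powr \<alpha>"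
        using close[OF x(1)] 1 by (simp add: e_def)
      also have "\<dots> \<le> (128 * B + 17 * C) * e powr \<alpha>" using B C by (intro mult_right_mono) auto
      finally show ?thesis by (simp add: e_def)
    next
      case 2
      have "norm (F' x - F' x') \<le> 64 * B * e powr \<alpha>"
        using close[OF x(2), of x] 2 by (simp add: e_def dist_commute norm_minus_commute)
      also have "\<dots> \<le> (128 * B + 17 * C) * e powr \<alpha>" using B C by (intro mult_right_mono) auto
      finally show ?thesis by (simp add: e_def)
    next
      case 3
      have pw: "s powr \<alpha> \<le> k * e powr \<alpha>" if "0 \<le> s" "s \<le> k * e" "1 \<le> k" for s k
      proof -
        have "s powr \<alpha> \<le> (k * e) powr \<alpha>" using that \<alpha> by (intro powr_mono2) auto
        also have "\<dots> = k powr \<alpha> * e powr \<alpha>" using that by (simp add: powr_mult e_def)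
        also have "\<dots> \<le> k powr 1 * e powr \<alpha>" using that \<alpha> by (intro mult_right_mono powr_mono) auto
        finally show ?thesis using that by simp
      qed
      have d8: "8 * B * d z powr \<alpha> \<le> 8 * B * (8 * e powr \<alpha>)" if "d z / 8 \<le> e" for z
      proof -
        have "0 \<le> d z" using dpos[of z] dK[of z] by (cases "z \<in> K") auto
        then have "d z powr \<alpha> \<le> 8 * e powr \<alpha>" using pw[of "d z" 8] that by simp
        then show ?thesis using B by (intro mult_left_mono) auto
      qed
      have "dist (near x) (near x') \<le> dist (near x) x + (dist x x' + dist x' (near x'))"
        by (meson add_left_mono dist_triangle order_trans)
      also have "\<dots> \<le> 17 * e" using 3 near(2) by (simp add: e_def dist_commute)
      finally have nn: "dist (near x) (near x') powr \<alpha> \<le> 17 * e powr \<alpha>"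
        by (intro pw) auto
      have "F' x - F' x' = (F' x - A (near x)) + (A (near x) - A (near x')) - (F' x' - A (near x'))" by simp
      also have "norm \<dots> \<le> norm (F' x - A (near x)) + norm (A (near x) - A (near x')) + norm (F' x' - A (near x'))"
        by (meson norm_triangle_le norm_triangle_le_diff norm_triangle_ineq add_right_mono order_refl)
      also have "\<dots> \<le> 8 * B * (8 * e powr \<alpha>) + C * (17 * e powr \<alpha>) + 8 * B * (8 * e powr \<alpha>)"
        using order_trans[OF F'near[OF x(1)] d8[OF 3(1)]] order_trans[OF F'near[OF x(2)] d8[OF 3(2)]]
          order_trans[OF AK[OF near(1) near(1)] mult_left_mono[OF nn C]] by (intro add_mono)
      also have "\<dots> = (128 * B + 17 * C) * e powr \<alpha>" by (simp add: algebra_simps)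
      finally show ?thesis by (simp add: e_def)
    qed
  qed
  show thesis
  proof (rule that[of "128 * B + 17 * C" F F'])
    show "0 \<le> 128 * B + 17 * C" using B C by simp
    show "(F has_derivative blinfun_apply (F' x)) (at x)" if "infdist x K < 1" for x
      using that loc derK by (cases "x \<in> K") (auto simp: d_def)
    show "F a = f a" "F' a = A a" if "a \<in> K" for a using that by (auto simp: F_def F'_def)
    show "norm (F' x - F' y) \<le> (128 * B + 17 * C) * dist x y powr \<alpha>" if "infdist x K < 1" "infdist y K < 1" for x y
      using hoelder that by (simp add: d_def)
  qed
qed

section \<open>Submanifolds as level sets\<close>

lemma hoelder_imp_uniformly_continuous_on:
  fixes f :: "'a::metric_space \<Rightarrow> 'b::metric_space"
  assumes C: "0 \<le> C" and \<beta>: "0 < \<beta>"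
    and f: "\<And>x y. x \<in> S \<Longrightarrow> y \<in> S \<Longrightarrow> dist (f x) (f y) \<le> C * dist x y powr \<beta>"
  shows "uniformly_continuous_on S f"
  unfolding uniformly_continuous_on_def
proof (intro allI impI)
  fix e :: real assume e: "0 < e"
  define r where "r = (e / (C + 1)) powr (1 / \<beta>)"
  have "dist (f x') (f x) < e" if "x \<in> S" "x' \<in> S" "dist x' x < r" for x x'
  proof -
    have "dist x' x powr \<beta> \<le> r powr \<beta>" using that \<beta> by (intro powr_mono2) auto
    also have "r powr \<beta> = e / (C + 1)" using e C \<beta> by (simp add: r_def powr_powr)
    finally have "dist (f x') (f x) \<le> C * (e / (C + 1))"
      using f[OF that(2,1)] C by (meson mult_left_mono order_trans)
    also have "\<dots> < e" using C e by (simp add: field_simps)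
    finally show ?thesis .
  qed
  moreover have "0 < r" using e C by (simp add: r_def)
  ultimately show "\<exists>d>0. \<forall>x\<in>S. \<forall>x'\<in>S. dist x' x < d \<longrightarrow> dist (f x') (f x) < e" by blast
qed

lemma C1_hoelder_on_I:
  fixes f :: "'a::real_normed_vector \<Rightarrow> 'b::real_normed_vector"
  assumes "0 \<le> C" "0 < \<beta>" "\<And>x. x \<in> U \<Longrightarrow> (f has_derivative blinfun_apply (f' x)) (at x)"
    and h: "\<And>x y. x \<in> U \<Longrightarrow> y \<in> U \<Longrightarrow> norm (f' x - f' y) \<le> C * dist x y powr \<beta>"
  shows "C1_hoelder_on \<beta> U f"
proof -
  have "continuous_on U f'"
    by (rule uniformly_continuous_imp_continuous, rule hoelder_imp_uniformly_continuous_on[OF assms(1,2)]) (use h in \<open>auto simp: dist_norm\<close>)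
  then show ?thesis unfolding C1_hoelder_on_def using assms by blast
qed

text \<open>A map with derivative near the identity is a chart by the inverse function theorem. The
  Hoelder bound passes to the derivative \<open>T\<close> of the inverse chart because
  \<open>T y - T z\<close> is the composition of \<open>T y\<close>,
  \<open>\<sigma>' (\<tau> z) - \<sigma>' (\<tau> y)\<close> and \<open>T z\<close>.\<close>

lemma submanifold_vimage:
  fixes \<sigma> :: "'a::euclidean_space \<Rightarrow> 'a" and \<sigma>' :: "'a \<Rightarrow> 'a \<Rightarrow>\<^sub>L 'a"
  assumes W: "open W" "a \<in> W" and C: "0 \<le> C" and \<beta>: "0 < \<beta>"
    and der: "\<And>x. x \<in> W \<Longrightarrow> (\<sigma> has_derivative blinfun_apply (\<sigma>' x)) (at x)"
    and hoel: "\<And>x y. x \<in> W \<Longrightarrow> y \<in> W \<Longrightarrow> norm (\<sigma>' x - \<sigma>' y) \<le> C * dist x y powr \<beta>"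
    and near: "norm (\<sigma>' a - id_blinfun) \<le> 1 / 2"
    and Z: "subspace Z" "dim Z = m"
  obtains U where "open U" "a \<in> U" "C1_hoelder_submanifold m \<beta> {x\<in>U. \<sigma> x \<in> Z}"
proof -
  have cont: "continuous_on W \<sigma>'"
    by (rule uniformly_continuous_imp_continuous, rule hoelder_imp_uniformly_continuous_on[OF C \<beta>]) (use hoel in \<open>auto simp: dist_norm\<close>)
  \<comment> \<open>Relaxing \<open>1 / 2\<close> to \<open>3 / 4\<close> gives an open condition on
    the base point and still leaves \<open>norm v \<le> 4 * norm (\<sigma>' x v)\<close>.\<close>
  have "open (W \<inter> \<sigma>' -` ball id_blinfun (3/4))"
    using continuous_on_open_vimage[OF W(1)] cont by (auto simp: Int_commute)
  moreover have "a \<in> W \<inter> \<sigma>' -` ball id_blinfun (3/4)"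
    using W near by (auto simp: dist_norm norm_minus_commute)
  ultimately obtain r where r: "0 < r" "ball a r \<subseteq> W \<inter> \<sigma>' -` ball id_blinfun (3/4)"
    by (meson open_contains_ball)
  define X where "X = ball a r"
  have X: "open X" "a \<in> X" "convex X" "X \<subseteq> W" using r by (auto simp: X_def)
  have dX: "norm (\<sigma>' x - id_blinfun) \<le> 3/4" if "x \<in> X" for x
    using r that by (auto simp: X_def dist_norm norm_minus_commute)
  have low: "norm v \<le> 4 * norm (\<sigma>' x v)" if "x \<in> X" for x v
  proof -
    have "norm ((\<sigma>' x - id_blinfun) v) \<le> 3/4 * norm v"
      using norm_blinfun[of "\<sigma>' x - id_blinfun" v] dX[OF that] by (meson mult_right_mono norm_ge_zero order_trans)
    moreover have "norm v \<le> norm ((\<sigma>' x - id_blinfun) v) + norm (\<sigma>' x v)"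
      by (metis (no_types) blinfun_apply_id_blinfun id_apply minus_blinfun.rep_eq norm_minus_commute norm_triangle_sub add.commute)
    ultimately show ?thesis by simp
  qed
  \<comment> \<open>The mean value inequality for \<open>\<sigma> x - x\<close> on the convex ball
    \<open>X\<close> turns the bound on the derivative into an injectivity estimate, which later
    bounds \<open>dist (\<tau> z) (\<tau> y)\<close>.\<close>
  have inj: "norm (x - y) \<le> 4 * norm (\<sigma> x - \<sigma> y)" if "x \<in> X" "y \<in> X" for x y
  proof -
    have "norm ((\<sigma> x - x) - (\<sigma> y - y)) \<le> 3/4 * norm (x - y)"
    proof (rule differentiable_bound[OF X(3) _ _ that])
      fix z assume z: "z \<in> X"
      have "((\<lambda>z. \<sigma> z - z) has_derivative blinfun_apply (\<sigma>' z - id_blinfun)) (at z)"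
        using der[of z] z X(4) by (auto intro!: derivative_eq_intros simp: minus_blinfun.rep_eq)
      then show "((\<lambda>z. \<sigma> z - z) has_derivative blinfun_apply (\<sigma>' z - id_blinfun)) (at z within X)"
        by (rule has_derivative_at_withinI)
      show "onorm (blinfun_apply (\<sigma>' z - id_blinfun)) \<le> 3/4"
        using dX[OF z] by (simp add: norm_blinfun.rep_eq)
    qed
    moreover have "norm (x - y) \<le> norm ((\<sigma> x - x) - (\<sigma> y - y)) + norm (\<sigma> x - \<sigma> y)"
    proof -
      have "x - y = (\<sigma> x - \<sigma> y) - ((\<sigma> x - x) - (\<sigma> y - y))" by simp
      then show ?thesis by (metis norm_triangle_ineq4 add.commute)
    qed
    ultimately show ?thesis by simp
  qed
  have "linear (blinfun_apply (\<sigma>' a))" by (simp add: blinfun.bounded_linear_right bounded_linear.linear)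
  moreover have "inj (blinfun_apply (\<sigma>' a))"
  proof (rule injI)
    fix u v assume "\<sigma>' a u = \<sigma>' a v"
    then have "\<sigma>' a (u - v) = 0" by (simp add: blinfun.diff_right)
    then show "u = v" using low[OF X(2), of "u - v"] by simp
  qed
  ultimately obtain g0 where g0: "linear g0" "g0 \<circ> blinfun_apply (\<sigma>' a) = id"
    using linear_injective_left_inverse by blast
  have inv: "Blinfun g0 o\<^sub>L \<sigma>' a = id_blinfun"
    using g0 by (intro blinfun_eqI) (simp add: bounded_linear_Blinfun_apply linear_linear[symmetric] linear_conv_bounded_linear fun_eq_iff)
  have derX: "(\<sigma> has_derivative blinfun_apply (\<sigma>' x)) (at x)" if "x \<in> X" for x
    using der that X(4) by blast
  obtain U V \<tau> \<tau>' where U: "open U" "U \<subseteq> X" "a \<in> U" and V: "open V"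
    and hom: "homeomorphism U V \<sigma> \<tau>"
    and \<tau>': "\<And>y. y \<in> V \<Longrightarrow> (\<tau> has_derivative (\<tau>' y)) (at y)"
      "\<And>y. y \<in> V \<Longrightarrow> \<tau>' y = Hilbert_Choice.inv (blinfun_apply (\<sigma>' (\<tau> y)))"
      "\<And>y. y \<in> V \<Longrightarrow> bij (blinfun_apply (\<sigma>' (\<tau> y)))"
    using inverse_function_theorem[OF X(1) derX continuous_on_subset[OF cont X(4)] X(2) inv] by metis
  have \<tau>U: "\<tau> y \<in> X" "\<sigma> (\<tau> y) = y" if "y \<in> V" for y
    using hom that U(2) by (auto simp: homeomorphism_def)
  define T where "T y = Blinfun (\<tau>' y)" for y
  have T: "blinfun_apply (T y) = \<tau>' y" if "y \<in> V" for y
    using \<tau>'(1)[OF that] by (simp add: T_def bounded_linear_Blinfun_apply has_derivative_bounded_linear)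
  have T1: "\<sigma>' (\<tau> y) (T y v) = v" "T y (\<sigma>' (\<tau> y) v) = v" if "y \<in> V" for y v
    using T[OF that] \<tau>'(2,3)[OF that] by (auto simp: bij_is_surj bij_is_inj surj_f_inv_f inv_f_f)
  have T2: "norm (T y v) \<le> 4 * norm v" if "y \<in> V" for y v
    using low[OF \<tau>U(1)[OF that], of "T y v"] T1[OF that] by simp
  have "C1_hoelder_on \<beta> U \<sigma>"
    by (rule C1_hoelder_on_I[OF C \<beta>]) (use derX hoel U(2) X(4) in blast)+
  moreover have "C1_hoelder_on \<beta> V \<tau>"
  proof (rule C1_hoelder_on_I[OF _ \<beta>, where C="16 * (C * 4 powr \<beta>)" and f'=T])
    fix y z assume yz: "y \<in> V" "z \<in> V"
    show "(\<tau> has_derivative blinfun_apply (T y)) (at y)" using \<tau>'(1) T yz by simp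
    show "norm (T y - T z) \<le> 16 * (C * 4 powr \<beta>) * dist y z powr \<beta>"
    proof (rule norm_blinfun_bound)
      fix v
      have "(T y - T z) v = T y ((\<sigma>' (\<tau> z) - \<sigma>' (\<tau> y)) (T z v))"
        using T1 yz by (simp add: minus_blinfun.rep_eq blinfun.diff_right)
      then have "norm ((T y - T z) v) \<le> 4 * norm ((\<sigma>' (\<tau> z) - \<sigma>' (\<tau> y)) (T z v))"
        using T2[OF yz(1)] by simp
      also have "\<dots> \<le> 4 * (norm (\<sigma>' (\<tau> z) - \<sigma>' (\<tau> y)) * (4 * norm v))"
        using T2[OF yz(2), of v] order_trans[OF norm_blinfun mult_left_mono] by (intro mult_left_mono) auto
      also have "norm (\<sigma>' (\<tau> z) - \<sigma>' (\<tau> y)) \<le> C * (4 * dist y z) powr \<beta>"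
      proof -
        have "norm (\<sigma>' (\<tau> z) - \<sigma>' (\<tau> y)) \<le> C * dist (\<tau> z) (\<tau> y) powr \<beta>"
          using hoel \<tau>U(1) yz X(4) by blast
        also have "\<dots> \<le> C * (4 * dist y z) powr \<beta>"
          using inj[OF \<tau>U(1)[OF yz(2)] \<tau>U(1)[OF yz(1)]] \<tau>U(2) yz C \<beta>
          by (intro mult_left_mono powr_mono2) (auto simp: dist_norm norm_minus_commute)
        finally show ?thesis .
      qed
      also have "4 * (C * (4 * dist y z) powr \<beta> * (4 * norm v)) = 16 * (C * 4 powr \<beta>) * dist y z powr \<beta> * norm v"
        by (simp add: powr_mult)
      finally show "norm ((T y - T z) v) \<le> 16 * (C * 4 powr \<beta>) * dist y z powr \<beta> * norm v"
        by (simp add: mult_left_mono mult_right_mono)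
    qed (use C in auto)
  qed (use C in auto)
  moreover have "\<sigma> ` ({x\<in>U. \<sigma> x \<in> Z} \<inter> U) = Z \<inter> V"
    using hom unfolding homeomorphism_def by force
  ultimately have "C1_hoelder_submanifold m \<beta> {x\<in>U. \<sigma> x \<in> Z}"
    unfolding C1_hoelder_submanifold_def using U V hom Z by blast
  then show thesis using that U by blast
qed

section \<open>Outer measures and Hausdorff measure\<close>

lemma outer_measure_mono: "outer_measure_space UNIV \<mu> \<Longrightarrow> A \<subseteq> B \<Longrightarrow> \<mu> A \<le> \<mu> B"
  by (auto simp: outer_measure_space_def increasing_def)

lemma outer_measure_empty: "outer_measure_space UNIV \<mu> \<Longrightarrow> \<mu> {} = 0"
  by (auto simp: outer_measure_space_def positive_def)

text \<open>\<open>countably_subadditive\<close> speaks of disjoint families only; passing to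
  \<open>disjointed A\<close> and using monotonicity removes the restriction.\<close>

lemma outer_measure_countable_UN:
  fixes A :: "nat \<Rightarrow> 'a set"
  assumes "outer_measure_space UNIV \<mu>"
  shows "\<mu> (\<Union>i. A i) \<le> (\<Sum>i. \<mu> (A i))"
proof -
  have "countably_subadditive UNIV \<mu>" using assms by (auto simp: outer_measure_space_def)
  then have "\<mu> (\<Union>i. disjointed A i) \<le> (\<Sum>i. \<mu> (disjointed A i))"
    unfolding countably_subadditive_def by (auto simp: disjoint_family_disjointed)
  also have "\<dots> \<le> (\<Sum>i. \<mu> (A i))"
    by (intro suminf_le outer_measure_mono[OF assms] disjointed_subset) auto
  finally show ?thesis by (simp add: UN_disjointed_eq)
qed

lemma outer_measure_null_UN:
  assumes "outer_measure_space UNIV \<mu>" "countable I" "\<And>i. i \<in> I \<Longrightarrow> \<mu> (A i) = 0"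
  shows "\<mu> (\<Union>i\<in>I. A i) = 0"
proof (cases "I = {}")
  case True
  then show ?thesis using assms(1) by (simp add: outer_measure_empty)
next
  case False
  have "\<mu> (\<Union>i\<in>I. A i) = \<mu> (\<Union>n. A (from_nat_into I n))"
  proof -
    have "(\<Union>i\<in>I. A i) = (\<Union>i\<in>range (from_nat_into I). A i)"
      by (simp only: range_from_nat_into[OF False assms(2)])
    then show ?thesis by (simp add: image_image)
  qed
  also have "\<dots> \<le> (\<Sum>n. \<mu> (A (from_nat_into I n)))"
    by (rule outer_measure_countable_UN[OF assms(1)])
  also have "\<dots> = 0" using assms(3) from_nat_into[OF False] by simp
  finally show ?thesis by simp
qed

lemma outer_measure_null_subset:
  "outer_measure_space UNIV \<mu> \<Longrightarrow> \<mu> B = 0 \<Longrightarrow> A \<subseteq> B \<Longrightarrow> \<mu> A = 0"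
  using outer_measure_mono[of \<mu> A B] by simp

section \<open>From densities to ball estimates and absolute continuity\<close>

lemma ennreal_divide_mult_cancel: "0 < c \<Longrightarrow> a / ennreal c * ennreal c = a"
  by (simp add: ennreal_divide_times divide_ennreal)

text \<open>A single natural number is both the constant and the reciprocal of the radius, so points
  of finite upper density fall into countably many uniform classes.\<close>

lemma upper_density_finiteD:
  assumes "upper_density m \<mu> x < \<infinity>"
  obtains j :: nat where "0 < j" "\<And>r. 0 < r \<Longrightarrow> r \<le> 1 / real j \<Longrightarrow> \<mu> (cball x r) \<le> ennreal (real j * r ^ m)"
proof -
  obtain c where c: "upper_density m \<mu> x < ennreal c" "0 < c"
  proof -
    obtain z where z: "upper_density m \<mu> x < z" "z < top" using assms dense by auto
    then have "0 < z" by (metis le_less_trans zero_le)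
    then show thesis using z that[of "enn2real z"] by (simp add: enn2real_positive_iff)
  qed
  have "\<forall>\<^sub>F r in at_right 0. \<mu> (cball x r) / ennreal (unit_ball_vol (real m) * r ^ m) < ennreal c"
    using c(1) unfolding upper_density_def by (rule Limsup_lessD)
  then obtain b where b: "0 < b"
    "\<And>r. 0 < r \<Longrightarrow> r < b \<Longrightarrow> \<mu> (cball x r) / ennreal (unit_ball_vol (real m) * r ^ m) < ennreal c"
    unfolding eventually_at_right_field by auto
  obtain j1 :: nat where j1: "1 / b < real j1" using reals_Archimedean2 by blast
  obtain j2 :: nat where j2: "c * unit_ball_vol (real m) < real j2" using reals_Archimedean2 by blast
  define j where "j = max j1 j2 + 1"
  show thesis
  proof (rule that[of j])
    show "0 < j" by (simp add: j_def)
    fix r :: real assume r: "0 < r" "r \<le> 1 / real j"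
    have "1 / b < real j" using j1 by (simp add: j_def)
    then have "1 / real j < b" using b(1) by (simp add: j_def field_simps)
    then have lt: "\<mu> (cball x r) / ennreal (unit_ball_vol (real m) * r ^ m) < ennreal c"
      using b r by simp
    have pos: "0 < unit_ball_vol (real m) * r ^ m" using r by simp
    have "\<mu> (cball x r) = (\<mu> (cball x r) / ennreal (unit_ball_vol (real m) * r ^ m)) * ennreal (unit_ball_vol (real m) * r ^ m)"
      by (simp only: ennreal_divide_mult_cancel[OF pos])
    also have "\<dots> \<le> ennreal c * ennreal (unit_ball_vol (real m) * r ^ m)"
      using lt by (intro mult_right_mono) auto
    also have "\<dots> = ennreal (c * unit_ball_vol (real m) * r ^ m)"
      using pos c by (simp add: ennreal_mult[symmetric] mult.assoc)
    also have "\<dots> \<le> ennreal (real j * r ^ m)"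
      using j2 r by (intro ennreal_leI mult_right_mono) (auto simp: j_def)
    finally show "\<mu> (cball x r) \<le> ennreal (real j * r ^ m)" .
  qed
qed

lemma lower_density_posD:
  assumes "0 < lower_density m \<mu> x"
  obtains j :: nat where "0 < j" "\<And>r. 0 < r \<Longrightarrow> r \<le> 1 / real j \<Longrightarrow> ennreal (r ^ m / real j) \<le> \<mu> (cball x r)"
proof -
  obtain c where c: "ennreal c < lower_density m \<mu> x" "0 < c"
  proof -
    obtain z where z: "0 < z" "z < lower_density m \<mu> x" using assms dense by blast
    then have "z < top" using top.not_eq_extremum by fastforce
    then show thesis using z that[of "enn2real z"] by (simp add: enn2real_positive_iff ennreal_enn2real_if less_top[symmetric])
  qed
  have "\<forall>\<^sub>F r in at_right 0. ennreal c < \<mu> (cball x r) / ennreal (unit_ball_vol (real m) * r ^ m)"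
    using c(1) unfolding lower_density_def by (rule less_LiminfD)
  then obtain b where b: "0 < b"
    "\<And>r. 0 < r \<Longrightarrow> r < b \<Longrightarrow> ennreal c < \<mu> (cball x r) / ennreal (unit_ball_vol (real m) * r ^ m)"
    unfolding eventually_at_right_field by auto
  obtain j1 :: nat where j1: "1 / b < real j1" using reals_Archimedean2 by blast
  obtain j2 :: nat where j2: "1 / (c * unit_ball_vol (real m)) < real j2" using reals_Archimedean2 by blast
  define j where "j = max j1 j2 + 1"
  have w: "0 < c * unit_ball_vol (real m)" using c by simp
  show thesis
  proof (rule that[of j])
    show j0: "0 < j" by (simp add: j_def)
    fix r :: real assume r: "0 < r" "r \<le> 1 / real j"
    have "1 / b < real j" using j1 by (simp add: j_def)
    then have "1 / real j < b" using b(1) by (simp add: j_def field_simps)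
    then have lt: "ennreal c < \<mu> (cball x r) / ennreal (unit_ball_vol (real m) * r ^ m)"
      using b r by simp
    have pos: "0 < unit_ball_vol (real m) * r ^ m" using r by simp
    have "1 / (c * unit_ball_vol (real m)) < real j" using j2 by (simp add: j_def)
    then have "1 / real j \<le> c * unit_ball_vol (real m)"
      using w j0 by (simp add: field_simps)
    then have "ennreal (r ^ m / real j) \<le> ennreal (c * unit_ball_vol (real m) * r ^ m)"
      using r by (intro ennreal_leI) (metis mult_right_mono zero_le_power less_imp_le times_divide_eq_left mult_1)
    also have "\<dots> = ennreal c * ennreal (unit_ball_vol (real m) * r ^ m)"
      using pos c by (simp add: ennreal_mult[symmetric] mult.assoc)
    also have "\<dots> \<le> (\<mu> (cball x r) / ennreal (unit_ball_vol (real m) * r ^ m)) * ennreal (unit_ball_vol (real m) * r ^ m)"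
      using lt by (intro mult_right_mono) auto
    also have "\<dots> = \<mu> (cball x r)"
      by (simp only: ennreal_divide_mult_cancel[OF pos])
    finally show "ennreal (r ^ m / real j) \<le> \<mu> (cball x r)" .
  qed
qed

lemma hausdorff_premeasure_le: "0 < \<delta> \<Longrightarrow> hausdorff_premeasure d \<delta> A \<le> hausdorff_measure d A"
  unfolding hausdorff_measure_def by (rule SUP_upper) simp

text \<open>A covering set that meets \<open>N\<close> meets it inside a ball centred in
  \<open>N\<close> with radius the diameter of the covering set, so the mass captured is a fixed
  multiple of its term in the Hausdorff sum.\<close>

lemma density_bound_imp_null:
  fixes N :: "'a::metric_space set"
  assumes om: "outer_measure_space UNIV \<mu>" and m: "1 \<le> m" and j: "0 < j"
    and up: "\<And>x r. x \<in> N \<Longrightarrow> 0 < r \<Longrightarrow> r \<le> 1 / real j \<Longrightarrow> \<mu> (cball x r) \<le> ennreal (real j * r ^ m)"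
    and H: "hausdorff_measure m N = 0"
  shows "\<mu> N = 0"
proof -
  define \<omega> where "\<omega> = unit_ball_vol (real m)"
  have \<omega>: "0 < \<omega>" by (simp add: \<omega>_def)
  define c where "c = real j * 2 ^ m / \<omega>"
  have c: "0 < c" using j \<omega> by (simp add: c_def)
  have piece: "\<mu> (S \<inter> N) \<le> ennreal c * (if S = {} then 0 else ennreal (\<omega> * (diameter S / 2) ^ m))"
    if S: "bounded S" "diameter S \<le> 1 / real j" for S
  proof (cases "S \<inter> N = {}")
    case True
    then show ?thesis using om by (simp add: outer_measure_empty)
  next
    case False
    then obtain x where x: "x \<in> S" "x \<in> N" by auto
    have sub: "S \<inter> N \<subseteq> cball x (diameter S)"
      using diameter_bounded_bound[OF S(1) x(1)] by auto
    have "\<mu> (S \<inter> N) \<le> ennreal (real j * diameter S ^ m)"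
    \<comment> \<open>The ball estimate needs a positive radius. For a piece of diameter zero all
      small radii are admissible, and \<open>1 \<le> m\<close> makes the bounds tend to
      zero.\<close>
    proof (cases "diameter S = 0")
      case True
      have "\<mu> (S \<inter> N) \<le> ennreal e" if e: "0 < e" for e
      proof -
        define r where "r = min (1 / real j) (e / real j)"
        have r: "0 < r" "r \<le> 1 / real j" using e j by (auto simp: r_def)
        have "r \<le> 1" using r(2) j by (auto intro: order_trans)
        then have rm: "r ^ m \<le> r" using r m power_decreasing[of 1 m r] by auto
        have "\<mu> (S \<inter> N) \<le> \<mu> (cball x r)"
          using sub r True by (intro outer_measure_mono[OF om]) auto
        also have "\<dots> \<le> ennreal (real j * r ^ m)" by (rule up[OF x(2) r])
        also have "\<dots> \<le> ennreal (real j * (e / real j))"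
          using rm by (intro ennreal_leI mult_left_mono) (auto simp: r_def)
        finally show ?thesis using j by simp
      qed
      then have "\<mu> (S \<inter> N) = 0" by (metis ennreal_le_epsilon le_zero_eq add_0 zero_less_one ennreal_0)
      then show ?thesis by simp
    next
      case False
      then have "0 < diameter S" using diameter_ge_0[OF S(1)] by simp
      then show ?thesis
        using outer_measure_mono[OF om sub] up[OF x(2) _ S(2)] by (meson order_trans)
    qed
    also have "real j * diameter S ^ m = c * (\<omega> * (diameter S / 2) ^ m)"
      using \<omega> by (simp add: c_def power_divide)
    finally show ?thesis using x c \<omega> diameter_ge_0[OF S(1)] by (auto simp: ennreal_mult[symmetric])
  qed
  have "\<mu> N \<le> ennreal e" if e: "0 < e" for e
  proof -
    have "hausdorff_premeasure m (1 / real j) N \<le> 0"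
      using hausdorff_premeasure_le[of "1 / real j" m N] H j by simp
    then have "hausdorff_premeasure m (1 / real j) N < ennreal (e / c)" using e c by simp
    then obtain S where S: "N \<subseteq> (\<Union>i. S i)" "\<And>i::nat. bounded (S i) \<and> diameter (S i) \<le> 1 / real j"
      and sum: "(\<Sum>i. if S i = {} then 0 else ennreal (\<omega> * (diameter (S i) / 2) ^ m)) < ennreal (e / c)"
      unfolding hausdorff_premeasure_def \<omega>_def INF_less_iff by auto
    have "\<mu> N = \<mu> (\<Union>i. S i \<inter> N)" by (rule arg_cong[where f=\<mu>]) (use S(1) in auto)
    also have "\<dots> \<le> (\<Sum>i. \<mu> (S i \<inter> N))" by (rule outer_measure_countable_UN[OF om])
    also have "\<dots> \<le> (\<Sum>i. ennreal c * (if S i = {} then 0 else ennreal (\<omega> * (diameter (S i) / 2) ^ m)))"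
      using piece S(2) by (intro suminf_le) auto
    also have "\<dots> = ennreal c * (\<Sum>i. if S i = {} then 0 else ennreal (\<omega> * (diameter (S i) / 2) ^ m))"
      by simp
    also have "\<dots> \<le> ennreal c * ennreal (e / c)" using sum by (intro mult_left_mono) auto
    also have "\<dots> = ennreal e" using c e by (simp add: ennreal_mult[symmetric])
    finally show ?thesis .
  qed
  then show ?thesis by (metis ennreal_le_epsilon le_zero_eq add_0 zero_less_one ennreal_0)
qed

lemma abs_continuous_hausdorff_measure:
  assumes om: "outer_measure_space UNIV \<mu>" and m: "1 \<le> m"
    and up: "almost_all \<mu> (\<lambda>x. upper_density m \<mu> x < \<infinity>)"
  shows "abs_continuous \<mu> (hausdorff_measure m)"
  unfolding abs_continuous_def
proof (intro allI impI)
  fix N :: "'a set" assume N: "hausdorff_measure m N = 0"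
  define A where "A j = {x. \<forall>r. 0 < r \<longrightarrow> r \<le> 1 / real j \<longrightarrow> \<mu> (cball x r) \<le> ennreal (real j * r ^ m)}" for j :: nat
  \<comment> \<open>The ball estimates use positive \<open>j\<close>, so index \<open>0\<close> is
    free to hold the exceptional set of infinite upper density.\<close>
  define E where "E j = (if j = 0 then {x. \<not> upper_density m \<mu> x < \<infinity>} else N \<inter> A j)" for j :: nat
  have "N \<subseteq> (\<Union>j. E j)"
  proof
    fix x assume x: "x \<in> N"
    show "x \<in> (\<Union>j. E j)"
    proof (cases "upper_density m \<mu> x < \<infinity>")
      case True
      then obtain j where "0 < j" "x \<in> A j" unfolding A_def by (rule upper_density_finiteD) blast
      then show ?thesis using x by (auto simp: E_def intro: exI[of _ j])
    next
      case False
      then show ?thesis by (auto simp: E_def intro: exI[of _ 0])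
    qed
  qed
  moreover have "\<mu> (E j) = 0" for j
  proof (cases "j = 0")
    case True
    then show ?thesis using up by (simp add: E_def almost_all_def)
  next
    case False
    have pre: "hausdorff_premeasure m \<delta> (N \<inter> A j) \<le> hausdorff_premeasure m \<delta> N" for \<delta>
      unfolding hausdorff_premeasure_def by (rule INF_superset_mono) auto
    have "hausdorff_measure m (N \<inter> A j) \<le> hausdorff_measure m N"
      unfolding hausdorff_measure_def by (rule SUP_mono) (use pre in auto)
    then have "hausdorff_measure m (N \<inter> A j) = 0" using N by simp
    then have "\<mu> (N \<inter> A j) = 0"
      by (intro density_bound_imp_null[OF om m, of j]) (use False in \<open>auto simp: A_def\<close>)
    then show ?thesis using False by (simp add: E_def)
  qed
  then have "\<mu> (\<Union>j. E j) = 0" by (intro outer_measure_null_UN[OF om]) auto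
  ultimately show "\<mu> N = 0" by (metis outer_measure_null_subset[OF om])
qed

section \<open>Two-sided volume bounds for boxes under Hausdorff measure\<close>

lemma hausdorff_premeasure_finite_cover:
  fixes S :: "'i \<Rightarrow> 'a::metric_space set"
  assumes I: "finite I" and A: "A \<subseteq> (\<Union>i\<in>I. S i)"
    and S: "\<And>i. i \<in> I \<Longrightarrow> bounded (S i)" "\<And>i. i \<in> I \<Longrightarrow> diameter (S i) \<le> d" and d: "0 \<le> d" "d \<le> \<delta>"
  shows "hausdorff_premeasure k \<delta> A \<le> ennreal (real (card I) * (unit_ball_vol (real k) * (d / 2) ^ k))"
proof -
  obtain h where h: "bij_betw h {..<card I} I"
    using ex_bij_betw_nat_finite[OF I] by (auto simp: atLeast0LessThan)
  define S' where "S' n = (if n < card I then S (h n) else {})" for n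
  let ?w = "\<lambda>n. if S' n = {} then 0 else ennreal (unit_ball_vol (real k) * (diameter (S' n) / 2) ^ k)"
  have hI: "h n \<in> I" if "n < card I" for n using h that by (auto simp: bij_betw_def)
  have "A \<subseteq> (\<Union>n. S' n)"
  proof
    fix x assume "x \<in> A"
    then obtain i where "i \<in> I" "x \<in> S i" using A by auto
    then have "i \<in> h ` {..<card I}" using h by (simp add: bij_betw_def)
    then obtain n where "n < card I" "h n = i" by auto
    then show "x \<in> (\<Union>n. S' n)" using \<open>x \<in> S i\<close> by (auto simp: S'_def intro: exI[of _ n])
  qed
  moreover have "bounded (S' n) \<and> diameter (S' n) \<le> \<delta>" for n
    using S hI[of n] d by (auto simp: S'_def intro: order_trans)
  ultimately have "hausdorff_premeasure k \<delta> A \<le> (\<Sum>n. ?w n)"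
    unfolding hausdorff_premeasure_def by (intro INF_lower) auto
  also have "\<dots> = (\<Sum>n<card I. ?w n)"
    by (rule suminf_finite) (auto simp: S'_def)
  also have "\<dots> \<le> (\<Sum>n<card I. ennreal (unit_ball_vol (real k) * (d / 2) ^ k))"
    using S(2)[OF hI] diameter_ge_0[OF S(1)[OF hI]]
    by (intro sum_mono) (auto simp: S'_def intro!: ennreal_leI mult_left_mono power_mono divide_right_mono)
  also have "\<dots> = ennreal (real (card I) * (unit_ball_vol (real k) * (d / 2) ^ k))"
    using d by (simp add: ennreal_mult ennreal_of_nat_eq_real_of_nat)
  finally show ?thesis .
qed

lemma parallelepiped_cell_diameter:
  fixes w :: "nat \<Rightarrow> 'a::real_normed_vector"
  assumes w: "\<And>i. i < k \<Longrightarrow> norm (w i) \<le> L" and \<eta>: "0 \<le> \<eta>" and L: "0 \<le> L"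
    and S: "S \<subseteq> {x0 + (\<Sum>i<k. s i *\<^sub>R w i) | s. \<forall>i<k. l i \<le> s i \<and> s i \<le> l i + \<eta>}"
  shows "bounded S" "diameter S \<le> real k * (\<eta> * L)"
proof -
  have *: "dist x y \<le> real k * (\<eta> * L)" if xy: "x \<in> S" "y \<in> S" for x y
  proof -
    obtain s t where s: "x = x0 + (\<Sum>i<k. s i *\<^sub>R w i)" "\<And>i. i < k \<Longrightarrow> l i \<le> s i \<and> s i \<le> l i + \<eta>"
      and t: "y = x0 + (\<Sum>i<k. t i *\<^sub>R w i)" "\<And>i. i < k \<Longrightarrow> l i \<le> t i \<and> t i \<le> l i + \<eta>"
      using S xy by blast
    have "x - y = (\<Sum>i<k. (s i - t i) *\<^sub>R w i)"
      by (simp add: s t scaleR_diff_left sum_subtractf)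
    also have "norm \<dots> \<le> (\<Sum>i<k. \<eta> * L)"
    proof (rule sum_norm_le)
      fix i assume "i \<in> {..<k}"
      then show "norm ((s i - t i) *\<^sub>R w i) \<le> \<eta> * L"
        using s(2)[of i] t(2)[of i] w[of i] \<eta> by (auto intro!: mult_mono)
    qed
    finally show ?thesis by (simp add: dist_norm)
  qed
  show "bounded S"
  proof (cases "S = {}")
    case False
    then obtain z where "z \<in> S" by auto
    then show ?thesis using * unfolding bounded_def by blast
  qed simp
  show "diameter S \<le> real k * (\<eta> * L)"
    by (rule diameter_le) (use * \<eta> L in \<open>auto simp: dist_norm\<close>)
qed

text \<open>At most \<open>2 * \<rho> i / \<eta> + 1\<close> intervals of length
  \<open>\<eta>\<close> are needed in direction \<open>i\<close>, and
  \<open>\<eta> \<le> \<rho> i\<close> absorbs the \<open>1\<close>. The grid serves twice: for the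
  volume of thin simplices and for covering tubes about planes.\<close>

lemma parallelepiped_grid:
  fixes w :: "nat \<Rightarrow> 'a::real_normed_vector"
  assumes w: "\<And>i. i < k \<Longrightarrow> norm (w i) \<le> L" and \<eta>: "0 < \<eta>" and L: "0 \<le> L"
    and \<rho>: "\<And>i. i < k \<Longrightarrow> \<eta> \<le> \<rho> i"
    and A: "A \<subseteq> {x0 + (\<Sum>i<k. s i *\<^sub>R w i) | s. \<forall>i<k. \<bar>s i\<bar> \<le> \<rho> i}"
  obtains I :: "(nat \<Rightarrow> nat) set" and S where "finite I" "A \<subseteq> (\<Union>z\<in>I. S z)"
    "\<And>z. z \<in> I \<Longrightarrow> bounded (S z)" "\<And>z. z \<in> I \<Longrightarrow> diameter (S z) \<le> real k * (\<eta> * L)"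
    "real (card I) \<le> (\<Prod>i<k. 3 * \<rho> i / \<eta>)"
proof -
  define N where "N i = nat \<lfloor>2 * \<rho> i / \<eta>\<rfloor> + 1" for i
  define I where "I = PiE {..<k} (\<lambda>i. {..<N i})"
  define S where "S z = {x0 + (\<Sum>i<k. s i *\<^sub>R w i) | s. \<forall>i<k. - \<rho> i + real (z i) * \<eta> \<le> s i \<and> s i \<le> - \<rho> i + real (z i) * \<eta> + \<eta>}"
    for z :: "nat \<Rightarrow> nat"
  show thesis
  proof (rule that[of I S])
    show "finite I" unfolding I_def by (intro finite_PiE) auto
    show "A \<subseteq> (\<Union>z\<in>I. S z)"
    proof
      fix x assume "x \<in> A"
      then obtain s where s: "x = x0 + (\<Sum>i<k. s i *\<^sub>R w i)" "\<And>i. i < k \<Longrightarrow> \<bar>s i\<bar> \<le> \<rho> i" using A by blast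
      define z where "z = restrict (\<lambda>i. nat \<lfloor>(s i + \<rho> i) / \<eta>\<rfloor>) {..<k}"
      have "z i < N i \<and> - \<rho> i + real (z i) * \<eta> \<le> s i \<and> s i \<le> - \<rho> i + real (z i) * \<eta> + \<eta>" if i: "i < k" for i
      proof -
        have s0: "0 \<le> s i + \<rho> i" "s i + \<rho> i \<le> 2 * \<rho> i" using s(2)[OF i] by auto
        then have "\<lfloor>(s i + \<rho> i) / \<eta>\<rfloor> \<le> \<lfloor>2 * \<rho> i / \<eta>\<rfloor>"
          using \<eta> by (intro floor_mono divide_right_mono) auto
        then have "z i < N i" using i by (simp add: z_def N_def nat_le_eq_zle less_Suc_eq_le nat_mono)
        moreover have "real (z i) = of_int \<lfloor>(s i + \<rho> i) / \<eta>\<rfloor>" using i s0 \<eta> by (simp add: z_def)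
        moreover have "of_int \<lfloor>(s i + \<rho> i) / \<eta>\<rfloor> * \<eta> \<le> s i + \<rho> i"
          by (subst pos_le_divide_eq[OF \<eta>, symmetric]) (rule of_int_floor_le)
        moreover have "s i + \<rho> i \<le> (of_int \<lfloor>(s i + \<rho> i) / \<eta>\<rfloor> + 1) * \<eta>"
          by (subst pos_divide_le_eq[OF \<eta>, symmetric]) (rule real_of_int_floor_add_one_ge)
        ultimately show ?thesis by (simp add: algebra_simps)
      qed
      then have "z \<in> I" "x \<in> S z" using s(1) by (auto simp: I_def S_def z_def)
      then show "x \<in> (\<Union>z\<in>I. S z)" by blast
    qed
    show "bounded (S z)" "diameter (S z) \<le> real k * (\<eta> * L)" if "z \<in> I" for z
      using parallelepiped_cell_diameter[of k w L \<eta> "S z" x0 "\<lambda>i. - \<rho> i + real (z i) * \<eta>"] w \<eta> L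
      by (auto simp: S_def)
    have "real (card I) = (\<Prod>i<k. real (N i))" by (simp add: I_def card_PiE)
    also have "\<dots> \<le> (\<Prod>i<k. 3 * \<rho> i / \<eta>)"
    proof (rule prod_mono)
      fix i assume "i \<in> {..<k}"
      then have r: "\<eta> \<le> \<rho> i" using \<rho> by simp
      have "real (nat \<lfloor>2 * \<rho> i / \<eta>\<rfloor>) \<le> 2 * \<rho> i / \<eta>" using r \<eta> by simp
      moreover have "1 \<le> \<rho> i / \<eta>" using r \<eta> by simp
      moreover have "2 * \<rho> i / \<eta> + \<rho> i / \<eta> = 3 * \<rho> i / \<eta>" by (simp add: add_divide_distrib[symmetric])
      ultimately show "0 \<le> real (N i) \<and> real (N i) \<le> 3 * \<rho> i / \<eta>"
        unfolding N_def by linarith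
    qed
    finally show "real (card I) \<le> (\<Prod>i<k. 3 * \<rho> i / \<eta>)" .
  qed
qed

text \<open>Refining the grid raises the number of cells by the factor by which it lowers the
  \<open>k\<close>-th power of their diameters; the mesh cancels and the bound is uniform in
  \<open>\<delta>\<close>.\<close>

lemma hausdorff_measure_parallelepiped_le:
  fixes w :: "nat \<Rightarrow> 'a::real_normed_vector"
  assumes w: "\<And>i. i < k \<Longrightarrow> norm (w i) \<le> L" and L: "0 < L" and \<rho>: "\<And>i. i < k \<Longrightarrow> 0 < \<rho> i"
    and A: "A \<subseteq> {x0 + (\<Sum>i<k. s i *\<^sub>R w i) | s. \<forall>i<k. \<bar>s i\<bar> \<le> \<rho> i}"
  shows "hausdorff_measure k A \<le> ennreal (unit_ball_vol (real k) * (2 * real k * L) ^ k * (\<Prod>i<k. \<rho> i))"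
  unfolding hausdorff_measure_def
proof (rule SUP_least)
  fix \<delta> :: real assume "\<delta> \<in> {0<..}"
  then have \<delta>: "0 < \<delta>" by simp
  \<comment> \<open>Small enough both for cells of diameter at most \<open>\<delta>\<close> and for
    the grid lemma, which wants \<open>\<eta> \<le> \<rho> i\<close>.\<close>
  define \<eta> where "\<eta> = Min (insert (\<delta> / ((real k + 1) * L)) (\<rho> ` {..<k}))"
  have \<eta>: "0 < \<eta>" unfolding \<eta>_def using \<delta> L \<rho> by (subst Min_gr_iff) auto
  have \<eta>\<rho>: "\<eta> \<le> \<rho> i" if "i < k" for i unfolding \<eta>_def using that by (intro Min_le) auto
  have "\<eta> \<le> \<delta> / ((real k + 1) * L)" unfolding \<eta>_def by (intro Min_le) auto
  then have "\<eta> * ((real k + 1) * L) \<le> \<delta>" using L by (subst (asm) pos_le_divide_eq) auto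
  moreover have "real k * (\<eta> * L) \<le> \<eta> * ((real k + 1) * L)" using L \<eta> by (simp add: algebra_simps)
  ultimately have \<eta>\<delta>: "real k * (\<eta> * L) \<le> \<delta>" by linarith
  obtain I :: "(nat \<Rightarrow> nat) set" and S where IS: "finite I" "A \<subseteq> (\<Union>z\<in>I. S z)"
    "\<And>z. z \<in> I \<Longrightarrow> bounded (S z)" "\<And>z. z \<in> I \<Longrightarrow> diameter (S z) \<le> real k * (\<eta> * L)"
    and card: "real (card I) \<le> (\<Prod>i<k. 3 * \<rho> i / \<eta>)"
    by (rule parallelepiped_grid[OF w \<eta> less_imp_le[OF L] \<eta>\<rho> A]) (assumption, assumption, (rule that; blast))
  have "hausdorff_premeasure k \<delta> A \<le> ennreal (real (card I) * (unit_ball_vol (real k) * (real k * (\<eta> * L) / 2) ^ k))"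
    using hausdorff_premeasure_finite_cover[OF IS _ \<eta>\<delta>] \<eta> L by simp
  also have "real (card I) * (unit_ball_vol (real k) * (real k * (\<eta> * L) / 2) ^ k)
      \<le> (\<Prod>i<k. 3 * \<rho> i / \<eta>) * (unit_ball_vol (real k) * (real k * (\<eta> * L) / 2) ^ k)"
    using card \<eta> L by (intro mult_right_mono) auto
  also have "(\<Prod>i<k. 3 * \<rho> i / \<eta>) = (3 / \<eta>) ^ k * (\<Prod>i<k. \<rho> i)"
  proof -
    have "(\<Prod>i<k. 3 * \<rho> i / \<eta>) = (\<Prod>i<k. (3 / \<eta>) * \<rho> i)" by simp
    then show ?thesis by (simp only: prod.distrib prod_constant card_lessThan)
  qed
  also have "(3 / \<eta>) ^ k * (\<Prod>i<k. \<rho> i) * (unit_ball_vol (real k) * (real k * (\<eta> * L) / 2) ^ k)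
      = unit_ball_vol (real k) * (3 / 2 * real k * L) ^ k * (\<Prod>i<k. \<rho> i)"
    using \<eta> by (simp add: power_mult_distrib power_divide field_simps)
  also have "\<dots> \<le> unit_ball_vol (real k) * (2 * real k * L) ^ k * (\<Prod>i<k. \<rho> i)"
    using L \<rho> by (intro mult_right_mono mult_left_mono power_mono prod_nonneg) (auto simp: less_imp_le)
  finally show "hausdorff_premeasure k \<delta> A \<le> ennreal (unit_ball_vol (real k) * (2 * real k * L) ^ k * (\<Prod>i<k. \<rho> i))"
    by (simp add: ennreal_leI)
qed

text \<open>In orthonormal coordinates each covering set lies in a cube of side twice its diameter.
  These cubes cover a box of volume \<open>2 ^ k * (\<Prod>i<k. \<rho> i)\<close>, and the volume of
  a cube is \<open>4 ^ k / \<omega>\<close> times the corresponding Hausdorff term, so every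
  Hausdorff sum is bounded below.\<close>

lemma hausdorff_measure_box_ge:
  fixes e :: "nat \<Rightarrow> 'a::real_inner"
  assumes k: "1 \<le> k" and e: "\<And>i j. i < k \<Longrightarrow> j < k \<Longrightarrow> e i \<bullet> e j = (if i = j then 1 else 0)"
    and \<rho>: "\<And>i. i < k \<Longrightarrow> 0 < \<rho> i"
    and A: "\<And>s. (\<And>i. i < k \<Longrightarrow> \<bar>s i\<bar> \<le> \<rho> i) \<Longrightarrow> x0 + (\<Sum>i<k. s i *\<^sub>R e i) \<in> A"
  shows "ennreal (unit_ball_vol (real k) / 2 ^ k * (\<Prod>i<k. \<rho> i)) \<le> hausdorff_measure k A"
proof -
  interpret P: product_sigma_finite "\<lambda>_::nat. lborel :: real measure" ..
  let ?M = "Pi\<^sub>M {..<k} (\<lambda>_. lborel :: real measure)"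
  define \<omega> where "\<omega> = unit_ball_vol (real k)"
  have \<omega>: "0 < \<omega>" by (simp add: \<omega>_def)
  have vol: "emeasure ?M (PiE {..<k} (\<lambda>i. {l i..u i})) = ennreal (\<Prod>i<k. u i - l i)" if "\<And>i. l i \<le> u i" for l u :: "nat \<Rightarrow> real"
    using that by (subst P.emeasure_PiM) (auto simp: prod_ennreal)
  have "ennreal (\<omega> / 2 ^ k * (\<Prod>i<k. \<rho> i)) \<le> hausdorff_premeasure k 1 A"
    unfolding hausdorff_premeasure_def \<omega>_def[symmetric]
  proof (rule INF_greatest, clarsimp)
    fix S :: "nat \<Rightarrow> 'a set" assume cov: "A \<subseteq> (\<Union>i. S i)" and S: "\<forall>i. bounded (S i) \<and> diameter (S i) \<le> 1"
    define p where "p j = (SOME x. x \<in> S j)" for j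
    have p: "p j \<in> S j" if "S j \<noteq> {}" for j using that unfolding p_def by (simp add: some_in_eq)
    define d where "d j = diameter (S j)" for j
    have d: "0 \<le> d j" for j unfolding d_def using S diameter_ge_0 by blast
    define T where "T j = (if S j = {} then {} else PiE {..<k} (\<lambda>i. {(p j - x0) \<bullet> e i - d j..(p j - x0) \<bullet> e i + d j}))" for j
    have sub: "PiE {..<k} (\<lambda>i. {- \<rho> i..\<rho> i}) \<subseteq> (\<Union>j. T j)"
    proof
      fix s assume s: "s \<in> PiE {..<k} (\<lambda>i. {- \<rho> i..\<rho> i})"
      then have "x0 + (\<Sum>i<k. s i *\<^sub>R e i) \<in> A" by (intro A) (auto simp: PiE_def Pi_def abs_le_iff)
      then obtain j where j: "x0 + (\<Sum>i<k. s i *\<^sub>R e i) \<in> S j" using cov by auto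
      then have ne: "S j \<noteq> {}" by auto
      have "\<bar>s i - (p j - x0) \<bullet> e i\<bar> \<le> d j" if i: "i < k" for i
      proof -
        have "(\<Sum>i'<k. s i' *\<^sub>R e i') \<bullet> e i = (\<Sum>i'<k. if i' = i then s i' else 0)"
          unfolding inner_sum_left using i by (intro sum.cong) (auto simp: e)
        then have "s i - (p j - x0) \<bullet> e i = (x0 + (\<Sum>i<k. s i *\<^sub>R e i) - p j) \<bullet> e i"
          using i by (simp add: inner_diff_left inner_add_left)
        also have "\<bar>\<dots>\<bar> \<le> norm (x0 + (\<Sum>i<k. s i *\<^sub>R e i) - p j) * norm (e i)" by (rule Cauchy_Schwarz_ineq2)
        also have "norm (e i) = 1" using e[OF i i] by (simp add: norm_eq_sqrt_inner)
        also have "norm (x0 + (\<Sum>i<k. s i *\<^sub>R e i) - p j) \<le> d j"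
          using diameter_bounded_bound[OF _ j p[OF ne]] S by (auto simp: d_def dist_norm)
        finally show ?thesis by simp
      qed
      then have "s \<in> T j" using s ne by (auto simp: T_def PiE_def Pi_def abs_le_iff algebra_simps)
      then show "s \<in> (\<Union>j. T j)" by auto
    qed
    have Tm: "T j \<in> sets ?M" for j unfolding T_def by (auto intro!: sets_PiM_I_finite)
    have "ennreal (\<Prod>i<k. 2 * \<rho> i) = emeasure ?M (PiE {..<k} (\<lambda>i. {- \<rho> i..\<rho> i}))"
    proof -
      have "emeasure ?M (PiE {..<k} (\<lambda>i. {- \<rho> i..\<rho> i})) = (\<Prod>i<k. ennreal (2 * \<rho> i))"
        using \<rho> by (subst P.emeasure_PiM) (auto intro!: prod.cong simp: less_imp_le)
      then show ?thesis using \<rho> by (subst prod_ennreal[symmetric]) (auto simp: less_imp_le)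
    qed
    also have "\<dots> \<le> emeasure ?M (\<Union>j. T j)"
      using Tm by (intro emeasure_mono[OF sub]) auto
    also have "\<dots> \<le> (\<Sum>j. emeasure ?M (T j))"
      using Tm by (intro emeasure_subadditive_countably) auto
    also have "\<dots> \<le> (\<Sum>j. ennreal (4 ^ k / \<omega>) * (if S j = {} then 0 else ennreal (\<omega> * (d j / 2) ^ k)))"
    proof (intro suminf_le)
      fix j
      show "emeasure ?M (T j) \<le> ennreal (4 ^ k / \<omega>) * (if S j = {} then 0 else ennreal (\<omega> * (d j / 2) ^ k))"
      proof (cases "S j = {}")
        case False
        have "emeasure ?M (T j) = ennreal ((2 * d j) ^ k)"
          using False d[of j] by (simp add: T_def vol)
        also have "(2 * d j) ^ k = (4 ^ k / \<omega>) * (\<omega> * (d j / 2) ^ k)"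
        proof -
          have "(2 * d j) ^ k = (4 * (d j / 2)) ^ k" by simp
          also have "\<dots> = 4 ^ k * (d j / 2) ^ k" by (rule power_mult_distrib)
          finally show ?thesis using \<omega> by simp
        qed
        finally show ?thesis using False \<omega> d[of j] by (simp add: ennreal_mult[symmetric])
      qed (simp add: T_def)
    qed auto
    also have "\<dots> = ennreal (4 ^ k / \<omega>) * (\<Sum>j. if S j = {} then 0 else ennreal (\<omega> * (d j / 2) ^ k))"
      by simp
    finally have "ennreal (\<omega> / 4 ^ k) * ennreal (\<Prod>i<k. 2 * \<rho> i)
      \<le> ennreal (\<omega> / 4 ^ k) * (ennreal (4 ^ k / \<omega>) * (\<Sum>j. if S j = {} then 0 else ennreal (\<omega> * (d j / 2) ^ k)))"
      by (rule mult_left_mono) simp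
    also have "\<dots> = (\<Sum>j. if S j = {} then 0 else ennreal (\<omega> * (d j / 2) ^ k))"
      using \<omega> by (simp add: mult.assoc[symmetric] ennreal_mult[symmetric])
    also have "ennreal (\<omega> / 4 ^ k) * ennreal (\<Prod>i<k. 2 * \<rho> i) = ennreal (\<omega> / 2 ^ k * (\<Prod>i<k. \<rho> i))"
    proof -
      have "(4::real) ^ k = 2 ^ k * 2 ^ k" by (subst power_mult_distrib[symmetric]) simp
      moreover have "(\<Prod>i<k. 2 * \<rho> i) = 2 ^ k * (\<Prod>i<k. \<rho> i)" by (simp add: prod.distrib)
      moreover have "0 \<le> (\<Prod>i<k. \<rho> i)" using \<rho> by (intro prod_nonneg) (auto simp: less_imp_le)
      ultimately show ?thesis using \<omega> by (subst ennreal_mult[symmetric]) auto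
    qed
    finally show "ennreal (\<omega> * (\<Prod>i<k. \<rho> i) / 2 ^ k) \<le> (\<Sum>i. if S i = {} then 0 else ennreal (\<omega> * (diameter (S i) / 2) ^ k))"
      unfolding d_def by simp
  qed
  also have "\<dots> \<le> hausdorff_measure k A" by (rule hausdorff_premeasure_le) simp
  finally show ?thesis by (simp add: \<omega>_def)
qed

section \<open>Volume of fat simplices\<close>

text \<open>Quantitative linear independence at scale \<open>r\<close>. Distances to spans of
  predecessors take the place of a determinant because they can be secured one vector at a
  time.\<close>

definition fat_family :: "real \<Rightarrow> real \<Rightarrow> (nat \<Rightarrow> 'a::real_normed_vector) \<Rightarrow> nat \<Rightarrow> bool" where
  "fat_family \<eta> r v k \<longleftrightarrow>
     (\<forall>i<k. norm (v i) \<le> r \<and> (\<forall>y\<in>span (v ` {..<i}). \<eta> * r \<le> norm (v i - y)))"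

text \<open>Fatness of the last vector bounds its coefficient by the norm of the whole combination.
  Removing that term enlarges the norm at most by \<open>1 + 1 / \<eta>\<close>, and the induction
  goes on with one such factor per vector.\<close>

lemma fat_family_coeff:
  assumes "fat_family \<eta> r v k" and \<eta>: "0 < \<eta>" and r: "0 < r" and "i < k"
  shows "\<bar>t i\<bar> * r \<le> (1 + 1 / \<eta>) ^ k * norm (\<Sum>i<k. t i *\<^sub>R v i)"
  using assms(1,4)
proof (induction k arbitrary: i)
  case (Suc k)
  define z where "z = (\<Sum>i<k. t i *\<^sub>R v i)"
  define y where "y = (\<Sum>i<Suc k. t i *\<^sub>R v i)"
  have y: "y = z + t k *\<^sub>R v k" by (simp add: y_def z_def)
  have zs: "z \<in> span (v ` {..<k})" unfolding z_def by (intro span_sum span_scale span_base) auto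
  have fk: "norm (v k) \<le> r" "\<And>y. y \<in> span (v ` {..<k}) \<Longrightarrow> \<eta> * r \<le> norm (v k - y)"
    using Suc.prems(1) by (auto simp: fat_family_def)
  have tk: "\<bar>t k\<bar> * r \<le> 1 / \<eta> * norm y"
  proof (cases "t k = 0")
    case False
    have "\<eta> * r \<le> norm (v k - (- (1 / t k)) *\<^sub>R z)" by (intro fk span_scale zs)
    then have "\<bar>t k\<bar> * (\<eta> * r) \<le> \<bar>t k\<bar> * norm (v k - (- (1 / t k)) *\<^sub>R z)" by (intro mult_left_mono) auto
    also have "\<dots> = norm (t k *\<^sub>R (v k - (- (1 / t k)) *\<^sub>R z))" by simp
    also have "t k *\<^sub>R (v k - (- (1 / t k)) *\<^sub>R z) = y" using False by (simp add: y algebra_simps)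
    finally show ?thesis using \<eta> by (simp add: field_simps)
  qed (use \<eta> in simp)
  have nz: "norm z \<le> (1 + 1 / \<eta>) * norm y"
  proof -
    have "z = y - t k *\<^sub>R v k" by (simp add: y)
    then have "norm z \<le> norm y + \<bar>t k\<bar> * norm (v k)" by (metis norm_triangle_ineq4 norm_scaleR)
    also have "\<dots> \<le> norm y + \<bar>t k\<bar> * r" using fk by (intro add_left_mono mult_left_mono) auto
    finally show ?thesis using tk by (simp add: algebra_simps)
  qed
  have p1: "1 \<le> (1 + 1 / \<eta>) ^ k" using \<eta> by (intro one_le_power) auto
  show ?case
  proof (cases "i = k")
    case True
    have "1 / \<eta> * norm y \<le> (1 + 1 / \<eta>) ^ Suc k * norm y"
    proof (rule mult_right_mono)
      have "1 / \<eta> \<le> (1 + 1 / \<eta>) * 1" by simp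
      also have "\<dots> \<le> (1 + 1 / \<eta>) * (1 + 1 / \<eta>) ^ k" using p1 \<eta> by (intro mult_left_mono) auto
      finally show "1 / \<eta> \<le> (1 + 1 / \<eta>) ^ Suc k" by simp
    qed simp
    then show ?thesis using tk True by (simp add: y_def)
  next
    case False
    then have "\<bar>t i\<bar> * r \<le> (1 + 1 / \<eta>) ^ k * norm z"
      using Suc by (auto simp: fat_family_def z_def)
    also have "\<dots> \<le> (1 + 1 / \<eta>) ^ k * ((1 + 1 / \<eta>) * norm y)" using nz p1 by (intro mult_left_mono) auto
    finally show ?thesis by (simp add: y_def mult_ac)
  qed
qed simp

lemma span_image_lessThanE:
  fixes v :: "nat \<Rightarrow> 'a::real_vector"
  assumes "y \<in> span (v ` {..<k})"
  obtains t where "y = (\<Sum>i<k. t i *\<^sub>R v i)"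
proof -
  have "\<exists>t. y = (\<Sum>i<k. t i *\<^sub>R v i)"
    using assms
  proof (induction k arbitrary: y)
    case (Suc k)
    then obtain c where "y - c *\<^sub>R v k \<in> span (v ` {..<k})"
      unfolding lessThan_Suc image_insert span_breakdown_eq by blast
    then obtain t where t: "y - c *\<^sub>R v k = (\<Sum>i<k. t i *\<^sub>R v i)" using Suc.IH by blast
    have "y = (\<Sum>i<Suc k. (t(k := c)) i *\<^sub>R v i)"
      using t by (simp add: algebra_simps)
    then show ?case by blast
  qed simp
  then show thesis using that by blast
qed

lemma fat_family_dim:
  fixes v :: "nat \<Rightarrow> 'a::euclidean_space"
  assumes "fat_family \<eta> r v k" "0 < \<eta>" "0 < r"
  shows "dim (span (v ` {..<k})) = k"
proof -
  have "independent (v ` {..<k}) \<and> card (v ` {..<k}) = k"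
    using assms(1)
  proof (induction k)
    case (Suc k)
    then have IH: "independent (v ` {..<k})" "card (v ` {..<k}) = k" by (auto simp: fat_family_def)
    have "v k \<notin> span (v ` {..<k})"
    proof
      assume "v k \<in> span (v ` {..<k})"
      then have "\<eta> * r \<le> norm (v k - v k)" using Suc.prems unfolding fat_family_def by blast
      moreover have "0 < \<eta> * r" using assms by simp
      ultimately show False by simp
    qed
    then show ?case
      using IH by (auto simp: lessThan_Suc independent_insert card_insert_if intro: span_base)
  qed (simp add: independent_empty)
  then show ?thesis by (metis dim_eq_card_independent dim_span)
qed

lemma orthonormal_sequence_of_subspace:
  fixes W :: "'a::euclidean_space set"
  assumes "subspace W"
  obtains e :: "nat \<Rightarrow> 'a" where "\<And>i. i < dim W \<Longrightarrow> e i \<in> W"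
    "\<And>i j. i < dim W \<Longrightarrow> j < dim W \<Longrightarrow> e i \<bullet> e j = (if i = j then 1 else 0)"
    "span (e ` {..<dim W}) = W"
proof -
  obtain B where B: "B \<subseteq> W" "pairwise orthogonal B" "\<And>x. x \<in> B \<Longrightarrow> norm x = 1" "independent B"
    "card B = dim W" "span B = W"
    using orthonormal_basis_subspace[OF assms] by metis
  have "finite B" using B(4) by (rule independent_imp_finite)
  then obtain e where e: "bij_betw e {..<dim W} B"
    using ex_bij_betw_nat_finite B(5) by (metis atLeast0LessThan)
  show thesis
  proof (rule that)
    show "e i \<in> W" if "i < dim W" for i using e B(1) that by (auto simp: bij_betw_def)
    show "span (e ` {..<dim W}) = W" using e B(6) by (simp add: bij_betw_def)
    show "e i \<bullet> e j = (if i = j then 1 else 0)" if ij: "i < dim W" "j < dim W" for i j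
    proof -
      have "e i \<in> B" "e j \<in> B" using e ij by (auto simp: bij_betw_def)
      moreover have "i \<noteq> j \<Longrightarrow> e i \<noteq> e j" using e ij by (auto simp: bij_betw_def inj_on_def)
      ultimately show ?thesis
        using B(2,3) by (auto simp: pairwise_def orthogonal_def norm_eq_1)
    qed
  qed
qed

text \<open>The constant of \<open>hausdorff_measure_box_ge\<close> in dimension
  \<open>m + 1\<close>, times the power of the relative size of a box that fits around the
  barycentre of a fat simplex; \<open>(1 + 1 / \<eta>) ^ m\<close> stems from
  \<open>fat_family_coeff\<close>.\<close>

definition simplex_const :: "nat \<Rightarrow> real \<Rightarrow> real" where
  "simplex_const m \<eta> =
     unit_ball_vol (real (m + 1)) / 2 ^ (m + 1) * (1 / (real (m + 2) ^ 3 * (1 + 1 / \<eta>) ^ m)) ^ (m + 1)"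

lemma simplex_const_pos: "0 < \<eta> \<Longrightarrow> 0 < simplex_const m \<eta>"
  unfolding simplex_const_def
  by (intro mult_pos_pos divide_pos_pos zero_less_power) (auto intro!: mult_pos_pos zero_less_power add_pos_pos)

text \<open>A box about the barycentre, with half-width \<open>\<epsilon> * r\<close> along the base
  and \<open>\<epsilon> * norm q\<close> along the height, stays inside: at the centre all
  barycentric coordinates equal \<open>1 / (m + 2)\<close>, and moving within the box changes each
  by no more than that.\<close>

lemma hausdorff_measure_simplex_ge:
  fixes v :: "nat \<Rightarrow> 'a::euclidean_space"
  assumes fat: "fat_family \<eta> r v m" and \<eta>: "0 < \<eta>" and r: "0 < r"
    and c: "c - a = w + q" "w \<in> span (v ` {..<m})" "\<And>y. y \<in> span (v ` {..<m}) \<Longrightarrow> q \<bullet> y = 0"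
    and q0: "q \<noteq> 0" and car: "norm (c - a) \<le> r"
  shows "ennreal (simplex_const m \<eta> * (r ^ m * norm q))
    \<le> hausdorff_measure (m + 1) (convex hull (insert a (insert c ((\<lambda>i. a + v i) ` {..<m}))))"
proof -
  define W where "W = span (v ` {..<m})"
  define h where "h = norm q"
  have h: "0 < h" using q0 by (simp add: h_def)
  have dimW: "dim W = m" unfolding W_def by (rule fat_family_dim[OF fat \<eta> r])
  obtain e0 where e0: "\<And>i. i < m \<Longrightarrow> e0 i \<in> W"
    "\<And>i j. i < m \<Longrightarrow> j < m \<Longrightarrow> e0 i \<bullet> e0 j = (if i = j then 1 else 0)"
    using orthonormal_sequence_of_subspace[of W] dimW by (metis W_def subspace_span)
  define e where "e i = (if i < m then e0 i else q /\<^sub>R h)" for i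
  have orth: "e i \<bullet> e j = (if i = j then 1 else 0)" if "i < m + 1" "j < m + 1" for i j
  proof -
    have "q \<bullet> e0 i = 0" if "i < m" for i using c(3) e0(1)[OF that] by (simp add: W_def)
    moreover have "q \<bullet> q = h * h" by (simp add: h_def power2_norm_eq_inner[symmetric] power2_eq_square)
    ultimately show ?thesis using that e0 h by (auto simp: e_def inner_commute field_simps)
  qed
  have nw: "norm w \<le> r"
  proof -
    have "q \<bullet> w = 0" using c by simp
    then have "(norm (c - a))\<^sup>2 = (norm w)\<^sup>2 + (norm q)\<^sup>2"
      unfolding c(1) by (simp add: power2_norm_eq_inner inner_add_left inner_add_right inner_commute)
    then have "(norm w)\<^sup>2 \<le> (norm (c - a))\<^sup>2" by simp
    then have "norm w \<le> norm (c - a)" by (simp add: power2_le_iff_abs_le)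
    then show ?thesis using car by simp
  qed
  define C where "C = (1 + 1 / \<eta>) ^ m"
  have C: "1 \<le> C" unfolding C_def using \<eta> by (intro one_le_power) auto
  define M where "M = real (m + 2)"
  have M: "2 \<le> M" "real m = M - 2" by (auto simp: M_def)
  define \<epsilon> where "\<epsilon> = 1 / (M ^ 3 * C)"
  have \<epsilon>: "0 < \<epsilon>" using M C by (simp add: \<epsilon>_def)
  have \<epsilon>C: "M * (M * (C * \<epsilon>)) = 1 / M" using M C by (simp add: \<epsilon>_def power3_eq_cube)
  define \<rho> where "\<rho> i = (if i < m then \<epsilon> * r else \<epsilon> * h)" for i
  define x0 where "x0 = a + (1 / M) *\<^sub>R ((\<Sum>i<m. v i) + (c - a))"
  let ?S = "insert a (insert c ((\<lambda>i. a + v i) ` {..<m}))"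
  have "x0 + (\<Sum>i<m+1. s i *\<^sub>R e i) \<in> convex hull ?S" if s: "\<And>i. i < m + 1 \<Longrightarrow> \<bar>s i\<bar> \<le> \<rho> i" for s
  proof -
    \<comment> \<open>Moving by \<open>s m\<close> along the unit vector
      \<open>q /\<^sub>R h\<close> is moving by \<open>s m / h\<close> along \<open>c - a\<close>,
      corrected within the base plane by the multiple of \<open>w\<close>.\<close>
    define y where "y = (\<Sum>i<m. s i *\<^sub>R e0 i) - (s m / h) *\<^sub>R w"
    have "y \<in> W" unfolding y_def using e0(1) c(2)
      by (intro subspace_diff subspace_sum subspace_scale) (auto simp: W_def)
    then obtain t where t: "y = (\<Sum>i<m. t i *\<^sub>R v i)" unfolding W_def by (rule span_image_lessThanE)
    have smh: "\<bar>s m / h\<bar> \<le> \<epsilon>" using s[of m] h by (simp add: \<rho>_def field_simps)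
    have ny: "norm y \<le> (M - 1) * (\<epsilon> * r)"
    proof -
      have "norm y \<le> norm (\<Sum>i<m. s i *\<^sub>R e0 i) + norm ((s m / h) *\<^sub>R w)" unfolding y_def by (rule norm_triangle_ineq4)
      also have "norm (\<Sum>i<m. s i *\<^sub>R e0 i) \<le> (\<Sum>i<m. \<epsilon> * r)"
      proof (rule sum_norm_le)
        fix i assume i: "i \<in> {..<m}"
        then have "norm (e0 i) = 1" using e0(2)[of i i] by (simp add: norm_eq_1)
        then show "norm (s i *\<^sub>R e0 i) \<le> \<epsilon> * r" using s[of i] i by (simp add: \<rho>_def)
      qed
      also have "norm ((s m / h) *\<^sub>R w) \<le> \<epsilon> * r"
        using mult_mono[OF smh nw] \<epsilon> by simp
      finally show ?thesis by (simp add: M algebra_simps)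
    qed
    have ti: "\<bar>t i\<bar> \<le> M * (C * \<epsilon>)" if i: "i < m" for i
    proof -
      have "\<bar>t i\<bar> * r \<le> C * norm y"
        unfolding C_def t by (rule fat_family_coeff[OF fat \<eta> r i])
      also have "\<dots> \<le> C * ((M - 1) * (\<epsilon> * r))" using ny C by (intro mult_left_mono) auto
      also have "\<dots> \<le> C * (M * (\<epsilon> * r))" using C \<epsilon> r by (intro mult_left_mono mult_right_mono) auto
      finally have "\<bar>t i\<bar> * r \<le> M * (C * \<epsilon>) * r" by (simp add: mult_ac)
      then show ?thesis using r by simp
    qed
    have MCe: "M * (C * \<epsilon>) \<le> 1 / M" "\<epsilon> \<le> M * (C * \<epsilon>)"
    proof -
      have "1 * (M * (C * \<epsilon>)) \<le> M * (M * (C * \<epsilon>))" using M C \<epsilon> by (intro mult_right_mono) auto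
      then show "M * (C * \<epsilon>) \<le> 1 / M" using \<epsilon>C by simp
      have "1 * (1 * \<epsilon>) \<le> M * (C * \<epsilon>)" using M C \<epsilon> by (intro mult_mono) auto
      then show "\<epsilon> \<le> M * (C * \<epsilon>)" by simp
    qed
    \<comment> \<open>Barycentric coordinates for the vertices \<open>a + v i\<close>, then
      \<open>c\<close>, then \<open>a\<close>; the last one is forced by the sum being one.\<close>
    define u where "u i = (if i < m then 1 / M + t i else if i = m then 1 / M + s m / h
      else 1 / M - (\<Sum>i<m. t i) - s m / h)" for i
    define z where "z i = (if i < m then a + v i else if i = m then c else a)" for i
    have u1: "(\<Sum>i<m+2. u i) = 1"
    proof -
      have "(\<Sum>i<m+2. u i) = (\<Sum>i<m. 1 / M + t i) + (1 / M + s m / h) + (1 / M - (\<Sum>i<m. t i) - s m / h)"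
        by (simp add: u_def)
      also have "\<dots> = (real m + 2) / M" by (simp add: sum.distrib add_divide_distrib)
      finally show ?thesis using M by simp
    qed
    have u0: "0 \<le> u i" for i
    proof -
      have "\<bar>\<Sum>i<m. t i\<bar> \<le> (\<Sum>i<m. \<bar>t i\<bar>)" by (rule sum_abs)
      also have "\<dots> \<le> (\<Sum>i<m. M * (C * \<epsilon>))" using ti by (intro sum_mono) auto
      also have "\<dots> = (M - 2) * (M * (C * \<epsilon>))" using M by simp
      finally have "\<bar>\<Sum>i<m. t i\<bar> + \<bar>s m / h\<bar> \<le> (M - 2) * (M * (C * \<epsilon>)) + M * (C * \<epsilon>)"
        using smh MCe by linarith
      also have "\<dots> = M * (M * (C * \<epsilon>)) - M * (C * \<epsilon>)" by (simp add: algebra_simps)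
      also have "\<dots> \<le> 1 / M" using \<epsilon>C M C \<epsilon> by simp
      finally have tot: "\<bar>\<Sum>i<m. t i\<bar> + \<bar>s m / h\<bar> \<le> 1 / M" .
      consider "i < m" | "i = m" | "m < i" by linarith
      then show ?thesis
      proof cases
        case 1
        then show ?thesis using ti[of i] MCe unfolding u_def by simp
      next
        case 2
        then have "u i = 1 / M + s m / h" by (simp add: u_def)
        then show ?thesis using smh MCe by linarith
      next
        case 3
        then have "u i = 1 / M - (\<Sum>i<m. t i) - s m / h" by (simp add: u_def)
        then show ?thesis using tot by linarith
      qed
    qed
    have uz: "(\<Sum>i<m+2. u i *\<^sub>R z i) = x0 + (\<Sum>i<m+1. s i *\<^sub>R e i)"
    proof -
      have "(\<Sum>i<m+2. u i *\<^sub>R z i) = (\<Sum>i<m+2. u i *\<^sub>R (z i - a)) + (\<Sum>i<m+2. u i) *\<^sub>R a"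
        by (simp add: scaleR_diff_right sum_subtractf scaleR_sum_left del: sum.lessThan_Suc)
      also have "(\<Sum>i<m+2. u i *\<^sub>R (z i - a)) = (\<Sum>i<m. (1 / M + t i) *\<^sub>R v i) + (1 / M + s m / h) *\<^sub>R (c - a)"
        by (simp add: u_def z_def)
      also have "(\<Sum>i<m. (1 / M + t i) *\<^sub>R v i) = (1 / M) *\<^sub>R (\<Sum>i<m. v i) + y"
        by (simp add: t scaleR_add_left sum.distrib scaleR_sum_right)
      also have "(1 / M + s m / h) *\<^sub>R (c - a) = (1 / M) *\<^sub>R (c - a) + (s m / h) *\<^sub>R (w + q)"
        by (simp add: scaleR_add_left c(1))
      also have "(\<Sum>i<m+2. u i) *\<^sub>R a = a" unfolding u1 by simp
      finally show ?thesis
      proof -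
        assume eq: "(\<Sum>i<m+2. u i *\<^sub>R z i) =
          (1 / M) *\<^sub>R (\<Sum>i<m. v i) + y + ((1 / M) *\<^sub>R (c - a) + (s m / h) *\<^sub>R (w + q)) + a"
        show ?thesis
          unfolding eq by (simp add: x0_def y_def e_def scaleR_add_right divide_inverse algebra_simps)
      qed
    qed
    have "(\<Sum>i<m+2. u i *\<^sub>R z i) \<in> convex hull ?S"
      by (rule convex_sum[OF _ convex_convex_hull u1 u0]) (auto simp: z_def intro!: hull_inc)
    then show ?thesis unfolding uz .
  qed
  then have "ennreal (unit_ball_vol (real (m+1)) / 2 ^ (m+1) * (\<Prod>i<m+1. \<rho> i)) \<le> hausdorff_measure (m + 1) (convex hull ?S)"
    using \<epsilon> r h orth by (intro hausdorff_measure_box_ge[where e=e and \<rho>=\<rho> and ?x0.0=x0]) (auto simp: \<rho>_def)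
  also have "(\<Prod>i<m+1. \<rho> i) = \<epsilon> ^ (m+1) * (r ^ m * norm q)"
    by (simp add: \<rho>_def h_def power_mult_distrib)
  also have "unit_ball_vol (real (m+1)) / 2 ^ (m+1) * (\<epsilon> ^ (m+1) * (r ^ m * norm q)) = simplex_const m \<eta> * (r ^ m * norm q)"
    by (simp add: simplex_const_def \<epsilon>_def M_def C_def)
  finally show ?thesis .
qed

lemma convex_parallelepiped:
  fixes w :: "nat \<Rightarrow> 'a::real_vector" and \<rho> :: "nat \<Rightarrow> real"
  shows "convex {x0 + (\<Sum>i<k. s i *\<^sub>R w i) | s. \<forall>i<k. \<bar>s i\<bar> \<le> \<rho> i}"
  unfolding convex_def
proof (clarify)
  fix u v :: real and s t :: "nat \<Rightarrow> real"
  assume uv: "0 \<le> u" "0 \<le> v" "u + v = 1" and st: "\<forall>i<k. \<bar>s i\<bar> \<le> \<rho> i" "\<forall>i<k. \<bar>t i\<bar> \<le> \<rho> i"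
  have "u *\<^sub>R (x0 + (\<Sum>i<k. s i *\<^sub>R w i)) + v *\<^sub>R (x0 + (\<Sum>i<k. t i *\<^sub>R w i))
     = (u + v) *\<^sub>R x0 + (\<Sum>i<k. (u * s i + v * t i) *\<^sub>R w i)"
    unfolding scaleR_add_right scaleR_add_left scaleR_sum_right sum.distrib by (simp add: algebra_simps)
  moreover have "\<bar>u * s i + v * t i\<bar> \<le> \<rho> i" if "i < k" for i
  proof -
    have "\<bar>u * s i + v * t i\<bar> \<le> u * \<bar>s i\<bar> + v * \<bar>t i\<bar>" using uv by (metis abs_mult abs_of_nonneg abs_triangle_ineq)
    also have "\<dots> \<le> u * \<rho> i + v * \<rho> i" using uv st that by (intro add_mono mult_left_mono) auto
    also have "\<dots> = \<rho> i" using uv by (simp add: distrib_right[symmetric])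
    finally show ?thesis .
  qed
  ultimately show "\<exists>s'. u *\<^sub>R (x0 + (\<Sum>i<k. s i *\<^sub>R w i)) + v *\<^sub>R (x0 + (\<Sum>i<k. t i *\<^sub>R w i))
      = x0 + (\<Sum>i<k. s' i *\<^sub>R w i) \<and> (\<forall>i<k. \<bar>s' i\<bar> \<le> \<rho> i)"
    using uv by (intro exI[of _ "\<lambda>i. u * s i + v * t i"]) auto
qed

text \<open>An infinite volume would be sent to zero by \<open>enn2real\<close> and destroy lower
  curvature bounds. The simplex lies in the parallelepiped of its edges at
  \<open>T 0\<close>.\<close>

lemma hausdorff_measure_simplex_finite:
  fixes T :: "nat \<Rightarrow> 'a::euclidean_space"
  shows "hausdorff_measure k (convex hull (T ` {0..k})) < \<infinity>"
proof -
  define L where "L = 1 + (\<Sum>i\<le>k. norm (T i - T 0))"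
  have L: "norm (T (Suc i) - T 0) \<le> L" if "i < k" for i
  proof -
    have "norm (T (Suc i) - T 0) \<le> (\<Sum>i\<le>k. norm (T i - T 0))" using that by (intro member_le_sum) auto
    then show ?thesis by (simp add: L_def)
  qed
  have L0: "0 < L" unfolding L_def by (intro add_pos_nonneg sum_nonneg) auto
  have "convex hull (T ` {0..k}) \<subseteq> {T 0 + (\<Sum>i<k. s i *\<^sub>R (T (Suc i) - T 0)) | s. \<forall>i<k. \<bar>s i\<bar> \<le> (1::real)}" (is "_ \<subseteq> ?P")
  proof (rule hull_minimal)
    show "convex ?P" by (rule convex_parallelepiped)
    show "T ` {0..k} \<subseteq> ?P"
    proof clarify
      fix j assume j: "j \<in> {0..k}"
      define s where "s i = (if Suc i = j then 1 else 0::real)" for i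
      have "(\<Sum>i<k. s i *\<^sub>R (T (Suc i) - T 0)) = T j - T 0"
      proof (cases j)
        case (Suc j')
        have "(\<Sum>i<k. s i *\<^sub>R (T (Suc i) - T 0)) = (\<Sum>i<k. if i = j' then T (Suc i) - T 0 else 0)"
          by (intro sum.cong) (auto simp: s_def Suc)
        then show ?thesis using j Suc by simp
      qed (simp add: s_def)
      then show "\<exists>s. T j = T 0 + (\<Sum>i<k. s i *\<^sub>R (T (Suc i) - T 0)) \<and> (\<forall>i<k. \<bar>s i\<bar> \<le> 1)"
        by (intro exI[of _ s]) (auto simp: s_def)
    qed
  qed
  then have "hausdorff_measure k (convex hull (T ` {0..k})) \<le> ennreal (unit_ball_vol (real k) * (2 * real k * L) ^ k * (\<Prod>i<k. 1))"
    using L L0 by (intro hausdorff_measure_parallelepiped_le[where w="\<lambda>i. T (Suc i) - T 0" and \<rho>="\<lambda>_. 1" and ?x0.0="T 0"]) auto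
  then show ?thesis by (auto intro: le_less_trans)
qed

lemma discrete_curvature_nonneg: "0 \<le> discrete_curvature m T"
  by (auto simp: discrete_curvature_def Let_def)

lemma diameter_convex_hull_le:
  fixes S :: "'a::euclidean_space set"
  assumes "\<And>x y. x \<in> S \<Longrightarrow> y \<in> S \<Longrightarrow> dist x y \<le> d" "0 \<le> d"
  shows "diameter (convex hull S) \<le> d"
proof (rule diameter_le)
  fix x y assume xy: "x \<in> convex hull S" "y \<in> convex hull S"
  have "convex hull S \<subseteq> cball s d" if "s \<in> S" for s
    using assms(1)[OF that] by (intro hull_minimal) auto
  then have "S \<subseteq> cball x d" using xy(1) by (auto simp: subset_iff dist_commute)
  then have "convex hull S \<subseteq> cball x d" by (intro hull_minimal) auto
  then show "norm (x - y) \<le> d" using xy(2) by (auto simp: dist_norm)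
qed (use assms in auto)

text \<open>The link from curvature to distance: the height \<open>norm q\<close> over the fat base
  bounds the volume from below, and the diameter is at most \<open>2 * r\<close>. The vertices enter
  as a set, so any order in which they are selected is admissible.\<close>

lemma discrete_curvature_ge:
  fixes v :: "nat \<Rightarrow> 'a::euclidean_space"
  assumes fat: "fat_family \<eta> r v m" and \<eta>: "0 < \<eta>" and r: "0 < r"
    and c: "c - a = w + q" "w \<in> span (v ` {..<m})" "\<And>y. y \<in> span (v ` {..<m}) \<Longrightarrow> q \<bullet> y = 0"
    and car: "norm (c - a) \<le> r"
    and T: "T ` {0..m + 1} = insert a (insert c ((\<lambda>i. a + v i) ` {..<m}))"
  shows "simplex_const m \<eta> / 2 ^ (m + 1) * (norm q / r) \<le> discrete_curvature m T"
proof (cases "q = 0")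
  case True
  then show ?thesis by (simp add: discrete_curvature_nonneg)
next
  case False
  let ?S = "insert a (insert c ((\<lambda>i. a + v i) ` {..<m}))"
  define D where "D = diameter (convex hull ?S)"
  have "norm (v i) \<le> r" if "i < m" for i using fat that by (auto simp: fat_family_def)
  then have "dist x a \<le> r" if "x \<in> ?S" for x
    using that car r by (auto simp: dist_norm)
  then have D2: "D \<le> 2 * r"
    unfolding D_def
  proof (intro diameter_convex_hull_le)
    fix x y assume "x \<in> ?S" "y \<in> ?S"
    then have "dist x a \<le> r" "dist y a \<le> r" using \<open>\<And>x. x \<in> ?S \<Longrightarrow> dist x a \<le> r\<close> by blast+
    then show "dist x y \<le> 2 * r" using dist_triangle2[of x y a] by linarith
  qed (use r in simp)
  have ca: "c \<noteq> a"
  proof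
    assume "c = a"
    then have "q = - w" using c(1) by (simp add: eq_neg_iff_add_eq_0 add.commute)
    then have "q \<bullet> q = 0" using c(2,3) by simp
    then show False using False by simp
  qed
  have bd: "bounded (convex hull ?S)" by (intro bounded_convex_hull finite_imp_bounded) auto
  have "dist c a \<le> D"
    unfolding D_def using bd by (intro diameter_bounded_bound) (auto intro!: hull_inc)
  then have D0: "0 < D" using ca by (meson less_le_trans zero_less_dist_iff)
  have H: "ennreal (simplex_const m \<eta> * (r ^ m * norm q)) \<le> hausdorff_measure (m + 1) (convex hull ?S)"
    by (rule hausdorff_measure_simplex_ge[OF fat \<eta> r c False car])
  have "hausdorff_measure (m + 1) (convex hull ?S) < \<infinity>"
    using hausdorff_measure_simplex_finite[of "m + 1" T] by (simp only: T)
  then have "enn2real (ennreal (simplex_const m \<eta> * (r ^ m * norm q))) \<le> enn2real (hausdorff_measure (m + 1) (convex hull ?S))"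
    using H by (intro enn2real_mono) auto
  then have H': "simplex_const m \<eta> * (r ^ m * norm q) \<le> enn2real (hausdorff_measure (m + 1) (convex hull ?S))"
    using simplex_const_pos[OF \<eta>, of m] r by (simp add: less_imp_le)
  have "simplex_const m \<eta> / 2 ^ (m + 1) * (norm q / r) = simplex_const m \<eta> * (r ^ m * norm q) / (2 * r) ^ (m + 1)"
    using r by (simp add: power_mult_distrib field_simps)
  also have "\<dots> \<le> simplex_const m \<eta> * (r ^ m * norm q) / D ^ (m + 1)"
    using D2 D0 r simplex_const_pos[OF \<eta>, of m] by (intro divide_left_mono power_mono mult_pos_pos mult_nonneg_nonneg) (auto simp: less_imp_le)
  also have "\<dots> \<le> enn2real (hausdorff_measure (m + 1) (convex hull ?S)) / D ^ (m + 1)"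
    using H' D0 by (intro divide_right_mono) auto
  also have "\<dots> = discrete_curvature m T"
    unfolding discrete_curvature_def T Let_def using D0 by (simp add: D_def)
  finally show ?thesis .
qed

section \<open>Orthogonal projections\<close>

text \<open>The orthogonal projection onto the orthogonal complement of \<open>T\<close>. As a
  bounded linear map it turns planes into points of a complete normed space, where limits of planes
  can be taken.\<close>

definition normal_proj :: "'a::euclidean_space set \<Rightarrow> 'a \<Rightarrow>\<^sub>L 'a" where
  "normal_proj T = (SOME Q. (\<forall>x. x - blinfun_apply Q x \<in> T) \<and> (\<forall>x. \<forall>y\<in>T. blinfun_apply Q x \<bullet> y = 0))"

lemma normal_proj:
  fixes T :: "'a::euclidean_space set"
  assumes "subspace T"
  shows "x - normal_proj T x \<in> T" "y \<in> T \<Longrightarrow> normal_proj T x \<bullet> y = 0"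
proof -
  obtain e :: "nat \<Rightarrow> 'a" where e: "\<And>i. i < dim T \<Longrightarrow> e i \<in> T"
    "\<And>i j. i < dim T \<Longrightarrow> j < dim T \<Longrightarrow> e i \<bullet> e j = (if i = j then 1 else 0)"
    "span (e ` {..<dim T}) = T"
    by (rule orthonormal_sequence_of_subspace[OF assms]) blast
  define q where "q x = x - (\<Sum>i<dim T. (x \<bullet> e i) *\<^sub>R e i)" for x
  have "bounded_linear q"
    unfolding q_def by (intro bounded_linear_intros)
  then have q: "blinfun_apply (Blinfun q) = q" by (rule bounded_linear_Blinfun_apply)
  have "x - q x \<in> T" for x
    unfolding q_def using e(1) by (auto intro!: subspace_sum[OF assms] subspace_scale[OF assms])
  moreover have "q x \<bullet> y = 0" if y: "y \<in> T" for x y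
  proof -
    have "span (e ` {..<dim T}) \<subseteq> {y. q x \<bullet> y = 0}"
    proof (rule span_minimal)
      show "subspace {y. q x \<bullet> y = 0}" by (auto simp: subspace_def inner_add_right)
      have "q x \<bullet> e j = 0" if j: "j < dim T" for j
      proof -
        have "(\<Sum>i<dim T. (x \<bullet> e i) * (e i \<bullet> e j)) = (\<Sum>i<dim T. if i = j then x \<bullet> e i else 0)"
          using j e(2) by (intro sum.cong) auto
        then show ?thesis using j by (simp add: q_def inner_diff_left inner_sum_left)
      qed
      then show "e ` {..<dim T} \<subseteq> {y. q x \<bullet> y = 0}" by auto
    qed
    then show ?thesis using y e(3) by auto
  qed
  ultimately have "(\<forall>x. x - blinfun_apply (Blinfun q) x \<in> T) \<and> (\<forall>x. \<forall>y\<in>T. blinfun_apply (Blinfun q) x \<bullet> y = 0)"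
    by (simp add: q)
  then have *: "(\<forall>x. x - normal_proj T x \<in> T) \<and> (\<forall>x. \<forall>y\<in>T. normal_proj T x \<bullet> y = 0)"
    unfolding normal_proj_def by (rule someI)
  show "x - normal_proj T x \<in> T" "y \<in> T \<Longrightarrow> normal_proj T x \<bullet> y = 0" using * by blast+
qed

lemma normal_proj_pythagoras:
  fixes T :: "'a::euclidean_space set"
  assumes "subspace T"
  shows "(norm x)\<^sup>2 = (norm (normal_proj T x))\<^sup>2 + (norm (x - normal_proj T x))\<^sup>2"
proof -
  define p where "p = x - normal_proj T x"
  have x: "x = normal_proj T x + p" by (simp add: p_def)
  have "normal_proj T x \<bullet> p = 0" using normal_proj[OF assms] by (simp add: p_def)
  then have "(norm (normal_proj T x + p))\<^sup>2 = (norm (normal_proj T x))\<^sup>2 + (norm p)\<^sup>2"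
    by (simp add: power2_norm_eq_inner inner_add_left inner_add_right inner_commute)
  then show ?thesis unfolding x[symmetric] by (simp add: p_def)
qed

lemma norm_normal_proj_le:
  fixes T :: "'a::euclidean_space set"
  assumes "subspace T"
  shows "norm (normal_proj T x) \<le> norm x" "norm (x - normal_proj T x) \<le> norm x"
proof -
  have "(norm (normal_proj T x))\<^sup>2 \<le> (norm x)\<^sup>2" "(norm (x - normal_proj T x))\<^sup>2 \<le> (norm x)\<^sup>2"
    using normal_proj_pythagoras[OF assms, of x] by simp_all
  then show "norm (normal_proj T x) \<le> norm x" "norm (x - normal_proj T x) \<le> norm x"
    by (simp_all add: power2_le_iff_abs_le)
qed

lemma normal_proj_eqI:
  fixes T :: "'a::euclidean_space set"
  assumes T: "subspace T" and y: "x - y \<in> T" "\<And>z. z \<in> T \<Longrightarrow> y \<bullet> z = 0"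
  shows "normal_proj T x = y"
proof -
  let ?d = "normal_proj T x - y"
  have "?d = (x - y) - (x - normal_proj T x)" by simp
  then have "?d \<in> T" using y(1) normal_proj(1)[OF T, of x] subspace_diff[OF T] by metis
  then have "?d \<bullet> ?d = 0"
    using normal_proj(2)[OF T, of ?d x] y(2)[of ?d] by (simp add: inner_diff_left)
  then show ?thesis by simp
qed

lemma normal_proj_in: "subspace T \<Longrightarrow> y \<in> T \<Longrightarrow> normal_proj T y = 0"
  by (rule normal_proj_eqI) auto

lemma normal_proj_idem: "subspace T \<Longrightarrow> normal_proj T (normal_proj T x) = normal_proj T x"
  by (rule normal_proj_eqI) (auto simp: subspace_0 normal_proj)

text \<open>Equality of dimensions turns the one-sided estimate into an estimate for the operator norm.\<close>

lemma normal_proj_close: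
  fixes T W :: "'a::euclidean_space set"
  assumes T: "subspace T" and W: "subspace W" and dim: "dim T = dim W" and \<delta>: "0 \<le> \<delta>"
    and one: "\<And>x. x \<in> W \<Longrightarrow> norm (normal_proj T x) \<le> \<delta> * norm x"
  shows "norm (normal_proj T - normal_proj W) \<le> 4 * \<delta>"
proof (cases "\<delta> \<le> 1/2")
  \<comment> \<open>Two orthogonal projections differ by at most \<open>2\<close>, so a bound with
    \<open>\<delta> > 1 / 2\<close> is trivial.\<close>
  case False
  have "norm (normal_proj T) \<le> 1" "norm (normal_proj W) \<le> 1"
    by (rule norm_blinfun_bound; use norm_normal_proj_le[OF T] norm_normal_proj_le[OF W] in simp)+
  then have "norm (normal_proj T - normal_proj W) \<le> 2"
    using norm_triangle_ineq4[of "normal_proj T" "normal_proj W"] by linarith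
  then show ?thesis using False by simp
next
  case True
  define P where "P x = x - normal_proj T x" for x
  have linP: "linear P" unfolding P_def
    by (intro linear_compose_sub linear_id[unfolded id_def] bounded_linear.linear[OF blinfun.bounded_linear_right])
  have low: "norm x / 2 \<le> norm (P x)" if "x \<in> W" for x
  proof -
    have "norm x \<le> norm (P x) + norm (normal_proj T x)"
      unfolding P_def by (metis diff_add_cancel norm_triangle_ineq)
    moreover have "\<delta> * norm x \<le> 1/2 * norm x" using True by (intro mult_right_mono) auto
    ultimately show ?thesis using one[OF that] by simp
  qed
  have inj: "inj_on P W"
  proof (rule inj_onI)
    fix x y assume xy: "x \<in> W" "y \<in> W" "P x = P y"
    then have "P (x - y) = 0" using linP by (simp add: linear_diff)
    then show "x = y" using low[of "x - y"] xy subspace_diff[OF W] by simp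
  qed
  have "dim (P ` W) = dim W"
    by (rule dim_image_eq[OF linP]) (use inj W in \<open>simp add: span_eq_iff[THEN iffD2]\<close>)
  moreover have "P ` W \<subseteq> T" using normal_proj(1)[OF T] by (auto simp: P_def)
  moreover have "subspace (P ` W)" using linP W by (rule linear_subspace_image)
  ultimately have PW: "P ` W = T" using dim T by (metis subspace_dim_equal order_refl)
  \<comment> \<open>By \<open>PW\<close> every vector of \<open>T\<close> is the projection of a
    vector of \<open>W\<close> at most twice as long, which exchanges the roles of the
    planes.\<close>
  have two: "norm (normal_proj W y) \<le> 2 * \<delta> * norm y" if y: "y \<in> T" for y
  proof -
    obtain x where x: "x \<in> W" "y = P x" using PW y by auto
    have "normal_proj W y = normal_proj W (y - x)"
      using normal_proj_in[OF W x(1)] by (simp add: blinfun.diff_right)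
    then have "norm (normal_proj W y) \<le> norm (y - x)" using norm_normal_proj_le(1)[OF W] by metis
    also have "\<dots> = norm (normal_proj T x)" by (simp add: x P_def)
    also have "\<dots> \<le> \<delta> * norm x" by (rule one[OF x(1)])
    also have "\<dots> \<le> \<delta> * (2 * norm y)" using low[OF x(1)] \<delta> by (intro mult_left_mono) (auto simp: x)
    finally show ?thesis by simp
  qed
  \<comment> \<open>Duality: the component \<open>p\<close> of \<open>z\<close> in \<open>W\<close>
    is paired with \<open>z\<close>, which is orthogonal to \<open>T\<close> and hence sees only the
    small normal part of \<open>p\<close>.\<close>
  have three: "norm (z - normal_proj W z) \<le> \<delta> * norm z" if z: "\<And>y. y \<in> T \<Longrightarrow> z \<bullet> y = 0" for z
  proof -
    define p where "p = z - normal_proj W z"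
    have pW: "p \<in> W" using normal_proj(1)[OF W] by (simp add: p_def)
    have "p \<bullet> p = z \<bullet> p" using normal_proj(2)[OF W pW] by (simp add: p_def inner_diff_left)
    also have "\<dots> = z \<bullet> normal_proj T p"
      using z[OF normal_proj(1)[OF T, of p]] by (simp add: inner_diff_right)
    also have "\<dots> \<le> norm z * norm (normal_proj T p)" by (rule norm_cauchy_schwarz)
    also have "\<dots> \<le> norm z * (\<delta> * norm p)" using one[OF pW] by (intro mult_left_mono) auto
    finally have "norm p * norm p \<le> (\<delta> * norm z) * norm p"
      by (simp add: power2_norm_eq_inner[symmetric] power2_eq_square mult_ac)
    then show ?thesis using \<delta> by (cases "norm p = 0") (auto simp: p_def)
  qed
  show ?thesis
  proof (rule norm_blinfun_bound)
    fix x
    define z where "z = normal_proj T x"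
    have "(normal_proj T - normal_proj W) x = (z - normal_proj W z) - normal_proj W (x - z)"
      by (simp add: minus_blinfun.rep_eq z_def blinfun.diff_right)
    then have "norm ((normal_proj T - normal_proj W) x) \<le> norm (z - normal_proj W z) + norm (normal_proj W (x - z))"
      by (metis norm_triangle_ineq4)
    also have "\<dots> \<le> \<delta> * norm z + 2 * \<delta> * norm (x - z)"
      using normal_proj[OF T] by (intro add_mono three two) (auto simp: z_def)
    also have "\<dots> \<le> \<delta> * norm x + 2 * \<delta> * norm x"
      using norm_normal_proj_le[OF T, of x] \<delta> by (intro add_mono mult_left_mono) (auto simp: z_def)
    also have "\<dots> \<le> 4 * \<delta> * norm x" using \<delta> by (simp add: algebra_simps)
    finally show "norm ((normal_proj T - normal_proj W) x) \<le> 4 * \<delta> * norm x" .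
  qed (use \<delta> in simp)
qed

section \<open>Density points and non-concentration near planes\<close>

lemma outer_measure_Un:
  assumes "outer_measure_space UNIV \<mu>"
  shows "\<mu> (A \<union> B) \<le> \<mu> A + \<mu> B"
proof -
  define S where "S n = (if n = 0 then A else if n = 1 then B else {})" for n :: nat
  have "\<mu> (A \<union> B) \<le> \<mu> (\<Union>n. S n)"
  proof (rule outer_measure_mono[OF assms])
    have "A = S 0" "B = S 1" by (simp_all add: S_def)
    then show "A \<union> B \<subseteq> (\<Union>n. S n)" by blast
  qed
  also have "\<dots> \<le> (\<Sum>n. \<mu> (S n))" by (rule outer_measure_countable_UN[OF assms])
  also have "\<dots> = (\<Sum>n<2. \<mu> (S n))"
    by (rule suminf_finite) (simp_all add: S_def outer_measure_empty[OF assms])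
  finally show ?thesis by (simp add: S_def numeral_2_eq_2)
qed

lemma outer_measure_finite_UN:
  assumes "outer_measure_space UNIV \<mu>" "finite I"
  shows "\<mu> (\<Union>i\<in>I. A i) \<le> (\<Sum>i\<in>I. \<mu> (A i))"
  using assms(2)
proof (induction I rule: finite_induct)
  case (insert i I)
  then show ?case
    using order_trans[OF outer_measure_Un[OF assms(1), of "A i" "\<Union>i\<in>I. A i"] add_left_mono[OF insert.IH]] by simp
qed (simp add: outer_measure_empty[OF assms(1)])

lemma
  assumes "radon_measure \<mu>"
  shows radon_measure_outer: "outer_measure_space UNIV \<mu>"
    and radon_measure_compact: "compact K \<Longrightarrow> \<mu> K < \<infinity>"
    and radon_measure_open_caratheodory: "open V \<Longrightarrow> V \<in> caratheodory_sets \<mu>"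
    and radon_measure_outer_regular: "\<mu> A = (INF V\<in>{V. open V \<and> A \<subseteq> V}. \<mu> V)"
proof -
  note r = assms[unfolded radon_measure_def]
  show "outer_measure_space UNIV \<mu>" using r by (rule conjunct1)
  show "compact K \<Longrightarrow> \<mu> K < \<infinity>" using r by (elim conjE) (erule allE, erule mp)
  show "open V \<Longrightarrow> V \<in> caratheodory_sets \<mu>"
    using r[THEN conjunct2, THEN conjunct2, THEN conjunct1, THEN spec, of V] by (elim impE conjE) assumption
  show "\<mu> A = (INF V\<in>{V. open V \<and> A \<subseteq> V}. \<mu> V)"
    using r[THEN conjunct2, THEN conjunct2, THEN conjunct2] by (rule spec)
qed

lemma sets_borel_subset_measure_space_of:
  assumes "radon_measure (\<mu> :: 'a::topological_space set \<Rightarrow> ennreal)"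
  shows "sets borel \<subseteq> sets (measure_space_of \<mu>)"
proof -
  note om = radon_measure_outer[OF assms]
  have "Collect open \<subseteq> sets (measure_space_of \<mu>)"
    using radon_measure_open_caratheodory[OF assms] by (auto simp: sets_measure_space_of[OF om])
  then have "sigma_sets (space (measure_space_of \<mu>)) (Collect open) \<subseteq> sets (measure_space_of \<mu>)"
    by (rule sets.sigma_sets_subset)
  then have "sigma_sets UNIV (Collect open) \<subseteq> sets (measure_space_of \<mu>)"
    by (simp only: space_measure_space_of[OF om])
  then show ?thesis by (simp add: borel_def)
qed

lemma emeasure_measure_space_of_borel:
  assumes "radon_measure (\<mu> :: 'a::topological_space set \<Rightarrow> ennreal)" "A \<in> sets borel"
  shows "emeasure (measure_space_of \<mu>) A = \<mu> A"
proof (rule emeasure_measure_space_of[OF radon_measure_outer[OF assms(1)]])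
  show "A \<in> caratheodory_sets \<mu>"
    using sets_borel_subset_measure_space_of[OF assms(1)] assms(2)
    unfolding sets_measure_space_of[OF radon_measure_outer[OF assms(1)]] by (rule subsetD)
qed

text \<open>The bound on \<open>norm a\<close> makes the set compact, hence Borel and of finite
  measure, as the density argument wants. The strict \<open>r < 1 / real j\<close> leaves room for
  slightly larger radii when closedness is proved.\<close>

definition regular_points :: "nat \<Rightarrow> ('a::real_normed_vector set \<Rightarrow> ennreal) \<Rightarrow> nat \<Rightarrow> 'a set" where
  "regular_points m \<mu> j = {a. norm a \<le> real j \<and>
     (\<forall>r. 0 < r \<and> r < 1 / real j \<longrightarrow>
        ennreal (r ^ m / real j) \<le> \<mu> (cball a r) \<and> \<mu> (cball a r) \<le> ennreal (real j * r ^ m))}"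

text \<open>Both bounds survive limits of centres. The lower one does by outer regularity, since an
  open set around a closed ball contains its small translates; the upper one does because the limit
  ball lies in slightly larger balls about nearby centres.\<close>

lemma compact_regular_points:
  fixes \<mu> :: "'a::euclidean_space set \<Rightarrow> ennreal"
  assumes rad: "radon_measure \<mu>"
  shows "compact (regular_points m \<mu> j)"
proof -
  note om = radon_measure_outer[OF rad]
  have "closed (regular_points m \<mu> j)"
    unfolding closed_sequential_limits
  proof (intro allI impI, elim conjE)
    fix x a assume x: "\<forall>n. x n \<in> regular_points m \<mu> j" and lim: "x \<longlonglongrightarrow> a"
    have "norm a \<le> real j"
      using x by (intro tendsto_upperbound[OF tendsto_norm[OF lim]]) (auto simp: regular_points_def)
    moreover have "ennreal (r ^ m / real j) \<le> \<mu> (cball a r) \<and> \<mu> (cball a r) \<le> ennreal (real j * r ^ m)"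
      if r: "0 < r" "r < 1 / real j" for r
    proof
      show "ennreal (r ^ m / real j) \<le> \<mu> (cball a r)"
        unfolding radon_measure_outer_regular[OF rad, of "cball a r"]
      proof (rule INF_greatest, clarify)
        fix V assume V: "open V" "cball a r \<subseteq> V"
        have "\<exists>s>0. (\<Union>y\<in>cball a r. ball y s) \<subseteq> V"
          by (rule compact_subset_open_imp_ball_epsilon_subset[OF compact_cball V]) blast
        then obtain s where s: "0 < s" "(\<Union>y\<in>cball a r. ball y s) \<subseteq> V" by blast
        have "\<forall>\<^sub>F n in sequentially. dist (x n) a < s" using lim s(1) by (rule tendstoD)
        then obtain n where n: "dist (x n) a < s" by (auto simp: eventually_sequentially)
        have "cball (x n) r \<subseteq> V"
        proof
          fix y assume y: "y \<in> cball (x n) r"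
          have "a + (y - x n) \<in> cball a r" using y by (simp add: dist_norm norm_minus_commute)
          moreover have "y \<in> ball (a + (y - x n)) s" using n by (simp add: dist_norm norm_minus_commute)
          ultimately show "y \<in> V" using s(2) by blast
        qed
        then have "\<mu> (cball (x n) r) \<le> \<mu> V" by (rule outer_measure_mono[OF om])
        moreover have "ennreal (r ^ m / real j) \<le> \<mu> (cball (x n) r)" using x r by (auto simp: regular_points_def)
        ultimately show "ennreal (r ^ m / real j) \<le> \<mu> V" by (rule order_trans[rotated])
      qed
      have le: "\<mu> (cball a r) \<le> ennreal (real j * r' ^ m)" if r': "r < r'" "r' < 1 / real j" for r'
      proof -
        have "\<forall>\<^sub>F n in sequentially. dist (x n) a < r' - r" using lim r' by (intro tendstoD) auto
        then obtain n where n: "dist (x n) a < r' - r" by (auto simp: eventually_sequentially)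
        have "cball a r \<subseteq> cball (x n) r'"
        proof
          fix y assume "y \<in> cball a r"
          then show "y \<in> cball (x n) r'" using n dist_triangle[of "x n" y a] by simp
        qed
        then have "\<mu> (cball a r) \<le> \<mu> (cball (x n) r')" by (rule outer_measure_mono[OF om])
        also have "\<dots> \<le> ennreal (real j * r' ^ m)" using x r r' by (auto simp: regular_points_def)
        finally show ?thesis .
      qed
      show "\<mu> (cball a r) \<le> ennreal (real j * r ^ m)"
      proof (rule tendsto_lowerbound)
        show "((\<lambda>r'. ennreal (real j * r' ^ m)) \<longlongrightarrow> ennreal (real j * r ^ m)) (at_right r)"
          by (intro tendsto_ennrealI tendsto_intros)
        show "\<forall>\<^sub>F r' in at_right r. \<mu> (cball a r) \<le> ennreal (real j * r' ^ m)"
          using eventually_at_right_real[OF r(2)] by eventually_elim (use le in auto)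
      qed simp
    qed
    ultimately show "a \<in> regular_points m \<mu> j" by (auto simp: regular_points_def)
  qed
  moreover have "bounded (regular_points m \<mu> j)"
    by (rule boundedI[of _ "real j"]) (auto simp: regular_points_def)
  ultimately show ?thesis by (simp add: compact_eq_bounded_closed)
qed

text \<open>A direct Vitali argument. Around a bad point small balls carry relative mass above
  \<open>t\<close> outside \<open>F\<close>. Disjoint such balls inside an open \<open>V\<close>
  containing \<open>F\<close> have total outside mass at most that of \<open>V - F\<close>, which is
  arbitrarily small; the upper ball bound at points of \<open>F\<close> makes the fivefold
  enlargement cost only the constant \<open>c\<close>.\<close>

lemma regular_points_density:
  fixes \<mu> :: "'a::euclidean_space set \<Rightarrow> ennreal" and m j :: nat
  assumes rad: "radon_measure \<mu>" and j: "0 < j" and t: "0 < t"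
  defines "F \<equiv> regular_points m \<mu> j"
  shows "\<mu> {a \<in> F. \<not> (\<exists>i::nat. 0 < i \<and> (\<forall>r. 0 < r \<and> r \<le> 1 / real i \<longrightarrow> \<mu> (cball a r - F) \<le> ennreal (t * r ^ m)))} = 0"
    (is "\<mu> ?Z = 0")
proof -
  note om = radon_measure_outer[OF rad]
  define Z where "Z = ?Z"
  let ?M = "measure_space_of \<mu>"
  have Fc: "compact F" unfolding F_def by (rule compact_regular_points[OF rad])
  then have Fb: "F \<in> sets borel" by (simp add: compact_imp_closed)
  have fin: "\<mu> F < \<infinity>" by (rule radon_measure_compact[OF rad Fc])
  define c where "c = real j * 5 ^ m / t"
  have c: "0 < c" using j t by (simp add: c_def)
  have main: "\<mu> Z \<le> ennreal (c * e)" if e: "0 < e" for e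
  proof -
    have "(INF V\<in>{V. open V \<and> F \<subseteq> V}. \<mu> V) < \<mu> F + ennreal e"
      unfolding radon_measure_outer_regular[OF rad, of F, symmetric] using fin e by (simp add: ennreal_add_left_cancel_less[of "\<mu> F" 0 "ennreal e", simplified])
    then obtain V where V: "open V" "F \<subseteq> V" "\<mu> V < \<mu> F + ennreal e"
      unfolding INF_less_iff by blast
    have Vb: "V \<in> sets borel" using V by simp
    have "\<mu> V = \<mu> F + \<mu> (V - F)"
    proof -
      have "emeasure ?M (F \<union> (V - F)) = emeasure ?M F + emeasure ?M (V - F)"
        using Fb Vb sets_borel_subset_measure_space_of[OF rad] by (intro plus_emeasure[symmetric]) auto
      moreover have "F \<union> (V - F) = V" using V by auto
      ultimately show ?thesis using Fb Vb by (simp add: emeasure_measure_space_of_borel[OF rad])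
    qed
    then have VF: "\<mu> (V - F) \<le> ennreal e"
      using V(3) fin by (metis ennreal_add_left_cancel_less infinity_ennreal_def less_imp_le)
    \<comment> \<open>\<open>5 * r < 1 / real j\<close> keeps the enlarged ball in the range of the
      regularity bound.\<close>
    have "\<exists>r. 0 < r \<and> 5 * r < 1 / real j \<and> cball a r \<subseteq> V \<and> ennreal (t * r ^ m) < \<mu> (cball a r - F)" if a: "a \<in> Z" for a
    proof -
      have "a \<in> V" using a V by (auto simp: Z_def)
      then obtain s where s: "0 < s" "cball a s \<subseteq> V" using V(1) open_contains_cball by blast
      obtain i :: nat where i: "1 / s + 6 * real j < real i" using reals_Archimedean2 by blast
      have s0: "0 < 1 / s" using s by simp
      have i0: "0 < real i" using i s0 by linarith
      then have "0 < i" by simp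
      then have "\<not> (\<forall>r. 0 < r \<and> r \<le> 1 / real i \<longrightarrow> \<mu> (cball a r - F) \<le> ennreal (t * r ^ m))"
        using a unfolding Z_def by blast
      then obtain r where r: "0 < r" "r \<le> 1 / real i" "ennreal (t * r ^ m) < \<mu> (cball a r - F)"
        by (auto simp: not_le)
      have "1 / s < real i" using i j by linarith
      then have "1 / real i \<le> s" using s i0 by (simp add: field_simps)
      then have "cball a r \<subseteq> V" using r s by auto
      moreover have "5 * r < 1 / real j"
      proof -
        have "6 * real j < real i" using i s0 by linarith
        then have "1 / real i < 1 / (6 * real j)" using j by (intro divide_strict_left_mono) auto
        moreover have "1 / (6 * real j) = 1 / real j / 6" by simp
        ultimately show ?thesis using r(1,2) by linarith
      qed
      ultimately show ?thesis using r by blast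
    qed
    then obtain \<rho> where \<rho>: "\<And>a. a \<in> Z \<Longrightarrow> 0 < \<rho> a \<and> 5 * \<rho> a < 1 / real j \<and> cball a (\<rho> a) \<subseteq> V \<and> ennreal (t * \<rho> a ^ m) < \<mu> (cball a (\<rho> a) - F)"
      by metis
    obtain C where C: "countable C" "C \<subseteq> Z"
      "pairwise (\<lambda>i j. disjnt (cball i (\<rho> i)) (cball j (\<rho> j))) C"
      "Z \<subseteq> (\<Union>i\<in>C. cball i (5 * \<rho> i))"
    proof (rule Vitali_covering_lemma_cballs[where S="Z" and K="Z" and a="\<lambda>x. x" and r=\<rho> and B="1 / real j"])
      show "Z \<subseteq> (\<Union>i\<in>Z. cball i (\<rho> i))"
        using \<rho> by (auto simp: less_imp_le)
      show "0 < \<rho> i \<and> \<rho> i \<le> 1 / real j" if "i \<in> Z" for i using \<rho>[OF that] by linarith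
    qed blast
    define I where "I = to_nat_on C ` C"
    define g where "g = from_nat_into C"
    have gI: "g ` I = C" "inj_on g I"
      using C(1) by (auto simp: I_def g_def image_image inj_on_def)
    define A where "A n = (if n \<in> I then cball (g n) (5 * \<rho> (g n)) else {})" for n
    define D where "D n = (if n \<in> I then cball (g n) (\<rho> (g n)) - F else {})" for n
    have AD: "\<mu> (A n) \<le> ennreal c * \<mu> (D n)" for n
    proof (cases "n \<in> I")
      case True
      then have gn: "g n \<in> Z" using gI C(2) by auto
      note r = \<rho>[OF gn]
      have "g n \<in> regular_points m \<mu> j" using gn by (simp add: Z_def F_def)
      then have "\<mu> (cball (g n) (5 * \<rho> (g n))) \<le> ennreal (real j * (5 * \<rho> (g n)) ^ m)"
        using r unfolding regular_points_def by (blast intro: mult_pos_pos zero_less_numeral)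
      then have "\<mu> (A n) \<le> ennreal (real j * (5 * \<rho> (g n)) ^ m)"
        using True by (simp only: A_def if_True)
      also have "real j * (5 * \<rho> (g n)) ^ m = c * (t * \<rho> (g n) ^ m)"
        using t by (simp add: c_def power_mult_distrib)
      also have "ennreal \<dots> = ennreal c * ennreal (t * \<rho> (g n) ^ m)"
        using c t r by (intro ennreal_mult) auto
      also have "\<dots> \<le> ennreal c * \<mu> (D n)"
        using r True by (intro mult_left_mono) (auto simp: D_def less_imp_le)
      finally show ?thesis .
    qed (simp add: A_def outer_measure_empty[OF om])
    have "Z \<subseteq> (\<Union>n. A n)"
    proof
      fix x assume "x \<in> Z"
      then obtain a where "a \<in> C" "x \<in> cball a (5 * \<rho> a)" using C(4) by blast
      moreover obtain n where "n \<in> I" "g n = a" using gI(1) \<open>a \<in> C\<close> by blast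
      ultimately have "x \<in> A n" by (simp add: A_def)
      then show "x \<in> (\<Union>n. A n)" by blast
    qed
    then have "\<mu> Z \<le> \<mu> (\<Union>n. A n)" by (rule outer_measure_mono[OF om])
    also have "\<dots> \<le> (\<Sum>n. \<mu> (A n))" by (rule outer_measure_countable_UN[OF om])
    also have "\<dots> \<le> (\<Sum>n. ennreal c * \<mu> (D n))" by (intro suminf_le AD) auto
    also have "\<dots> = ennreal c * (\<Sum>n. \<mu> (D n))" by simp
    also have "(\<Sum>n. \<mu> (D n)) = \<mu> (\<Union>n. D n)"
    proof -
      have Db: "D n \<in> sets borel" for n using Fb by (simp add: D_def)
      have "disjoint_family D"
        unfolding disjoint_family_on_def
      proof (intro ballI impI)
        fix n k :: nat assume nk: "n \<noteq> k"
        show "D n \<inter> D k = {}"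
        proof (cases "n \<in> I \<and> k \<in> I")
          case True
          then have "g n \<noteq> g k" "g n \<in> C" "g k \<in> C" using gI nk by (auto simp: inj_on_def)
          then have "disjnt (cball (g n) (\<rho> (g n))) (cball (g k) (\<rho> (g k)))" using C(3) by (auto simp: pairwise_def)
          then show ?thesis by (auto simp: D_def disjnt_def)
        qed (auto simp: D_def)
      qed
      then have "(\<Sum>n. emeasure ?M (D n)) = emeasure ?M (\<Union>n. D n)"
        using Db sets_borel_subset_measure_space_of[OF rad] by (intro suminf_emeasure) auto
      moreover have "(\<Union>n. D n) \<in> sets borel" using Db by auto
      ultimately show ?thesis using Db by (simp add: emeasure_measure_space_of_borel[OF rad])
    qed
    also have "\<mu> (\<Union>n. D n) \<le> \<mu> (V - F)"
    proof (rule outer_measure_mono[OF om], rule UN_least)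
      fix n show "D n \<subseteq> V - F"
      proof (cases "n \<in> I")
        case True
        then have "g n \<in> Z" using gI C(2) by auto
        then show ?thesis using \<rho> True unfolding D_def by auto
      qed (simp add: D_def)
    qed
    also have "ennreal c * \<mu> (V - F) \<le> ennreal c * ennreal e"
      using VF by (intro mult_left_mono) auto
    also have "\<dots> = ennreal (c * e)" using c e by (simp add: ennreal_mult)
    finally show ?thesis by (simp add: mult_left_mono)
  qed
  have "\<mu> Z \<le> ennreal e" if "0 < e" for e
    using main[of "e / c"] that c by simp
  then have "\<mu> Z = 0" by (metis ennreal_le_epsilon le_zero_eq add_0 zero_less_one ennreal_0)
  then show ?thesis by (simp only: Z_def)
qed

text \<open>For \<open>k = dim W\<close>, of order \<open>\<eta> ^ (- k)\<close> cells of size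
  \<open>\<eta> * r\<close> cover the relevant piece of the plane, and each accounts for mass of
  order \<open>(\<eta> * r) ^ m\<close>; as \<open>k \<le> m - 1\<close>, a factor
  \<open>\<eta>\<close> remains. Intersecting with the regular points supplies centres at which the
  mass bound is known.\<close>

lemma regular_points_tube_le:
  fixes \<mu> :: "'a::euclidean_space set \<Rightarrow> ennreal"
  assumes rad: "radon_measure \<mu>" and j: "0 < j" and W: "subspace W" "dim W < m"
    and \<eta>: "0 < \<eta>" "\<eta> \<le> 1" and r: "0 < r" and small: "real (m + 2) * (\<eta> * r) < 1 / real j"
  shows "\<mu> {x \<in> cball a r \<inter> regular_points m \<mu> j. \<exists>w\<in>W. norm (x - q - w) < \<eta> * r}
     \<le> ennreal ((12 * real (m + 2)) ^ m * real j * \<eta> * r ^ m)"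
proof -
  note om = radon_measure_outer[OF rad]
  define k where "k = dim W"
  have km: "k < m" using W by (simp add: k_def)
  obtain e :: "nat \<Rightarrow> 'a" where e: "\<And>i. i < k \<Longrightarrow> e i \<in> W"
    "\<And>i j. i < k \<Longrightarrow> j < k \<Longrightarrow> e i \<bullet> e j = (if i = j then 1 else 0)" "span (e ` {..<k}) = W"
    unfolding k_def by (rule orthonormal_sequence_of_subspace[OF W(1)]) blast
  let ?T = "{x \<in> cball a r \<inter> regular_points m \<mu> j. \<exists>w\<in>W. norm (x - q - w) < \<eta> * r}"
  show ?thesis
  proof (cases "?T = {}")
    case True
    show ?thesis unfolding True by (simp add: outer_measure_empty[OF om])
  next
    case False
    then obtain x1 w1 where x1: "x1 \<in> cball a r" "w1 \<in> W" "norm (x1 - q - w1) < \<eta> * r" by blast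
    \<comment> \<open>The points of the affine plane \<open>q + W\<close> that lie within
      \<open>\<eta> * r\<close> of the ball; this bounded piece is what the grid has to
      cover.\<close>
    define A where "A = {q + w | w x. w \<in> W \<and> x \<in> cball a r \<and> norm (x - q - w) < \<eta> * r}"
    have A: "A \<subseteq> {(q + w1) + (\<Sum>i<k. s i *\<^sub>R e i) | s. \<forall>i<k. \<bar>s i\<bar> \<le> 4 * r}"
    proof
      fix y assume "y \<in> A"
      then obtain w x where w: "y = q + w" "w \<in> W" "x \<in> cball a r" "norm (x - q - w) < \<eta> * r"
        by (auto simp: A_def)
      have "\<eta> * r \<le> r" using \<eta> r by simp
      moreover have "norm (w - w1) \<le> norm (x - x1) + norm (x1 - q - w1) + norm (x - q - w)"
      proof -
        have eq: "w - w1 = (x - x1) + (x1 - q - w1) - (x - q - w)" by simp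
        show ?thesis
          unfolding eq by (intro norm_triangle_le_diff add_right_mono norm_triangle_ineq)
      qed
      moreover have "norm (x - x1) \<le> 2 * r"
        using w(3) x1(1) dist_triangle2[of x x1 a] by (simp add: dist_norm norm_minus_commute)
      ultimately have nw: "norm (w - w1) \<le> 4 * r" using w(4) x1(3) by linarith
      have "w - w1 \<in> span (e ` {..<k})" using w x1 e(3) subspace_diff[OF W(1)] by simp
      then obtain s where s: "w - w1 = (\<Sum>i<k. s i *\<^sub>R e i)" by (rule span_image_lessThanE)
      have "\<bar>s i\<bar> \<le> 4 * r" if i: "i < k" for i
      proof -
        have "(\<Sum>i'<k. s i' * (e i' \<bullet> e i)) = (\<Sum>i'<k. if i' = i then s i' else 0)"
          using i e(2) by (intro sum.cong) auto
        then have "s i = (w - w1) \<bullet> e i"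
          unfolding s inner_sum_left using i by simp
        also have "\<bar>(w - w1) \<bullet> e i\<bar> \<le> norm (w - w1) * norm (e i)" by (rule Cauchy_Schwarz_ineq2)
        also have "norm (e i) = 1" using e(2)[OF i i] by (simp add: norm_eq_1)
        finally show ?thesis using nw by simp
      qed
      moreover have "y = (q + w1) + (\<Sum>i<k. s i *\<^sub>R e i)" by (simp add: w s[symmetric])
      ultimately show "y \<in> {(q + w1) + (\<Sum>i<k. s i *\<^sub>R e i) | s. \<forall>i<k. \<bar>s i\<bar> \<le> 4 * r}" by blast
    qed
    have ne: "norm (e i) \<le> 1" if "i < k" for i
      using e(2)[OF that that] norm_eq_1[of "e i"] by simp
    have \<eta>r: "0 < \<eta> * r" "\<And>i. i < k \<Longrightarrow> \<eta> * r \<le> 4 * r" using \<eta> r by auto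
    obtain I :: "(nat \<Rightarrow> nat) set" and S where IS: "finite I" "A \<subseteq> (\<Union>z\<in>I. S z)"
      "\<And>z. z \<in> I \<Longrightarrow> bounded (S z)" "\<And>z. z \<in> I \<Longrightarrow> diameter (S z) \<le> real k * ((\<eta> * r) * 1)"
      and card: "real (card I) \<le> (\<Prod>i<k. 3 * (4 * r) / (\<eta> * r))"
      by (rule parallelepiped_grid[OF ne \<eta>r(1) zero_le_one \<eta>r(2) A]) (assumption, assumption, (rule that; blast))
    define P where "P z = {x \<in> regular_points m \<mu> j. \<exists>y\<in>S z. norm (x - y) < \<eta> * r}" for z
    have Tsub: "?T \<subseteq> (\<Union>z\<in>I. P z)"
    proof
      fix x assume "x \<in> ?T"
      then obtain w where w: "x \<in> cball a r" "x \<in> regular_points m \<mu> j" "w \<in> W" "norm (x - q - w) < \<eta> * r" by blast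
      then have "q + w \<in> A" by (auto simp: A_def)
      then obtain z where z: "z \<in> I" "q + w \<in> S z" using IS(2) by blast
      have "x \<in> P z" unfolding P_def using w z by (auto simp: diff_diff_eq intro!: bexI[of _ "q + w"])
      then show "x \<in> (\<Union>z\<in>I. P z)" using z by blast
    qed
    have P: "\<mu> (P z) \<le> ennreal (real j * (real (m + 2) * (\<eta> * r)) ^ m)" if z: "z \<in> I" for z
    proof (cases "P z = {}")
      case True
      then show ?thesis by (simp add: outer_measure_empty[OF om])
    next
      case False
      then obtain x where x: "x \<in> P z" by blast
      then obtain y where y: "x \<in> regular_points m \<mu> j" "y \<in> S z" "norm (x - y) < \<eta> * r" by (auto simp: P_def)
      have "P z \<subseteq> cball x (real (m + 2) * (\<eta> * r))"
      proof
        fix x' assume "x' \<in> P z"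
        then obtain y' where y': "y' \<in> S z" "norm (x' - y') < \<eta> * r" by (auto simp: P_def)
        have "dist y y' \<le> real k * (\<eta> * r)"
          using diameter_bounded_bound[OF IS(3)[OF z] y(2) y'(1)] IS(4)[OF z] by simp
        also have "\<dots> \<le> real m * (\<eta> * r)" using km \<eta> r by (intro mult_right_mono) auto
        finally have "dist y y' \<le> real m * (\<eta> * r)" .
        moreover have "dist x x' \<le> dist x y + dist y y' + dist x' y'"
          using dist_triangle[of x x' y] dist_triangle[of y x' y'] dist_commute[of x' y'] by linarith
        ultimately have "dist x x' \<le> real m * (\<eta> * r) + 2 * (\<eta> * r)"
          using y(3) y'(2) by (simp add: dist_norm)
        then show "x' \<in> cball x (real (m + 2) * (\<eta> * r))" by (simp add: algebra_simps)
      qed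
      then have "\<mu> (P z) \<le> \<mu> (cball x (real (m + 2) * (\<eta> * r)))" by (rule outer_measure_mono[OF om])
      also have "\<dots> \<le> ennreal (real j * (real (m + 2) * (\<eta> * r)) ^ m)"
        using y(1) small \<eta> r by (auto simp: regular_points_def)
      finally show ?thesis .
    qed
    have "\<mu> ?T \<le> \<mu> (\<Union>z\<in>I. P z)" by (rule outer_measure_mono[OF om Tsub])
    also have "\<dots> \<le> (\<Sum>z\<in>I. \<mu> (P z))" by (rule outer_measure_finite_UN[OF om IS(1)])
    also have "\<dots> \<le> (\<Sum>z\<in>I. ennreal (real j * (real (m + 2) * (\<eta> * r)) ^ m))" by (intro sum_mono P)
    also have "\<dots> = ennreal (real (card I) * (real j * (real (m + 2) * (\<eta> * r)) ^ m))"
      using \<eta> r by (simp add: ennreal_mult ennreal_of_nat_eq_real_of_nat)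
    also have "\<dots> \<le> ennreal ((12 * real (m + 2)) ^ m * real j * \<eta> * r ^ m)"
    proof (rule ennreal_leI)
      have "(\<Prod>i<k. 3 * (4 * r) / (\<eta> * r)) = (12 / \<eta>) ^ k" using r \<eta> by simp
      then have cI: "real (card I) \<le> (12 / \<eta>) ^ k" using card by simp
      have "(12 / \<eta>) ^ k \<le> (12 / \<eta>) ^ (m - 1)"
        using km \<eta> by (intro power_increasing) (auto simp: field_simps)
      also have "\<dots> = 12 ^ (m - 1) / \<eta> ^ (m - 1)" by (simp add: power_divide)
      also have "\<dots> \<le> 12 ^ m / \<eta> ^ (m - 1)"
        using \<eta> by (intro divide_right_mono power_increasing) auto
      finally have "real (card I) * (real j * (real (m + 2) * (\<eta> * r)) ^ m) \<le>
          12 ^ m / \<eta> ^ (m - 1) * (real j * (real (m + 2) * (\<eta> * r)) ^ m)"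
        using cI \<eta> r by (intro mult_right_mono) auto
      also have "12 ^ m / \<eta> ^ (m - 1) * (real j * (real (m + 2) * (\<eta> * r)) ^ m) = (12 * real (m + 2)) ^ m * real j * \<eta> * r ^ m"
      proof -
        have \<eta>m: "\<eta> ^ m = \<eta> * \<eta> ^ (m - 1)" using km by (cases m) auto
        have e1: "(real (m + 2) * (\<eta> * r)) ^ m = real (m + 2) ^ m * ((\<eta> * \<eta> ^ (m - 1)) * r ^ m)"
          unfolding \<eta>m[symmetric] by (simp only: power_mult_distrib)
        have e2: "(12 * real (m + 2)) ^ m = 12 ^ m * real (m + 2) ^ m" by (rule power_mult_distrib)
        show ?thesis unfolding e1 e2 using \<eta> by simp
      qed
      finally show "real (card I) * (real j * (real (m + 2) * (\<eta> * r)) ^ m) \<le> (12 * real (m + 2)) ^ m * real j * \<eta> * r ^ m" .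
    qed
    finally show ?thesis .
  qed
qed

text \<open>The ratio \<open>4\<close> is a budget: in \<open>compare_planes\<close> two exceptional
  sets and one tube, each of mass at most \<open>\<tau> * r ^ m\<close>, must leave points of the
  ball over. As \<open>q\<close> is arbitrary, all affine planes of dimension below \<open>m\<close>
  are meant.\<close>

definition noncollapsed ::
  "nat \<Rightarrow> ('a::euclidean_space set \<Rightarrow> ennreal) \<Rightarrow> real \<Rightarrow> real \<Rightarrow> real \<Rightarrow> 'a \<Rightarrow> bool" where
  "noncollapsed m \<mu> \<tau> \<eta> r0 a \<longleftrightarrow> (\<forall>r. 0 < r \<and> r \<le> r0 \<longrightarrow>
     ennreal (4 * \<tau> * r ^ m) \<le> \<mu> (cball a r) \<and>
     (\<forall>W q. subspace W \<and> dim W < m \<longrightarrow>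
        \<mu> {x \<in> cball a r. \<exists>w\<in>W. norm (x - q - w) < \<eta> * r} \<le> ennreal (\<tau> * r ^ m)))"

text \<open>With this width the tube estimate gives \<open>1 / (8 * real j)\<close>, half of
  \<open>\<tau> = 1 / (4 * real j)\<close>; the other half is reserved for points that are not
  regular.\<close>

definition tube_width :: "nat \<Rightarrow> nat \<Rightarrow> real" where
  "tube_width m j = 1 / (8 * (real j)\<^sup>2 * (12 * real (m + 2)) ^ m)"

lemma almost_all_noncollapsed:
  fixes \<mu> :: "'a::euclidean_space set \<Rightarrow> ennreal"
  assumes rad: "radon_measure \<mu>" and dens: "density_condition m \<mu>" and m: "1 \<le> m"
  shows "almost_all \<mu> (\<lambda>a. \<exists>j i. 0 < j \<and> 0 < i \<and> noncollapsed m \<mu> (1 / (4 * real j)) (tube_width m j) (1 / real i) a)"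
proof -
  note om = radon_measure_outer[OF rad]
  define Z where "Z j = {a \<in> regular_points m \<mu> j. \<not> (\<exists>i::nat. 0 < i \<and> (\<forall>r. 0 < r \<and> r \<le> 1 / real i \<longrightarrow>
      \<mu> (cball a r - regular_points m \<mu> j) \<le> ennreal (1 / (8 * real j) * r ^ m)))}" for j
  define N where "N = {x. \<not> (0 < lower_density m \<mu> x \<and> lower_density m \<mu> x \<le> upper_density m \<mu> x \<and> upper_density m \<mu> x < \<infinity>)}"
  have N0: "\<mu> N = 0" using dens by (simp add: density_condition_def almost_all_def N_def)
  have Z0: "\<mu> (\<Union>j\<in>{0<..}. Z j) = 0"
  proof (rule outer_measure_null_UN[OF om])
    fix j :: nat assume "j \<in> {0<..}"
    then show "\<mu> (Z j) = 0" unfolding Z_def by (intro regular_points_density[OF rad]) auto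
  qed simp
  have good: "\<exists>j i. 0 < j \<and> 0 < i \<and> noncollapsed m \<mu> (1 / (4 * real j)) (tube_width m j) (1 / real i) a"
    if a: "a \<notin> N" "a \<notin> (\<Union>j\<in>{0<..}. Z j)" for a
  proof -
    have d: "0 < lower_density m \<mu> a" "upper_density m \<mu> a < \<infinity>" using a(1) unfolding N_def by blast+
    obtain j1 :: nat where j1: "0 < j1" "\<And>r. 0 < r \<Longrightarrow> r \<le> 1 / real j1 \<Longrightarrow> \<mu> (cball a r) \<le> ennreal (real j1 * r ^ m)"
      using d(2) by (rule upper_density_finiteD) blast
    obtain j2 :: nat where j2: "0 < j2" "\<And>r. 0 < r \<Longrightarrow> r \<le> 1 / real j2 \<Longrightarrow> ennreal (r ^ m / real j2) \<le> \<mu> (cball a r)"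
      using d(1) by (rule lower_density_posD) blast
    obtain j3 :: nat where j3: "norm a \<le> real j3" using real_arch_simple by blast
    define j where "j = j1 + j2 + j3"
    have j: "0 < j" "real j1 \<le> real j" "real j2 \<le> real j" "norm a \<le> real j"
      using j1 j3 by (auto simp: j_def)
    have "a \<in> regular_points m \<mu> j"
      unfolding regular_points_def
    proof (intro CollectI conjI allI impI)
      fix r :: real assume r: "0 < r \<and> r < 1 / real j"
      have "1 / real j \<le> 1 / real j1" "1 / real j \<le> 1 / real j2"
        using j j1 j2 by (auto intro!: divide_left_mono)
      then have r12: "r \<le> 1 / real j1" "r \<le> 1 / real j2" using r by linarith+
      have "ennreal (r ^ m / real j) \<le> ennreal (r ^ m / real j2)"
        using j j2 r by (intro ennreal_leI divide_left_mono) auto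
      then show "ennreal (r ^ m / real j) \<le> \<mu> (cball a r)" using j2(2) r r12 by (meson order_trans)
      have "ennreal (real j1 * r ^ m) \<le> ennreal (real j * r ^ m)"
        using j r by (intro ennreal_leI mult_right_mono) auto
      then show "\<mu> (cball a r) \<le> ennreal (real j * r ^ m)" using j1(2) r r12 by (meson order_trans)
    qed (rule j(4))
    then have aF: "a \<in> regular_points m \<mu> j" .
    moreover have "a \<notin> Z j" using a(2) j by auto
    ultimately obtain i0 :: nat where i0: "0 < i0" "\<And>r. 0 < r \<Longrightarrow> r \<le> 1 / real i0 \<Longrightarrow>
      \<mu> (cball a r - regular_points m \<mu> j) \<le> ennreal (1 / (8 * real j) * r ^ m)"
      unfolding Z_def by blast
    define i where "i = i0 + j + 1"
    have "noncollapsed m \<mu> (1 / (4 * real j)) (tube_width m j) (1 / real i) a"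
      unfolding noncollapsed_def
    proof (intro allI impI conjI)
      fix r :: real assume r: "0 < r \<and> r \<le> 1 / real i"
      have "1 / real i \<le> 1 / real i0" "1 / real i < 1 / real j"
        using i0 j by (auto simp: i_def intro!: divide_left_mono divide_strict_left_mono)
      then have r': "r \<le> 1 / real i0" "r < 1 / real j" using r by linarith+
      have "ennreal (r ^ m / real j) \<le> \<mu> (cball a r)"
        using aF r r' by (auto simp: regular_points_def)
      then show "ennreal (4 * (1 / (4 * real j)) * r ^ m) \<le> \<mu> (cball a r)" by simp
      fix W :: "'a set" and q assume W: "subspace W \<and> dim W < m"
      have tw: "0 < tube_width m j" "tube_width m j \<le> 1" "real (m + 2) * tube_width m j \<le> 1"
        and twj: "(12 * real (m + 2)) ^ m * real j * tube_width m j = 1 / (8 * real j)"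
      proof -
        have X: "12 * real (m + 2) \<le> (12 * real (m + 2)) ^ m" using m by (intro self_le_power) auto
        have J: "1 \<le> (real j)\<^sup>2" using j by simp
        show "0 < tube_width m j" using j by (simp add: tube_width_def)
        have "1 * (12 * real (m + 2)) \<le> 8 * (real j)\<^sup>2 * (12 * real (m + 2)) ^ m"
          using X J by (intro mult_mono) auto
        then show "real (m + 2) * tube_width m j \<le> 1" using j by (simp add: tube_width_def field_simps)
        moreover have "1 * tube_width m j \<le> real (m + 2) * tube_width m j"
          using \<open>0 < tube_width m j\<close> by (intro mult_right_mono) auto
        ultimately show "tube_width m j \<le> 1" by simp
        have "(12 * real (m + 2)) ^ m \<noteq> 0" by simp
        then show "(12 * real (m + 2)) ^ m * real j * tube_width m j = 1 / (8 * real j)"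
          using j by (simp add: tube_width_def power2_eq_square del: power_mult_distrib)
      qed
      have "real (m + 2) * (tube_width m j * r) \<le> 1 * r"
        using tw(3) r by (simp add: mult.assoc[symmetric] del: of_nat_add mult_1)
      then have small: "real (m + 2) * (tube_width m j * r) < 1 / real j" using r' by linarith
      let ?T = "{x \<in> cball a r. \<exists>w\<in>W. norm (x - q - w) < tube_width m j * r}"
      let ?TF = "{x \<in> cball a r \<inter> regular_points m \<mu> j. \<exists>w\<in>W. norm (x - q - w) < tube_width m j * r}"
      have "\<mu> ?T \<le> \<mu> (?TF \<union> (cball a r - regular_points m \<mu> j))"
        by (rule outer_measure_mono[OF om]) auto
      also have "\<dots> \<le> \<mu> ?TF + \<mu> (cball a r - regular_points m \<mu> j)" by (rule outer_measure_Un[OF om])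
      also have "\<dots> \<le> ennreal ((12 * real (m + 2)) ^ m * real j * tube_width m j * r ^ m) + ennreal (1 / (8 * real j) * r ^ m)"
        using W r r' tw small j by (intro add_mono regular_points_tube_le[OF rad] i0(2)) auto
      also have "\<dots> = ennreal (1 / (4 * real j) * r ^ m)"
        unfolding twj using r by (simp add: ennreal_plus[symmetric] del: ennreal_plus)
      finally show "\<mu> ?T \<le> ennreal (1 / (4 * real j) * r ^ m)" .
    qed
    then show ?thesis using j(1) by (intro exI[of _ j] exI[of _ i]) (auto simp: i_def)
  qed
  have "\<mu> {a. \<not> (\<exists>j i. 0 < j \<and> 0 < i \<and> noncollapsed m \<mu> (1 / (4 * real j)) (tube_width m j) (1 / real i) a)}
      \<le> \<mu> (N \<union> (\<Union>j\<in>{0<..}. Z j))"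
    by (rule outer_measure_mono[OF om]) (use good in blast)
  also have "\<dots> \<le> 0" using outer_measure_Un[OF om, of N "\<Union>j\<in>{0<..}. Z j"] N0 Z0 by simp
  finally show ?thesis by (simp add: almost_all_def)
qed

section \<open>Approximating planes at a given scale\<close>

text \<open>Mass \<open>4 * \<tau>\<close> of the ball less \<open>\<tau>\<close> of the tube about
  \<open>a + W\<close>. The points of \<open>S\<close> are those that can extend a fat family with
  span \<open>W\<close>.\<close>

lemma noncollapsed_select:
  fixes \<mu> :: "'a::euclidean_space set \<Rightarrow> ennreal"
  assumes rad: "radon_measure \<mu>" and nc: "noncollapsed m \<mu> \<tau> \<eta> r0 a" and r: "0 < r" "r \<le> r0"
    and W: "subspace W" "dim W < m" and \<tau>: "0 < \<tau>"
  defines "S \<equiv> {x \<in> cball a r. \<forall>w\<in>W. \<eta> * r \<le> norm (x - a - w)}"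
  shows "S \<in> sets borel" "ennreal (3 * \<tau> * r ^ m) \<le> \<mu> S"
proof -
  note om = radon_measure_outer[OF rad]
  have "S = cball a r - (\<Union>w\<in>W. ball (a + w) (\<eta> * r))"
    by (auto simp: S_def dist_norm not_less norm_minus_commute algebra_simps)
  moreover have "open (\<Union>w\<in>W. ball (a + w) (\<eta> * r))" by auto
  ultimately show "S \<in> sets borel" by (simp only: sets.Diff borel_open borel_closed closed_cball)
  let ?T = "{x \<in> cball a r. \<exists>w\<in>W. norm (x - a - w) < \<eta> * r}"
  have mass: "ennreal (4 * \<tau> * r ^ m) \<le> \<mu> (cball a r)" "\<mu> ?T \<le> ennreal (\<tau> * r ^ m)"
    using nc r W unfolding noncollapsed_def by blast+
  have "ennreal (4 * \<tau> * r ^ m) \<le> \<mu> (S \<union> ?T)"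
    by (rule order_trans[OF mass(1) outer_measure_mono[OF om]]) (auto simp: S_def not_le)
  also have "\<dots> \<le> \<mu> S + \<mu> ?T" by (rule outer_measure_Un[OF om])
  also have "\<dots> \<le> \<mu> S + ennreal (\<tau> * r ^ m)" using mass(2) by (rule add_left_mono)
  finally have le: "ennreal (4 * \<tau> * r ^ m) \<le> \<mu> S + ennreal (\<tau> * r ^ m)" .
  show "ennreal (3 * \<tau> * r ^ m) \<le> \<mu> S"
  proof (cases "\<mu> S")
    case (real s)
    have "ennreal (4 * \<tau> * r ^ m) \<le> ennreal (s + \<tau> * r ^ m)"
      using le real \<tau> r by simp
    then have "4 * \<tau> * r ^ m \<le> s + \<tau> * r ^ m"
      using real \<tau> r by (subst (asm) ennreal_le_iff) auto
    then show ?thesis using real by (simp add: ennreal_leI)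
  qed simp
qed

text \<open>No measurability is needed: for a non-measurable integrand the integral is a lower integral.\<close>

lemma nn_integral_exists_le:
  assumes S: "S \<in> sets M" "S \<subseteq> B" "ennreal s \<le> emeasure M S" and s: "0 < s"
    and int: "(\<integral>\<^sup>+x\<in>B. g x \<partial>M) \<le> ennreal I" and I: "0 < I"
  shows "\<exists>x\<in>S. g x \<le> ennreal (I * (2 / s))"
proof (rule ccontr)
  assume "\<not> (\<exists>x\<in>S. g x \<le> ennreal (I * (2 / s)))"
  then have big: "ennreal (I * (2 / s)) \<le> g x" if "x \<in> S" for x using that by (auto simp: not_le less_imp_le)
  have "ennreal (2 * I) = ennreal (I * (2 / s)) * ennreal s"
    using s I by (simp add: ennreal_mult[symmetric])
  also have "\<dots> \<le> ennreal (I * (2 / s)) * emeasure M S" using S by (intro mult_left_mono) auto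
  also have "\<dots> = (\<integral>\<^sup>+x. ennreal (I * (2 / s)) * indicator S x \<partial>M)"
    using S(1) by (rule nn_integral_cmult_indicator[symmetric])
  also have "\<dots> \<le> (\<integral>\<^sup>+x\<in>B. g x \<partial>M)"
    using big S(2) by (intro nn_integral_mono) (auto simp: indicator_def)
  also have "\<dots> \<le> ennreal I" by (rule int)
  finally show False using I by (simp add: ennreal_le_iff)
qed

text \<open>A Chebyshev choice in each variable, from the outermost inwards: the point is taken from
  a set of mass at least \<open>s\<close> and the bound grows by \<open>2 / s\<close>. The predicate
  \<open>R\<close> transports a property of the points chosen so far; fatness is the intended
  one.\<close>

lemma iterated_integral_select:
  assumes s: "0 < s" and kK: "k0 \<le> k" "k \<le> K"
    and step: "\<And>k b. k0 \<le> k \<Longrightarrow> k < K \<Longrightarrow> R (Suc k) b \<Longrightarrow>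
      \<exists>S\<in>sets M. S \<subseteq> B \<and> ennreal s \<le> emeasure M S \<and> (\<forall>x\<in>S. R k (b(Suc k := x)))"
    and "R k b" "iterated_integral M B k F b \<le> ennreal I" "0 < I"
  shows "\<exists>b'. R k0 b' \<and> iterated_integral M B k0 F b' \<le> ennreal (I * (2 / s) ^ (k - k0))"
  using kK assms(5-7)
proof (induction "k - k0" arbitrary: k b I)
  case 0
  then show ?case by auto
next
  case (Suc n)
  then obtain k' where k': "k = Suc k'" "k0 \<le> k'" by (cases k) auto
  obtain S where S: "S \<in> sets M" "S \<subseteq> B" "ennreal s \<le> emeasure M S" "\<And>x. x \<in> S \<Longrightarrow> R k' (b(Suc k' := x))"
    using step[of k' b] k' Suc.prems by auto
  have "(\<integral>\<^sup>+x\<in>B. iterated_integral M B k' F (b(Suc k' := x)) \<partial>M) \<le> ennreal I"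
    using Suc.prems by (simp add: k')
  from nn_integral_exists_le[OF S(1-3) s this Suc.prems(5)]
  obtain x where x: "x \<in> S" "iterated_integral M B k' F (b(Suc k' := x)) \<le> ennreal (I * (2 / s))" by blast
  have "\<exists>b'. R k0 b' \<and> iterated_integral M B k0 F b' \<le> ennreal (I * (2 / s) * (2 / s) ^ (k' - k0))"
    using Suc.hyps(2) Suc.prems k' S(4)[OF x(1)] x(2) s
    by (intro Suc.hyps(1)[where b="b(Suc k' := x)"]) auto
  moreover have "k - k0 = Suc (k' - k0)" using k' by simp
  ultimately show ?case by (simp add: mult.assoc)
qed

text \<open>Fubini for the indicator of a measurable null set that contains the failures of
  \<open>P\<close>.\<close>

lemma AE_PiM_insertD:
  fixes I :: "'i set"
  assumes "product_sigma_finite (\<lambda>_::'i. N)" and I: "finite I" "i \<notin> I"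
    and AE: "AE x in Pi\<^sub>M (insert i I) (\<lambda>_. N). P x"
  shows "AE y in N. AE x in Pi\<^sub>M I (\<lambda>_. N). P (x(i := y))"
proof -
  interpret P: product_sigma_finite "\<lambda>_::'i. N" by fact
  interpret sigma_finite_measure "Pi\<^sub>M I (\<lambda>_. N)" by (rule P.sigma_finite[OF I(1)])
  obtain Z where Z: "{x \<in> space (Pi\<^sub>M (insert i I) (\<lambda>_. N)). \<not> P x} \<subseteq> Z" "emeasure (Pi\<^sub>M (insert i I) (\<lambda>_. N)) Z = 0"
    "Z \<in> sets (Pi\<^sub>M (insert i I) (\<lambda>_. N))"
    using AE by (rule AE_E)
  define f :: "('i \<Rightarrow> 'a) \<Rightarrow> ennreal" where "f = indicator Z"
  have f[measurable]: "f \<in> borel_measurable (Pi\<^sub>M (insert i I) (\<lambda>_. N))"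
    unfolding f_def using Z(3) by simp
  have "(\<integral>\<^sup>+ y. (\<integral>\<^sup>+ x. f (x(i := y)) \<partial>(Pi\<^sub>M I (\<lambda>_. N))) \<partial>N) = 0"
    using P.product_nn_integral_insert_rev[OF I f] Z by (simp add: f_def)
  then have "AE y in N. (\<integral>\<^sup>+ x. f (x(i := y)) \<partial>(Pi\<^sub>M I (\<lambda>_. N))) = 0"
    by (subst (asm) nn_integral_0_iff_AE) measurable
  then show ?thesis
    using AE_space
  proof eventually_elim
    case (elim y)
    have [measurable]: "y \<in> space N" by (rule elim(2))
    have "AE x in Pi\<^sub>M I (\<lambda>_. N). f (x(i := y)) = 0"
      using elim(1) by (subst (asm) nn_integral_0_iff_AE) measurable
    then show ?case
      using AE_space
    proof eventually_elim
      case (elim x)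
      then have "x(i := y) \<in> space (Pi\<^sub>M (insert i I) (\<lambda>_. N))"
        using \<open>y \<in> space N\<close> by (auto simp: space_PiM PiE_def extensional_def)
      moreover have "x(i := y) \<notin> Z" using elim(1) by (auto simp: f_def indicator_def split: if_splits)
      ultimately show ?case using Z(1) by blast
    qed
  qed
qed

text \<open>A property that holds almost everywhere persists after fixing coordinates in sets of
  positive measure. Coordinate \<open>l\<close> is left free, so the property survives for almost
  every choice of the last vertex.\<close>

lemma AE_PiM_select:
  fixes P :: "(nat \<Rightarrow> 'a) \<Rightarrow> bool"
  assumes N: "product_sigma_finite (\<lambda>_::nat. N)" and lK: "l \<le> K"
    and dep: "\<And>x y. (\<And>i. i \<in> {l..K} \<Longrightarrow> x i = y i) \<Longrightarrow> P x \<Longrightarrow> P y"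
    and AE: "AE x in Pi\<^sub>M {l..K} (\<lambda>_. N). P x" and R: "R K c0"
    and step: "\<And>k c. l \<le> k \<Longrightarrow> k < K \<Longrightarrow> R (Suc k) c \<Longrightarrow> \<exists>S\<in>sets N. 0 < emeasure N S \<and> (\<forall>x\<in>S. R k (c(Suc k := x)))"
  shows "\<exists>c. R l c \<and> (AE y in N. P (c(l := y)))"
proof -
  have claim: "\<exists>c. R k c \<and> (AE x in Pi\<^sub>M {l..k} (\<lambda>_. N). P (\<lambda>i. if i \<in> {l..k} then x i else c i))"
    if "l \<le> k" "k \<le> K" for k
    using that(2,1)
  \<comment> \<open>Downward induction: coordinates are fixed from \<open>K\<close> down to
    \<open>l + 1\<close>.\<close>
  proof (induction k rule: inc_induct)
    case base
    have "AE x in Pi\<^sub>M {l..K} (\<lambda>_. N). P (\<lambda>i. if i \<in> {l..K} then x i else c0 i)"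
      using AE by eventually_elim (erule dep[rotated], simp)
    then show ?case using R by blast
  next
    case (step k)
    then obtain c where c: "R (Suc k) c" "AE x in Pi\<^sub>M {l..Suc k} (\<lambda>_. N). P (\<lambda>i. if i \<in> {l..Suc k} then x i else c i)"
      by auto
    have eq: "insert (Suc k) {l..k} = {l..Suc k}" using step by auto
    have "AE y in N. AE x in Pi\<^sub>M {l..k} (\<lambda>_. N). P (\<lambda>i. if i \<in> {l..Suc k} then (x(Suc k := y)) i else c i)"
      using AE_PiM_insertD[OF N, of "{l..k}" "Suc k" "\<lambda>x. P (\<lambda>i. if i \<in> {l..Suc k} then x i else c i)"] c(2)
      unfolding eq by simp
    moreover have "(\<lambda>i. if i \<in> {l..Suc k} then (x(Suc k := y)) i else c i) = (\<lambda>i. if i \<in> {l..k} then x i else (c(Suc k := y)) i)" for x y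
      using step by (auto simp: fun_eq_iff)
    ultimately have ae: "AE y in N. AE x in Pi\<^sub>M {l..k} (\<lambda>_. N). P (\<lambda>i. if i \<in> {l..k} then x i else (c(Suc k := y)) i)"
      by simp
    obtain S where S: "S \<in> sets N" "0 < emeasure N S" "\<And>x. x \<in> S \<Longrightarrow> R k (c(Suc k := x))"
      using assms(6)[OF \<open>l \<le> k\<close> \<open>k < K\<close> c(1)] by blast
    have "\<exists>y\<in>S. AE x in Pi\<^sub>M {l..k} (\<lambda>_. N). P (\<lambda>i. if i \<in> {l..k} then x i else (c(Suc k := y)) i)"
    proof (rule ccontr)
      assume neg: "\<not> ?thesis"
      have "AE y in N. y \<notin> S" using ae by eventually_elim (use neg in blast)
      then have "emeasure N S = 0" using S(1) by (simp add: AE_iff_null_sets null_setsD1)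
      then show False using S(2) by simp
    qed
    then show ?case using S(3) by blast
  qed
  obtain c where c: "R l c" "AE x in Pi\<^sub>M {l..l} (\<lambda>_. N). P (\<lambda>i. if i \<in> {l..l} then x i else c i)"
    using claim[OF order_refl lK] by blast
  have "AE x in Pi\<^sub>M {l} (\<lambda>_. N). P (\<lambda>i. if i \<in> {l} then x i else c i)"
    using c(2) unfolding atLeastAtMost_singleton .
  then have "AE y in N. AE x in Pi\<^sub>M {} (\<lambda>_. N). P (\<lambda>i. if i \<in> {l} then (x(l := y)) i else c i)"
    by (intro AE_PiM_insertD[OF N]) auto
  then have "AE y in N. P (c(l := y))"
  proof eventually_elim
    case (elim y)
    then have "P (\<lambda>i. if i \<in> {l} then ((\<lambda>_. undefined)(l := y)) i else c i)"
      unfolding PiM_empty AE_count_space by simp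
    moreover have "(\<lambda>i. if i \<in> {l} then ((\<lambda>_. undefined)(l := y)) i else c i) = c(l := y)"
      by (auto simp: fun_eq_iff)
    ultimately show ?case by simp
  qed
  then show ?thesis using c(1) by blast
qed

lemma fat_family_cong:
  assumes "fat_family \<eta> r v k" "\<And>i. i < k \<Longrightarrow> v' i = v i"
  shows "fat_family \<eta> r v' k"
proof -
  have "v' ` {..<i} = v ` {..<i}" if "i < k" for i using assms(2) that by (intro image_cong) auto
  then show ?thesis using assms unfolding fat_family_def by simp
qed

lemma fat_family_Suc:
  assumes "fat_family \<eta> r v k" "\<And>i. i < k \<Longrightarrow> v' i = v i" "norm (v' k) \<le> r"
    "\<And>w. w \<in> span (v ` {..<k}) \<Longrightarrow> \<eta> * r \<le> norm (v' k - w)"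
  shows "fat_family \<eta> r v' (Suc k)"
proof -
  have "v' ` {..<k} = v ` {..<k}" using assms(2) by (intro image_cong) auto
  then show ?thesis
    using fat_family_cong[OF assms(1,2)] assms(3,4) unfolding fat_family_def by (auto simp: less_Suc_eq)
qed

text \<open>Off the tube of radius \<open>C * r powr (1 + \<alpha>)\<close> the simplex is high, so
  its curvature is large, while the denominator is at most a power of \<open>2 * r\<close>. The
  constant \<open>C\<close> is left open, to be tuned against the integral bound.\<close>

lemma curvature_quotient_ge:
  fixes v :: "nat \<Rightarrow> 'a::euclidean_space"
  assumes fat: "fat_family \<eta> r v m" and \<eta>: "0 < \<eta>" and r: "0 < r" and y: "y \<in> cball a r"
    and T: "T ` {0..m + 1} = insert a (insert y ((\<lambda>i. a + v i) ` {..<m}))"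
    and C: "0 < C" "C * r powr (1 + \<alpha>) < norm (normal_proj (span (v ` {..<m})) (y - a))"
    and p: "1 \<le> p" and l: "1 \<le> l" and \<alpha>: "0 < \<alpha>"
  shows "ennreal ((simplex_const m \<eta> / 2 ^ (m + 1) * (C * r powr \<alpha>)) powr p / (2 * r) powr (real m * (real l - 1) + \<alpha> * p))
    \<le> curvature_quotient m l p \<alpha> T"
proof -
  define W where "W = span (v ` {..<m})"
  have W: "subspace W" by (simp add: W_def)
  define q where "q = normal_proj W (y - a)"
  define E where "E = real m * (real l - 1) + \<alpha> * p"
  have E: "0 \<le> E" using l \<alpha> p by (simp add: E_def)
  have q: "C * r powr (1 + \<alpha>) < norm q" using C by (simp add: q_def W_def)
  have "0 < C * r powr (1 + \<alpha>)" using C r by simp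
  then have q0: "q \<noteq> 0" using q by auto
  have qr: "C * r powr \<alpha> \<le> norm q / r" using q r by (simp add: powr_add field_simps)
  have "simplex_const m \<eta> / 2 ^ (m + 1) * (norm q / r) \<le> discrete_curvature m T"
  proof (rule discrete_curvature_ge[OF fat \<eta> r])
    show "y - a = (y - a - q) + q" by simp
    show "y - a - q \<in> span (v ` {..<m})" using normal_proj(1)[OF W, of "y - a"] by (simp add: q_def W_def)
    show "q \<bullet> z = 0" if "z \<in> span (v ` {..<m})" for z
      using normal_proj(2)[OF W] that by (simp add: q_def W_def)
    show "norm (y - a) \<le> r" using y by (simp add: dist_norm norm_minus_commute)
  qed (rule T)
  moreover have sc: "0 < simplex_const m \<eta> / 2 ^ (m + 1)" using simplex_const_pos[OF \<eta>] by simp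
  ultimately have curv: "simplex_const m \<eta> / 2 ^ (m + 1) * (C * r powr \<alpha>) \<le> discrete_curvature m T"
    using qr by (meson mult_left_mono less_imp_le order_trans)
  define D where "D = diameter (T ` {0..m + 1})"
  have "norm (v i) \<le> r" if "i < m" for i using fat that by (auto simp: fat_family_def)
  then have da: "dist x a \<le> r" if "x \<in> T ` {0..m + 1}" for x
    using that y r unfolding T by (auto simp: dist_norm norm_minus_commute)
  have "D \<le> 2 * r"
    unfolding D_def
  proof (rule diameter_le)
    fix x z assume "x \<in> T ` {0..m + 1}" "z \<in> T ` {0..m + 1}"
    then show "norm (x - z) \<le> 2 * r"
      using da[of x] da[of z] dist_triangle2[of x z a] by (simp add: dist_norm)
  qed (use r in auto)
  moreover have "0 < D"
  proof -
    have "y \<noteq> a"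
    proof
      assume "y = a"
      then have "q = 0" by (simp add: q_def)
      then show False using q0 by simp
    qed
    moreover have "dist y a \<le> D"
      unfolding D_def by (intro diameter_bounded_bound finite_imp_bounded) (auto simp: T[simplified] simp del: image_Suc_atLeastAtMost)
    ultimately show ?thesis by (meson less_le_trans zero_less_dist_iff)
  qed
  ultimately have Dp: "0 < D powr E" "D powr E \<le> (2 * r) powr E" using E by (auto intro: powr_mono2)
  have "(simplex_const m \<eta> / 2 ^ (m + 1) * (C * r powr \<alpha>)) powr p \<le> discrete_curvature m T powr p"
  proof (rule powr_mono2[OF _ _ curv])
    show "0 \<le> simplex_const m \<eta> / 2 ^ (m + 1) * (C * r powr \<alpha>)"
      by (intro mult_nonneg_nonneg) (use sc C in auto)
  qed (use p in simp)
  then have "(simplex_const m \<eta> / 2 ^ (m + 1) * (C * r powr \<alpha>)) powr p / (2 * r) powr E \<le> discrete_curvature m T powr p / D powr E"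
    using Dp r by (intro frac_le) auto
  then show ?thesis
    unfolding curvature_quotient_def D_def E_def by (rule ennreal_leI)
qed

text \<open>Fix \<open>m\<close> vertices that form a fat family about \<open>a\<close> while the
  remaining quantity stays bounded; points far from their plane then violate the bound. For
  \<open>l \<le> m + 1\<close> the free vertex is a coordinate of the essential supremum, and the
  far points form a null set. For \<open>l = m + 2\<close> it is the innermost integration variable,
  and the far points have mass at most \<open>\<theta> * r ^ m\<close>. The constant must precede
  measure, point and radius, since it is used at all scales.\<close>

lemma approximating_plane:
  fixes m l :: nat and \<alpha> p \<tau> \<eta> \<Lambda> \<theta> :: real
  assumes m: "1 \<le> m" and l: "l \<in> {1..m + 2}" and \<alpha>: "0 < \<alpha>" and p: "1 \<le> p"
    and \<tau>: "0 < \<tau>" and \<eta>: "0 < \<eta>" and \<Lambda>: "0 < \<Lambda>" and \<theta>: "0 < \<theta>"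
  obtains C where "0 < C"
    "\<And>(\<mu> :: 'a::euclidean_space set \<Rightarrow> ennreal) a r0 r. radon_measure \<mu> \<Longrightarrow> noncollapsed m \<mu> \<tau> \<eta> r0 a \<Longrightarrow> r0 \<le> 1 \<Longrightarrow>
       curvature_integral m l p \<alpha> \<mu> a 1 \<le> ennreal \<Lambda> \<Longrightarrow> 0 < r \<Longrightarrow> r \<le> r0 \<Longrightarrow>
       \<exists>T. subspace T \<and> dim T = m \<and>
         \<mu> {y \<in> cball a r. C * r powr (1 + \<alpha>) < norm (normal_proj T (y - a))} \<le> ennreal (\<theta> * r ^ m)"
proof -
  define c0 where "c0 = simplex_const m \<eta> / 2 ^ (m + 1)"
  have c0: "0 < c0" using simplex_const_pos[OF \<eta>] by (simp add: c0_def)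
  define E where "E = real m * (real l - 1) + \<alpha> * p"
  \<comment> \<open>After \<open>n\<close> selections the bound reads
    \<open>X n / 2 powr E / r ^ (m * n)\<close>; the factor \<open>2 powr E\<close> compensates the
    diameter bound \<open>2 * r\<close>.\<close>
  define X where "X n = 2 powr E * (\<Lambda> * (2 / (3 * \<tau>)) ^ n)" for n :: nat
  have X: "0 < X n" for n using \<Lambda> \<tau> by (simp add: X_def)
  \<comment> \<open>\<open>G\<close> exceeds \<open>X (l - 1)\<close>, to contradict the essential
    supremum, and is at least \<open>X m / \<theta>\<close>, for the mass estimate in the case
    \<open>l = m + 2\<close>.\<close>
  define G where "G = X (l - 1) + X m / \<theta> + 1"
  have G: "0 < G" "X (l - 1) < G" "X m / \<theta> \<le> G"
    using X[of "l - 1"] X[of m] \<theta> by (auto simp: G_def add_pos_pos)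
  define C where "C = G powr (1 / p) / c0"
  have C: "0 < C" using G c0 by (simp add: C_def)
  \<comment> \<open>The powers \<open>r powr (\<alpha> * p)\<close> cancel; what is left has the
    same order in \<open>r\<close> as the bound after \<open>l - 1\<close> selections.\<close>
  have cC: "(c0 * (C * r powr \<alpha>)) powr p / (2 * r) powr E = G / 2 powr E / r ^ (m * (l - 1))" if r: "0 < r" for r
  proof -
    have "(c0 * (C * r powr \<alpha>)) powr p = (G powr (1 / p)) powr p * (r powr \<alpha>) powr p"
      using c0 r by (simp add: C_def powr_mult)
    also have "\<dots> = G * r powr (\<alpha> * p)" using p G by (simp add: powr_powr)
    finally have "(c0 * (C * r powr \<alpha>)) powr p / (2 * r) powr E = G * r powr (\<alpha> * p) / (2 powr E * r powr E)"
      using r by (simp add: powr_mult)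
    also have "r powr E = r ^ (m * (l - 1)) * r powr (\<alpha> * p)"
    proof -
      have "real m * (real l - 1) = real (m * (l - 1))" using l by (simp add: of_nat_diff)
      then show ?thesis using r unfolding E_def by (simp add: powr_add powr_realpow del: of_nat_mult)
    qed
    finally show ?thesis using r by simp
  qed
  show thesis
  proof (rule that[OF C])
    fix \<mu> :: "'a set \<Rightarrow> ennreal" and a r0 r
    assume rad: "radon_measure \<mu>" and nc: "noncollapsed m \<mu> \<tau> \<eta> r0 a" and r01: "r0 \<le> 1"
      and K: "curvature_integral m l p \<alpha> \<mu> a 1 \<le> ennreal \<Lambda>" and r: "0 < r" "r \<le> r0"
    define M where "M = measure_space_of \<mu>"
    define B where "B = cball a (1::real)"
    define F where "F = curvature_esssup m l p \<alpha> \<mu> a 1"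
    define s where "s = 3 * \<tau> * r ^ m"
    have s: "0 < s" using \<tau> r by (simp add: s_def)
    have borelM: "S \<in> sets M \<and> emeasure M S = \<mu> S" if "S \<in> sets borel" for S
      using that sets_borel_subset_measure_space_of[OF rad] emeasure_measure_space_of_borel[OF rad that] by (auto simp: M_def)
    have s2: "\<Lambda> * (2 / s) ^ n = X n / 2 powr E / r ^ (m * n)" for n
      using r by (simp add: s_def X_def power_divide power_mult_distrib power_mult)
    have sel: "\<exists>S\<in>sets borel. S \<subseteq> cball a r \<and> ennreal s \<le> \<mu> S \<and>
        (\<forall>x\<in>S. \<forall>v'. (\<forall>i<k. v' i = v i) \<longrightarrow> v' k = x - a \<longrightarrow> fat_family \<eta> r v' (Suc k))"
      if fat: "fat_family \<eta> r v k" and k: "k < m" for v k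
    proof -
      define W where "W = span (v ` {..<k})"
      have W: "subspace W" "dim W < m" using fat_family_dim[OF fat \<eta> r(1)] k by (auto simp: W_def)
      define S where "S = {x \<in> cball a r. \<forall>w\<in>W. \<eta> * r \<le> norm (x - a - w)}"
      have "S \<in> sets borel" "ennreal s \<le> \<mu> S"
        using noncollapsed_select[OF rad nc r W \<tau>] by (simp_all add: S_def s_def)
      moreover have "S \<subseteq> cball a r" by (auto simp: S_def)
      moreover have "fat_family \<eta> r v' (Suc k)" if x: "x \<in> S" and v': "\<forall>i<k. v' i = v i" "v' k = x - a" for x v'
        by (rule fat_family_Suc[OF fat]) (use x v' in \<open>auto simp: S_def W_def dist_norm norm_minus_commute\<close>)
      ultimately show ?thesis by blast
    qed
    \<comment> \<open>The variable with index \<open>l - 1\<close> is outermost and chosen first, so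
      the indices are reversed to make the earliest choice the first member of the fat
      family.\<close>
    define R where "R k b \<longleftrightarrow> fat_family \<eta> r (\<lambda>i. b (l - 1 - i) - a) (l - 1 - k)" for k and b :: "nat \<Rightarrow> 'a"
    \<comment> \<open>For \<open>l = m + 2\<close> variable \<open>1\<close> stays unchosen and
      becomes the free vertex.\<close>
    define k0 :: nat where "k0 = (if l = m + 2 then 1 else 0)"
    have R0: "R (l - 1) b" for b by (simp add: R_def fat_family_def)
    have step: "\<exists>S\<in>sets M. S \<subseteq> B \<and> ennreal s \<le> emeasure M S \<and> (\<forall>x\<in>S. R k (b(Suc k := x)))"
      if k: "k0 \<le> k" "k < l - 1" and Rb: "R (Suc k) b" for k b
    proof -
      have km: "l - 1 - Suc k < m" using k l by (auto simp: k0_def split: if_splits)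
      obtain S where S: "S \<in> sets borel" "S \<subseteq> cball a r" "ennreal s \<le> \<mu> S"
        "\<And>x v'. x \<in> S \<Longrightarrow> (\<forall>i<l - 1 - Suc k. v' i = b (l - 1 - i) - a) \<Longrightarrow> v' (l - 1 - Suc k) = x - a \<Longrightarrow> fat_family \<eta> r v' (Suc (l - 1 - Suc k))"
        using sel[OF Rb[unfolded R_def] km] by blast
      have "R k (b(Suc k := x))" if x: "x \<in> S" for x
      proof -
        have "Suc (l - 1 - Suc k) = l - 1 - k" using k by simp
        moreover have "fat_family \<eta> r (\<lambda>i. (b(Suc k := x)) (l - 1 - i) - a) (Suc (l - 1 - Suc k))"
          by (rule S(4)[OF x]) (use k in auto)
        ultimately show ?thesis by (simp only: R_def)
      qed
      moreover have "S \<subseteq> B" using S(2) r r01 by (auto simp: B_def)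
      ultimately show ?thesis using borelM[OF S(1)] S(3) by (intro bexI[of _ S]) auto
    qed
    have "k0 \<le> l - 1" using l m by (auto simp: k0_def)
    moreover have "iterated_integral M B (l - 1) F (\<lambda>_. a) \<le> ennreal \<Lambda>"
      using K by (simp add: curvature_integral_def M_def B_def F_def)
    ultimately obtain b where b: "R k0 b" "iterated_integral M B k0 F b \<le> ennreal (\<Lambda> * (2 / s) ^ (l - 1 - k0))"
      using iterated_integral_select[where k="l - 1" and K="l - 1" and R=R and F=F and b="\<lambda>_. a", OF s _ order_refl step R0 _ \<Lambda>] by blast
    have badS: "{y \<in> cball a r. C * r powr (1 + \<alpha>) < norm (normal_proj T (y - a))} \<in> sets borel" for T
    proof -
      have "{y \<in> cball a r. C * r powr (1 + \<alpha>) < norm (normal_proj T (y - a))} =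
        cball a r \<inter> {y. C * r powr (1 + \<alpha>) < norm (normal_proj T (y - a))}" by auto
      moreover have "open {y. C * r powr (1 + \<alpha>) < norm (normal_proj T (y - a))}"
        by (intro open_Collect_less continuous_intros)
      ultimately show ?thesis by (simp only: sets.Int borel_open borel_closed closed_cball)
    qed
    have quot: "ennreal (G / 2 powr E / r ^ (m * (l - 1))) \<le> curvature_quotient m l p \<alpha> T"
      if fat: "fat_family \<eta> r v m" and y: "y \<in> {y \<in> cball a r. C * r powr (1 + \<alpha>) < norm (normal_proj (span (v ` {..<m})) (y - a))}"
        and T: "T ` {0..m + 1} = insert a (insert y ((\<lambda>i. a + v i) ` {..<m}))" for v y T
    proof -
      have "ennreal ((c0 * (C * r powr \<alpha>)) powr p / (2 * r) powr E) \<le> curvature_quotient m l p \<alpha> T"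
        unfolding c0_def E_def using y l by (intro curvature_quotient_ge[OF fat \<eta> r(1) _ T C _ p _ \<alpha>]) auto
      then show ?thesis unfolding cC[OF r(1)] .
    qed
    have "\<exists>v. fat_family \<eta> r v m \<and>
      \<mu> {y \<in> cball a r. C * r powr (1 + \<alpha>) < norm (normal_proj (span (v ` {..<m})) (y - a))} \<le> ennreal (\<theta> * r ^ m)"
    proof (cases "l = m + 2")
      case True
      define v where "v i = b (m + 1 - i) - a" for i
      have fat: "fat_family \<eta> r v m" using b(1) True by (simp add: R_def k0_def v_def[abs_def])
      define S where "S = {y \<in> cball a r. C * r powr (1 + \<alpha>) < norm (normal_proj (span (v ` {..<m})) (y - a))}"
      have Sb: "S \<in> sets borel" unfolding S_def by (rule badS)
      have SB: "S \<subseteq> B" using r r01 by (auto simp: S_def B_def)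
      define g where "g = G / 2 powr E / r ^ (m * (m + 1))"
      have g: "0 < g" using G r by (simp add: g_def)
      have Fg: "ennreal g \<le> F (b(1 := y))" if y: "y \<in> S" for y
      proof -
        define T where "T c i = (if i = 0 then a else if i < l then (b(1 := y)) i else c i)" for c :: "nat \<Rightarrow> 'a" and i
        have Tim: "T c ` {0..m + 1} = insert a (insert y ((\<lambda>i. a + v i) ` {..<m}))" for c
        proof -
          have "{0..m + 1} = insert 0 (insert 1 ((\<lambda>i. m + 1 - i) ` {..<m}))"
          proof (intro set_eqI iffI)
            fix x assume x: "x \<in> {0..m + 1}"
            show "x \<in> insert 0 (insert 1 ((\<lambda>i. m + 1 - i) ` {..<m}))"
            proof (cases "x \<le> 1")
              case False
              then have "x = m + 1 - (m + 1 - x)" "m + 1 - x \<in> {..<m}" using x by auto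
              then show ?thesis by blast
            qed auto
          qed auto
          moreover have "T c (m + 1 - i) = a + v i" if "i < m" for i
          proof -
            have "m + 1 - i \<noteq> 0" "m + 1 - i \<noteq> 1" "m + 1 - i < l" using that True by auto
            then show ?thesis unfolding T_def v_def by simp
          qed
          moreover have "T c 0 = a" "T c 1 = y" using l m True by (auto simp: T_def)
          ultimately show ?thesis by (simp add: image_image)
        qed
        have eq: "F (b(1 := y)) = esssup (Pi\<^sub>M {l..m + 1} (\<lambda>_. restrict_space (measure_space_of \<mu>) (cball a 1))) (\<lambda>c. curvature_quotient m l p \<alpha> (T c))"
          unfolding F_def curvature_esssup_def T_def ..
        \<comment> \<open>All indices up to \<open>m + 1\<close> are below \<open>l\<close>, so no
          relevant vertex comes from \<open>c\<close> and the essential supremum over the empty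
          product is that of a constant.\<close>
        have const: "curvature_quotient m l p \<alpha> (T c) = curvature_quotient m l p \<alpha> (T (\<lambda>_. a))" for c
        proof -
          have "T c ` {0..m + 1} = T (\<lambda>_. a) ` {0..m + 1}" unfolding Tim ..
          then show ?thesis by (simp add: curvature_quotient_def discrete_curvature_def del: image_Suc_atLeastAtMost)
        qed
        have emp: "{l..m + 1} = {}" using True by simp
        have "F (b(1 := y)) = curvature_quotient m l p \<alpha> (T (\<lambda>_. a))"
        proof -
          have cst: "(\<lambda>c. curvature_quotient m l p \<alpha> (T c)) = (\<lambda>_. curvature_quotient m l p \<alpha> (T (\<lambda>_. a)))"
            by (rule ext, rule const)
          show ?thesis
            unfolding eq emp by (subst cst, rule esssup_const) (simp add: space_PiM_empty)
        qed
        then show ?thesis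
          using quot[OF fat y[unfolded S_def] Tim[of "\<lambda>_. a"]] True by (simp add: g_def)
      qed
      have "ennreal g * \<mu> S = ennreal g * emeasure M S" using borelM[OF Sb] by simp
      also have "\<dots> = (\<integral>\<^sup>+y. ennreal g * indicator S y \<partial>M)"
        using borelM[OF Sb] by (intro nn_integral_cmult_indicator[symmetric]) blast
      also have "\<dots> \<le> (\<integral>\<^sup>+y\<in>B. F (b(1 := y)) \<partial>M)"
        using Fg SB by (intro nn_integral_mono) (auto simp: indicator_def)
      also have "\<dots> \<le> ennreal (\<Lambda> * (2 / s) ^ m)"
        using b(2) True by (simp add: k0_def)
      also have "\<Lambda> * (2 / s) ^ m = X m / 2 powr E / r ^ (m * m)" by (rule s2)
      also have "\<dots> \<le> g * (\<theta> * r ^ m)"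
      proof -
        have "X m \<le> G * \<theta>" using G(3) \<theta> by (simp add: field_simps)
        then have "X m / 2 powr E / r ^ (m * m) \<le> G * \<theta> / 2 powr E / r ^ (m * m)"
          using r by (intro divide_right_mono) auto
        also have "\<dots> = g * (\<theta> * r ^ m)" using r by (simp add: g_def power_add)
        finally show ?thesis .
      qed
      finally have "ennreal g * \<mu> S \<le> ennreal g * ennreal (\<theta> * r ^ m)"
        using g \<theta> r by (simp add: ennreal_mult[symmetric] ennreal_leI)
      then have "\<mu> S \<le> ennreal (\<theta> * r ^ m)"
        using g by (subst (asm) ennreal_mult_le_mult_iff) auto
      then show ?thesis using fat unfolding S_def by blast
    next
      case False
      then have lm: "l \<le> m + 1" "k0 = 0" using l by (auto simp: k0_def)
      define I2 where "I2 = ennreal (\<Lambda> * (2 / s) ^ (l - 1))"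
      define N where "N = restrict_space M B"
      have BM: "B \<in> sets M" using borelM[of B] by (simp add: B_def)
      have NS: "S \<in> sets N \<and> emeasure N S = \<mu> S" if "S \<in> sets borel" "S \<subseteq> B" for S
        using borelM[OF that(1)] that(2) BM by (auto simp: N_def sets_restrict_space_iff emeasure_restrict_space)
      have "finite_measure N"
      proof (rule finite_measureI)
        have "emeasure N B = \<mu> B" using NS[of B] by (simp add: B_def)
        moreover have "space N = B" using BM sets.sets_into_space[OF BM] by (auto simp: N_def space_restrict_space)
        moreover have "\<mu> B < \<infinity>" unfolding B_def by (rule radon_measure_compact[OF rad compact_cball])
        ultimately show "emeasure N (space N) \<noteq> \<infinity>" by simp
      qed
      then interpret N: finite_measure N .
      have N: "product_sigma_finite (\<lambda>_::nat. N)" by (rule product_sigma_finite.intro) (rule N.sigma_finite_measure_axioms)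
      define T where "T c i = (if i = 0 then a else if i < l then b i else c i)" for c :: "nat \<Rightarrow> 'a" and i
      have "F b = esssup (Pi\<^sub>M {l..m + 1} (\<lambda>_. N)) (\<lambda>c. curvature_quotient m l p \<alpha> (T c))"
        unfolding F_def curvature_esssup_def T_def N_def M_def B_def ..
      moreover have "F b \<le> I2" using b(2) lm by (simp add: I2_def)
      ultimately have "AE c in Pi\<^sub>M {l..m + 1} (\<lambda>_. N). curvature_quotient m l p \<alpha> (T c) \<le> I2"
        using esssup_AE[of "\<lambda>c. curvature_quotient m l p \<alpha> (T c)" "Pi\<^sub>M {l..m + 1} (\<lambda>_. N)"]
        by (auto elim!: eventually_mono)
      note ae = this
      \<comment> \<open>After the points \<open>b\<close>, the coordinates of \<open>c\<close> join
        from \<open>m + 1\<close> down to \<open>l + 1\<close>; \<open>c l\<close> is left out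
        because it plays the part of the free vertex.\<close>
      define v where "v c i = (if i < l - 1 then b (l - 1 - i) - a else c (m + 1 - (i - (l - 1))) - a)" for c :: "nat \<Rightarrow> 'a" and i
      define R' where "R' k c \<longleftrightarrow> fat_family \<eta> r (v c) (l - 1 + (m + 1 - k))" for k c
      have "\<exists>c. R' l c \<and> (AE y in N. curvature_quotient m l p \<alpha> (T (c(l := y))) \<le> I2)"
      proof (rule AE_PiM_select[OF N lm(1) _ ae, where R=R' and ?c0.0="\<lambda>_. a"])
        fix x y :: "nat \<Rightarrow> 'a" assume xy: "\<And>i. i \<in> {l..m + 1} \<Longrightarrow> x i = y i" and q: "curvature_quotient m l p \<alpha> (T x) \<le> I2"
        have "T x ` {0..m + 1} = T y ` {0..m + 1}" by (rule image_cong) (use xy in \<open>auto simp: T_def\<close>)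
        then show "curvature_quotient m l p \<alpha> (T y) \<le> I2"
          using q by (simp add: curvature_quotient_def discrete_curvature_def del: image_Suc_atLeastAtMost)
      next
        have "fat_family \<eta> r (\<lambda>i. b (l - 1 - i) - a) (l - 1)" using b(1) lm by (simp add: R_def)
        then have "fat_family \<eta> r (v (\<lambda>_. a)) (l - 1)" by (rule fat_family_cong) (simp add: v_def)
        then show "R' (m + 1) (\<lambda>_. a)" by (simp add: R'_def)
      next
        fix k c assume k: "l \<le> k" "k < m + 1" and Rc: "R' (Suc k) c"
        let ?t = "l - 1 + (m + 1 - Suc k)"
        have tm: "?t < m" using k l by auto
        obtain S where S: "S \<in> sets borel" "S \<subseteq> cball a r" "ennreal s \<le> \<mu> S"
          "\<And>x v'. x \<in> S \<Longrightarrow> (\<forall>i<?t. v' i = v c i) \<Longrightarrow> v' ?t = x - a \<Longrightarrow> fat_family \<eta> r v' (Suc ?t)"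
          using sel[OF Rc[unfolded R'_def] tm] by blast
        have SB: "S \<subseteq> B" using S(2) r r01 by (auto simp: B_def)
        have "0 < \<mu> S" using S(3) s by (metis ennreal_less_zero_iff less_le_trans)
        moreover have "R' k (c(Suc k := x))" if x: "x \<in> S" for x
        proof -
          have "fat_family \<eta> r (v (c(Suc k := x))) (Suc ?t)"
            by (rule S(4)[OF x]) (use k in \<open>auto simp: v_def\<close>)
          moreover have "Suc ?t = l - 1 + (m + 1 - k)" using k by simp
          ultimately show ?thesis by (simp only: R'_def)
        qed
        ultimately show "\<exists>S\<in>sets N. 0 < emeasure N S \<and> (\<forall>x\<in>S. R' k (c(Suc k := x)))"
          using NS[OF S(1) SB] by (intro bexI[of _ S]) auto
      qed
      then obtain c where c: "R' l c" "AE y in N. curvature_quotient m l p \<alpha> (T (c(l := y))) \<le> I2" by blast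
      have fat: "fat_family \<eta> r (v c) m"
      proof -
        have "l - 1 + (m + 1 - l) = m" using l lm by auto
        then show ?thesis using c(1) by (simp add: R'_def)
      qed
      define S where "S = {y \<in> cball a r. C * r powr (1 + \<alpha>) < norm (normal_proj (span (v c ` {..<m})) (y - a))}"
      have Sb: "S \<in> sets borel" unfolding S_def by (rule badS)
      have SB: "S \<subseteq> B" using r r01 by (auto simp: S_def B_def)
      have "I2 < curvature_quotient m l p \<alpha> (T (c(l := y)))" if y: "y \<in> S" for y
      proof -
        have Tim: "T (c(l := y)) ` {0..m + 1} = insert a (insert y ((\<lambda>i. a + v c i) ` {..<m}))"
        proof (intro equalityI subsetI)
          fix z assume "z \<in> T (c(l := y)) ` {0..m + 1}"
          then obtain i where i: "i \<le> m + 1" "z = T (c(l := y)) i" by auto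
          consider "i = 0" | "0 < i" "i < l" | "i = l" | "l < i" by linarith
          then show "z \<in> insert a (insert y ((\<lambda>i. a + v c i) ` {..<m}))"
          proof cases
            case 2
            then have "z = a + v c (l - 1 - i)" "l - 1 - i < m"
              using i l lm by (auto simp: T_def v_def)
            then show ?thesis by blast
          next
            case 4
            then have "z = a + v c (l - 1 + (m + 1 - i))" "l - 1 + (m + 1 - i) < m"
              using i l lm by (auto simp: T_def v_def)
            then show ?thesis by blast
          qed (use i l in \<open>auto simp: T_def\<close>)
        next
          fix z assume "z \<in> insert a (insert y ((\<lambda>i. a + v c i) ` {..<m}))"
          then consider "z = a" | "z = y" | i where "i < m" "z = a + v c i" by auto
          then show "z \<in> T (c(l := y)) ` {0..m + 1}"
          proof cases
            case 1
            then have "z = T (c(l := y)) 0" by (simp add: T_def)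
            then show ?thesis by (rule image_eqI) simp
          next
            case 2
            then have "z = T (c(l := y)) l" using l by (simp add: T_def)
            then show ?thesis by (rule image_eqI) (use lm in simp)
          next
            case (3 i)
            show ?thesis
            proof (cases "i < l - 1")
              case True
              then have "z = T (c(l := y)) (l - 1 - i)" using 3 by (auto simp: T_def v_def)
              then show ?thesis by (rule image_eqI) (use lm in simp)
            next
              case False
              then have "l < m + 1 - (i - (l - 1))" using 3 l by auto
              then have "z = T (c(l := y)) (m + 1 - (i - (l - 1)))" using 3 False by (auto simp: T_def v_def)
              then show ?thesis by (rule image_eqI) simp
            qed
          qed
        qed
        have "I2 = ennreal (X (l - 1) / 2 powr E / r ^ (m * (l - 1)))" unfolding I2_def s2 ..
        also have "\<dots> < ennreal (G / 2 powr E / r ^ (m * (l - 1)))"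
        proof (rule ennreal_lessI)
          show "0 < G / 2 powr E / r ^ (m * (l - 1))" using G r by simp
          show "X (l - 1) / 2 powr E / r ^ (m * (l - 1)) < G / 2 powr E / r ^ (m * (l - 1))"
            using G r by (intro divide_strict_right_mono) auto
        qed
        also have "\<dots> \<le> curvature_quotient m l p \<alpha> (T (c(l := y)))"
          by (rule quot[OF fat y[unfolded S_def] Tim])
        finally show ?thesis .
      qed
      then have "AE y in N. y \<notin> S" using c(2) by (auto elim!: eventually_mono simp: not_le[symmetric])
      then have "S \<in> null_sets N" using NS[OF Sb SB] AE_iff_null_sets[of S N] by blast
      then have "emeasure N S = 0" by (rule null_setsD1)
      then have "\<mu> S = 0" using NS[OF Sb SB] by simp
      then show ?thesis using fat unfolding S_def by (intro exI[of _ "v c"]) simp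
    qed
    then obtain v where v: "fat_family \<eta> r v m"
      "\<mu> {y \<in> cball a r. C * r powr (1 + \<alpha>) < norm (normal_proj (span (v ` {..<m})) (y - a))} \<le> ennreal (\<theta> * r ^ m)" by blast
    then show "\<exists>T. subspace T \<and> dim T = m \<and>
         \<mu> {y \<in> cball a r. C * r powr (1 + \<alpha>) < norm (normal_proj T (y - a))} \<le> ennreal (\<theta> * r ^ m)"
      using fat_family_dim[OF v(1) \<eta> r(1)] subspace_span by blast
  qed
qed

section \<open>Tangent planes and rectifiability\<close>

text \<open>Since \<open>4 * \<tau>\<close> exceeds three exceptional masses, outside every tube of
  dimension below \<open>m\<close> there remain points good for both planes. From such points one
  builds a fat family of differences; both normal projections are small on it, so both planes are
  close to its span.\<close>

lemma compare_planes:
  fixes \<mu> :: "'a::euclidean_space set \<Rightarrow> ennreal"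
  assumes rad: "radon_measure \<mu>" and nc: "noncollapsed m \<mu> \<tau> \<eta> r0 a" and \<rho>: "0 < \<rho>" "\<rho> \<le> r0"
    and m: "1 \<le> m" and \<tau>: "0 < \<tau>" and \<eta>: "0 < \<eta>" and \<epsilon>: "0 \<le> \<epsilon>"
    and T: "subspace T1" "dim T1 = m" "subspace T2" "dim T2 = m"
    and bad1: "\<mu> {y \<in> cball a \<rho>. \<epsilon> < norm (normal_proj T1 (y - a1))} \<le> ennreal (\<tau> * \<rho> ^ m)"
    and bad2: "\<mu> {y \<in> cball a \<rho>. \<epsilon> < norm (normal_proj T2 (y - a2))} \<le> ennreal (\<tau> * \<rho> ^ m)"
  obtains c where "c \<in> cball a \<rho>" "norm (normal_proj T1 (c - a1)) \<le> \<epsilon>" "norm (normal_proj T2 (c - a2)) \<le> \<epsilon>"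
    "norm (normal_proj T1 - normal_proj T2) \<le> 8 * (real m * (1 + 2 / \<eta>) ^ m) * (\<epsilon> / \<rho>)"
proof -
  note om = radon_measure_outer[OF rad]
  define G where "G = {y \<in> cball a \<rho>. norm (normal_proj T1 (y - a1)) \<le> \<epsilon> \<and> norm (normal_proj T2 (y - a2)) \<le> \<epsilon>}"
  have sel: "\<exists>y\<in>G. \<forall>w\<in>W. \<eta> * \<rho> \<le> norm (y - q - w)" if W: "subspace W" "dim W < m" for W q
  proof (rule ccontr)
    assume neg: "\<not> ?thesis"
    let ?B1 = "{y \<in> cball a \<rho>. \<epsilon> < norm (normal_proj T1 (y - a1))}"
    let ?B2 = "{y \<in> cball a \<rho>. \<epsilon> < norm (normal_proj T2 (y - a2))}"
    let ?T = "{x \<in> cball a \<rho>. \<exists>w\<in>W. norm (x - q - w) < \<eta> * \<rho>}"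
    have mass: "ennreal (4 * \<tau> * \<rho> ^ m) \<le> \<mu> (cball a \<rho>)" "\<mu> ?T \<le> ennreal (\<tau> * \<rho> ^ m)"
      using nc \<rho> W unfolding noncollapsed_def by blast+
    have "cball a \<rho> \<subseteq> ?B1 \<union> (?B2 \<union> ?T)"
    proof
      fix y assume y: "y \<in> cball a \<rho>"
      show "y \<in> ?B1 \<union> (?B2 \<union> ?T)"
      proof (cases "y \<in> G")
        case True
        then have "\<not> (\<forall>w\<in>W. \<eta> * \<rho> \<le> norm (y - q - w))" using neg by blast
        then show ?thesis using y by (auto simp: not_le)
      next
        case False
        then show ?thesis using y by (auto simp: G_def not_le)
      qed
    qed
    then have "ennreal (4 * \<tau> * \<rho> ^ m) \<le> \<mu> (?B1 \<union> (?B2 \<union> ?T))"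
      using mass(1) outer_measure_mono[OF om] by (meson order_trans)
    also have "\<dots> \<le> \<mu> ?B1 + (\<mu> ?B2 + \<mu> ?T)"
      by (rule order_trans[OF outer_measure_Un[OF om] add_left_mono[OF outer_measure_Un[OF om]]])
    also have "\<dots> \<le> ennreal (\<tau> * \<rho> ^ m) + (ennreal (\<tau> * \<rho> ^ m) + ennreal (\<tau> * \<rho> ^ m))"
      by (intro add_mono bad1 bad2 mass)
    also have "\<dots> = ennreal (3 * \<tau> * \<rho> ^ m)"
      using \<tau> \<rho> by (simp add: ennreal_plus[symmetric] del: ennreal_plus)
    finally have "4 * \<tau> * \<rho> ^ m \<le> 3 * \<tau> * \<rho> ^ m" using \<tau> \<rho> by (simp add: ennreal_le_iff)
    moreover have "0 < \<tau> * \<rho> ^ m" using \<tau> \<rho> by simp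
    ultimately show False by simp
  qed
  obtain c where c: "c \<in> G"
    using sel[of "{0}" a] m by (auto simp: subspace_single_0)
  \<comment> \<open>Differences of two points of the ball are bounded by \<open>2 * \<rho>\<close>,
    so width \<open>\<eta> * \<rho>\<close> is recorded as fatness \<open>\<eta> / 2\<close> at
    scale \<open>2 * \<rho>\<close>.\<close>
  have "\<exists>v. fat_family (\<eta> / 2) (2 * \<rho>) v k \<and> (\<forall>i<k. c + v i \<in> G)" if "k \<le> m" for k
    using that
  proof (induction k)
    case 0
    show ?case by (auto simp: fat_family_def)
  next
    case (Suc k)
    then obtain v where v: "fat_family (\<eta> / 2) (2 * \<rho>) v k" "\<And>i. i < k \<Longrightarrow> c + v i \<in> G" by auto
    have "dim (span (v ` {..<k})) = k" using fat_family_dim[OF v(1)] \<eta> \<rho> by simp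
    then obtain y where y: "y \<in> G" "\<And>w. w \<in> span (v ` {..<k}) \<Longrightarrow> \<eta> * \<rho> \<le> norm (y - c - w)"
      using sel[of "span (v ` {..<k})" c] Suc.prems by auto
    have yc: "norm (y - c) \<le> 2 * \<rho>"
      using y(1) c dist_triangle2[of y c a] by (auto simp: G_def dist_norm norm_minus_commute)
    have "fat_family (\<eta> / 2) (2 * \<rho>) (v(k := y - c)) (Suc k)"
      by (rule fat_family_Suc[OF v(1)]) (use yc y(2) in auto)
    moreover have "\<forall>i<Suc k. c + (v(k := y - c)) i \<in> G" using v(2) y(1) by (auto simp: less_Suc_eq)
    ultimately show ?case by blast
  qed
  then obtain v where v: "fat_family (\<eta> / 2) (2 * \<rho>) v m" "\<And>i. i < m \<Longrightarrow> c + v i \<in> G" by blast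
  define W where "W = span (v ` {..<m})"
  have W: "subspace W" "dim W = m" using fat_family_dim[OF v(1)] \<eta> \<rho> by (auto simp: W_def)
  define \<delta> where "\<delta> = real m * (1 + 2 / \<eta>) ^ m * (\<epsilon> / \<rho>)"
  have \<delta>: "0 \<le> \<delta>" using \<epsilon> \<rho> \<eta> by (simp add: \<delta>_def)
  have close: "norm (normal_proj T - normal_proj W) \<le> 4 * \<delta>"
    if T: "subspace T" "dim T = m" and G: "\<And>y. y \<in> G \<Longrightarrow> norm (normal_proj T (y - z)) \<le> \<epsilon>" for T z
  proof (rule normal_proj_close[OF T(1) W(1) _ \<delta>])
    show "dim T = dim W" using T W by simp
    have nv: "norm (normal_proj T (v i)) \<le> 2 * \<epsilon>" if i: "i < m" for i
    proof -
      have "normal_proj T (v i) = normal_proj T (c + v i - z) - normal_proj T (c - z)"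
        by (simp add: blinfun.diff_right[symmetric])
      then have "norm (normal_proj T (v i)) \<le> norm (normal_proj T (c + v i - z)) + norm (normal_proj T (c - z))"
        by (metis norm_triangle_ineq4)
      then show ?thesis using G[OF v(2)[OF i]] G[OF c] by simp
    qed
    fix x assume "x \<in> W"
    then obtain t where t: "x = (\<Sum>i<m. t i *\<^sub>R v i)" unfolding W_def by (rule span_image_lessThanE)
    have ti: "\<bar>t i\<bar> * (2 * \<epsilon>) \<le> (1 + 2 / \<eta>) ^ m * norm x * (\<epsilon> / \<rho>)" if i: "i < m" for i
    proof -
      have "\<bar>t i\<bar> * (2 * \<rho>) \<le> (1 + 1 / (\<eta> / 2)) ^ m * norm x"
        unfolding t by (rule fat_family_coeff[OF v(1) _ _ i]) (use \<eta> \<rho> in auto)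
      then have "\<bar>t i\<bar> * (2 * \<rho>) * (\<epsilon> / \<rho>) \<le> (1 + 2 / \<eta>) ^ m * norm x * (\<epsilon> / \<rho>)"
        using \<epsilon> \<rho> by (intro mult_right_mono) auto
      then show ?thesis using \<rho> by simp
    qed
    have "norm (normal_proj T x) = norm (\<Sum>i<m. t i *\<^sub>R normal_proj T (v i))"
      by (simp add: t blinfun.sum_right blinfun.scaleR_right)
    also have "\<dots> \<le> (\<Sum>i<m. (1 + 2 / \<eta>) ^ m * norm x * (\<epsilon> / \<rho>))"
    proof (rule sum_norm_le)
      fix i assume "i \<in> {..<m}"
      then have i: "i < m" by simp
      have "norm (t i *\<^sub>R normal_proj T (v i)) \<le> \<bar>t i\<bar> * (2 * \<epsilon>)"
        using nv[OF i] by (simp add: mult_left_mono)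
      then show "norm (t i *\<^sub>R normal_proj T (v i)) \<le> (1 + 2 / \<eta>) ^ m * norm x * (\<epsilon> / \<rho>)"
        using ti[OF i] by linarith
    qed
    also have "\<dots> = \<delta> * norm x" by (simp add: \<delta>_def)
    finally show "norm (normal_proj T x) \<le> \<delta> * norm x" .
  qed
  have "norm (normal_proj T1 - normal_proj W) \<le> 4 * \<delta>"
    by (rule close[OF T(1,2), of a1]) (simp add: G_def)
  moreover have "norm (normal_proj T2 - normal_proj W) \<le> 4 * \<delta>"
    by (rule close[OF T(3,4), of a2]) (simp add: G_def)
  ultimately have "norm (normal_proj T1 - normal_proj T2) \<le> 8 * \<delta>"
    using norm_triangle_ineq4[of "normal_proj T1 - normal_proj W" "normal_proj T2 - normal_proj W"] by simp
  then show thesis using that[of c] c by (simp add: G_def \<delta>_def mult.assoc)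
qed

lemma geometric_increments_limit:
  fixes x :: "nat \<Rightarrow> 'a::banach"
  assumes q: "0 < q" "q < 1" and x: "\<And>k. norm (x k - x (Suc k)) \<le> A * q ^ k"
  obtains L where "\<And>k. norm (x k - L) \<le> A * q ^ k / (1 - q)"
proof -
  define d where "d k = x (Suc k) - x k" for k
  have dn: "norm (d k) \<le> A * q ^ k" for k using x[of k] by (simp add: d_def norm_minus_commute)
  have sg: "summable (\<lambda>k. A * q ^ k)" using q by (intro summable_mult summable_geometric) simp
  have sd: "summable d" by (rule summable_comparison_test'[OF sg dn])
  define L where "L = x 0 + suminf d"
  have tele: "x k = x 0 + (\<Sum>i<k. d i)" for k
    by (induction k) (simp_all add: d_def)
  show thesis
  proof (rule that[of L])
    fix k
    have "suminf d = (\<Sum>n. d (n + k)) + (\<Sum>i<k. d i)" by (rule suminf_split_initial_segment[OF sd])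
    then have "L - x k = (\<Sum>n. d (n + k))" by (simp add: L_def tele[of k])
    then have "norm (x k - L) = norm (\<Sum>n. d (n + k))" by (metis norm_minus_commute)
    also have "\<dots> \<le> (\<Sum>n. A * q ^ k * q ^ n)"
    proof (rule norm_suminf_le)
      show "norm (d (n + k)) \<le> A * q ^ k * q ^ n" for n using dn[of "n + k"] by (simp add: power_add mult_ac)
      show "summable (\<lambda>n. A * q ^ k * q ^ n)" using q by (intro summable_mult summable_geometric) simp
    qed
    also have "\<dots> = A * q ^ k / (1 - q)" using q by (simp add: suminf_mult suminf_geometric summable_geometric)
    finally show "norm (x k - L) \<le> A * q ^ k / (1 - q)" .
  qed
qed

text \<open>Planes at dyadic scales about \<open>a\<close> converge at rate
  \<open>r k powr \<alpha>\<close>, and \<open>Q a\<close> is the limit of their normal projections.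
  Two base points are compared at the dyadic scale of their distance; writing
  \<open>b - a = (c - a) - (c - b)\<close> with a common good point \<open>c\<close> shows that
  \<open>b\<close> is close to the plane at \<open>a\<close>.\<close>

lemma tangent_jets:
  fixes \<mu> :: "'a::euclidean_space set \<Rightarrow> ennreal" and m l :: nat and \<alpha> p \<tau> \<eta> \<Lambda> r0 :: real
  assumes rad: "radon_measure \<mu>" and m: "1 \<le> m" and l: "l \<in> {1..m + 2}" and \<alpha>: "0 < \<alpha>" "\<alpha> \<le> 1" and p: "1 \<le> p"
    and \<tau>: "0 < \<tau>" and \<eta>: "0 < \<eta>" and \<Lambda>: "0 < \<Lambda>" and r0: "0 < r0" "r0 \<le> 1"
  defines "G \<equiv> {a. noncollapsed m \<mu> \<tau> \<eta> r0 a \<and> curvature_integral m l p \<alpha> \<mu> a 1 \<le> ennreal \<Lambda>}"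
  obtains Q :: "'a \<Rightarrow> 'a \<Rightarrow>\<^sub>L 'a" and D where "0 \<le> D"
    "\<And>a b. a \<in> G \<Longrightarrow> b \<in> G \<Longrightarrow> dist a b \<le> r0 / 2 \<Longrightarrow> norm (Q a - Q b) \<le> D * dist a b powr \<alpha>"
    "\<And>a b. a \<in> G \<Longrightarrow> b \<in> G \<Longrightarrow> dist a b \<le> r0 / 2 \<Longrightarrow> norm (Q a (b - a)) \<le> D * dist a b powr (1 + \<alpha>)"
    "\<And>a e. a \<in> G \<Longrightarrow> 0 < e \<Longrightarrow> \<exists>T. subspace T \<and> dim T = m \<and> norm (Q a - normal_proj T) < e"
proof -
  note om = radon_measure_outer[OF rad]
  \<comment> \<open>Halving a radius divides its \<open>m\<close>-th power by \<open>2 ^ m\<close>;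
    with this \<open>\<theta>\<close> the exceptional set at radius \<open>r k\<close> is still
    within the budget of the ball of radius \<open>r (Suc k)\<close>.\<close>
  define \<theta> where "\<theta> = \<tau> / 2 ^ m"
  have \<theta>: "0 < \<theta>" using \<tau> by (simp add: \<theta>_def)
  obtain C where C: "0 < C" and plane0: "\<And>(\<mu> :: 'a set \<Rightarrow> ennreal) a r0 r. radon_measure \<mu> \<Longrightarrow> noncollapsed m \<mu> \<tau> \<eta> r0 a \<Longrightarrow> r0 \<le> 1 \<Longrightarrow>
       curvature_integral m l p \<alpha> \<mu> a 1 \<le> ennreal \<Lambda> \<Longrightarrow> 0 < r \<Longrightarrow> r \<le> r0 \<Longrightarrow>
       \<exists>T. subspace T \<and> dim T = m \<and>
         \<mu> {y \<in> cball a r. C * r powr (1 + \<alpha>) < norm (normal_proj T (y - a))} \<le> ennreal (\<theta> * r ^ m)"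
    by (rule approximating_plane[OF m l \<alpha>(1) p \<tau> \<eta> \<Lambda> \<theta>, where 'a='a]) blast
  define r where "r k = r0 / 2 ^ k" for k :: nat
  have r: "0 < r k" "r k \<le> r0" "r (Suc k) = r k / 2" for k
    using r0 by (auto simp: r_def divide_le_eq)
  define PT where "PT a k T \<longleftrightarrow> subspace T \<and> dim T = m \<and>
         \<mu> {y \<in> cball a (r k). C * r k powr (1 + \<alpha>) < norm (normal_proj T (y - a))} \<le> ennreal (\<theta> * r k ^ m)" for a k T
  have exT: "\<exists>T. PT a k T" if "a \<in> G" for a k
    unfolding PT_def by (rule plane0[OF rad _ r0(2) _ r(1,2)]) (use that in \<open>simp_all add: G_def\<close>)
  define T where "T a k = (SOME T. PT a k T)" for a k
  have "PT a k (T a k)" if "a \<in> G" for a k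
    unfolding T_def by (rule someI_ex[OF exT[OF that]])
  then have T: "\<And>a k. a \<in> G \<Longrightarrow> subspace (T a k)" "\<And>a k. a \<in> G \<Longrightarrow> dim (T a k) = m"
    "\<And>a k. a \<in> G \<Longrightarrow> \<mu> {y \<in> cball a (r k). C * r k powr (1 + \<alpha>) < norm (normal_proj (T a k) (y - a))} \<le> ennreal (\<theta> * r k ^ m)"
    unfolding PT_def by blast+
  define Qk where "Qk a k = normal_proj (T a k)" for a k
  define D0 where "D0 = 8 * (real m * (1 + 2 / \<eta>) ^ m)"
  have D0: "0 \<le> D0" using \<eta> by (simp add: D0_def)
  define D1 where "D1 = 2 * D0 * C"
  have D1: "0 \<le> D1" using D0 C by (simp add: D1_def)
  have \<theta>r: "\<theta> * r k ^ m = \<tau> * r (Suc k) ^ m" for k by (simp add: \<theta>_def r power_divide)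
  have pw: "D0 * (C * r k powr (1 + \<alpha>) / r (Suc k)) = D1 * r k powr \<alpha>" for k
    using r(1)[of k] by (simp add: D1_def r(3) powr_add abs_of_pos)
  \<comment> \<open>One estimate for two uses: equal base points at consecutive scales, and
    different base points at the same scale.\<close>
  have cmp: "\<exists>c\<in>cball a (r (Suc k)). norm (Qk a k (c - a)) \<le> C * r k powr (1 + \<alpha>) \<and> norm (Qk b k' (c - b)) \<le> C * r k powr (1 + \<alpha>)
      \<and> norm (Qk a k - Qk b k') \<le> D1 * r k powr \<alpha>"
    if a: "a \<in> G" and b: "b \<in> G" and k': "k \<le> k'" and sub: "cball a (r (Suc k)) \<subseteq> cball b (r k')" for a b k k'
  proof -
    define \<epsilon> where "\<epsilon> = C * r k powr (1 + \<alpha>)"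
    have rk: "r k' \<le> r k" using k' r0 by (auto simp: r_def intro!: divide_left_mono power_increasing)
    have \<epsilon>': "C * r k' powr (1 + \<alpha>) \<le> \<epsilon>"
      unfolding \<epsilon>_def using C \<alpha> rk r(1)[of k'] by (intro mult_left_mono powr_mono2) auto
    have b1: "\<mu> {y \<in> cball a (r (Suc k)). \<epsilon> < norm (normal_proj (T a k) (y - a))} \<le> ennreal (\<tau> * r (Suc k) ^ m)"
    proof -
      have "cball a (r (Suc k)) \<subseteq> cball a (r k)"
        using r(1)[of k] by (intro subset_cball) (simp add: r(3))
      then have "\<mu> {y \<in> cball a (r (Suc k)). \<epsilon> < norm (normal_proj (T a k) (y - a))} \<le> \<mu> {y \<in> cball a (r k). C * r k powr (1 + \<alpha>) < norm (normal_proj (T a k) (y - a))}"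
        unfolding \<epsilon>_def by (intro outer_measure_mono[OF om]) blast
      also have "\<dots> \<le> ennreal (\<tau> * r (Suc k) ^ m)" using T(3)[OF a, of k] unfolding \<theta>r .
      finally show ?thesis .
    qed
    have b2: "\<mu> {y \<in> cball a (r (Suc k)). \<epsilon> < norm (normal_proj (T b k') (y - b))} \<le> ennreal (\<tau> * r (Suc k) ^ m)"
    proof -
      have "{y \<in> cball a (r (Suc k)). \<epsilon> < norm (normal_proj (T b k') (y - b))}
          \<subseteq> {y \<in> cball b (r k'). C * r k' powr (1 + \<alpha>) < norm (normal_proj (T b k') (y - b))}"
        using sub \<epsilon>' by (auto simp del: mem_cball)
      then have "\<mu> {y \<in> cball a (r (Suc k)). \<epsilon> < norm (normal_proj (T b k') (y - b))} \<le> \<mu> {y \<in> cball b (r k'). C * r k' powr (1 + \<alpha>) < norm (normal_proj (T b k') (y - b))}"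
        by (rule outer_measure_mono[OF om])
      also have "\<dots> \<le> ennreal (\<theta> * r k' ^ m)" by (rule T(3)[OF b])
      also have "\<dots> \<le> ennreal (\<theta> * r k ^ m)" using \<theta> rk r(1)[of k'] by (intro ennreal_leI mult_left_mono power_mono) auto
      finally show ?thesis unfolding \<theta>r .
    qed
    have nca: "noncollapsed m \<mu> \<tau> \<eta> r0 a" using a by (simp add: G_def)
    have \<epsilon>0: "0 \<le> \<epsilon>" using C by (simp add: \<epsilon>_def)
    obtain c where "c \<in> cball a (r (Suc k))" "norm (normal_proj (T a k) (c - a)) \<le> \<epsilon>" "norm (normal_proj (T b k') (c - b)) \<le> \<epsilon>"
      "norm (normal_proj (T a k) - normal_proj (T b k')) \<le> 8 * (real m * (1 + 2 / \<eta>) ^ m) * (\<epsilon> / r (Suc k))"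
      by (rule compare_planes[OF rad nca r(1,2) m \<tau> \<eta> \<epsilon>0 T(1,2)[OF a] T(1,2)[OF b] b1 b2]) blast
    then show ?thesis
      unfolding pw[symmetric] Qk_def \<epsilon>_def D0_def by blast
  qed
  define q where "q = (1 / 2) powr \<alpha>"
  have q: "0 < q" "q < 1"
    using \<alpha> powr_less_mono2[of \<alpha> "1/2" 1] by (auto simp: q_def)
  have rq: "r k powr \<alpha> = r0 powr \<alpha> * q ^ k" for k
  proof -
    have "r k = r0 * (1 / 2) ^ k" by (simp add: r_def power_divide)
    then have "r k powr \<alpha> = r0 powr \<alpha> * ((1 / 2) ^ k) powr \<alpha>" using r0 by (simp add: powr_mult)
    also have "((1 / 2 :: real) ^ k) powr \<alpha> = q ^ k"
      by (simp add: q_def powr_realpow[symmetric] powr_powr mult.commute del: powr_realpow)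
    finally show ?thesis .
  qed
  define D3 where "D3 = D1 / (1 - q)"
  have D3: "0 \<le> D3" using D1 q by (simp add: D3_def)
  have "\<exists>L. \<forall>k. norm (Qk a k - L) \<le> D3 * r k powr \<alpha>" if a: "a \<in> G" for a
  proof -
    have "norm (Qk a k - Qk a (Suc k)) \<le> (D1 * r0 powr \<alpha>) * q ^ k" for k
      using cmp[OF a a, of k "Suc k"] by (auto simp: rq mult.assoc)
    from geometric_increments_limit[OF q this]
    obtain L where L: "\<And>k. norm (Qk a k - L) \<le> (D1 * r0 powr \<alpha>) * q ^ k / (1 - q)" by blast
    have "(D1 * r0 powr \<alpha>) * q ^ k / (1 - q) = D3 * r k powr \<alpha>" for k by (simp add: rq D3_def)
    then show ?thesis using L by (intro exI[of _ L]) simp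
  qed
  then have "\<exists>Q. \<forall>a\<in>G. \<forall>k. norm (Qk a k - Q a) \<le> D3 * r k powr \<alpha>"
    by (intro bchoice ballI) auto
  then obtain Q where Q: "\<And>a k. a \<in> G \<Longrightarrow> norm (Qk a k - Q a) \<le> D3 * r k powr \<alpha>" by blast
  \<comment> \<open>The largest available dyadic radius comparable to the distance is found by a
    least index; the factor \<open>4\<close> turns into \<open>4 powr 2 = 16\<close> below, as all
    exponents are at most \<open>2\<close>.\<close>
  have scale: "\<exists>k. dist a b \<le> r k / 2 \<and> r k \<le> 4 * dist a b" if ab: "a \<noteq> b" "dist a b \<le> r0 / 2" for a b :: 'a
  proof -
    have "\<exists>n. r n / 2 < dist a b"
    proof -
      obtain n where "r0 / (2 * dist a b) < 2 ^ n" using real_arch_pow[of 2 "r0 / (2 * dist a b)"] by auto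
      then have "r n / 2 < dist a b" using ab by (simp add: r_def field_simps)
      then show ?thesis ..
    qed
    define n where "n = (LEAST n. r n / 2 < dist a b)"
    have n: "r n / 2 < dist a b" unfolding n_def using \<open>\<exists>n. r n / 2 < dist a b\<close> by (rule LeastI_ex)
    have "n \<noteq> 0"
    proof
      assume "n = 0"
      then have "r n = r0" by (simp add: r_def)
      then show False using n ab(2) by simp
    qed
    then obtain k where k: "n = Suc k" by (cases n) auto
    have "\<not> r k / 2 < dist a b" using not_less_Least[of k "\<lambda>n. r n / 2 < dist a b"] k by (simp add: n_def)
    then show ?thesis using n k r(3)[of k] by (intro exI[of _ k]) auto
  qed
  define D2 where "D2 = 2 * C + D1"
  define D where "D = 16 * (2 * D3 + D1 + D2 + D3)"
  have Dpos: "0 \<le> D2" "0 \<le> D" using C D1 D3 by (auto simp: D_def D2_def)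
  have main: "norm (Q a - Q b) \<le> D * dist a b powr \<alpha> \<and> norm (Q a (b - a)) \<le> D * dist a b powr (1 + \<alpha>)"
    if a: "a \<in> G" and b: "b \<in> G" and ab: "dist a b \<le> r0 / 2" for a b
  proof (cases "a = b")
    case False
    obtain k where k: "dist a b \<le> r k / 2" "r k \<le> 4 * dist a b" using scale[OF False ab] by blast
    have sub: "cball a (r (Suc k)) \<subseteq> cball b (r k)"
    proof
      fix y assume "y \<in> cball a (r (Suc k))"
      then show "y \<in> cball b (r k)"
        using k(1) dist_triangle[of b y a] by (simp add: r dist_commute)
    qed
    obtain c where c: "c \<in> cball a (r (Suc k))" "norm (Qk a k (c - a)) \<le> C * r k powr (1 + \<alpha>)"
      "norm (Qk b k (c - b)) \<le> C * r k powr (1 + \<alpha>)" "norm (Qk a k - Qk b k) \<le> D1 * r k powr \<alpha>"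
      using cmp[OF a b order_refl sub] by blast
    have ra: "r k powr \<alpha> \<le> 16 * dist a b powr \<alpha>" "r k powr (1 + \<alpha>) \<le> 16 * dist a b powr (1 + \<alpha>)"
    proof -
      have 4: "(4::real) powr \<alpha> \<le> 4 powr 2" "(4::real) powr (1 + \<alpha>) \<le> 4 powr 2"
        using \<alpha> by (intro powr_mono; simp)+
      have "r k powr \<alpha> \<le> (4 * dist a b) powr \<alpha>" "r k powr (1 + \<alpha>) \<le> (4 * dist a b) powr (1 + \<alpha>)"
        using k(2) r(1)[of k] \<alpha> by (auto intro!: powr_mono2)
      moreover have "(4 * dist a b) powr \<alpha> \<le> 16 * dist a b powr \<alpha>" "(4 * dist a b) powr (1 + \<alpha>) \<le> 16 * dist a b powr (1 + \<alpha>)"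
        using 4 by (simp_all add: powr_mult mult_right_mono)
      ultimately show "r k powr \<alpha> \<le> 16 * dist a b powr \<alpha>" "r k powr (1 + \<alpha>) \<le> 16 * dist a b powr (1 + \<alpha>)" by linarith+
    qed
    have rr: "r k powr \<alpha> * r k = r k powr (1 + \<alpha>)" using r(1)[of k] by (simp add: powr_add mult.commute)
    have eq: "Q a - Q b = (Qk a k - Qk b k) - (Qk a k - Q a) + (Qk b k - Q b)" by simp
    have "norm (Q a - Q b) \<le> norm (Qk a k - Qk b k) + norm (Qk a k - Q a) + norm (Qk b k - Q b)"
      unfolding eq
      using norm_triangle_ineq[of "(Qk a k - Qk b k) - (Qk a k - Q a)" "Qk b k - Q b"]
        norm_triangle_ineq4[of "Qk a k - Qk b k" "Qk a k - Q a"] by linarith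
    also have "\<dots> \<le> D1 * r k powr \<alpha> + D3 * r k powr \<alpha> + D3 * r k powr \<alpha>"
      using Q[OF a, of k] Q[OF b, of k] c(4) by (intro add_mono)
    also have "\<dots> = (2 * D3 + D1) * r k powr \<alpha>" by (simp add: algebra_simps)
    also have "\<dots> \<le> (2 * D3 + D1 + D2 + D3) * (16 * dist a b powr \<alpha>)"
      using ra D3 D1 Dpos by (intro mult_mono) auto
    also have "\<dots> = D * dist a b powr \<alpha>" by (simp add: D_def algebra_simps)
    finally have first: "norm (Q a - Q b) \<le> D * dist a b powr \<alpha>" .
    have cb: "norm (c - b) \<le> r k"
      using c(1) sub by (auto simp: dist_norm norm_minus_commute)
    have eq: "Qk a k (b - a) = Qk a k (c - a) - Qk b k (c - b) - (Qk a k - Qk b k) (c - b)"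
      by (simp add: minus_blinfun.rep_eq blinfun.diff_right)
    have "norm (Qk a k (b - a)) \<le> norm (Qk a k (c - a)) + norm (Qk b k (c - b)) + norm (Qk a k - Qk b k) * norm (c - b)"
      unfolding eq
      using norm_triangle_ineq4[of "Qk a k (c - a) - Qk b k (c - b)" "(Qk a k - Qk b k) (c - b)"]
        norm_triangle_ineq4[of "Qk a k (c - a)" "Qk b k (c - b)"] norm_blinfun[of "Qk a k - Qk b k" "c - b"] by linarith
    also have "\<dots> \<le> C * r k powr (1 + \<alpha>) + C * r k powr (1 + \<alpha>) + (D1 * r k powr \<alpha>) * r k"
      using c cb D1 by (intro add_mono mult_mono) auto
    also have "\<dots> = D2 * r k powr (1 + \<alpha>)" by (simp add: D2_def rr[symmetric] algebra_simps)
    finally have second: "norm (Qk a k (b - a)) \<le> D2 * r k powr (1 + \<alpha>)" .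
    have eq: "Q a (b - a) = Qk a k (b - a) - (Qk a k - Q a) (b - a)" by (simp add: minus_blinfun.rep_eq)
    have "norm (Q a (b - a)) \<le> norm (Qk a k (b - a)) + norm (Qk a k - Q a) * norm (b - a)"
      unfolding eq
      using norm_triangle_ineq4[of "Qk a k (b - a)" "(Qk a k - Q a) (b - a)"] norm_blinfun[of "Qk a k - Q a" "b - a"] by linarith
    also have "\<dots> \<le> D2 * r k powr (1 + \<alpha>) + (D3 * r k powr \<alpha>) * r k"
      using second Q[OF a, of k] k(1) r(1)[of k] D3 by (intro add_mono mult_mono) (auto simp: dist_norm norm_minus_commute)
    also have "\<dots> = (D2 + D3) * r k powr (1 + \<alpha>)" by (simp add: rr[symmetric] algebra_simps)
    also have "\<dots> \<le> (2 * D3 + D1 + D2 + D3) * (16 * dist a b powr (1 + \<alpha>))"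
      using ra D3 D1 Dpos by (intro mult_mono) auto
    also have "\<dots> = D * dist a b powr (1 + \<alpha>)" by (simp add: D_def algebra_simps)
    finally show ?thesis using first by blast
  qed simp
  show thesis
  proof (rule that[of D Q])
    show "0 \<le> D" by (rule Dpos)
    show "norm (Q a - Q b) \<le> D * dist a b powr \<alpha>" if "a \<in> G" "b \<in> G" "dist a b \<le> r0 / 2" for a b
      using main[OF that] ..
    show "norm (Q a (b - a)) \<le> D * dist a b powr (1 + \<alpha>)" if "a \<in> G" "b \<in> G" "dist a b \<le> r0 / 2" for a b
      using main[OF that] ..
    fix a and e :: real assume a: "a \<in> G" and e: "0 < e"
    have "(\<lambda>k. D3 * (r0 powr \<alpha> * q ^ k)) \<longlonglongrightarrow> D3 * (r0 powr \<alpha> * 0)"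
      using q by (intro tendsto_intros LIMSEQ_power_zero) auto
    then have "\<forall>\<^sub>F k in sequentially. D3 * (r0 powr \<alpha> * q ^ k) < e" using e by (intro order_tendstoD) auto
    then obtain k where "D3 * r k powr \<alpha> < e" by (auto simp: eventually_sequentially rq)
    then have "norm (Q a - normal_proj (T a k)) < e"
      using Q[OF a, of k] by (simp add: Qk_def norm_minus_commute)
    then show "\<exists>T. subspace T \<and> dim T = m \<and> norm (Q a - normal_proj T) < e" using T(1,2)[OF a] by blast
  qed
qed

text \<open>The extension \<open>F\<close> of the zero function with derivative \<open>Q\<close> is
  not itself a chart, as its derivative is near a projection. Composed with
  \<open>normal_proj T\<close> and completed by the tangential part it becomes
  \<open>\<sigma>\<close>, whose derivative is near the identity, and
  \<open>\<sigma> x \<in> T\<close> holds exactly where \<open>normal_proj T (F x) = 0\<close>, in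
  particular on \<open>G\<close> near \<open>a0\<close>.\<close>

lemma locally_submanifold:
  fixes G :: "'a::euclidean_space set" and Q :: "'a \<Rightarrow> 'a \<Rightarrow>\<^sub>L 'a"
  assumes \<alpha>: "0 < \<alpha>" "\<alpha> \<le> 1" and s: "0 < s" and D: "0 \<le> D"
    and Q1: "\<And>a b. a \<in> G \<Longrightarrow> b \<in> G \<Longrightarrow> dist a b \<le> s \<Longrightarrow> norm (Q a - Q b) \<le> D * dist a b powr \<alpha>"
    and Q2: "\<And>a b. a \<in> G \<Longrightarrow> b \<in> G \<Longrightarrow> dist a b \<le> s \<Longrightarrow> norm (Q a (b - a)) \<le> D * dist a b powr (1 + \<alpha>)"
    and Q3: "\<And>a e. a \<in> G \<Longrightarrow> 0 < e \<Longrightarrow> \<exists>T. subspace T \<and> dim T = m \<and> norm (Q a - normal_proj T) < e"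
    and a0: "a0 \<in> G"
  shows "\<exists>U S. open U \<and> a0 \<in> U \<and> C1_hoelder_submanifold m \<alpha> S \<and> G \<inter> U \<subseteq> S"
proof -
  define A where "A = G \<inter> cball a0 (s / 2)"
  have a0A: "a0 \<in> A" using a0 s by (simp add: A_def)
  have AG: "a \<in> G" "b \<in> G" "dist a b \<le> s" if "a \<in> A" "b \<in> A" for a b
    using that dist_triangle3[of a b a0] by (auto simp: A_def)
  \<comment> \<open>Whitney data must live on a closed set; \<open>Q\<close> extends uniformly
    continuously to the closure, and both estimates persist there by continuity.\<close>
  have "uniformly_continuous_on A Q"
    by (rule hoelder_imp_uniformly_continuous_on[OF D \<alpha>(1)]) (use Q1 AG in \<open>auto simp: dist_norm\<close>)
  then obtain g where g: "uniformly_continuous_on (closure A) g" "\<And>x. x \<in> A \<Longrightarrow> Q x = g x"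
    by (rule uniformly_continuous_on_extension_on_closure) blast
  have gc: "continuous_on (closure A) g" using g(1) by (rule uniformly_continuous_imp_continuous)
  have gfst: "continuous_on (closure (A \<times> A)) (\<lambda>z. g (fst z))" "continuous_on (closure (A \<times> A)) (\<lambda>z. g (snd z))"
    unfolding closure_Times by (auto intro!: continuous_on_compose2[OF gc] continuous_intros)
  have ext: "norm (g a - g b) - D * dist a b powr \<alpha> \<le> 0 \<and> norm (g a (b - a)) - D * dist a b powr (1 + \<alpha>) \<le> 0"
    if ab: "a \<in> closure A" "b \<in> closure A" for a b
  proof -
    have c: "(a, b) \<in> closure (A \<times> A)" using ab by (simp add: closure_Times)
    have "norm (g (fst (a, b)) - g (snd (a, b))) - D * dist (fst (a, b)) (snd (a, b)) powr \<alpha> \<le> 0"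
    proof (rule continuous_le_on_closure[OF _ c, where f="\<lambda>z. norm (g (fst z) - g (snd z)) - D * dist (fst z) (snd z) powr \<alpha>"])
      show "continuous_on (closure (A \<times> A)) (\<lambda>z. norm (g (fst z) - g (snd z)) - D * dist (fst z) (snd z) powr \<alpha>)"
        using \<alpha> by (intro continuous_intros gfst continuous_on_powr') auto
      show "norm (g (fst z) - g (snd z)) - D * dist (fst z) (snd z) powr \<alpha> \<le> 0" if "z \<in> A \<times> A" for z
        using that Q1[of "fst z" "snd z"] AG[of "fst z" "snd z"] g(2) by auto
    qed
    moreover have "norm (g (fst (a, b)) (snd (a, b) - fst (a, b))) - D * dist (fst (a, b)) (snd (a, b)) powr (1 + \<alpha>) \<le> 0"
    proof (rule continuous_le_on_closure[OF _ c, where f="\<lambda>z. norm (g (fst z) (snd z - fst z)) - D * dist (fst z) (snd z) powr (1 + \<alpha>)"])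
      show "continuous_on (closure (A \<times> A)) (\<lambda>z. norm (g (fst z) (snd z - fst z)) - D * dist (fst z) (snd z) powr (1 + \<alpha>))"
        using \<alpha> by (intro continuous_intros gfst continuous_on_powr' bounded_bilinear.continuous_on[OF bounded_bilinear_blinfun_apply]) auto
      show "norm (g (fst z) (snd z - fst z)) - D * dist (fst z) (snd z) powr (1 + \<alpha>) \<le> 0" if "z \<in> A \<times> A" for z
        using that Q2[of "fst z" "snd z"] AG[of "fst z" "snd z"] g(2)[of "fst z"] by auto
    qed
    ultimately show ?thesis by simp
  qed
  have ne: "closure A \<noteq> {}" using a0A closure_subset by blast
  obtain F :: "'a \<Rightarrow> 'a" and F' C' where F: "0 \<le> C'"
    "\<And>x. infdist x (closure A) < 1 \<Longrightarrow> (F has_derivative blinfun_apply (F' x)) (at x)"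
    "\<And>a. a \<in> closure A \<Longrightarrow> F a = 0" "\<And>a. a \<in> closure A \<Longrightarrow> F' a = g a"
    "\<And>x y. infdist x (closure A) < 1 \<Longrightarrow> infdist y (closure A) < 1 \<Longrightarrow> norm (F' x - F' y) \<le> C' * dist x y powr \<alpha>"
  proof (rule whitney_extension[OF closed_closure ne D \<alpha>, where f="\<lambda>_. 0" and A=g])
    show "norm (0 - 0 - g a (b - a)) \<le> D * dist a b powr (1 + \<alpha>)" if "a \<in> closure A" "b \<in> closure A" for a b
      using ext[OF that] by simp
    show "norm (g a - g b) \<le> D * dist a b powr \<alpha>" if "a \<in> closure A" "b \<in> closure A" for a b
      using ext[OF that] by simp
  qed blast
  obtain T where T: "subspace T" "dim T = m" "norm (Q a0 - normal_proj T) < 1/2"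
    using Q3[OF a0, of "1/2"] by auto
  have nQ: "norm (normal_proj T o\<^sub>L L) \<le> norm L" for L :: "'a \<Rightarrow>\<^sub>L 'a"
    by (rule norm_blinfun_bound) (auto intro: order_trans[OF norm_normal_proj_le(1)[OF T(1)] norm_blinfun])
  define W where "W = {x. infdist x (closure A) < 1}"
  have W: "open W" unfolding W_def by (intro open_Collect_less continuous_intros)
  have a0c: "a0 \<in> closure A" using a0A closure_subset by blast
  then have a0W: "a0 \<in> W" by (simp add: W_def)
  define \<sigma> where "\<sigma> x = x - normal_proj T x + normal_proj T (F x)" for x
  define \<sigma>' where "\<sigma>' x = id_blinfun - normal_proj T + (normal_proj T o\<^sub>L F' x)" for x
  have der: "(\<sigma> has_derivative blinfun_apply (\<sigma>' x)) (at x)" if "x \<in> W" for x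
  proof -
    have "((\<lambda>x. x - normal_proj T x + normal_proj T (F x)) has_derivative (\<lambda>h. h - normal_proj T h + normal_proj T (F' x h))) (at x)"
      using F(2)[of x] that by (auto simp: W_def intro!: derivative_eq_intros)
    moreover have "blinfun_apply (\<sigma>' x) = (\<lambda>h. h - normal_proj T h + normal_proj T (F' x h))"
      by (simp add: \<sigma>'_def fun_eq_iff plus_blinfun.rep_eq minus_blinfun.rep_eq)
    ultimately show ?thesis unfolding \<sigma>_def[abs_def] by simp
  qed
  have hoel: "norm (\<sigma>' x - \<sigma>' y) \<le> C' * dist x y powr \<alpha>" if "x \<in> W" "y \<in> W" for x y
  proof -
    have "\<sigma>' x - \<sigma>' y = normal_proj T o\<^sub>L (F' x - F' y)"
      by (rule blinfun_eqI) (simp add: \<sigma>'_def plus_blinfun.rep_eq minus_blinfun.rep_eq blinfun.diff_right)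
    then have "norm (\<sigma>' x - \<sigma>' y) \<le> norm (F' x - F' y)" using nQ by metis
    also have "\<dots> \<le> C' * dist x y powr \<alpha>" using F(5) that by (simp add: W_def)
    finally show ?thesis .
  qed
  \<comment> \<open>Idempotence makes \<open>\<sigma>'\<close> the identity wherever
    \<open>F'\<close> equals \<open>normal_proj T\<close>; the deviation at \<open>a0\<close> is at
    most the distance of \<open>Q a0\<close> from that projection.\<close>
  have near: "norm (\<sigma>' a0 - id_blinfun) \<le> 1 / 2"
  proof -
    have "\<sigma>' a0 - id_blinfun = normal_proj T o\<^sub>L (Q a0 - normal_proj T)"
      by (rule blinfun_eqI) (simp add: \<sigma>'_def F(4)[OF a0c] g(2)[OF a0A, symmetric] plus_blinfun.rep_eq minus_blinfun.rep_eq
          blinfun.diff_right normal_proj_idem[OF T(1)])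
    then have "norm (\<sigma>' a0 - id_blinfun) \<le> norm (Q a0 - normal_proj T)" using nQ by metis
    then show ?thesis using T(3) by simp
  qed
  obtain U where U: "open U" "a0 \<in> U" "C1_hoelder_submanifold m \<alpha> {x\<in>U. \<sigma> x \<in> T}"
    by (rule submanifold_vimage[OF W a0W F(1) \<alpha>(1) der hoel near T(1,2)]) blast
  have "G \<inter> (U \<inter> ball a0 (s / 2)) \<subseteq> {x\<in>U. \<sigma> x \<in> T}"
  proof
    fix x assume x: "x \<in> G \<inter> (U \<inter> ball a0 (s / 2))"
    then have "x \<in> closure A" using closure_subset[of A] by (auto simp: A_def)
    then have "\<sigma> x = x - normal_proj T x" by (simp add: \<sigma>_def F(3))
    then show "x \<in> {x\<in>U. \<sigma> x \<in> T}" using x normal_proj(1)[OF T(1)] by simp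
  qed
  then show ?thesis using U s by (intro exI[of _ "U \<inter> ball a0 (s / 2)"] exI[of _ "{x\<in>U. \<sigma> x \<in> T}"]) auto
qed

lemma countably_many_submanifolds:
  fixes G :: "'a::euclidean_space set"
  assumes loc: "\<And>a. a \<in> G \<Longrightarrow> \<exists>U S. open U \<and> a \<in> U \<and> C1_hoelder_submanifold m \<alpha> S \<and> G \<inter> U \<subseteq> S"
  shows "\<exists>\<A>. countable \<A> \<and> (\<forall>S\<in>\<A>. C1_hoelder_submanifold m \<alpha> S) \<and> G \<subseteq> \<Union>\<A>"
proof -
  define \<U> where "\<U> = {U. open U \<and> (\<exists>S. C1_hoelder_submanifold m \<alpha> S \<and> G \<inter> U \<subseteq> S)}"
  obtain \<U>' where U': "\<U>' \<subseteq> \<U>" "countable \<U>'" "\<Union>\<U>' = \<Union>\<U>"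
    by (rule Lindelof[of \<U>]) (auto simp: \<U>_def)
  define S where "S U = (SOME S. C1_hoelder_submanifold m \<alpha> S \<and> G \<inter> U \<subseteq> S)" for U
  have S: "C1_hoelder_submanifold m \<alpha> (S U) \<and> G \<inter> U \<subseteq> S U" if "U \<in> \<U>" for U
    unfolding S_def by (rule someI_ex) (use that in \<open>simp add: \<U>_def\<close>)
  have "G \<subseteq> \<Union>(S ` \<U>')"
  proof
    fix a assume a: "a \<in> G"
    then have "a \<in> \<Union>\<U>" using loc[OF a] by (auto simp: \<U>_def)
    then obtain U where "U \<in> \<U>'" "a \<in> U" using U'(3) by auto
    then show "a \<in> \<Union>(S ` \<U>')" using S U'(1) a by blast
  qed
  moreover have "countable (S ` \<U>')" using U'(2) by simp
  moreover have "\<forall>S\<in>S ` \<U>'. C1_hoelder_submanifold m \<alpha> S" using S U'(1) by blast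
  ultimately show ?thesis by blast
qed

text \<open>Noncollapsing constants, radii and curvature bounds are indexed by naturals, so
  countably many classes \<open>G j i n\<close>, each locally inside one submanifold, exhaust almost
  every point.\<close>

theorem finite_curvature_imp_rectifiable:
  fixes \<mu> :: "'a::euclidean_space set \<Rightarrow> ennreal" and m l :: nat and \<alpha> p :: real
  assumes m: "1 \<le> m" and l: "l \<in> {1..m + 2}" and \<alpha>: "0 < \<alpha>" "\<alpha> \<le> 1" and p: "1 \<le> p"
    and rad: "radon_measure \<mu>" and dens: "density_condition m \<mu>"
    and curv: "almost_all \<mu> (\<lambda>a. curvature_integral m l p \<alpha> \<mu> a 1 < \<infinity>)"
  shows "countably_rectifiable \<mu> m \<alpha> UNIV"
proof -
  note om = radon_measure_outer[OF rad]
  define G where "G j i n = {a. noncollapsed m \<mu> (1 / (4 * real j)) (tube_width m j) (1 / real i) a \<and>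
     curvature_integral m l p \<alpha> \<mu> a 1 \<le> ennreal (real n)}" for j i n :: nat
  have ex: "\<exists>\<A>. countable \<A> \<and> (\<forall>S\<in>\<A>. C1_hoelder_submanifold m \<alpha> S) \<and> G j i n \<subseteq> \<Union>\<A>"
    if jin: "0 < j" "0 < i" "0 < n" for j i n
  proof (rule countably_many_submanifolds)
    fix a0 assume a0: "a0 \<in> G j i n"
    have pos: "0 < 1 / (4 * real j)" "0 < tube_width m j" "0 < real n" "0 < 1 / real i" "1 / real i \<le> 1" "0 < 1 / real i / 2"
      using jin by (auto simp: tube_width_def)
    obtain Q :: "'a \<Rightarrow> 'a \<Rightarrow>\<^sub>L 'a" and D where Q: "0 \<le> D"
      "\<And>a b. a \<in> G j i n \<Longrightarrow> b \<in> G j i n \<Longrightarrow> dist a b \<le> 1 / real i / 2 \<Longrightarrow> norm (Q a - Q b) \<le> D * dist a b powr \<alpha>"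
      "\<And>a b. a \<in> G j i n \<Longrightarrow> b \<in> G j i n \<Longrightarrow> dist a b \<le> 1 / real i / 2 \<Longrightarrow> norm (Q a (b - a)) \<le> D * dist a b powr (1 + \<alpha>)"
      "\<And>a e. a \<in> G j i n \<Longrightarrow> 0 < e \<Longrightarrow> \<exists>T. subspace T \<and> dim T = m \<and> norm (Q a - normal_proj T) < e"
      by (rule tangent_jets[OF rad m l \<alpha> p pos(1-5), folded G_def]) blast
    show "\<exists>U S. open U \<and> a0 \<in> U \<and> C1_hoelder_submanifold m \<alpha> S \<and> G j i n \<inter> U \<subseteq> S"
      by (rule locally_submanifold[OF \<alpha> pos(6) Q a0])
  qed
  define \<A> where "\<A> t = (SOME \<A>. countable \<A> \<and> (\<forall>S\<in>\<A>. C1_hoelder_submanifold m \<alpha> S) \<and> G (fst t) (fst (snd t)) (snd (snd t)) \<subseteq> \<Union>\<A>)"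
    for t :: "nat \<times> nat \<times> nat"
  have A: "countable (\<A> t) \<and> (\<forall>S\<in>\<A> t. C1_hoelder_submanifold m \<alpha> S) \<and> G (fst t) (fst (snd t)) (snd (snd t)) \<subseteq> \<Union>(\<A> t)"
    if "t \<in> {0<..} \<times> {0<..} \<times> {0<..}" for t
    unfolding \<A>_def by (rule someI_ex, rule ex) (use that in auto)
  define I where "I = ({0<..} \<times> {0<..} \<times> {0<..} :: (nat \<times> nat \<times> nat) set)"
  define N1 where "N1 = {a. \<not> curvature_integral m l p \<alpha> \<mu> a 1 < \<infinity>}"
  define N2 where "N2 = {a. \<not> (\<exists>j i. 0 < j \<and> 0 < i \<and> noncollapsed m \<mu> (1 / (4 * real j)) (tube_width m j) (1 / real i) a)}"
  have null: "\<mu> N1 = 0" "\<mu> N2 = 0"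
    using curv almost_all_noncollapsed[OF rad dens m] unfolding almost_all_def N1_def N2_def by blast+
  have sub: "UNIV - \<Union>(\<Union>t\<in>I. \<A> t) \<subseteq> N1 \<union> N2"
  proof
    fix a assume a: "a \<in> UNIV - \<Union>(\<Union>t\<in>I. \<A> t)"
    show "a \<in> N1 \<union> N2"
    proof (rule ccontr)
      assume "a \<notin> N1 \<union> N2"
      then have "curvature_integral m l p \<alpha> \<mu> a 1 < \<infinity>" and "\<exists>j i. 0 < j \<and> 0 < i \<and> noncollapsed m \<mu> (1 / (4 * real j)) (tube_width m j) (1 / real i) a"
        by (simp_all add: N1_def N2_def)
      moreover obtain n :: nat where "curvature_integral m l p \<alpha> \<mu> a 1 \<le> ennreal (real n)" "0 < n"
      proof -
        obtain n :: nat where n: "enn2real (curvature_integral m l p \<alpha> \<mu> a 1) < real n" using reals_Archimedean2 by blast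
        have "curvature_integral m l p \<alpha> \<mu> a 1 = ennreal (enn2real (curvature_integral m l p \<alpha> \<mu> a 1))"
          using calculation(1) by (simp add: less_top)
        also have "\<dots> \<le> ennreal (real n)" using n by (intro ennreal_leI) simp
        finally have "curvature_integral m l p \<alpha> \<mu> a 1 \<le> ennreal (real n)" .
        moreover have "0 < n" using n enn2real_nonneg[of "curvature_integral m l p \<alpha> \<mu> a 1"] by (cases n) auto
        ultimately show thesis by (rule that)
      qed
      ultimately obtain j i where "0 < j" "0 < i" "0 < n" "a \<in> G j i n" by (auto simp: G_def)
      then have t: "(j, i, n) \<in> I" and "a \<in> \<Union>(\<A> (j, i, n))"
        using A[of "(j, i, n)"] by (auto simp: I_def)
      then show False using a by blast
    qed
  qed
  have "\<mu> (N1 \<union> N2) = 0" using outer_measure_Un[OF om, of N1 N2] null by simp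
  then have "\<mu> (UNIV - \<Union>(\<Union>t\<in>I. \<A> t)) = 0" using outer_measure_null_subset[OF om _ sub] by blast
  moreover have "countable (\<Union>t\<in>I. \<A> t)" using A by (intro countable_UN) (auto simp: I_def)
  moreover have "\<forall>S\<in>(\<Union>t\<in>I. \<A> t). C1_hoelder_submanifold m \<alpha> S" using A by (auto simp: I_def)
  ultimately show ?thesis unfolding countably_rectifiable_def by blast
qed

section \<open>A function whose derivative is Hoelder continuous but nowhere better\<close>

lemma abs_cos_diff_le: "\<bar>cos b - cos a\<bar> \<le> \<bar>b - a\<bar>" for a b :: real
proof -
  have "norm (cos b - cos a) \<le> 1 * norm (b - a)"
    by (rule field_differentiable_bound[of UNIV cos "\<lambda>x. - sin x"]) (auto intro!: derivative_eq_intros)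
  then show ?thesis by simp
qed

lemma abs_sin_diff_le: "\<bar>sin b - sin a\<bar> \<le> \<bar>b - a\<bar>" for a b :: real
proof -
  have "norm (sin b - sin a) \<le> 1 * norm (b - a)"
    by (rule field_differentiable_bound[of UNIV sin cos]) (auto intro!: derivative_eq_intros)
  then show ?thesis by simp
qed

lemma abs_cos_taylor_le: "\<bar>cos b - cos a + sin a * (b - a)\<bar> \<le> \<bar>b - a\<bar> * \<bar>b - a\<bar>" for a b :: real
proof -
  define S where "S = cball a \<bar>b - a\<bar>"
  have "norm ((cos b + sin a * b) - (cos a + sin a * a)) \<le> \<bar>b - a\<bar> * norm (b - a)"
  proof (rule field_differentiable_bound[of S _ "\<lambda>x. sin a - sin x"])
    show "convex S" by (simp add: S_def)
    show "b \<in> S" "a \<in> S" by (auto simp: S_def dist_real_def abs_minus_commute)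
    show "((\<lambda>b. cos b + sin a * b) has_field_derivative sin a - sin x) (at x within S)" for x
      by (auto intro!: derivative_eq_intros)
    show "norm (sin a - sin x) \<le> \<bar>b - a\<bar>" if "x \<in> S" for x
      using abs_sin_diff_le[of a x] that by (simp add: S_def dist_real_def)
  qed
  then show ?thesis by (simp add: algebra_simps)
qed

text \<open>Interpolation: the quadratic bound serves increments up to one, the linear bound larger
  ones.\<close>

lemma abs_cos_taylor_le_powr:
  fixes a b \<alpha> :: real
  assumes "0 < \<alpha>" "\<alpha> < 1"
  shows "\<bar>cos b - cos a + sin a * (b - a)\<bar> \<le> 2 * \<bar>b - a\<bar> powr (1 + \<alpha>)"
proof -
  let ?w = "\<bar>b - a\<bar>"
  consider "?w = 0" | "0 < ?w" "?w \<le> 1" | "1 < ?w" by linarith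
  then show ?thesis
  proof cases
    case 2
    have "?w powr 2 \<le> ?w powr (1 + \<alpha>)" using 2 assms by (intro powr_mono') auto
    moreover have "?w powr 2 = ?w * ?w" using 2 by (simp add: power2_eq_square)
    ultimately have "?w * ?w \<le> 2 * ?w powr (1 + \<alpha>)" by (smt (verit) powr_ge_zero)
    then show ?thesis using abs_cos_taylor_le[of b a] by linarith
  next
    case 3
    have "\<bar>sin a\<bar> * ?w \<le> 1 * ?w" by (intro mult_right_mono) auto
    then have "\<bar>cos b - cos a + sin a * (b - a)\<bar> \<le> 2 * ?w"
      using abs_cos_diff_le[of b a] abs_triangle_ineq[of "cos b - cos a" "sin a * (b - a)"] by (simp add: abs_mult)
    moreover have "?w powr 1 \<le> ?w powr (1 + \<alpha>)" using 3 assms by (intro powr_mono) auto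
    ultimately show ?thesis using 3 by simp
  qed simp
qed

lemma cos_second_difference: "cos (a + 2 * b) - 2 * cos (a + b) + cos a = 2 * cos (a + b) * (cos b - 1)" for a b :: real
proof -
  have "cos (a + 2 * b) + cos a = cos ((a + b) + b) + cos ((a + b) - b)" by (simp add: algebra_simps)
  also have "\<dots> = 2 * cos (a + b) * cos b" unfolding cos_add cos_diff by simp
  finally show ?thesis by (simp add: algebra_simps)
qed

lemma abs_cos_second_difference_le: "\<bar>cos (a + 2 * b) - 2 * cos (a + b) + cos a\<bar> \<le> b\<^sup>2" for a b :: real
proof -
  have "1 - cos b = 2 * (sin (b / 2))\<^sup>2" using cos_double_sin[of "b / 2"] by simp
  moreover have "(sin (b / 2))\<^sup>2 \<le> (b / 2)\<^sup>2"
    using abs_sin_x_le_abs_x[of "b / 2"] abs_le_square_iff by blast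
  moreover have "\<bar>cos b - 1\<bar> = 1 - cos b" by simp
  ultimately have "\<bar>cos b - 1\<bar> \<le> b\<^sup>2 / 2"
    by (simp add: power_divide)
  then have "2 * \<bar>cos (a + b)\<bar> * \<bar>cos b - 1\<bar> \<le> 2 * 1 * (b\<^sup>2 / 2)" by (intro mult_mono) auto
  then show ?thesis unfolding cos_second_difference by (simp add: abs_mult)
qed

text \<open>A lacunary series \<open>\<Sum>\<^sub>j N\<^sub>j\<^sup>-\<^sup>1\<^sup>-\<^sup>\<gamma> cos (N\<^sub>j x)\<close> with \<open>N\<^sub>j = B\<^sup>j\<close> and \<open>B\<close> even: at the step
  \<open>\<pi> / N\<^sub>k\<close> the second differences of all terms with \<open>j > k\<close> vanish by periodicity.\<close>

lemma rough_function:
  fixes \<alpha> \<gamma> :: real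
  assumes \<alpha>: "0 < \<alpha>" "\<alpha> < \<gamma>" and \<gamma>: "\<gamma> < 1"
  obtains L c :: real and u u' :: "real \<Rightarrow> real" and h :: "nat \<Rightarrow> real" where
    "0 < L" "0 < c"
    "\<And>x y. \<bar>u y - u x\<bar> \<le> L * \<bar>y - x\<bar>"
    "\<And>x. \<bar>u' x\<bar> \<le> L"
    "\<And>x y. \<bar>u y - u x - u' x * (y - x)\<bar> \<le> L * \<bar>y - x\<bar> powr (1 + \<alpha>)"
    "\<And>k. 0 < h k" "h \<longlonglongrightarrow> 0"
    "\<And>k x. c * h k powr (1 + \<gamma>) \<le> \<bar>u (x + 2 * h k) - 2 * u (x + h k) + u x\<bar> \<or>
       c * h k powr (1 + \<gamma>) \<le> \<bar>u (x + h k / 2 + 2 * h k) - 2 * u (x + h k / 2 + h k) + u (x + h k / 2)\<bar>"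
proof -
  \<comment> \<open>Large enough for \<open>B powr (1 - \<gamma>)\<close> to be at least
    \<open>100\<close>, so that the terms of lower frequency add up to at most half of
    \<open>a k\<close>; the factor two in \<open>B\<close> makes it even.\<close>
  define M where "M = nat \<lceil>100 powr (1 / (1 - \<gamma>))\<rceil>"
  define B where "B = real (2 * M)"
  have M: "100 powr (1 / (1 - \<gamma>)) \<le> real M" unfolding M_def by (rule real_nat_ceiling_ge)
  have B100: "100 \<le> B powr (1 - \<gamma>)"
  proof -
    have "100 = (100 powr (1 / (1 - \<gamma>))) powr (1 - \<gamma>)" using \<gamma> by (simp add: powr_powr)
    also have "\<dots> \<le> B powr (1 - \<gamma>)" using M \<gamma> by (intro powr_mono2) (auto simp: B_def)
    finally show ?thesis .
  qed
  have "1 \<le> M"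
  proof -
    have "(1::real) \<le> 100 powr (1 / (1 - \<gamma>))" using \<gamma> by (intro ge_one_powr_ge_zero) auto
    then show ?thesis using M by linarith
  qed
  then have B2: "2 \<le> B" by (simp add: B_def)
  define N where "N j = B ^ j" for j :: nat
  have N: "0 < N j" for j using B2 by (simp add: N_def)
  define a where "a j = N j powr (- (1 + \<gamma>))" for j
  have a: "0 < a j" for j using N by (simp add: a_def less_imp_neq[symmetric])
  have Npow: "N j powr s = (B powr s) ^ j" for j s
    using B2 by (simp add: N_def powr_realpow[symmetric] powr_powr mult.commute del: powr_realpow)
  have geo: "summable (\<lambda>j. N j powr s)" if "s < 0" for s
  proof -
    have "B powr s < B powr 0" using that B2 by (intro powr_less_mono) auto
    then show ?thesis unfolding Npow using B2 by (intro summable_geometric) auto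
  qed
  have aN: "a j * N j = N j powr (- \<gamma>)" "a j * (N j * x) powr (1 + \<alpha>) = N j powr (\<alpha> - \<gamma>) * x powr (1 + \<alpha>)"
    if "0 \<le> x" for j x
  proof -
    have "N j powr (- (1 + \<gamma>)) * N j powr 1 = N j powr (- \<gamma>)" by (simp only: powr_add[symmetric]) simp
    then show "a j * N j = N j powr (- \<gamma>)" using N[of j] by (simp add: a_def)
    have "N j powr (- (1 + \<gamma>)) * N j powr (1 + \<alpha>) = N j powr (\<alpha> - \<gamma>)" by (simp only: powr_add[symmetric]) simp
    then show "a j * (N j * x) powr (1 + \<alpha>) = N j powr (\<alpha> - \<gamma>) * x powr (1 + \<alpha>)"
      using N[of j] that by (simp add: a_def powr_mult)
  qed
  have sa: "summable a" unfolding a_def using \<alpha> by (intro geo) auto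
  have sf: "summable (\<lambda>j. a j * cos (N j * x))" for x
    by (rule summable_comparison_test'[OF sa]) (use a in \<open>auto simp: abs_mult less_imp_le mult_left_le\<close>)
  have sN: "summable (\<lambda>j. N j powr (- \<gamma>))" "summable (\<lambda>j. N j powr (\<alpha> - \<gamma>))" using \<alpha> by (auto intro: geo)
  have der: "\<bar>- (a j * N j) * sin (N j * x)\<bar> \<le> 1 * N j powr (- \<gamma>)" for j x
  proof -
    have "a j * N j * \<bar>sin (N j * x)\<bar> \<le> a j * N j * 1"
      using a[of j] N[of j] by (intro mult_left_mono) auto
    then show ?thesis using a[of j] N[of j] by (simp add: abs_mult aN(1)[of 0])
  qed
  have sg: "summable (\<lambda>j. - (a j * N j) * sin (N j * x))" for x
    by (rule summable_comparison_test'[OF sN(1)]) (use der in simp)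
  define u where "u x = (\<Sum>j. a j * cos (N j * x))" for x
  define u' where "u' x = (\<Sum>j. - (a j * N j) * sin (N j * x))" for x
  define L where "L = (\<Sum>j. N j powr (- \<gamma>)) + 2 * (\<Sum>j. N j powr (\<alpha> - \<gamma>))"
  have Lpos: "0 < (\<Sum>j. N j powr (- \<gamma>))" "0 < (\<Sum>j. N j powr (\<alpha> - \<gamma>))"
    using N by (auto intro!: suminf_pos sN simp: less_imp_neq[symmetric])
  have LL: "(\<Sum>j. N j powr (- \<gamma>)) \<le> L" "2 * (\<Sum>j. N j powr (\<alpha> - \<gamma>)) \<le> L"
    using Lpos by (auto simp: L_def)
  have abs_sum_le: "\<bar>suminf f\<bar> \<le> C * suminf g" if "\<And>j. \<bar>f j\<bar> \<le> C * g j" "summable g" for f g :: "nat \<Rightarrow> real" and C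
  proof -
    have "norm (suminf f) \<le> (\<Sum>j. C * g j)" using that by (intro norm_suminf_le summable_mult) auto
    then show ?thesis using suminf_mult[OF that(2)] by simp
  qed
  have lip: "\<bar>u y - u x\<bar> \<le> L * \<bar>y - x\<bar>" for x y
  proof -
    have "u y - u x = (\<Sum>j. a j * cos (N j * y) - a j * cos (N j * x))"
      unfolding u_def by (rule suminf_diff[OF sf sf])
    also have "\<bar>\<dots>\<bar> \<le> \<bar>y - x\<bar> * (\<Sum>j. N j powr (- \<gamma>))"
    proof (rule abs_sum_le[OF _ sN(1)])
      fix j
      have "\<bar>a j * cos (N j * y) - a j * cos (N j * x)\<bar> = a j * \<bar>cos (N j * y) - cos (N j * x)\<bar>"
        using a[of j] by (simp add: abs_mult right_diff_distrib[symmetric])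
      also have "\<dots> \<le> a j * \<bar>N j * y - N j * x\<bar>" using a[of j] abs_cos_diff_le by (intro mult_left_mono) auto
      also have "\<dots> = a j * N j * \<bar>y - x\<bar>" using N[of j] by (simp add: abs_mult right_diff_distrib[symmetric])
      finally show "\<bar>a j * cos (N j * y) - a j * cos (N j * x)\<bar> \<le> \<bar>y - x\<bar> * N j powr (- \<gamma>)"
        unfolding aN(1)[OF order_refl] by (simp add: mult.commute)
    qed
    also have "\<dots> \<le> \<bar>y - x\<bar> * L" using LL(1) by (rule mult_left_mono) simp
    finally show ?thesis by (simp only: mult.commute)
  qed
  have u'L: "\<bar>u' x\<bar> \<le> L" for x
  proof -
    have "\<bar>u' x\<bar> \<le> 1 * (\<Sum>j. N j powr (- \<gamma>))"
      unfolding u'_def by (rule abs_sum_le[OF der sN(1)])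
    then show ?thesis using Lpos by (simp add: L_def)
  qed
  have taylor: "\<bar>u y - u x - u' x * (y - x)\<bar> \<le> L * \<bar>y - x\<bar> powr (1 + \<alpha>)" for x y
  proof -
    have "u y - u x - u' x * (y - x) = (\<Sum>j. a j * cos (N j * y) - a j * cos (N j * x) - - (a j * N j) * sin (N j * x) * (y - x))"
      unfolding u_def u'_def suminf_mult2[OF sg] by (simp only: suminf_diff sf sg summable_diff summable_mult2)
    also have "\<bar>\<dots>\<bar> \<le> (2 * \<bar>y - x\<bar> powr (1 + \<alpha>)) * (\<Sum>j. N j powr (\<alpha> - \<gamma>))"
    proof (rule abs_sum_le[OF _ sN(2)])
      fix j
      have "a j * cos (N j * y) - a j * cos (N j * x) - - (a j * N j) * sin (N j * x) * (y - x)
          = a j * (cos (N j * y) - cos (N j * x) + sin (N j * x) * (N j * y - N j * x))"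
        by (simp add: algebra_simps)
      also have "\<bar>\<dots>\<bar> = a j * \<bar>cos (N j * y) - cos (N j * x) + sin (N j * x) * (N j * y - N j * x)\<bar>"
        using a[of j] by (simp add: abs_mult)
      also have "\<dots> \<le> a j * (2 * \<bar>N j * y - N j * x\<bar> powr (1 + \<alpha>))"
        using a[of j] \<alpha> \<gamma> by (intro mult_left_mono abs_cos_taylor_le_powr) auto
      also have "\<bar>N j * y - N j * x\<bar> = N j * \<bar>y - x\<bar>" using N[of j] by (simp add: abs_mult right_diff_distrib[symmetric])
      also have "a j * (2 * (N j * \<bar>y - x\<bar>) powr (1 + \<alpha>)) = 2 * \<bar>y - x\<bar> powr (1 + \<alpha>) * N j powr (\<alpha> - \<gamma>)"
        using aN(2)[of "\<bar>y - x\<bar>" j] by (simp add: mult_ac)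
      finally show "\<bar>a j * cos (N j * y) - a j * cos (N j * x) - - (a j * N j) * sin (N j * x) * (y - x)\<bar>
          \<le> 2 * \<bar>y - x\<bar> powr (1 + \<alpha>) * N j powr (\<alpha> - \<gamma>)" .
    qed
    also have "\<dots> = \<bar>y - x\<bar> powr (1 + \<alpha>) * (2 * (\<Sum>j. N j powr (\<alpha> - \<gamma>)))" by simp
    also have "\<dots> \<le> \<bar>y - x\<bar> powr (1 + \<alpha>) * L" using LL(2) by (rule mult_left_mono) simp
    finally show ?thesis by (simp only: mult.commute)
  qed
  define h where "h k = pi / N k" for k
  have h: "0 < h k" for k using N by (simp add: h_def)
  have hlim: "h \<longlonglongrightarrow> 0"
  proof -
    have "(\<lambda>k. pi * (1 / B) ^ k) \<longlonglongrightarrow> pi * 0" using B2 by (intro tendsto_intros LIMSEQ_power_zero) auto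
    then show ?thesis by (simp add: h_def[abs_def] N_def power_divide)
  qed
  define \<Delta> where "\<Delta> k x = u (x + 2 * h k) - 2 * u (x + h k) + u x" for k x
  \<comment> \<open>Term \<open>k\<close> contributes \<open>4 * a k * cos (N k * x)\<close>, and
    the terms \<open>j < k\<close> are dominated by a geometric sum of ratio
    \<open>\<rho> \<le> 1 / 100\<close>.\<close>
  have \<Delta>: "\<bar>\<Delta> k x\<bar> \<ge> a k * (4 * \<bar>cos (N k * x)\<bar> - 1/2)" for k x
  proof -
    define f where "f j = a j * cos (N j * (x + 2 * h k)) - 2 * (a j * cos (N j * (x + h k))) + a j * cos (N j * x)" for j
    have "\<Delta> k x = (\<Sum>j. f j)"
      unfolding \<Delta>_def u_def f_def suminf_mult[OF sf, symmetric]
      by (simp only: suminf_diff suminf_add sf summable_mult summable_diff)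
    also have "\<dots> = (\<Sum>j\<le>k. f j)"
    proof (rule suminf_finite)
      fix j assume "j \<notin> {..k}"
      then have "k < j" by simp
      then obtain d where d: "j = k + Suc d" by (metis less_iff_Suc_add add_Suc_right)
      have "N j * h k = pi * B ^ Suc d" using N[of k] by (simp add: h_def N_def d power_add)
      also have "\<dots> = 2 * (real (M * (2 * M) ^ d)) * pi" by (simp add: B_def)
      finally have Nh: "N j * h k = 2 * real (M * (2 * M) ^ d) * pi" .
      have c1: "cos (N j * (x + h k)) = cos (N j * x)"
        unfolding distrib_left Nh cos_add by (simp only: cos_2npi sin_2npi mult_1_right mult_zero_right diff_zero)
      have "N j * (2 * h k) = 2 * real (2 * (M * (2 * M) ^ d)) * pi" using Nh by simp
      then have "cos (N j * (x + 2 * h k)) = cos (N j * x)"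
        unfolding distrib_left cos_add by (simp only: cos_2npi sin_2npi mult_1_right mult_zero_right diff_zero)
      then show "f j = 0" using c1 by (simp add: f_def)
    qed simp
    also have "\<dots> = (\<Sum>j<k. f j) + f k" by (simp add: lessThan_Suc_atMost[symmetric])
    finally have eq: "\<Delta> k x = (\<Sum>j<k. f j) + f k" .
    have fk: "f k = a k * (4 * cos (N k * x))"
    proof -
      have "N k * (x + 2 * h k) = N k * x + 2 * pi" "N k * (x + h k) = N k * x + pi" using N[of k] by (simp_all add: h_def distrib_left)
      then show ?thesis unfolding f_def by (simp add: cos_add)
    qed
    define \<rho> where "\<rho> = B powr (\<gamma> - 1)"
    have \<rho>: "0 < \<rho>" "\<rho> \<le> 1/100"
    proof -
      show "0 < \<rho>" using B2 by (simp add: \<rho>_def)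
      have "\<rho> * B powr (1 - \<gamma>) = 1" using B2 by (simp add: \<rho>_def powr_add[symmetric])
      moreover have "\<rho> * 100 \<le> \<rho> * B powr (1 - \<gamma>)" using B100 \<open>0 < \<rho>\<close> by (intro mult_left_mono) auto
      ultimately show "\<rho> \<le> 1/100" by simp
    qed
    have fj: "\<bar>f j\<bar> \<le> 16 * a k * \<rho> ^ (k - j)" if "j < k" for j
    proof -
      have "f j = a j * (cos (N j * x + 2 * (N j * h k)) - 2 * cos (N j * x + N j * h k) + cos (N j * x))"
        by (simp add: f_def algebra_simps)
      then have "\<bar>f j\<bar> \<le> a j * (N j * h k)\<^sup>2"
        using a[of j] abs_cos_second_difference_le[of "N j * x" "N j * h k"] by (simp add: abs_mult mult_left_mono)
      also have "\<dots> = pi\<^sup>2 * (a j * (N j)\<^sup>2 / (N k)\<^sup>2)" by (simp add: h_def power_mult_distrib power_divide)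
      also have "\<dots> \<le> 16 * (a j * (N j)\<^sup>2 / (N k)\<^sup>2)"
      proof (rule mult_right_mono)
        have "pi\<^sup>2 \<le> 4\<^sup>2" using pi_less_4 pi_gt_zero by (intro power_mono) auto
        then show "pi\<^sup>2 \<le> 16" by simp
      qed (use a[of j] N in auto)
      also have "a j * (N j)\<^sup>2 / (N k)\<^sup>2 = a k * \<rho> ^ (k - j)"
      proof -
        have "a j * (N j)\<^sup>2 = N j powr (- (1 + \<gamma>)) * N j powr 2" using N[of j] by (simp add: a_def)
        also have "\<dots> = N j powr (1 - \<gamma>)" by (simp only: powr_add[symmetric]) simp
        finally have e1: "a j * (N j)\<^sup>2 = (B powr (1 - \<gamma>)) ^ j" by (simp add: Npow)
        have "a k * (N k)\<^sup>2 = N k powr (- (1 + \<gamma>)) * N k powr 2" using N[of k] by (simp add: a_def)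
        also have "\<dots> = N k powr (1 - \<gamma>)" by (simp only: powr_add[symmetric]) simp
        finally have e2: "a k * (N k)\<^sup>2 = (B powr (1 - \<gamma>)) ^ k" by (simp add: Npow)
        have "(B powr (1 - \<gamma>)) ^ k * \<rho> ^ (k - j) = (B powr (1 - \<gamma>)) ^ j * ((B powr (1 - \<gamma>)) ^ (k - j) * \<rho> ^ (k - j))"
          using that by (simp add: power_add[symmetric] mult.assoc[symmetric])
        also have "(B powr (1 - \<gamma>)) ^ (k - j) * \<rho> ^ (k - j) = 1"
          unfolding power_mult_distrib[symmetric] using B2 by (simp add: \<rho>_def powr_add[symmetric])
        finally have "a j * (N j)\<^sup>2 = a k * (N k)\<^sup>2 * \<rho> ^ (k - j)" by (simp add: e1 e2)
        then show ?thesis using N[of k] by (simp add: field_simps)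
      qed
      finally show ?thesis by simp
    qed
    have "\<bar>\<Sum>j<k. f j\<bar> \<le> (\<Sum>j<k. \<bar>f j\<bar>)" by (rule sum_abs)
    also have "\<dots> \<le> (\<Sum>j<k. 16 * a k * \<rho> ^ (k - j))" using fj by (intro sum_mono) auto
    also have "\<dots> = 16 * a k * (\<Sum>j<k. \<rho> ^ (k - j))" by (simp add: sum_distrib_left)
    also have "(\<Sum>j<k. \<rho> ^ (k - j)) = (\<Sum>j<k. \<rho> ^ Suc j)"
      by (rule sum.reindex_bij_witness[of _ "\<lambda>j. k - Suc j" "\<lambda>j. k - Suc j"]) (auto simp: Suc_diff_Suc)
    also have "\<dots> \<le> 1 / 32"
    proof -
      have "(\<Sum>j<k. \<rho> ^ Suc j) = \<rho> * (\<Sum>j<k. \<rho> ^ j)" by (simp add: sum_distrib_left)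
      also have "(\<Sum>j<k. \<rho> ^ j) = (1 - \<rho> ^ k) / (1 - \<rho>)" using \<rho> by (subst sum_gp_strict) auto
      also have "\<rho> * ((1 - \<rho> ^ k) / (1 - \<rho>)) \<le> (1/100) * (1 / (99/100))"
        using \<rho> power_le_one[of \<rho> k] by (intro mult_mono frac_le divide_nonneg_nonneg) auto
      finally show ?thesis by simp
    qed
    finally have rest: "\<bar>\<Sum>j<k. f j\<bar> \<le> a k / 2" using a[of k] by (simp add: mult_left_mono)
    have "\<bar>f k\<bar> = a k * (4 * \<bar>cos (N k * x)\<bar>)" using a[of k] by (simp add: fk abs_mult)
    then have "\<bar>\<Delta> k x\<bar> \<ge> a k * (4 * \<bar>cos (N k * x)\<bar>) - a k / 2"
      using rest eq by linarith
    then show ?thesis by (simp add: algebra_simps)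
  qed
  define c where "c = pi powr (- (1 + \<gamma>))"
  have cak: "c * h k powr (1 + \<gamma>) = a k" for k
  proof -
    have "h k powr (1 + \<gamma>) = pi powr (1 + \<gamma>) / N k powr (1 + \<gamma>)" using N[of k] by (simp add: h_def powr_divide)
    moreover have "pi powr (- (1 + \<gamma>)) * pi powr (1 + \<gamma>) = 1" by (simp only: powr_add[symmetric]) simp
    moreover have "N k powr (- (1 + \<gamma>)) = 1 / N k powr (1 + \<gamma>)" by (rule powr_minus_divide)
    ultimately show ?thesis by (simp only: c_def a_def times_divide_eq_right)
  qed
  \<comment> \<open>Shifting by half a step turns the cosine into a sine up to sign, and the two
    cannot both be below \<open>1 / 2\<close> in absolute value; hence the alternative.\<close>
  have alt: "c * h k powr (1 + \<gamma>) \<le> \<bar>\<Delta> k x\<bar> \<or> c * h k powr (1 + \<gamma>) \<le> \<bar>\<Delta> k (x + h k / 2)\<bar>" for k x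
  proof -
    have "N k * (x + h k / 2) = N k * x + pi / 2" using N[of k] by (simp add: h_def distrib_left)
    then have "\<bar>cos (N k * (x + h k / 2))\<bar> = \<bar>sin (N k * x)\<bar>" by (simp add: cos_add)
    moreover have "1/2 \<le> \<bar>cos (N k * x)\<bar> \<or> 1/2 \<le> \<bar>sin (N k * x)\<bar>"
    proof (rule ccontr)
      assume "\<not> ?thesis"
      then have "\<bar>cos (N k * x)\<bar> < 1/2" "\<bar>sin (N k * x)\<bar> < 1/2" by simp_all
      then have "\<bar>cos (N k * x)\<bar>\<^sup>2 < (1/2)\<^sup>2" "\<bar>sin (N k * x)\<bar>\<^sup>2 < (1/2)\<^sup>2"
        by (intro power_strict_mono abs_ge_zero; simp)+
      then show False using sin_cos_squared_add[of "N k * x"] by (simp add: power2_eq_square)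
    qed
    moreover have ge: "a k \<le> \<bar>\<Delta> k y\<bar>" if "1/2 \<le> \<bar>cos (N k * y)\<bar>" for y
    proof -
      have "a k * 1 \<le> a k * (4 * \<bar>cos (N k * y)\<bar> - 1/2)" using that a[of k] by (intro mult_left_mono) auto
      then show ?thesis using \<Delta>[of k y] by linarith
    qed
    ultimately show ?thesis unfolding cak by metis
  qed
  show thesis
  proof (rule that[of L c u u' h])
    show "0 < L" using Lpos by (simp add: L_def)
    show "0 < c" by (simp add: c_def)
  qed (use lip u'L taylor h hlim alt in \<open>auto simp: \<Delta>_def\<close>)
qed

section \<open>Radon measures from finite Borel measures\<close>

lemma outer_measure_of_borel_eq: "A \<in> sets M \<Longrightarrow> outer_measure_of M A = emeasure M A"
  unfolding outer_measure_of_def by (intro antisym INF_lower INF_greatest emeasure_mono) auto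

text \<open>Every set has a measurable hull of the same outer measure, and subadditivity is
  inherited from the hulls.\<close>

lemma outer_measure_space_outer_measure_of:
  assumes [simp]: "space M = UNIV"
  shows "outer_measure_space UNIV (outer_measure_of M)"
  unfolding outer_measure_space_def positive_def increasing_def countably_subadditive_def
proof (intro conjI ballI allI impI)
  show "outer_measure_of M {} = 0" by (simp add: outer_measure_of_borel_eq)
  show "outer_measure_of M A \<le> outer_measure_of M B" if "A \<subseteq> B" for A B
    by (rule outer_measure_of_mono[OF that])
  fix A :: "nat \<Rightarrow> 'a set"
  have "\<forall>i. \<exists>E\<in>sets M. A i \<subseteq> E \<and> outer_measure_of M (A i) = emeasure M E"
    by (intro allI outer_measure_of_attain) simp
  then obtain E where E: "\<And>i. E i \<in> sets M" "\<And>i. A i \<subseteq> E i" "\<And>i. outer_measure_of M (A i) = emeasure M (E i)"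
    by metis
  have "outer_measure_of M (\<Union>i. A i) \<le> emeasure M (\<Union>i. E i)"
    unfolding outer_measure_of_def using E by (intro INF_lower) auto
  also have "\<dots> \<le> (\<Sum>i. emeasure M (E i))" using E(1) by (intro emeasure_subadditive_countably) auto
  finally show "outer_measure_of M (\<Union>i. A i) \<le> (\<Sum>i. outer_measure_of M (A i))" by (simp add: E(3))
qed

text \<open>Finite Borel measures on a Euclidean space are inner and outer regular. The Caratheodory
  condition for an open set follows by splitting a measurable hull of the test set.\<close>

lemma radon_measure_outer_measure_of:
  fixes M :: "'a::euclidean_space measure"
  assumes sb: "sets M = sets borel" and fin: "emeasure M UNIV \<noteq> \<infinity>"
  shows "radon_measure (outer_measure_of M)"
proof -
  have sp: "space M = UNIV" using sets_eq_imp_space_eq[OF sb] by simp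
  note om = outer_measure_space_outer_measure_of[OF sp]
  have att: "\<exists>E\<in>sets M. A \<subseteq> E \<and> outer_measure_of M A = emeasure M E" for A
    by (rule outer_measure_of_attain) (simp add: sp)
  show ?thesis
    unfolding radon_measure_def
  proof (intro conjI allI impI)
    show "outer_measure_space UNIV (outer_measure_of M)" by (rule om)
    show "outer_measure_of M K < \<infinity>" if "compact K" for K
    proof -
      have "K \<in> sets M" using that by (simp add: sb compact_imp_closed)
      then have "outer_measure_of M K \<le> emeasure M UNIV"
        unfolding outer_measure_of_borel_eq[OF \<open>K \<in> sets M\<close>] by (intro emeasure_mono) (auto simp: sb)
      then show ?thesis using fin by (simp add: less_top top_unique order_le_less_trans)
    qed
    fix V :: "'a set" assume V: "open V"
    then have Vs: "V \<in> sets M" by (simp add: sb)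
    show "V \<in> caratheodory_sets (outer_measure_of M)"
      unfolding lambda_system_def
    proof (intro CollectI conjI ballI UNIV_I)
      fix X :: "'a set"
      obtain E where E: "E \<in> sets M" "X \<subseteq> E" "outer_measure_of M X = emeasure M E" using att by blast
      have "outer_measure_of M (V \<inter> X) + outer_measure_of M ((UNIV - V) \<inter> X) \<le> emeasure M (V \<inter> E) + emeasure M (E - V)"
        unfolding outer_measure_of_def using E Vs by (intro add_mono INF_lower) auto
      also have "\<dots> = emeasure M ((V \<inter> E) \<union> (E - V))" using E Vs by (intro plus_emeasure) auto
      also have "(V \<inter> E) \<union> (E - V) = E" by auto
      finally have "outer_measure_of M (V \<inter> X) + outer_measure_of M ((UNIV - V) \<inter> X) \<le> outer_measure_of M X" by (simp add: E(3))
      moreover have "outer_measure_of M X \<le> outer_measure_of M (V \<inter> X) + outer_measure_of M ((UNIV - V) \<inter> X)"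
      proof -
        have "X = (V \<inter> X) \<union> ((UNIV - V) \<inter> X)" by auto
        then show ?thesis using outer_measure_Un[OF om, of "V \<inter> X" "(UNIV - V) \<inter> X"] by simp
      qed
      ultimately show "outer_measure_of M (V \<inter> X) + outer_measure_of M ((UNIV - V) \<inter> X) = outer_measure_of M X"
        by (rule antisym)
    qed
    have "outer_measure_of M V = emeasure M V" by (rule outer_measure_of_borel_eq[OF Vs])
    also have "\<dots> = (SUP K\<in>{K. K \<subseteq> V \<and> compact K}. emeasure M K)"
      using Vs fin by (intro inner_regular[OF sb]) (simp_all add: sb sp)
    also have "\<dots> = (SUP K\<in>{K. compact K \<and> K \<subseteq> V}. outer_measure_of M K)"
      by (intro SUP_cong) (auto simp: outer_measure_of_borel_eq sb compact_imp_closed)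
    finally show "outer_measure_of M V = (SUP K\<in>{K. compact K \<and> K \<subseteq> V}. outer_measure_of M K)" .
  next
    fix A :: "'a set"
    obtain E where E: "E \<in> sets M" "A \<subseteq> E" "outer_measure_of M A = emeasure M E" using att by blast
    have "(INF V\<in>{V. open V \<and> A \<subseteq> V}. outer_measure_of M V) \<le> (INF V\<in>{V. E \<subseteq> V \<and> open V}. emeasure M V)"
    proof (rule INF_mono)
      fix V assume "V \<in> {V. E \<subseteq> V \<and> open V}"
      then show "\<exists>V'\<in>{V. open V \<and> A \<subseteq> V}. outer_measure_of M V' \<le> emeasure M V"
        using E(2) by (intro bexI[of _ V]) (auto simp: outer_measure_of_borel_eq sb)
    qed
    also have "\<dots> = emeasure M E"
      using E(1) fin by (intro outer_regular[OF sb, symmetric]) (simp_all add: sb sp)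
    finally have "(INF V\<in>{V. open V \<and> A \<subseteq> V}. outer_measure_of M V) \<le> outer_measure_of M A" by (simp add: E(3))
    then show "outer_measure_of M A = (INF V\<in>{V. open V \<and> A \<subseteq> V}. outer_measure_of M V)"
      by (intro antisym INF_greatest outer_measure_of_mono) auto
  qed
qed

section \<open>Measurability of the discrete curvature\<close>

text \<open>Coverings by open sets make the approximating measures upper semicontinuous.\<close>

definition open_premeasure :: "nat \<Rightarrow> real \<Rightarrow> 'a::metric_space set \<Rightarrow> ennreal" where
  "open_premeasure d \<delta> A =
     (INF S \<in> {S :: nat \<Rightarrow> 'a set. A \<subseteq> (\<Union>i. S i) \<and> (\<forall>i. open (S i) \<and> bounded (S i) \<and> diameter (S i) \<le> \<delta>)}.
        \<Sum>i. if S i = {} then 0 else ennreal (unit_ball_vol (real d) * (diameter (S i) / 2) ^ d))"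

text \<open>Thicken by a small radius: continuity of \<open>t ^ d\<close> controls the growth of the
  summand, and starting from \<open>\<delta> / 2\<close> leaves room for the diameter.\<close>

lemma open_enlargement:
  fixes S :: "'a::euclidean_space set"
  assumes S: "bounded S" "diameter S \<le> \<delta> / 2" and \<delta>: "0 < \<delta>" and e: "0 < e" and c: "0 \<le> c"
  obtains S' where "open S'" "S \<subseteq> S'" "bounded S'" "diameter S' \<le> \<delta>"
    "(if S' = {} then 0 else ennreal (c * (diameter S' / 2) ^ d)) \<le> (if S = {} then 0 else ennreal (c * (diameter S / 2) ^ d)) + ennreal e"
proof (cases "S = {}")
  case True
  then show thesis using that[of "{}"] \<delta> by simp
next
  case False
  define f where "f t = c * (t / 2) ^ d" for t :: real
  have "continuous_on UNIV f" unfolding f_def by (intro continuous_intros) auto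
  then have "isCont f (diameter S)" by (simp add: continuous_on_eq_continuous_at)
  then obtain r where r: "0 < r" "\<And>t. dist t (diameter S) < r \<Longrightarrow> dist (f t) (f (diameter S)) < e"
    unfolding continuous_at_eps_delta using e by blast
  define s where "s = min (r / 4) (\<delta> / 4)"
  have s: "0 < s" "2 * s < r" "2 * s \<le> \<delta> / 2" using r \<delta> by (auto simp: s_def min_def)
  define S' where "S' = (\<Union>x\<in>S. ball x s)"
  have sub: "S \<subseteq> S'" using s by (auto simp: S'_def)
  have dS': "dist x y \<le> diameter S + 2 * s" if "x \<in> S'" "y \<in> S'" for x y
  proof -
    obtain x0 y0 where xy: "x0 \<in> S" "y0 \<in> S" "dist x0 x < s" "dist y0 y < s" using \<open>x \<in> S'\<close> \<open>y \<in> S'\<close> by (auto simp: S'_def)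
    have "dist x0 y0 \<le> diameter S" using diameter_bounded_bound[OF S(1) xy(1,2)] .
    moreover have "dist x y \<le> dist x0 x + dist x0 y0 + dist y0 y"
      using dist_triangle[of x y x0] dist_triangle[of x0 y y0] dist_commute[of x x0] by linarith
    ultimately show ?thesis using xy by linarith
  qed
  have bd: "bounded S'"
  proof -
    obtain z where "z \<in> S'" using False sub by blast
    then show ?thesis using dS' unfolding bounded_def by blast
  qed
  have d1: "diameter S' \<le> diameter S + 2 * s"
    using dS' s diameter_ge_0[OF S(1)] by (intro diameter_le) (auto simp: dist_norm)
  have d2: "diameter S \<le> diameter S'" by (rule diameter_subset[OF sub bd])
  show thesis
  proof (rule that[of S'])
    show "open S'" by (auto simp: S'_def)
    show "diameter S' \<le> \<delta>" using d1 s S(2) by linarith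
    have "dist (diameter S') (diameter S) < r" using d1 d2 s by (simp add: dist_real_def)
    then have "f (diameter S') \<le> f (diameter S) + e" using r(2) by (force simp: dist_real_def)
    moreover have "0 \<le> f (diameter S)" using c diameter_ge_0[OF S(1)] by (simp add: f_def)
    ultimately have "ennreal (f (diameter S')) \<le> ennreal (f (diameter S)) + ennreal e"
      using e by (simp add: ennreal_plus[symmetric] ennreal_leI del: ennreal_plus)
    then show "(if S' = {} then 0 else ennreal (c * (diameter S' / 2) ^ d)) \<le> (if S = {} then 0 else ennreal (c * (diameter S / 2) ^ d)) + ennreal e"
      using False by (simp add: f_def)
  qed (use sub bd in auto)
qed

text \<open>Halving \<open>\<delta>\<close> is harmless because only the supremum over all
  \<open>\<delta>\<close> matters. The error \<open>e\<close> is spent as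
  \<open>e * (1 / 2) ^ Suc i\<close> on the covering set with index \<open>i\<close>.\<close>

lemma open_premeasure_le:
  fixes A :: "'a::euclidean_space set"
  assumes \<delta>: "0 < \<delta>"
  shows "open_premeasure d \<delta> A \<le> hausdorff_premeasure d (\<delta> / 2) A"
  unfolding hausdorff_premeasure_def
proof (rule INF_greatest, clarify)
  fix S :: "nat \<Rightarrow> 'a set" assume S: "A \<subseteq> (\<Union>i. S i)" "\<forall>i. bounded (S i) \<and> diameter (S i) \<le> \<delta> / 2"
  let ?w = "\<lambda>S :: 'a set. if S = {} then 0 else ennreal (unit_ball_vol (real d) * (diameter S / 2) ^ d)"
  show "open_premeasure d \<delta> A \<le> (\<Sum>i. ?w (S i))"
  proof (rule ennreal_le_epsilon)
    fix e :: real assume e: "0 < e"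
    have "\<exists>S'. open S' \<and> S i \<subseteq> S' \<and> bounded S' \<and> diameter S' \<le> \<delta> \<and> ?w S' \<le> ?w (S i) + ennreal (e * (1 / 2) ^ Suc i)" for i
    proof -
      have e': "0 < e * (1 / 2) ^ Suc i" using e by simp
      have S': "bounded (S i)" "diameter (S i) \<le> \<delta> / 2" using S(2) by auto
      show ?thesis by (rule open_enlargement[OF S' \<delta> e', of "unit_ball_vol (real d)" d]) (simp, blast)
    qed
    then obtain S' where S': "\<And>i. open (S' i)" "\<And>i. S i \<subseteq> S' i" "\<And>i. bounded (S' i)" "\<And>i. diameter (S' i) \<le> \<delta>"
      "\<And>i. ?w (S' i) \<le> ?w (S i) + ennreal (e * (1 / 2) ^ Suc i)" by metis
    have "A \<subseteq> (\<Union>i. S' i)" using S(1) S'(2) by blast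
    then have "open_premeasure d \<delta> A \<le> (\<Sum>i. ?w (S' i))"
      unfolding open_premeasure_def using S' by (intro INF_lower) auto
    also have "\<dots> \<le> (\<Sum>i. ?w (S i) + ennreal (e * (1 / 2) ^ Suc i))" using S'(5) by (intro suminf_le) auto
    also have "\<dots> = (\<Sum>i. ?w (S i)) + (\<Sum>i. ennreal (e * (1 / 2) ^ Suc i))" by (rule suminf_add[symmetric]) auto
    also have "(\<Sum>i. ennreal (e * (1 / 2) ^ Suc i)) = ennreal e"
    proof -
      have "(\<lambda>i. e * (1 / 2) ^ Suc i) sums (e * 1)" by (intro sums_mult power_half_series)
      then show ?thesis using e by (intro suminf_ennreal_eq) auto
    qed
    finally show "open_premeasure d \<delta> A \<le> (\<Sum>i. ?w (S i)) + ennreal e" .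
  qed
qed

lemma hausdorff_measure_eq_SUP_open:
  fixes A :: "'a::euclidean_space set"
  shows "hausdorff_measure d A = (SUP n. open_premeasure d (1 / real (Suc n)) A)"
proof (rule antisym)
  show "hausdorff_measure d A \<le> (SUP n. open_premeasure d (1 / real (Suc n)) A)"
    unfolding hausdorff_measure_def
  proof (rule SUP_least)
    fix \<delta> :: real assume "\<delta> \<in> {0<..}"
    then obtain n where n: "1 / real (Suc n) < \<delta>" using nat_approx_posE by auto
    have "hausdorff_premeasure d \<delta> A \<le> open_premeasure d (1 / real (Suc n)) A"
      unfolding hausdorff_premeasure_def open_premeasure_def
      by (rule INF_superset_mono) (use n in \<open>auto intro: order_trans\<close>)
    also have "\<dots> \<le> (SUP n. open_premeasure d (1 / real (Suc n)) A)" by (rule SUP_upper) simp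
    finally show "hausdorff_premeasure d \<delta> A \<le> (SUP n. open_premeasure d (1 / real (Suc n)) A)" .
  qed
  show "(SUP n. open_premeasure d (1 / real (Suc n)) A) \<le> hausdorff_measure d A"
  proof (rule SUP_least)
    fix n :: nat
    have "open_premeasure d (1 / real (Suc n)) A \<le> hausdorff_premeasure d (1 / real (Suc n) / 2) A"
      by (rule open_premeasure_le) simp
    also have "\<dots> \<le> hausdorff_measure d A" by (rule hausdorff_premeasure_le) simp
    finally show "open_premeasure d (1 / real (Suc n)) A \<le> hausdorff_measure d A" .
  qed
qed

text \<open>The hull is compact, so some \<open>\<epsilon>\<close>-neighbourhood lies in
  \<open>V\<close>. The Minkowski sum of the hull with the ball of radius \<open>\<epsilon>\<close>
  is convex and thus contains the hull of any vertices moved by less than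
  \<open>\<epsilon>\<close>.\<close>

lemma open_convex_hull_subset:
  fixes V :: "'a::euclidean_space set"
  assumes V: "open V"
  shows "open {T :: nat \<Rightarrow> 'a. convex hull (T ` {0..k}) \<subseteq> V}"
proof (subst open_subopen, intro ballI)
  fix T :: "nat \<Rightarrow> 'a" assume "T \<in> {T. convex hull (T ` {0..k}) \<subseteq> V}"
  then have T: "convex hull (T ` {0..k}) \<subseteq> V" by simp
  have "compact (convex hull (T ` {0..k}))" by (intro compact_convex_hull finite_imp_compact) simp
  then obtain \<epsilon> where \<epsilon>: "0 < \<epsilon>" "(\<Union>x\<in>convex hull (T ` {0..k}). ball x \<epsilon>) \<subseteq> V"
    using compact_subset_open_imp_ball_epsilon_subset[OF _ V T] by blast
  define W where "W = (\<Inter>i\<in>{0..k}. (\<lambda>T' :: nat \<Rightarrow> 'a. T' i) -` ball (T i) \<epsilon>)"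
  have "open W"
    unfolding W_def by (intro open_INT ballI open_vimage continuous_on_product_coordinates) auto
  moreover have "T \<in> W" using \<epsilon>(1) by (simp add: W_def)
  moreover have "convex hull (T' ` {0..k}) \<subseteq> V" if T': "T' \<in> W" for T'
  proof -
    let ?S = "\<Union>x\<in>convex hull (T ` {0..k}). \<Union>y\<in>ball 0 \<epsilon>. {x + y}"
    have "T' ` {0..k} \<subseteq> ?S"
    proof clarify
      fix i assume i: "i \<in> {0..k}"
      have "T i \<in> convex hull (T ` {0..k})" using i by (intro hull_inc) auto
      moreover have "T' i - T i \<in> ball 0 \<epsilon>" using T' i by (auto simp: W_def dist_norm norm_minus_commute)
      moreover have "T' i = T i + (T' i - T i)" by simp
      ultimately show "T' i \<in> ?S" by blast
    qed
    then have "convex hull (T' ` {0..k}) \<subseteq> ?S"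
      by (intro hull_minimal convex_sums convex_convex_hull convex_ball)
    also have "\<dots> \<subseteq> (\<Union>x\<in>convex hull (T ` {0..k}). ball x \<epsilon>)" by (auto simp: dist_norm)
    finally show ?thesis using \<epsilon>(2) by blast
  qed
  ultimately show "\<exists>W. open W \<and> T \<in> W \<and> W \<subseteq> {T. convex hull (T ` {0..k}) \<subseteq> V}" by blast
qed

text \<open>\<open>esssup_I\<close> demands a measurable function, hence this detour. Strict
  sublevel sets of the open premeasures are open: they are unions, over cheap covers, of the tuples
  whose hull lies in the union of the cover.\<close>

lemma borel_measurable_hausdorff_convex_hull:
  "(\<lambda>T :: nat \<Rightarrow> 'a::euclidean_space. hausdorff_measure d (convex hull (T ` {0..k}))) \<in> borel_measurable borel"
proof -
  have "(\<lambda>T :: nat \<Rightarrow> 'a. open_premeasure d \<delta> (convex hull (T ` {0..k}))) \<in> borel_measurable borel" for \<delta>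
  proof (rule borel_measurableI_less)
    fix y :: ennreal
    let ?w = "\<lambda>S :: nat \<Rightarrow> 'a set. \<Sum>i. if S i = {} then 0 else ennreal (unit_ball_vol (real d) * (diameter (S i) / 2) ^ d)"
    define \<S> where "\<S> = {S :: nat \<Rightarrow> 'a set. (\<forall>i. open (S i) \<and> bounded (S i) \<and> diameter (S i) \<le> \<delta>) \<and> ?w S < y}"
    have "{T :: nat \<Rightarrow> 'a. open_premeasure d \<delta> (convex hull (T ` {0..k})) < y} = (\<Union>S\<in>\<S>. {T. convex hull (T ` {0..k}) \<subseteq> (\<Union>i. S i)})"
      unfolding open_premeasure_def INF_less_iff \<S>_def by auto
    moreover have "open (\<Union>S\<in>\<S>. {T :: nat \<Rightarrow> 'a. convex hull (T ` {0..k}) \<subseteq> (\<Union>i. S i)})"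
      by (intro open_UN ballI open_convex_hull_subset) (auto simp: \<S>_def)
    ultimately show "{T \<in> space borel. open_premeasure d \<delta> (convex hull ((T :: nat \<Rightarrow> 'a) ` {0..k})) < y} \<in> sets borel"
      by simp
  qed
  then show ?thesis
    unfolding hausdorff_measure_eq_SUP_open by (intro borel_measurable_SUP) auto
qed

lemma diameter_convex_hull_finite:
  fixes S :: "'a::euclidean_space set"
  assumes "finite S"
  shows "diameter (convex hull S) = diameter S"
proof (rule antisym)
  have b: "bounded S" using assms by (rule finite_imp_bounded)
  show "diameter (convex hull S) \<le> diameter S"
    using diameter_bounded_bound[OF b] diameter_ge_0[OF b] by (intro diameter_convex_hull_le) auto
  show "diameter S \<le> diameter (convex hull S)"
    by (intro diameter_subset hull_subset bounded_convex_hull b)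
qed

lemma borel_measurable_diameter_tuple:
  "(\<lambda>T :: nat \<Rightarrow> 'a::euclidean_space. diameter (T ` {0..k})) \<in> borel_measurable borel"
proof (rule borel_measurableI_le)
  fix y :: real
  have b: "bounded (T ` {0..k})" for T :: "nat \<Rightarrow> 'a" by (intro finite_imp_bounded) simp
  have eq: "{T :: nat \<Rightarrow> 'a. diameter (T ` {0..k}) \<le> y} =
      (if y < 0 then {} else (\<Inter>i\<in>{0..k}. \<Inter>j\<in>{0..k}. {T. dist (T i) (T j) \<le> y}))"
  proof (cases "y < 0")
    case True
    then show ?thesis using diameter_ge_0[OF b] by (auto simp: not_le intro: less_le_trans)
  next
    case False
    have "diameter (T ` {0..k}) \<le> y \<longleftrightarrow> (\<forall>i\<in>{0..k}. \<forall>j\<in>{0..k}. dist (T i) (T j) \<le> y)" for T :: "nat \<Rightarrow> 'a"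
    proof
      assume "diameter (T ` {0..k}) \<le> y"
      then show "\<forall>i\<in>{0..k}. \<forall>j\<in>{0..k}. dist (T i) (T j) \<le> y"
        using diameter_bounded_bound[OF b] by (meson imageI order_trans)
    next
      assume "\<forall>i\<in>{0..k}. \<forall>j\<in>{0..k}. dist (T i) (T j) \<le> y"
      then show "diameter (T ` {0..k}) \<le> y" using False by (intro diameter_le) (auto simp: dist_norm)
    qed
    then show ?thesis using False by auto
  qed
  have "closed {T :: nat \<Rightarrow> 'a. dist (T i) (T j) \<le> y}" for i j
    by (intro closed_Collect_le continuous_intros continuous_on_product_coordinates)
  then have "closed {T :: nat \<Rightarrow> 'a. diameter (T ` {0..k}) \<le> y}" unfolding eq by auto
  then show "{T \<in> space borel. diameter ((T :: nat \<Rightarrow> 'a) ` {0..k}) \<le> y} \<in> sets borel" by simp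
qed

lemma borel_measurable_curvature_quotient:
  "(curvature_quotient m l p \<alpha> :: (nat \<Rightarrow> 'a::euclidean_space) \<Rightarrow> ennreal) \<in> borel_measurable borel"
proof -
  note [measurable] = borel_measurable_diameter_tuple[of "m + 1"] borel_measurable_hausdorff_convex_hull[of "m + 1" "m + 1"]
  have [measurable]: "(discrete_curvature m :: (nat \<Rightarrow> 'a) \<Rightarrow> real) \<in> borel_measurable borel"
    unfolding discrete_curvature_def[abs_def] Let_def diameter_convex_hull_finite[OF finite_imageI[OF finite_atLeastAtMost]]
    by measurable
  show ?thesis unfolding curvature_quotient_def[abs_def] by measurable
qed

section \<open>The graph of a rough function\<close>

lemma emeasure_lborel_cbox_sum_Basis:
  fixes lo hi :: "'a::euclidean_space \<Rightarrow> real"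
  assumes "\<And>b. b \<in> Basis \<Longrightarrow> lo b \<le> hi b"
  shows "emeasure lborel (cbox (\<Sum>b\<in>Basis. lo b *\<^sub>R b) (\<Sum>b\<in>Basis. hi b *\<^sub>R b)) = ennreal (\<Prod>b\<in>Basis. hi b - lo b)"
  using assms by (subst emeasure_lborel_cbox_eq) (simp add: inner_diff_left)

lemma emeasure_lborel_cbox_two_sided:
  fixes I :: "'a::euclidean_space set"
  assumes I: "I \<subseteq> Basis" and "0 \<le> t" "\<And>b. b \<in> I \<Longrightarrow> hi b - lo b = t" "\<And>b. b \<in> Basis - I \<Longrightarrow> hi b - lo b = 1"
  shows "emeasure lborel (cbox (\<Sum>b\<in>Basis. lo b *\<^sub>R b) (\<Sum>b\<in>Basis. hi b *\<^sub>R b)) = ennreal (t ^ card I)"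
proof -
  have le: "lo b \<le> hi b" if "b \<in> Basis" for b
    using assms(2) assms(3)[of b] assms(4)[of b] that by (cases "b \<in> I") auto
  have "(\<Prod>b\<in>Basis. hi b - lo b) = (\<Prod>b\<in>Basis - I. hi b - lo b) * (\<Prod>b\<in>I. hi b - lo b)"
    by (rule prod.subset_diff[OF I]) simp
  also have "\<dots> = t ^ card I" using assms(3,4) by simp
  finally show ?thesis using emeasure_lborel_cbox_sum_Basis[of lo hi] le by simp
qed

text \<open>Dyadic balls: where \<open>dist a b\<close> lies between \<open>(1/2) ^ Suc n\<close>
  and \<open>(1/2) ^ n\<close> the integrand is at most \<open>c n\<close>, and the mass bound makes
  the series geometric with ratio \<open>(1/2) powr s\<close>.\<close>

lemma nn_integral_dist_powr_finite:
  fixes \<mu> :: "'a::euclidean_space set \<Rightarrow> ennreal"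
  assumes rad: "radon_measure \<mu>" and C: "0 \<le> C" and s: "0 < s" "s \<le> real m"
    and up: "\<And>r. 0 < r \<Longrightarrow> \<mu> (cball a r) \<le> ennreal (C * r ^ m)"
  shows "(\<integral>\<^sup>+b\<in>cball a 1. ennreal (dist a b powr (s - real m)) \<partial>measure_space_of \<mu>) < \<infinity>"
proof -
  let ?M = "measure_space_of \<mu>"
  define c where "c n = ((1/2) ^ Suc n) powr (s - real m)" for n :: nat
  define f where "f n b = ennreal (c n) * indicator (cball a ((1/2) ^ n)) b" for n :: nat and b
  have cb: "cball a r \<in> sets ?M" "emeasure ?M (cball a r) = \<mu> (cball a r)" for r
    using sets_borel_subset_measure_space_of[OF rad] emeasure_measure_space_of_borel[OF rad, of "cball a r"] by auto
  have pt: "ennreal (dist a b powr (s - real m)) * indicator (cball a 1) b \<le> (\<Sum>n. f n b)" for b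
  \<comment> \<open>At \<open>b = a\<close> the integrand is \<open>0\<close>, by the convention for
    \<open>0 powr t\<close>.\<close>
  proof (cases "b = a \<or> b \<notin> cball a 1")
    case False
    then have d: "0 < dist a b" "dist a b \<le> 1" by auto
    define n where "n = (LEAST n. (1/2) ^ Suc n < dist a b)"
    have "\<exists>n. (1/2) ^ Suc n < dist a b"
    proof -
      obtain n where "(1/2::real) ^ n < dist a b" using real_arch_pow_inv[OF d(1), of "1/2"] by auto
      then have "(1/2) ^ Suc n < dist a b" by (smt (verit) half_gt_zero_iff power_Suc zero_less_power mult_left_le_one_le divide_le_eq_1 power_one_over)
      then show ?thesis ..
    qed
    then have n1: "(1/2) ^ Suc n < dist a b" unfolding n_def by (rule LeastI_ex)
    have n2: "dist a b \<le> (1/2) ^ n"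
    proof (cases n)
      case 0
      then show ?thesis using d by simp
    next
      case (Suc n')
      then have "\<not> (1/2) ^ Suc n' < dist a b" using not_less_Least[of n' "\<lambda>n. (1/2) ^ Suc n < dist a b"] by (simp add: n_def)
      then show ?thesis using Suc by simp
    qed
    have "dist a b powr (s - real m) \<le> c n"
      unfolding c_def using n1 s by (intro powr_mono2') auto
    then have "ennreal (dist a b powr (s - real m)) * indicator (cball a 1) b \<le> f n b"
      using n2 False by (simp add: f_def ennreal_leI)
    also have "\<dots> = (\<Sum>i\<in>{n}. f i b)" by simp
    also have "\<dots> \<le> (\<Sum>n. f n b)" by (rule sum_le_suminf) auto
    finally show ?thesis .
  qed (auto simp: indicator_def)
  define q where "q = (1/2) powr s"
  have q: "0 < q" "q < 1" using s powr_less_mono2[of s "1/2" 1] by (auto simp: q_def)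
  have cn: "c n * (C * ((1/2) ^ n) ^ m) = (C * 2 powr (real m - s)) * q ^ n" for n
  proof -
    have h: "(1/2::real) ^ n = (1/2) powr real n" by (simp add: powr_realpow)
    have "((1/2::real) ^ n) ^ m = ((1/2) ^ n) powr real m" by (simp add: powr_realpow)
    moreover have "c n = ((1/2) ^ n) powr (s - real m) * (1/2) powr (s - real m)"
      unfolding c_def power_Suc2 by (rule powr_mult)
    moreover have "(1/2::real) powr (s - real m) = 2 powr (real m - s)"
      by (simp add: powr_divide powr_minus_divide[symmetric])
    moreover have "((1/2::real) ^ n) powr (s - real m) * ((1/2) ^ n) powr real m = ((1/2) ^ n) powr s"
      by (simp add: powr_add[symmetric])
    moreover have "((1/2::real) ^ n) powr s = q ^ n"
      by (simp add: q_def h powr_powr powr_realpow[symmetric] mult.commute del: powr_realpow)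
    ultimately show ?thesis by (simp add: mult_ac)
  qed
  have "(\<integral>\<^sup>+b\<in>cball a 1. ennreal (dist a b powr (s - real m)) \<partial>?M) \<le> (\<integral>\<^sup>+b. (\<Sum>n. f n b) \<partial>?M)"
    by (intro nn_integral_mono pt)
  also have "\<dots> = (\<Sum>n. \<integral>\<^sup>+b. f n b \<partial>?M)"
    by (rule nn_integral_suminf) (use cb in \<open>auto simp: f_def\<close>)
  also have "\<dots> = (\<Sum>n. ennreal (c n) * \<mu> (cball a ((1/2) ^ n)))"
    unfolding f_def using cb by (simp add: nn_integral_cmult_indicator)
  also have "\<dots> \<le> (\<Sum>n. ennreal ((C * 2 powr (real m - s)) * q ^ n))"
  proof (intro suminf_le)
    fix n
    have "ennreal (c n) * \<mu> (cball a ((1/2) ^ n)) \<le> ennreal (c n) * ennreal (C * ((1/2) ^ n) ^ m)"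
      by (intro mult_left_mono up) auto
    also have "\<dots> = ennreal ((C * 2 powr (real m - s)) * q ^ n)"
      unfolding cn[symmetric] using C by (subst ennreal_mult) (auto simp: c_def)
    finally show "ennreal (c n) * \<mu> (cball a ((1/2) ^ n)) \<le> ennreal ((C * 2 powr (real m - s)) * q ^ n)" .
  qed auto
  also have "\<dots> = ennreal (\<Sum>n. (C * 2 powr (real m - s)) * q ^ n)"
    using q C by (intro suminf_ennreal2 summable_mult summable_geometric) auto
  also have "\<dots> < \<infinity>" by simp
  finally show ?thesis .
qed

text \<open>A product of one-variable weights dominates the integrand, so each integration releases
  one factor \<open>\<integral>\<^sup>+x\<in>B. w x \<partial>M\<close>. The domination is only
  assumed on \<open>Gd\<close>; null sets are discarded in each variable separately.\<close>

lemma iterated_integral_le: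
  fixes w :: "'a \<Rightarrow> ennreal"
  assumes w: "w \<in> borel_measurable M" and B: "B \<in> sets M" and ae: "AE x in M. x \<in> B \<longrightarrow> x \<in> Gd"
    and F: "\<And>b. (\<And>i. i \<in> {1..K} \<Longrightarrow> b i \<in> Gd) \<Longrightarrow> F b \<le> A * (\<Prod>i=1..K. w (b i))"
    and "k \<le> K" and "\<And>i. i \<in> {Suc k..K} \<Longrightarrow> b i \<in> Gd"
  shows "iterated_integral M B k F b \<le> A * (\<integral>\<^sup>+x\<in>B. w x \<partial>M) ^ k * (\<Prod>i=Suc k..K. w (b i))"
  using assms(5,6)
proof (induction k arbitrary: b)
  case 0
  then show ?case using F[of b] by simp
next
  case (Suc k)
  let ?J = "\<integral>\<^sup>+x\<in>B. w x \<partial>M"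
  let ?P = "\<Prod>i=Suc (Suc k)..K. w (b i)"
  have "iterated_integral M B (Suc k) F b = (\<integral>\<^sup>+x\<in>B. iterated_integral M B k F (b(Suc k := x)) \<partial>M)" by simp
  also have "\<dots> \<le> (\<integral>\<^sup>+x. (A * ?J ^ k * ?P) * (w x * indicator B x) \<partial>M)"
  proof (rule nn_integral_mono_AE)
    show "AE x in M. iterated_integral M B k F (b(Suc k := x)) * indicator B x \<le> (A * ?J ^ k * ?P) * (w x * indicator B x)"
      using ae
    proof eventually_elim
      case (elim x)
      show ?case
      proof (cases "x \<in> B")
        case True
        have "iterated_integral M B k F (b(Suc k := x)) \<le> A * ?J ^ k * (\<Prod>i=Suc k..K. w ((b(Suc k := x)) i))"
          using Suc.prems elim True by (intro Suc.IH) auto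
        also have "(\<Prod>i=Suc k..K. w ((b(Suc k := x)) i)) = w x * ?P"
        proof -
          have "{Suc k..K} = insert (Suc k) {Suc (Suc k)..K}" using Suc.prems(1) by auto
          then have "(\<Prod>i=Suc k..K. w ((b(Suc k := x)) i)) = w x * (\<Prod>i=Suc (Suc k)..K. w ((b(Suc k := x)) i))" by simp
          also have "(\<Prod>i=Suc (Suc k)..K. w ((b(Suc k := x)) i)) = ?P" by (rule prod.cong) auto
          finally show ?thesis .
        qed
        finally show ?thesis using True by (simp add: mult_ac del: fun_upd_apply)
      qed simp
    qed
  qed
  also have "\<dots> = (A * ?J ^ k * ?P) * ?J"
    using w B by (intro nn_integral_cmult) auto
  finally show ?case by (simp add: mult_ac)
qed

text \<open>The graph stands over the coordinate plane of \<open>I\<close>, rises in the direction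
  \<open>e\<close>, and depends on the single coordinate \<open>i1\<close>. It is
  \<open>taylor\<close> that ties \<open>u'\<close> to \<open>u\<close>.\<close>

locale rough_graph =
  fixes I :: "'a::euclidean_space set" and i1 e :: 'a and u u' :: "real \<Rightarrow> real" and L \<alpha>1 :: real
  assumes I: "I \<subseteq> Basis" and i1: "i1 \<in> I" and e: "e \<in> Basis - I" and L: "0 < L" and \<alpha>1: "0 < \<alpha>1"
    and lip: "\<And>x y. \<bar>u y - u x\<bar> \<le> L * \<bar>y - x\<bar>"
    and u'_bound: "\<And>x. \<bar>u' x\<bar> \<le> L"
    and taylor: "\<And>x y. \<bar>u y - u x - u' x * (y - x)\<bar> \<le> L * \<bar>y - x\<bar> powr (1 + \<alpha>1)"
begin

text \<open>The parameters range over the ambient unit cube; \<open>\<Phi>\<close> ignores the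
  coordinates outside \<open>I\<close>, each of which contributes a factor one to volumes. The
  parameter space thus needs no type of its own.\<close>

definition \<Phi> :: "'a \<Rightarrow> 'a" where
  "\<Phi> x = (\<Sum>i\<in>I. (x \<bullet> i) *\<^sub>R i) + u (x \<bullet> i1) *\<^sub>R e"

definition M :: "'a measure" where
  "M = distr (restrict_space lborel (cbox 0 One)) borel \<Phi>"

definition \<mu> :: "'a set \<Rightarrow> ennreal" where "\<mu> = outer_measure_of M"

definition graph :: "'a set" where "graph = \<Phi> ` cbox 0 One"

lemma finite_I: "finite I" by (rule finite_subset[OF I finite_Basis])

lemma card_I: "1 \<le> card I" using i1 finite_I by (metis One_nat_def Suc_leI card_gt_0_iff empty_iff)

lemma inner_I: "i \<in> I \<Longrightarrow> j \<in> I \<Longrightarrow> j \<bullet> i = (if j = i then 1 else 0)"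
  using inner_Basis[of j i] subsetD[OF I] by auto

lemma inner_e_I: "i \<in> I \<Longrightarrow> e \<bullet> i = 0" "i \<in> I \<Longrightarrow> i \<bullet> e = 0"
  using inner_Basis[of e i] inner_Basis[of i e] subsetD[OF I] e by auto

lemma \<Phi>_inner_I: "\<Phi> x \<bullet> i = x \<bullet> i" if i: "i \<in> I"
proof -
  have "(\<Sum>j\<in>I. (x \<bullet> j) * (j \<bullet> i)) = (\<Sum>j\<in>I. if j = i then x \<bullet> j else 0)"
    using i by (intro sum.cong) (auto simp: inner_I)
  then show ?thesis using i finite_I by (simp add: \<Phi>_def inner_add_left inner_sum_left inner_e_I)
qed

lemma norm_\<Phi>_diff_le: "norm (\<Phi> y - \<Phi> x) \<le> (\<Sum>i\<in>I. \<bar>(y - x) \<bullet> i\<bar>) + L * \<bar>(y - x) \<bullet> i1\<bar>"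
proof -
  have "\<Phi> y - \<Phi> x = (\<Sum>i\<in>I. ((y - x) \<bullet> i) *\<^sub>R i) + (u (y \<bullet> i1) - u (x \<bullet> i1)) *\<^sub>R e"
    by (simp add: \<Phi>_def inner_diff_left scaleR_diff_left sum_subtractf)
  also have "norm \<dots> \<le> (\<Sum>i\<in>I. \<bar>(y - x) \<bullet> i\<bar>) + L * \<bar>(y - x) \<bullet> i1\<bar>"
  proof (intro norm_triangle_le add_mono sum_norm_le)
    show "norm (((y - x) \<bullet> i) *\<^sub>R i) \<le> \<bar>(y - x) \<bullet> i\<bar>" if "i \<in> I" for i
      using that I by auto
    show "norm ((u (y \<bullet> i1) - u (x \<bullet> i1)) *\<^sub>R e) \<le> L * \<bar>(y - x) \<bullet> i1\<bar>"
      using lip[of "y \<bullet> i1" "x \<bullet> i1"] e by (simp add: inner_diff_left)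
  qed
  finally show ?thesis .
qed

lemma continuous_u: "continuous_on UNIV u"
proof -
  have "L-lipschitz_on UNIV u"
    using lip L by (intro lipschitz_onI) (auto simp: dist_real_def)
  then show ?thesis by (rule lipschitz_on_continuous_on)
qed

lemma continuous_\<Phi>: "continuous_on UNIV \<Phi>"
  unfolding \<Phi>_def by (intro continuous_intros continuous_on_compose2[OF continuous_u]) auto

lemma \<Phi>_measurable [measurable]: "\<Phi> \<in> borel_measurable borel"
  by (rule borel_measurable_continuous_onI[OF continuous_\<Phi>])

lemma sets_M: "sets M = sets borel" by (simp add: M_def)

lemma emeasure_M:
  assumes "A \<in> sets borel"
  shows "emeasure M A = emeasure lborel (\<Phi> -` A \<inter> cbox 0 One)"
proof -
  have "\<Phi> \<in> measurable (restrict_space lborel (cbox 0 One)) borel"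
    by (intro measurable_restrict_space1) simp
  then have "emeasure M A = emeasure (restrict_space lborel (cbox 0 One)) (\<Phi> -` A \<inter> cbox 0 One)"
    unfolding M_def using assms by (subst emeasure_distr) (auto simp: space_restrict_space)
  also have "\<dots> = emeasure lborel (\<Phi> -` A \<inter> cbox 0 One)"
    by (subst emeasure_restrict_space) auto
  finally show ?thesis .
qed

lemma radon_\<mu>: "radon_measure \<mu>"
  unfolding \<mu>_def
proof (rule radon_measure_outer_measure_of[OF sets_M])
  have U: "(UNIV :: 'a set) \<in> sets borel" by simp
  have "emeasure M UNIV \<le> emeasure lborel (cbox 0 (One :: 'a))"
    unfolding emeasure_M[OF U] by (intro emeasure_mono) auto
  also have "\<dots> < \<infinity>" by (rule emeasure_lborel_cbox_finite)
  finally show "emeasure M UNIV \<noteq> \<infinity>" by simp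
qed

lemma \<mu>_borel: "A \<in> sets borel \<Longrightarrow> \<mu> A = emeasure lborel (\<Phi> -` A \<inter> cbox 0 One)"
  unfolding \<mu>_def by (simp add: outer_measure_of_borel_eq sets_M emeasure_M)

lemma compact_graph: "compact graph"
  unfolding graph_def by (intro compact_continuous_image continuous_on_subset[OF continuous_\<Phi>]) auto

lemma \<mu>_compl_graph: "\<mu> (- graph) = 0"
proof -
  have b: "- graph \<in> sets borel" using compact_graph by (auto intro!: borel_open open_Compl compact_imp_closed)
  have "\<Phi> -` (- graph) \<inter> cbox 0 One = {}" by (auto simp: graph_def)
  then show ?thesis by (simp add: \<mu>_borel[OF b])
qed

text \<open>The \<open>I\<close>-coordinates of a graph point are those of its parameter, so the
  preimage of a ball has width at most \<open>2 * r\<close> in these directions.\<close>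

lemma \<mu>_cball_le:
  assumes a: "a \<in> graph" and r: "0 < r"
  shows "\<mu> (cball a r) \<le> ennreal (2 ^ card I * r ^ card I)"
proof -
  obtain x where x: "a = \<Phi> x" using a by (auto simp: graph_def)
  define lo hi where "lo b = (if b \<in> I then x \<bullet> b - r else 0)" and "hi b = (if b \<in> I then x \<bullet> b + r else 1)" for b
  have "\<Phi> -` cball a r \<inter> cbox 0 One \<subseteq> cbox (\<Sum>b\<in>Basis. lo b *\<^sub>R b) (\<Sum>b\<in>Basis. hi b *\<^sub>R b)"
  proof
    fix y assume y: "y \<in> \<Phi> -` cball a r \<inter> cbox 0 One"
    have "\<bar>y \<bullet> b - x \<bullet> b\<bar> \<le> r" if b: "b \<in> I" for b
    proof -
      have "\<bar>(\<Phi> y - \<Phi> x) \<bullet> b\<bar> \<le> norm (\<Phi> y - \<Phi> x)" using b I by (intro Basis_le_norm) auto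
      then show ?thesis using y b by (simp add: inner_diff_left \<Phi>_inner_I x dist_norm norm_minus_commute)
    qed
    then show "y \<in> cbox (\<Sum>b\<in>Basis. lo b *\<^sub>R b) (\<Sum>b\<in>Basis. hi b *\<^sub>R b)"
      using y by (auto simp: mem_box lo_def hi_def abs_le_iff algebra_simps)
  qed
  then have "\<mu> (cball a r) \<le> emeasure lborel (cbox (\<Sum>b\<in>Basis. lo b *\<^sub>R b) (\<Sum>b\<in>Basis. hi b *\<^sub>R b))"
    by (subst \<mu>_borel) (auto intro!: emeasure_mono)
  also have "\<dots> = ennreal ((2 * r) ^ card I)"
    using r by (intro emeasure_lborel_cbox_two_sided[OF I]) (auto simp: lo_def hi_def)
  finally show ?thesis by (simp add: power_mult_distrib)
qed

lemma \<mu>_cball_ge: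
  assumes a: "a \<in> graph" and r: "0 < r" "r \<le> 1"
  shows "ennreal ((r / (2 * (real (card I) + L))) ^ card I) \<le> \<mu> (cball a r)"
proof -
  obtain x where x: "a = \<Phi> x" "x \<in> cbox 0 One" using a by (auto simp: graph_def)
  define t where "t = r / (2 * (real (card I) + L))"
  have cL: "1 \<le> real (card I) + L" using card_I L by simp
  have tr: "(real (card I) + L) * t = r / 2" using cL by (simp add: t_def field_simps)
  have "0 < t" using r cL by (simp add: t_def)
  moreover have "(real (card I) + L) * t \<le> r" using r(1) unfolding tr by linarith
  ultimately have t: "0 < t" "(real (card I) + L) * t \<le> r" by auto
  have "t \<le> (real (card I) + L) * t" using mult_right_mono[OF cL, of t] t(1) by simp
  then have t2: "t \<le> 1/2" using r tr by simp
  \<comment> \<open>In each direction of \<open>I\<close> the box extends from \<open>x\<close>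
    towards the farther face of the cube, so with \<open>t \<le> 1 / 2\<close> it does not leave the
    cube.\<close>
  define lo hi where "lo b = (if b \<in> I then if x \<bullet> b \<le> 1/2 then x \<bullet> b else x \<bullet> b - t else 0)"
    and "hi b = (if b \<in> I then if x \<bullet> b \<le> 1/2 then x \<bullet> b + t else x \<bullet> b else 1)" for b
  have "cbox (\<Sum>b\<in>Basis. lo b *\<^sub>R b) (\<Sum>b\<in>Basis. hi b *\<^sub>R b) \<subseteq> \<Phi> -` cball a r \<inter> cbox 0 One"
  proof
    fix y assume y: "y \<in> cbox (\<Sum>b\<in>Basis. lo b *\<^sub>R b) (\<Sum>b\<in>Basis. hi b *\<^sub>R b)"
    have yb: "lo b \<le> y \<bullet> b" "y \<bullet> b \<le> hi b" if "b \<in> Basis" for b using y that by (auto simp: mem_box)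
    have xb: "0 \<le> x \<bullet> b" "x \<bullet> b \<le> 1" if "b \<in> Basis" for b using x(2) that by (auto simp: mem_box)
    have "0 \<le> y \<bullet> b \<and> y \<bullet> b \<le> 1" if b: "b \<in> Basis" for b
      using yb[OF b] xb[OF b] t t2 by (auto simp: lo_def hi_def split: if_splits)
    then have "y \<in> cbox 0 One" by (auto simp: mem_box)
    moreover have yt: "\<bar>(y - x) \<bullet> b\<bar> \<le> t" if b: "b \<in> I" for b
    proof -
      have "b \<in> Basis" using b I by auto
      from yb[OF this] show ?thesis
        using b t t2 by (auto simp: lo_def hi_def inner_diff_left split: if_splits)
    qed
    have "norm (\<Phi> y - \<Phi> x) \<le> (\<Sum>i\<in>I. t) + L * t"
      by (rule order_trans[OF norm_\<Phi>_diff_le]) (intro add_mono sum_mono mult_left_mono yt i1, use L in auto)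
    then have "norm (\<Phi> y - \<Phi> x) \<le> r" using t(2) by (simp add: distrib_right)
    ultimately show "y \<in> \<Phi> -` cball a r \<inter> cbox 0 One" by (simp add: x(1) dist_norm norm_minus_commute)
  qed
  then have "emeasure lborel (cbox (\<Sum>b\<in>Basis. lo b *\<^sub>R b) (\<Sum>b\<in>Basis. hi b *\<^sub>R b)) \<le> \<mu> (cball a r)"
    using measurable_sets_borel[OF \<Phi>_measurable, of "cball a r"]
    by (simp only: \<mu>_borel[OF borel_closed[OF closed_cball]]) (intro emeasure_mono, auto)
  moreover have "emeasure lborel (cbox (\<Sum>b\<in>Basis. lo b *\<^sub>R b) (\<Sum>b\<in>Basis. hi b *\<^sub>R b)) = ennreal (t ^ card I)"
    using t t2 by (intro emeasure_lborel_cbox_two_sided[OF I]) (auto simp: lo_def hi_def)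
  ultimately show ?thesis by (simp add: t_def)
qed

lemma almost_all_graph:
  assumes "\<And>a. a \<in> graph \<Longrightarrow> P a"
  shows "almost_all \<mu> P"
  unfolding almost_all_def
  by (rule outer_measure_null_subset[OF radon_measure_outer[OF radon_\<mu>] \<mu>_compl_graph]) (use assms in auto)

lemma density_condition_\<mu>: "density_condition (card I) \<mu>"
  unfolding density_condition_def
proof (rule almost_all_graph)
  fix a assume a: "a \<in> graph"
  define \<omega> where "\<omega> = unit_ball_vol (real (card I))"
  have \<omega>: "0 < \<omega>" by (simp add: \<omega>_def)
  let ?f = "\<lambda>r. \<mu> (cball a r) / ennreal (\<omega> * r ^ card I)"
  define c where "c = (1 / (2 * (real (card I) + L))) ^ card I / \<omega>"
  have cL: "0 < real (card I) + L" using L by simp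
  have c: "0 < c" using cL \<omega> by (simp add: c_def)
  have ev: "\<forall>\<^sub>F r in at_right (0::real). 0 < r \<and> r \<le> 1"
    by (auto simp: eventually_at_right_field intro!: exI[of _ 1])
  have "ennreal c \<le> Liminf (at_right 0) ?f"
  proof (rule Liminf_bounded)
    show "\<forall>\<^sub>F r in at_right 0. ennreal c \<le> ?f r"
      using ev
    proof eventually_elim
      case (elim r)
      have "c = (r / (2 * (real (card I) + L))) ^ card I / (\<omega> * r ^ card I)"
        using elim by (simp add: c_def power_divide)
      then have "ennreal c = ennreal ((r / (2 * (real (card I) + L))) ^ card I) / ennreal (\<omega> * r ^ card I)"
        using elim \<omega> cL by (simp add: divide_ennreal)
      also have "\<dots> \<le> ?f r" using elim by (intro divide_right_mono_ennreal \<mu>_cball_ge[OF a]) auto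
      finally show ?case .
    qed
  qed
  moreover have "Limsup (at_right 0) ?f \<le> ennreal (2 ^ card I / \<omega>)"
  proof (rule Limsup_bounded)
    show "\<forall>\<^sub>F r in at_right 0. ?f r \<le> ennreal (2 ^ card I / \<omega>)"
      using ev
    proof eventually_elim
      case (elim r)
      have "?f r \<le> ennreal (2 ^ card I * r ^ card I) / ennreal (\<omega> * r ^ card I)"
        using elim by (intro divide_right_mono_ennreal \<mu>_cball_le[OF a]) auto
      also have "\<dots> = ennreal (2 ^ card I / \<omega>)" using elim \<omega> by (simp add: divide_ennreal)
      finally show ?case .
    qed
  qed
  moreover have "Liminf (at_right 0) ?f \<le> Limsup (at_right 0) ?f"
    by (rule Liminf_le_Limsup) simp
  ultimately show "0 < lower_density (card I) \<mu> a \<and> lower_density (card I) \<mu> a \<le> upper_density (card I) \<mu> a \<and> upper_density (card I) \<mu> a < \<infinity>"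
    unfolding lower_density_def upper_density_def \<omega>_def[symmetric]
    using c by (auto intro: less_le_trans[of 0 "ennreal c"] le_less_trans)
qed

text \<open>The constant of \<open>hausdorff_measure_parallelepiped_le\<close> for
  \<open>card I + 1\<close> edge vectors of norm at most \<open>1 + L\<close>, times the factor
  \<open>L\<close> of the thickness.\<close>

definition curvature_const :: real where
  "curvature_const = unit_ball_vol (real (card I + 1)) * (2 * real (card I + 1) * (1 + L)) ^ (card I + 1) * L"

lemma curvature_const_pos: "0 < curvature_const"
  unfolding curvature_const_def using L by (intro mult_pos_pos zero_less_power) auto

text \<open>By the Taylor estimate at the first vertex all vertices lie in a parallelepiped of
  extent \<open>D\<close> along the tangent plane and \<open>L * D powr (1 + \<alpha>1)\<close>
  along \<open>e\<close>; after division by the power of the diameter the order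
  \<open>D powr \<alpha>1\<close> is left.\<close>

lemma discrete_curvature_le:
  assumes T: "\<And>i. i \<le> card I + 1 \<Longrightarrow> T i \<in> graph"
  defines "D \<equiv> diameter (T ` {0..card I + 1})"
  shows "discrete_curvature (card I) T \<le> curvature_const * D powr \<alpha>1"
proof (cases "0 < D")
  case False
  then show ?thesis
    using curvature_const_pos by (simp add: discrete_curvature_def Let_def D_def diameter_convex_hull_finite)
next
  case D: True
  define m where "m = card I"
  obtain b where b: "bij_betw b {..<m} I"
    using ex_bij_betw_nat_finite[OF finite_I] by (auto simp: atLeast0LessThan m_def)
  have bI: "b i \<in> I" if "i < m" for i using b that by (auto simp: bij_betw_def)
  obtain x0 where x0: "T 0 = \<Phi> x0" using T[of 0] by (auto simp: graph_def)
  \<comment> \<open>The tangent vectors of the graph at \<open>x0\<close>, of which only the one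
    over \<open>i1\<close> is tilted, followed by \<open>e\<close>.\<close>
  define w where "w i = (if i < m then b i + (if b i = i1 then u' (x0 \<bullet> i1) else 0) *\<^sub>R e else e)" for i
  define \<rho> where "\<rho> i = (if i < m then D else L * D powr (1 + \<alpha>1))" for i
  let ?P = "{T 0 + (\<Sum>i<m+1. s i *\<^sub>R w i) | s. \<forall>i<m+1. \<bar>s i\<bar> \<le> \<rho> i}"
  have nw: "norm (w i) \<le> 1 + L" for i
  proof (cases "i < m")
    case True
    have "norm (w i) \<le> norm (b i) + norm ((if b i = i1 then u' (x0 \<bullet> i1) else 0) *\<^sub>R e)"
      using True by (simp only: w_def if_True) (rule norm_triangle_ineq)
    also have "norm (b i) = 1" using bI[OF True] I by auto
    also have "norm ((if b i = i1 then u' (x0 \<bullet> i1) else 0) *\<^sub>R e) \<le> L" using u'_bound L e by (auto simp: less_imp_le)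
    finally show ?thesis by simp
  next
    case False
    then show ?thesis using e L by (simp add: w_def)
  qed
  have "T ` {0..m + 1} \<subseteq> ?P"
  proof clarify
    fix j assume j: "j \<in> {0..m + 1}"
    obtain x where x: "T j = \<Phi> x" using T[of j] j by (auto simp: graph_def m_def)
    have TD: "norm (\<Phi> x - \<Phi> x0) \<le> D"
      unfolding D_def x[symmetric] x0[symmetric] dist_norm[symmetric] using j
      by (intro diameter_bounded_bound finite_imp_bounded) (auto simp: m_def)
    have comp: "\<bar>(x - x0) \<bullet> i\<bar> \<le> D" if i: "i \<in> I" for i
    proof -
      have "\<bar>(\<Phi> x - \<Phi> x0) \<bullet> i\<bar> \<le> norm (\<Phi> x - \<Phi> x0)" using i I by (intro Basis_le_norm) auto
      then show ?thesis using TD i by (simp add: inner_diff_left \<Phi>_inner_I)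
    qed
    define s where "s i = (if i < m then (x - x0) \<bullet> b i else u (x \<bullet> i1) - u (x0 \<bullet> i1) - u' (x0 \<bullet> i1) * ((x - x0) \<bullet> i1))" for i
    have "\<bar>s i\<bar> \<le> \<rho> i" for i
    proof (cases "i < m")
      case True
      then show ?thesis using comp[OF bI] by (simp add: s_def \<rho>_def)
    next
      case False
      have "\<bar>s i\<bar> \<le> L * \<bar>(x - x0) \<bullet> i1\<bar> powr (1 + \<alpha>1)"
        using False taylor[of "x \<bullet> i1" "x0 \<bullet> i1"] by (simp add: s_def inner_diff_left)
      also have "\<dots> \<le> L * D powr (1 + \<alpha>1)"
        using comp[OF i1] L \<alpha>1 by (intro mult_left_mono powr_mono2) auto
      finally show ?thesis using False by (simp add: \<rho>_def)
    qed
    moreover have "T j = T 0 + (\<Sum>i<m+1. s i *\<^sub>R w i)"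
    proof -
      have "(\<Sum>i<m. s i *\<^sub>R w i) = (\<Sum>i<m. ((x - x0) \<bullet> b i) *\<^sub>R (b i + (if b i = i1 then u' (x0 \<bullet> i1) else 0) *\<^sub>R e))"
        by (intro sum.cong) (auto simp: s_def w_def)
      also have "\<dots> = (\<Sum>i\<in>I. ((x - x0) \<bullet> i) *\<^sub>R (i + (if i = i1 then u' (x0 \<bullet> i1) else 0) *\<^sub>R e))"
        by (rule sum.reindex_bij_betw[OF b, of "\<lambda>i. ((x - x0) \<bullet> i) *\<^sub>R (i + (if i = i1 then u' (x0 \<bullet> i1) else 0) *\<^sub>R e)"])
      also have "\<dots> = (\<Sum>i\<in>I. ((x - x0) \<bullet> i) *\<^sub>R i) + (\<Sum>i\<in>I. if i = i1 then (((x - x0) \<bullet> i) * u' (x0 \<bullet> i1)) *\<^sub>R e else 0)"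
        unfolding sum.distrib[symmetric] by (intro sum.cong) (auto simp: scaleR_add_right)
      also have "(\<Sum>i\<in>I. if i = i1 then (((x - x0) \<bullet> i) * u' (x0 \<bullet> i1)) *\<^sub>R e else 0) = (((x - x0) \<bullet> i1) * u' (x0 \<bullet> i1)) *\<^sub>R e"
        using finite_I i1 by simp
      finally have "(\<Sum>i<m+1. s i *\<^sub>R w i) = (\<Sum>i\<in>I. ((x - x0) \<bullet> i) *\<^sub>R i) + (((x - x0) \<bullet> i1) * u' (x0 \<bullet> i1)) *\<^sub>R e
          + (u (x \<bullet> i1) - u (x0 \<bullet> i1) - u' (x0 \<bullet> i1) * ((x - x0) \<bullet> i1)) *\<^sub>R e"
        by (simp add: s_def w_def)
      also have "\<dots> = \<Phi> x - \<Phi> x0"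
        by (simp add: \<Phi>_def inner_diff_left scaleR_diff_left sum_subtractf algebra_simps)
      finally show ?thesis by (simp add: x x0)
    qed
    ultimately show "\<exists>s. T j = T 0 + (\<Sum>i<m+1. s i *\<^sub>R w i) \<and> (\<forall>i<m+1. \<bar>s i\<bar> \<le> \<rho> i)" by blast
  qed
  then have "convex hull (T ` {0..m + 1}) \<subseteq> ?P" by (intro hull_minimal convex_parallelepiped)
  then have "hausdorff_measure (m + 1) (convex hull (T ` {0..m + 1}))
      \<le> ennreal (unit_ball_vol (real (m + 1)) * (2 * real (m + 1) * (1 + L)) ^ (m + 1) * (\<Prod>i<m+1. \<rho> i))"
    using nw L D by (intro hausdorff_measure_parallelepiped_le) (auto simp: \<rho>_def)
  also have "(\<Prod>i<m+1. \<rho> i) = D ^ m * (L * D powr (1 + \<alpha>1))" by (simp add: \<rho>_def)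
  also have "unit_ball_vol (real (m + 1)) * (2 * real (m + 1) * (1 + L)) ^ (m + 1) * (D ^ m * (L * D powr (1 + \<alpha>1)))
      = curvature_const * D powr \<alpha>1 * D ^ (m + 1)"
    using D by (simp add: curvature_const_def m_def powr_add)
  finally have "enn2real (hausdorff_measure (m + 1) (convex hull (T ` {0..m + 1}))) \<le> curvature_const * D powr \<alpha>1 * D ^ (m + 1)"
    using curvature_const_pos D by (intro enn2real_leI) auto
  then have "enn2real (hausdorff_measure (m + 1) (convex hull (T ` {0..m + 1}))) / D ^ (m + 1) \<le> curvature_const * D powr \<alpha>1"
    using D by (simp add: field_simps)
  then show ?thesis
    using D unfolding discrete_curvature_def Let_def
    by (simp add: diameter_convex_hull_finite D_def m_def del: image_Suc_atLeastAtMost)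
qed

end

text \<open>A box with one factor \<open>A \<inter> B\<close> is null in the product; finitely many
  such boxes contain all tuples with a coordinate in \<open>A\<close>.\<close>

lemma AE_PiM_restrict_component:
  assumes B: "B \<in> sets N" "emeasure N B < \<infinity>" and A: "A \<in> sets N" "emeasure N A = 0" and J: "finite J"
  shows "AE c in Pi\<^sub>M J (\<lambda>_. restrict_space N B). \<forall>i\<in>J. c i \<in> B - A"
proof -
  let ?R = "restrict_space N B"
  have "finite_measure ?R"
    using B sets.sets_into_space[OF B(1)] by (intro finite_measureI) (auto simp: emeasure_restrict_space space_restrict_space Int_absorb2)
  then interpret product_sigma_finite "\<lambda>_. ?R"
    by (intro product_sigma_finite.intro finite_measure.axioms(1))
  have spR: "space ?R = B" using sets.sets_into_space[OF B(1)] by (auto simp: space_restrict_space)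
  have AE1: "AE c in Pi\<^sub>M J (\<lambda>_. ?R). c i \<notin> A" if i: "i \<in> J" for i
  proof (rule AE_I)
    let ?N = "Pi\<^sub>E J (\<lambda>j. if j = i then A \<inter> B else B)"
    have s: "(if j = i then A \<inter> B else B) \<in> sets ?R" for j
      using A B by (auto simp: sets_restrict_space_iff)
    then have "emeasure (Pi\<^sub>M J (\<lambda>_. ?R)) ?N = (\<Prod>j\<in>J. emeasure ?R (if j = i then A \<inter> B else B))"
      by (intro emeasure_PiM J)
    also have "\<dots> = 0"
    proof (rule prod_zero[OF J])
      have "emeasure ?R (A \<inter> B) = emeasure N (A \<inter> B)" using B by (intro emeasure_restrict_space) auto
      also have "\<dots> = 0" using A by (metis Int_lower1 emeasure_mono le_zero_eq)
      finally show "\<exists>j\<in>J. emeasure ?R (if j = i then A \<inter> B else B) = 0" using i by (intro bexI[of _ i]) auto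
    qed
    finally show "emeasure (Pi\<^sub>M J (\<lambda>_. ?R)) ?N = 0" .
    show "?N \<in> sets (Pi\<^sub>M J (\<lambda>_. ?R))" using s by (intro sets_PiM_I_finite J)
    show "{c \<in> space (Pi\<^sub>M J (\<lambda>_. ?R)). \<not> c i \<notin> A} \<subseteq> ?N"
      using i by (auto simp: space_PiM spR PiE_iff extensional_def)
  qed
  have "AE c in Pi\<^sub>M J (\<lambda>_. ?R). \<forall>i\<in>J. c i \<notin> A"
    using AE1 J by (simp add: AE_finite_all)
  moreover have "AE c in Pi\<^sub>M J (\<lambda>_. ?R). \<forall>i\<in>J. c i \<in> B"
    by (rule AE_I2) (simp add: space_PiM spR PiE_iff)
  ultimately show ?thesis by eventually_elim auto
qed

lemma curvature_quotient_cong: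
  "(\<And>i. i \<le> m + 1 \<Longrightarrow> T i = T' i) \<Longrightarrow> curvature_quotient m l p \<alpha> T = curvature_quotient m l p \<alpha> T'"
proof -
  assume "\<And>i. i \<le> m + 1 \<Longrightarrow> T i = T' i"
  then have "T ` {0..m + 1} = T' ` {0..m + 1}" by (intro image_cong) auto
  then show ?thesis unfolding curvature_quotient_def discrete_curvature_def by (simp only:)
qed

lemma borel_measurable_curvature_quotient_PiM:
  fixes \<mu> :: "'a::euclidean_space set \<Rightarrow> ennreal"
  assumes rad: "radon_measure \<mu>"
  shows "(\<lambda>c. curvature_quotient m l p \<alpha> (\<lambda>i. if i = 0 then a else if i < l then b i else c i))
    \<in> borel_measurable (Pi\<^sub>M {l..m + 1} (\<lambda>_. restrict_space (measure_space_of \<mu>) B))" (is "_ \<in> borel_measurable ?N")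
proof -
  \<comment> \<open>Measurability into the function space is checked at every index, but the product
    covers only \<open>l..m + 1\<close>; the coordinates beyond are frozen, which the quotient does
    not see.\<close>
  let ?T = "\<lambda>c i. if i = 0 then a else if i < l then b i else if i \<le> m + 1 then c i else a"
  have id: "(\<lambda>x. x) \<in> borel_measurable (restrict_space (measure_space_of \<mu>) B)"
    by (rule measurable_restrict_space1, rule borel_measurable_subalgebra[of borel])
      (use sets_borel_subset_measure_space_of[OF rad] radon_measure_outer[OF rad] in auto)
  have "?T \<in> borel_measurable ?N"
  proof (rule measurable_coordinatewise_then_product)
    fix i
    show "(\<lambda>c. ?T c i) \<in> borel_measurable ?N"
    proof (cases "i \<noteq> 0 \<and> l \<le> i \<and> i \<le> m + 1")
      case True
      then have "(\<lambda>c. c i) \<in> measurable ?N (restrict_space (measure_space_of \<mu>) B)"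
        by (intro measurable_component_singleton) auto
      from measurable_compose[OF this id] show ?thesis using True by simp
    next
      case False
      then have "(\<lambda>c. ?T c i) = (\<lambda>_. if i < l \<and> i \<noteq> 0 then b i else a)" by auto
      then show ?thesis by simp
    qed
  qed
  from measurable_compose[OF this borel_measurable_curvature_quotient]
  have "(\<lambda>c. curvature_quotient m l p \<alpha> (?T c)) \<in> borel_measurable ?N" .
  moreover have "curvature_quotient m l p \<alpha> (?T c) = curvature_quotient m l p \<alpha> (\<lambda>i. if i = 0 then a else if i < l then b i else c i)" for c
    by (rule curvature_quotient_cong) auto
  ultimately show ?thesis by simp
qed

context rough_graph
begin

text \<open>Permits discarding tuples with an integrated point equal to \<open>a\<close>, where the
  weight is \<open>0\<close> by the convention for \<open>0 powr q\<close> and could fail to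
  dominate.\<close>

lemma \<mu>_singleton:
  assumes a: "a \<in> graph"
  shows "\<mu> {a} = 0"
proof -
  have "\<mu> {a} \<le> 0"
  proof (rule ennreal_le_epsilon)
    fix \<epsilon> :: real assume \<epsilon>: "0 < \<epsilon>"
    define r where "r = min 1 (\<epsilon> / 2 ^ card I)"
    have r: "0 < r" "r \<le> 1" "2 ^ card I * r \<le> \<epsilon>" using \<epsilon> by (auto simp: r_def min_def field_simps)
    have "r ^ card I \<le> r ^ 1" using r card_I by (intro power_decreasing) auto
    then have "2 ^ card I * r ^ card I \<le> \<epsilon>" using r(3) by (smt (verit) mult_left_mono power_one_right zero_le_power)
    then have "ennreal (2 ^ card I * r ^ card I) \<le> ennreal \<epsilon>" by (rule ennreal_leI)
    moreover have "\<mu> {a} \<le> \<mu> (cball a r)" using r by (intro outer_measure_mono[OF radon_measure_outer[OF radon_\<mu>]]) auto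
    ultimately show "\<mu> {a} \<le> 0 + ennreal \<epsilon>" using \<mu>_cball_le[OF a r(1)] by simp
  qed
  then show ?thesis by simp
qed

text \<open>The exponent \<open>(\<alpha>1 - \<alpha>) * p - m * (l - 1)\<close> of the diameter is
  shared evenly by the \<open>l - 1\<close> integrated points. Each share is at most zero because
  \<open>(\<alpha>1 - \<alpha>) * p \<le> 1\<close>, so the larger diameter may be replaced by the
  distances to \<open>a\<close>; the gain \<open>\<alpha>1 - \<alpha>\<close> makes each factor
  integrable.\<close>

lemma curvature_quotient_le:
  assumes \<alpha>: "\<alpha> < \<alpha>1" and p: "1 \<le> p" and l: "l \<in> {1..card I + 2}" and d: "(\<alpha>1 - \<alpha>) * p \<le> 1"
    and T0: "T 0 = a" and T: "\<And>i. i \<le> card I + 1 \<Longrightarrow> T i \<in> graph \<inter> cball a 1"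
    and ne: "\<And>i. i \<in> {1..l - 1} \<Longrightarrow> T i \<noteq> a"
  shows "curvature_quotient (card I) l p \<alpha> T \<le> ennreal (curvature_const powr p * 2 powr ((\<alpha>1 - \<alpha>) * p))
    * (\<Prod>i=1..l - 1. ennreal (dist a (T i) powr ((\<alpha>1 - \<alpha>) * p / real (l - 1) - real (card I))))"
proof -
  define m k \<delta> where "m = card I" and "k = l - 1" and "\<delta> = (\<alpha>1 - \<alpha>) * p"
  define q where "q = \<delta> / real k - real m"
  define D where "D = diameter (T ` {0..m + 1})"
  have \<delta>: "0 < \<delta>" "\<delta> \<le> 1" using \<alpha> p d by (auto simp: \<delta>_def)
  have bd: "bounded (T ` {0..m + 1})" by (intro finite_imp_bounded) auto
  have q: "q \<le> 0" if "1 \<le> k"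
  proof -
    have "\<delta> / real k \<le> 1" using that \<delta> by (simp add: divide_le_eq)
    then show ?thesis using card_I by (simp add: q_def m_def)
  qed
  show ?thesis
  proof (cases "0 < D")
    case False
    moreover have "0 \<le> D" unfolding D_def by (rule diameter_ge_0[OF bd])
    ultimately have "D = 0" by simp
    then show ?thesis unfolding curvature_quotient_def D_def[symmetric] m_def[symmetric] by simp
  next
    case D: True
    have D2: "D \<le> 2"
    proof -
      have "D \<le> diameter (cball a 1)"
        unfolding D_def using T by (intro diameter_subset) (auto simp: m_def)
      then show ?thesis by simp
    qed
    have kap: "discrete_curvature m T \<le> curvature_const * D powr \<alpha>1"
      unfolding D_def m_def using T by (intro discrete_curvature_le) auto
    have ex: "real m * (real l - 1) = real m * real k" using l by (simp add: k_def of_nat_diff)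
    have "discrete_curvature m T powr p \<le> (curvature_const * D powr \<alpha>1) powr p"
      using kap p by (intro powr_mono2 discrete_curvature_nonneg) auto
    also have "\<dots> = curvature_const powr p * D powr (\<alpha>1 * p)"
      using curvature_const_pos by (simp add: powr_mult powr_powr)
    finally have "discrete_curvature m T powr p / D powr (real m * (real l - 1) + \<alpha> * p)
        \<le> curvature_const powr p * D powr (\<alpha>1 * p) / D powr (real m * real k + \<alpha> * p)"
      unfolding ex by (intro divide_right_mono) auto
    also have "\<dots> = curvature_const powr p * D powr (\<delta> - real m * real k)"
    proof -
      have "\<delta> - real m * real k = \<alpha>1 * p - (real m * real k + \<alpha> * p)" by (simp add: \<delta>_def algebra_simps)
      then show ?thesis by (simp only: powr_diff times_divide_eq_right)
    qed
    also have "\<dots> \<le> curvature_const powr p * (2 powr \<delta> * (\<Prod>i=1..k. dist a (T i) powr q))"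
    proof (rule mult_left_mono)
      show "D powr (\<delta> - real m * real k) \<le> 2 powr \<delta> * (\<Prod>i=1..k. dist a (T i) powr q)"
      \<comment> \<open>Without integrated points the exponent is positive, and
        \<open>D \<le> 2\<close> is used instead; this is the factor
        \<open>2 powr \<delta>\<close>.\<close>
      proof (cases "k = 0")
        case True
        then show ?thesis using D D2 \<delta> by (auto intro!: powr_mono2)
      next
        case False
        have "D powr (\<delta> - real m * real k) = (\<Prod>i=1..k. D powr q)"
          using False D by (simp add: q_def powr_realpow[symmetric] powr_powr left_diff_distrib)
        also have "\<dots> \<le> (\<Prod>i=1..k. dist a (T i) powr q)"
        proof (rule prod_mono)
          fix i assume i: "i \<in> {1..k}"
          have "dist a (T i) \<le> D"
            unfolding D_def T0[symmetric] using i l by (intro diameter_bounded_bound[OF bd]) (auto simp: k_def m_def)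
          moreover have "0 < dist a (T i)" using ne[of i] i by (auto simp: k_def)
          ultimately show "0 \<le> D powr q \<and> D powr q \<le> dist a (T i) powr q"
            using q False by (auto intro!: powr_mono2')
        qed
        also have "\<dots> \<le> 2 powr \<delta> * (\<Prod>i=1..k. dist a (T i) powr q)"
        proof -
          have "1 \<le> (2::real) powr \<delta>" using \<delta> by (simp add: ge_one_powr_ge_zero)
          moreover have "0 \<le> (\<Prod>i=1..k. dist a (T i) powr q)" by (intro prod_nonneg) auto
          ultimately show ?thesis using mult_right_mono[of 1 "2 powr \<delta>" "\<Prod>i=1..k. dist a (T i) powr q"] by simp
        qed
        finally show ?thesis .
      qed
    qed simp
    finally have "discrete_curvature m T powr p / D powr (real m * (real l - 1) + \<alpha> * p)
      \<le> curvature_const powr p * 2 powr \<delta> * (\<Prod>i=1..k. dist a (T i) powr q)" by (simp add: mult.assoc)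
    then have "curvature_quotient m l p \<alpha> T \<le> ennreal (curvature_const powr p * 2 powr \<delta> * (\<Prod>i=1..k. dist a (T i) powr q))"
      unfolding curvature_quotient_def D_def[symmetric] by (rule ennreal_leI)
    also have "\<dots> = ennreal (curvature_const powr p * 2 powr \<delta>) * (\<Prod>i=1..k. ennreal (dist a (T i) powr q))"
      by (simp add: ennreal_mult prod_nonneg prod_ennreal)
    finally show ?thesis by (simp add: m_def k_def \<delta>_def q_def)
  qed
qed

lemma curvature_integral_finite:
  assumes a: "a \<in> graph" and \<alpha>: "\<alpha> < \<alpha>1" and p: "1 \<le> p" and l: "l \<in> {1..card I + 2}" and d: "(\<alpha>1 - \<alpha>) * p \<le> 1"
  shows "curvature_integral (card I) l p \<alpha> \<mu> a 1 < \<infinity>"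
proof -
  let ?M = "measure_space_of \<mu>" and ?B = "cball a 1"
  define m k \<delta> where "m = card I" and "k = l - 1" and "\<delta> = (\<alpha>1 - \<alpha>) * p"
  define w where "w b = ennreal (dist a b powr (\<delta> / real k - real m))" for b
  define A where "A = ennreal (curvature_const powr p * 2 powr \<delta>)"
  define Gd where "Gd = graph \<inter> ?B - {a}"
  note om = radon_measure_outer[OF radon_\<mu>]
  have bor: "S \<in> sets borel \<Longrightarrow> S \<in> sets ?M" "S \<in> sets borel \<Longrightarrow> emeasure ?M S = \<mu> S" for S
    using sets_borel_subset_measure_space_of[OF radon_\<mu>] emeasure_measure_space_of_borel[OF radon_\<mu>] by auto
  have cg: "- graph \<in> sets borel" using compact_graph by (auto intro!: borel_open open_Compl compact_imp_closed)
  have N1: "- graph \<in> sets ?M" "emeasure ?M (- graph) = 0"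
    using bor[OF cg] \<mu>_compl_graph by auto
  have N2: "{a} \<in> sets ?M" "emeasure ?M {a} = 0"
    using bor[of "{a}"] \<mu>_singleton[OF a] by auto
  have B: "?B \<in> sets ?M" "emeasure ?M ?B < \<infinity>"
    using bor[of ?B] radon_measure_compact[OF radon_\<mu>, of ?B] by auto
  have \<delta>: "0 < \<delta>" "\<delta> \<le> 1" using \<alpha> p d by (auto simp: \<delta>_def)
  have w: "w \<in> borel_measurable ?M"
    unfolding w_def
    by (rule borel_measurable_subalgebra[of borel]) (use sets_borel_subset_measure_space_of[OF radon_\<mu>] om in auto)
  have ae: "AE x in ?M. x \<in> ?B \<longrightarrow> x \<in> Gd"
  proof -
    have "AE x in ?M. x \<notin> - graph" using N1 by (intro AE_not_in) auto
    moreover have "AE x in ?M. x \<notin> {a}" using N2 by (intro AE_not_in) auto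
    ultimately show ?thesis by eventually_elim (auto simp: Gd_def)
  qed
  have F: "curvature_esssup m l p \<alpha> \<mu> a 1 b \<le> A * (\<Prod>i=1..k. w (b i))" if b: "\<And>i. i \<in> {1..k} \<Longrightarrow> b i \<in> Gd" for b
    unfolding curvature_esssup_def
  proof (rule esssup_I[OF borel_measurable_curvature_quotient_PiM[OF radon_\<mu>]])
    have "AE c in Pi\<^sub>M {l..m + 1} (\<lambda>_. restrict_space ?M ?B). \<forall>i\<in>{l..m + 1}. c i \<in> ?B - (- graph)"
      by (rule AE_PiM_restrict_component[OF B N1]) simp
    then show "AE c in Pi\<^sub>M {l..m + 1} (\<lambda>_. restrict_space ?M ?B).
       curvature_quotient m l p \<alpha> (\<lambda>i. if i = 0 then a else if i < l then b i else c i) \<le> A * (\<Prod>i=1..k. w (b i))"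
    proof eventually_elim
      case (elim c)
      let ?T = "\<lambda>i. if i = 0 then a else if i < l then b i else c i"
      have "curvature_quotient (card I) l p \<alpha> ?T \<le> ennreal (curvature_const powr p * 2 powr ((\<alpha>1 - \<alpha>) * p))
        * (\<Prod>i=1..l - 1. ennreal (dist a (?T i) powr ((\<alpha>1 - \<alpha>) * p / real (l - 1) - real (card I))))"
      proof (rule curvature_quotient_le[OF \<alpha> p l d])
        show "?T i \<in> graph \<inter> cball a 1" if "i \<le> card I + 1" for i
          using that a b[of i] elim l by (auto simp: Gd_def k_def m_def)
        show "?T i \<noteq> a" if "i \<in> {1..l - 1}" for i
          using that b[of i] by (auto simp: Gd_def k_def)
      qed simp
      also have "(\<Prod>i=1..l - 1. ennreal (dist a (?T i) powr ((\<alpha>1 - \<alpha>) * p / real (l - 1) - real (card I)))) = (\<Prod>i=1..k. w (b i))"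
        unfolding k_def w_def \<delta>_def m_def by (rule prod.cong) auto
      finally show ?case by (simp add: m_def A_def \<delta>_def)
    qed
  qed
  have "curvature_integral m l p \<alpha> \<mu> a 1 \<le> A * (\<integral>\<^sup>+x\<in>?B. w x \<partial>?M) ^ k * (\<Prod>i=Suc k..k. w a)"
    unfolding curvature_integral_def k_def[symmetric]
    by (rule iterated_integral_le[OF w B(1) ae F]) auto
  also have "\<dots> < \<infinity>"
  proof (cases "k = 0")
    case False
    have "\<delta> / real k \<le> 1" using False \<delta> by (simp add: divide_le_eq)
    then have "\<delta> / real k \<le> real m" using card_I by (simp add: m_def)
    then have "(\<integral>\<^sup>+x\<in>?B. w x \<partial>?M) < \<infinity>"
      unfolding w_def using False \<delta> card_I \<mu>_cball_le[OF a]
      by (intro nn_integral_dist_powr_finite[OF radon_\<mu>, of "2 ^ card I"]) (auto simp: m_def)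
    then have "(\<integral>\<^sup>+x\<in>?B. w x \<partial>?M) ^ k < \<infinity>" by (simp add: power_less_top_ennreal)
    then show ?thesis by (simp add: A_def ennreal_mult_less_top)
  qed (simp add: A_def)
  finally show ?thesis by (simp add: m_def)
qed

end

section \<open>Failure of rectifiability\<close>

text \<open>\<open>P\<close> is the tangent plane at \<open>p\<close>, the image of \<open>Z\<close>
  under the derivative of the inverse chart, whose Hoelder bound gives the Taylor error. The
  neighbourhood is so small that the chart is Lipschitz and maps into one ball inside
  \<open>V\<close>, where segments are available.\<close>

lemma submanifold_flat_neighbourhood:
  fixes S :: "'a::euclidean_space set"
  assumes S: "C1_hoelder_submanifold m \<beta> S" and \<beta>: "0 < \<beta>" and a: "a \<in> S"
  obtains N C where "open N" "a \<in> N" "S \<inter> N \<in> sets borel" "0 \<le> C"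
    "\<And>p. p \<in> S \<inter> N \<Longrightarrow> \<exists>P. subspace P \<and> dim P \<le> m \<and>
       (\<forall>p'\<in>S \<inter> N. \<exists>w\<in>P. norm (p' - p - w) \<le> C * norm (p' - p) powr (1 + \<beta>))"
proof -
  obtain U V \<sigma> \<tau> and Z :: "'a set" where U: "open U" "a \<in> U" and V: "open V" and hom: "homeomorphism U V \<sigma> \<tau>"
    and \<sigma>: "C1_hoelder_on \<beta> U \<sigma>" and \<tau>: "C1_hoelder_on \<beta> V \<tau>" and Z: "subspace Z" "dim Z = m" and im: "\<sigma> ` (S \<inter> U) = Z \<inter> V"
    using bspec[OF S[unfolded C1_hoelder_submanifold_def] a] by blast
  obtain \<sigma>' :: "'a \<Rightarrow> 'a \<Rightarrow>\<^sub>L 'a" where d\<sigma>: "\<And>x. x \<in> U \<Longrightarrow> (\<sigma> has_derivative blinfun_apply (\<sigma>' x)) (at x)" and c\<sigma>: "continuous_on U \<sigma>'"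
    using \<sigma> unfolding C1_hoelder_on_def by blast
  obtain \<tau>' :: "'a \<Rightarrow> 'a \<Rightarrow>\<^sub>L 'a" and C0 where d\<tau>: "\<And>x. x \<in> V \<Longrightarrow> (\<tau> has_derivative blinfun_apply (\<tau>' x)) (at x)"
    and h\<tau>: "\<And>x y. x \<in> V \<Longrightarrow> y \<in> V \<Longrightarrow> norm (\<tau>' x - \<tau>' y) \<le> C0 * dist x y powr \<beta>"
    using \<tau> unfolding C1_hoelder_on_def by blast
  define B where "B = norm (\<sigma>' a) + 1"
  have B: "0 < B" by (simp add: B_def add_nonneg_pos)
  define W where "W = U \<inter> \<sigma>' -` ball (\<sigma>' a) 1"
  have W: "open W" "a \<in> W" "W \<subseteq> U" "\<And>z. z \<in> W \<Longrightarrow> norm (\<sigma>' z - \<sigma>' a) < 1"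
    using continuous_on_open_vimage[OF U(1)] c\<sigma> U(2) by (auto simp: W_def Int_commute dist_norm norm_minus_commute)
  obtain r1 where r1: "0 < r1" "ball a r1 \<subseteq> W"
    using openE[OF W(1,2)] by blast
  have lip: "norm (\<sigma> x - \<sigma> y) \<le> B * norm (x - y)" if "x \<in> ball a r1" "y \<in> ball a r1" for x y
  proof (rule differentiable_bound[where f = \<sigma> and f' = "\<lambda>z. blinfun_apply (\<sigma>' z)" and S = "ball a r1"])
    fix z assume z: "z \<in> ball a r1"
    then have "z \<in> U" using r1(2) W(3) by blast
    then show "(\<sigma> has_derivative blinfun_apply (\<sigma>' z)) (at z within ball a r1)"
      by (rule has_derivative_at_withinI[OF d\<sigma>])
    have "norm (\<sigma>' z - \<sigma>' a) < 1" using z r1(2) W(4) by blast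
    then show "onorm (blinfun_apply (\<sigma>' z)) \<le> B"
      using norm_triangle_sub[of "\<sigma>' z" "\<sigma>' a"] by (simp add: B_def norm_blinfun.rep_eq[symmetric])
  qed (use that in auto)
  have "\<sigma> a \<in> V" using hom U by (auto simp: homeomorphism_def)
  with V obtain \<rho> where \<rho>: "0 < \<rho>" "ball (\<sigma> a) \<rho> \<subseteq> V" by (rule openE)
  define N where "N = ball a (min r1 (\<rho> / B))"
  have N: "open N" "a \<in> N" "N \<subseteq> ball a r1" using r1(1) \<rho>(1) B by (auto simp: N_def)
  have NU: "N \<subseteq> U" using N(3) r1(2) W(3) by blast
  have \<sigma>N: "\<sigma> p \<in> ball (\<sigma> a) \<rho>" if p: "p \<in> N" for p
  proof -
    have "norm (\<sigma> a - \<sigma> p) \<le> B * norm (a - p)" using p N r1(1) by (intro lip) auto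
    also have "\<dots> < \<rho>" using p B by (simp add: N_def dist_norm field_simps)
    finally show ?thesis by (simp add: dist_norm)
  qed
  have \<tau>\<sigma>: "\<tau> (\<sigma> p) = p" if "p \<in> N" for p using hom that NU by (auto simp: homeomorphism_def)
  have \<sigma>Z: "p \<in> S \<longleftrightarrow> \<sigma> p \<in> Z" if p: "p \<in> N" for p
  proof
    show "\<sigma> p \<in> Z" if "p \<in> S" using that p NU im by blast
    assume "\<sigma> p \<in> Z"
    then have "\<sigma> p \<in> \<sigma> ` (S \<inter> U)" using \<sigma>N[OF p] \<rho>(2) im by blast
    then obtain s where s: "s \<in> S" "s \<in> U" "\<sigma> p = \<sigma> s" by blast
    then have "p = s" using hom p NU unfolding homeomorphism_def by (metis subsetD)
    then show "p \<in> S" using s by simp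
  qed
  \<comment> \<open>The Hoelder constant has no prescribed sign, hence the absolute value; the power
    of \<open>B\<close> converts distances in the chart to distances in the ambient space.\<close>
  define C where "C = \<bar>C0\<bar> * B powr (1 + \<beta>)"
  show thesis
  proof (rule that[OF N(1,2)])
    have "continuous_on N \<sigma>" using hom NU continuous_on_subset by (auto simp: homeomorphism_def)
    then have "closedin (top_of_set N) (N \<inter> \<sigma> -` Z)"
      using closed_subspace[OF Z(1)] by (intro continuous_closedin_preimage) auto
    then obtain T where "closed T" "N \<inter> \<sigma> -` Z = N \<inter> T" by (auto simp: closedin_closed)
    then have "N \<inter> \<sigma> -` Z \<in> sets borel" using sets.Int[OF borel_open[OF N(1)] borel_closed] by simp
    moreover have "S \<inter> N = N \<inter> \<sigma> -` Z" using \<sigma>Z by auto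
    ultimately show "S \<inter> N \<in> sets borel" by simp
    show "0 \<le> C" by (simp add: C_def)
    fix p assume p: "p \<in> S \<inter> N"
    let ?P = "blinfun_apply (\<tau>' (\<sigma> p)) ` Z"
    have lin: "linear (blinfun_apply (\<tau>' (\<sigma> p)))" by (rule bounded_linear.linear[OF blinfun.bounded_linear_right])
    have "\<exists>w\<in>?P. norm (p' - p - w) \<le> C * norm (p' - p) powr (1 + \<beta>)" if p': "p' \<in> S \<inter> N" for p'
    proof
      let ?z = "\<sigma> p" and ?z' = "\<sigma> p'"
      have zZ: "?z \<in> Z" "?z' \<in> Z" using \<sigma>Z p p' by auto
      then show "\<tau>' ?z (?z' - ?z) \<in> ?P" using subspace_diff[OF Z(1)] by blast
      have seg: "closed_segment ?z ?z' \<subseteq> V"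
        using closed_segment_subset[OF _ _ convex_ball, of ?z "\<sigma> a" \<rho> ?z'] \<sigma>N p p' \<rho>(2) by blast
      have "norm (\<tau> ?z' - \<tau> ?z - \<tau>' ?z (?z' - ?z)) \<le> norm (?z' - ?z) * (\<bar>C0\<bar> * norm (?z' - ?z) powr \<beta>)"
      proof (rule differentiable_bound_linearization[where S = "closed_segment ?z ?z'" and f' = "\<lambda>x. blinfun_apply (\<tau>' x)"])
        show "?z + t *\<^sub>R (?z' - ?z) \<in> closed_segment ?z ?z'" if "t \<in> {0..1}" for t
          using that by (auto simp: in_segment algebra_simps intro!: exI[of _ t])
        show "(\<tau> has_derivative blinfun_apply (\<tau>' x)) (at x within closed_segment ?z ?z')" if "x \<in> closed_segment ?z ?z'" for x
          by (rule has_derivative_at_withinI[OF d\<tau>], rule subsetD[OF seg that])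
        show "onorm (blinfun_apply (\<tau>' x) - blinfun_apply (\<tau>' ?z)) \<le> \<bar>C0\<bar> * norm (?z' - ?z) powr \<beta>"
          if x: "x \<in> closed_segment ?z ?z'" for x
        proof -
          have "norm (\<tau>' x - \<tau>' ?z) \<le> C0 * dist x ?z powr \<beta>" using x seg by (intro h\<tau>) auto
          also have "\<dots> \<le> \<bar>C0\<bar> * dist x ?z powr \<beta>" by (intro mult_right_mono) auto
          also have "\<dots> \<le> \<bar>C0\<bar> * norm (?z' - ?z) powr \<beta>"
            using x \<beta> segment_bound1[OF x] by (intro mult_left_mono powr_mono2) (auto simp: dist_norm)
          also have "norm (\<tau>' x - \<tau>' ?z) = onorm (blinfun_apply (\<tau>' x) - blinfun_apply (\<tau>' ?z))"
            by (simp only: norm_blinfun.rep_eq minus_blinfun.rep_eq fun_diff_def)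
          finally show ?thesis .
        qed
      qed simp
      also have "\<dots> = \<bar>C0\<bar> * norm (?z' - ?z) powr (1 + \<beta>)"
        by (simp add: mult.left_commute[of _ "\<bar>C0\<bar>"] powr_mult_base)
      also have "\<dots> \<le> \<bar>C0\<bar> * (B * norm (p' - p)) powr (1 + \<beta>)"
        using p p' N(3) \<beta> by (intro mult_left_mono powr_mono2 lip) auto
      also have "\<dots> = C * norm (p' - p) powr (1 + \<beta>)" by (simp add: C_def powr_mult)
      finally show "norm (p' - p - \<tau>' ?z (?z' - ?z)) \<le> C * norm (p' - p) powr (1 + \<beta>)"
        using \<tau>\<sigma> p p' by simp
    qed
    moreover have "dim ?P \<le> m" using dim_image_le[OF lin, of Z] Z(2) by simp
    moreover have "subspace ?P" using linear_subspace_image[OF lin Z(1)] .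
    ultimately show "\<exists>P. subspace P \<and> dim P \<le> m \<and> (\<forall>p'\<in>S \<inter> N. \<exists>w\<in>P. norm (p' - p - w) \<le> C * norm (p' - p) powr (1 + \<beta>))"
      by blast
  qed
qed

text \<open>Dimension count: the orthogonal complement of \<open>P\<close> has codimension
  \<open>dim P < dim X\<close> and so meets \<open>X\<close> in a nonzero vector.\<close>

lemma exists_unit_orthogonal:
  fixes P X :: "'a::euclidean_space set"
  assumes P: "subspace P" and X: "subspace X" and d: "dim P < dim X"
  obtains \<nu> where "\<nu> \<in> X" "norm \<nu> = 1" "\<And>w. w \<in> P \<Longrightarrow> \<nu> \<bullet> w = 0"
proof -
  define Q where "Q = {y \<in> UNIV. \<forall>x\<in>P. orthogonal x y}"
  have Q: "subspace Q" unfolding Q_def using subspace_orthogonal_to_vectors[of P] by simp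
  have "dim Q + dim P = DIM('a)" unfolding Q_def using dim_subspace_orthogonal_to_vectors[OF P subspace_UNIV] by simp
  moreover have "dim {x + y |x y. x \<in> X \<and> y \<in> Q} + dim (X \<inter> Q) = dim X + dim Q" by (rule dim_sums_Int[OF X Q])
  moreover have "dim {x + y |x y. x \<in> X \<and> y \<in> Q} \<le> DIM('a)" by (rule dim_subset_UNIV)
  ultimately have "dim (X \<inter> Q) \<noteq> 0" using d by linarith
  then have "\<not> X \<inter> Q \<subseteq> {0}" using dim_eq_0[of "X \<inter> Q"] by simp
  then obtain v where v: "v \<in> X \<inter> Q" "v \<noteq> 0" by auto
  show thesis
  proof (rule that[of "v /\<^sub>R norm v"])
    show "v /\<^sub>R norm v \<in> X" using v X by (auto intro: subspace_scale)
    show "norm (v /\<^sub>R norm v) = 1" using v by simp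
    show "(v /\<^sub>R norm v) \<bullet> w = 0" if "w \<in> P" for w
      using v that by (auto simp: Q_def orthogonal_def inner_commute)
  qed
qed

text \<open>Steinhaus' argument for several translates. Small translates of \<open>K\<close> stay in
  an open set barely larger than \<open>K\<close>, so each misses at most the fraction
  \<open>1 / (n + 1)\<close> of \<open>K\<close>, and \<open>n\<close> such losses cannot exhaust
  it.\<close>

lemma compact_translates_meet:
  fixes K :: "'a::euclidean_space set"
  assumes K: "compact K" and pos: "0 < measure lebesgue K"
  obtains r where "0 < r" "\<And>F. finite F \<Longrightarrow> card F \<le> n \<Longrightarrow> F \<subseteq> ball 0 r \<Longrightarrow> \<exists>x\<in>K. \<forall>v\<in>F. x + v \<in> K"
proof -
  define \<epsilon> where "\<epsilon> = measure lebesgue K / (real n + 1)"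
  have \<epsilon>: "0 < \<epsilon>" using pos by (simp add: \<epsilon>_def)
  have Km: "K \<in> lmeasurable" by (rule lmeasurable_compact[OF K])
  obtain T where T: "open T" "K \<subseteq> T" "T - K \<in> lmeasurable" "emeasure lebesgue (T - K) < ennreal \<epsilon>"
    using sets_lebesgue_outer_open[OF fmeasurableD[OF Km] \<epsilon>] by blast
  have TK: "measure lebesgue (T - K) < \<epsilon>"
    using T(3,4) by (simp add: emeasure_eq_measure2 ennreal_less_iff)
  have "T = K \<union> (T - K)" using T(2) by auto
  then have Tm: "T \<in> lmeasurable" using fmeasurable.Un[OF Km T(3)] by simp
  obtain r where r: "0 < r" "(\<Union>x\<in>K. ball x r) \<subseteq> T"
    using compact_subset_open_imp_ball_epsilon_subset[OF K T(1,2)] by blast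
  show thesis
  proof (rule that[OF r(1)], rule ccontr)
    fix F assume F: "finite F" "card F \<le> n" "F \<subseteq> ball 0 r" and no: "\<not> (\<exists>x\<in>K. \<forall>v\<in>F. x + v \<in> K)"
    define Kv where "Kv v = (\<lambda>x. x - v) ` K" for v
    have Kvm: "Kv v \<in> lmeasurable" "measure lebesgue (Kv v) = measure lebesgue K" for v
      unfolding Kv_def using measurable_translation_subtract[OF Km] measure_translation_subtract by auto
    have small: "measure lebesgue (K - Kv v) \<le> \<epsilon>" if v: "v \<in> F" for v
    proof -
      have "Kv v \<subseteq> T"
      proof
        fix x assume "x \<in> Kv v"
        then obtain k where k: "k \<in> K" "x = k - v" by (auto simp: Kv_def)
        moreover have "norm v < r" using F(3) v by auto
        ultimately have "x \<in> ball k r" by (simp add: dist_norm)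
        then show "x \<in> T" using r(2) k(1) by blast
      qed
      have "measure lebesgue (K - Kv v) \<le> measure lebesgue (T - Kv v)"
        using T(2) Km Kvm Tm by (intro measure_mono_fmeasurable fmeasurable.Diff sets.Diff) auto
      also have "\<dots> = measure lebesgue T - measure lebesgue (Kv v)"
        using \<open>Kv v \<subseteq> T\<close> Tm Kvm by (intro measurable_measure_Diff) auto
      also have "\<dots> = measure lebesgue (T - K)"
        unfolding Kvm(2) using T(2) Tm Km by (intro measurable_measure_Diff[symmetric]) auto
      finally show ?thesis using TK by simp
    qed
    have "K \<subseteq> (\<Union>v\<in>F. K - Kv v)"
    proof
      fix x assume x: "x \<in> K"
      then obtain v where v: "v \<in> F" "x + v \<notin> K" using no by blast
      then have "x \<notin> Kv v" by (auto simp: Kv_def)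
      then show "x \<in> (\<Union>v\<in>F. K - Kv v)" using x v by blast
    qed
    then have "measure lebesgue K \<le> measure lebesgue (\<Union>v\<in>F. K - Kv v)"
      using Km Kvm F by (intro measure_mono_fmeasurable fmeasurable.finite_UN fmeasurable.Diff) auto
    also have "\<dots> \<le> (\<Sum>v\<in>F. measure lebesgue (K - Kv v))"
      using F Km Kvm by (intro measure_UNION_le) auto
    also have "\<dots> \<le> (\<Sum>v\<in>F. \<epsilon>)" by (intro sum_mono small)
    also have "\<dots> \<le> real n * \<epsilon>" using F \<epsilon> by simp
    also have "\<dots> < measure lebesgue K" using pos by (simp add: \<epsilon>_def field_simps)
    finally show False by simp
  qed
qed

lemma borel_positive_compact_subset:
  fixes A :: "'a::euclidean_space set"
  assumes A: "A \<in> sets borel" "bounded A" "0 < emeasure lborel A"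
  obtains K where "compact K" "K \<subseteq> A" "0 < measure lebesgue K"
proof -
  have Am: "A \<in> lmeasurable" using A by (intro bounded_set_imp_lmeasurable) auto
  have pos: "0 < measure lebesgue A"
  proof -
    have "emeasure lebesgue A = emeasure lborel A" using A(1) by simp
    then have "0 < ennreal (measure lebesgue A)" using A(3) emeasure_eq_measure2[OF Am] by simp
    then show ?thesis by simp
  qed
  obtain T where T: "closed T" "T \<subseteq> A" "A - T \<in> lmeasurable" "emeasure lebesgue (A - T) < ennreal (measure lebesgue A)"
    using sets_lebesgue_inner_closed[OF fmeasurableD[OF Am] pos] by blast
  have c: "compact T" using T A(2) bounded_subset compact_eq_bounded_closed by blast
  have "measure lebesgue (A - T) < measure lebesgue A"
    using T(3,4) by (simp add: emeasure_eq_measure2 ennreal_less_iff)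
  moreover have "measure lebesgue (A - T) = measure lebesgue A - measure lebesgue T"
    using T(2) Am lmeasurable_compact[OF c] by (intro measurable_measure_Diff) auto
  ultimately show thesis using that[OF c T(2)] by simp
qed

context rough_graph
begin

text \<open>Take a unit normal \<open>\<nu>\<close> of the plane \<open>P\<close> inside the span of
  \<open>I\<close> and \<open>e\<close>. Along all translates in \<open>F\<close> the increments of
  \<open>\<Phi>\<close> have small component in direction \<open>\<nu>\<close>. The steps along
  \<open>I\<close> keep the component \<open>\<theta>\<close> along \<open>e\<close> away from zero;
  in a second difference along \<open>i1\<close> the linear part cancels, and a second difference of
  \<open>u\<close> becomes smaller than \<open>rough\<close> permits.\<close>

lemma \<mu>_flat_null:
  assumes \<gamma>: "0 < \<gamma>" "\<gamma> < \<beta>" and c: "0 < c" and h0: "\<And>k :: nat. 0 < h k" and hlim: "h \<longlonglongrightarrow> 0"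
    and rough: "\<And>k x. c * h k powr (1 + \<gamma>) \<le> \<bar>u (x + 2 * h k) - 2 * u (x + h k) + u x\<bar> \<or>
      c * h k powr (1 + \<gamma>) \<le> \<bar>u (x + h k / 2 + 2 * h k) - 2 * u (x + h k / 2 + h k) + u (x + h k / 2)\<bar>"
    and E: "E \<in> sets borel" and C: "0 \<le> C"
    and flat: "\<And>p. p \<in> E \<Longrightarrow> \<exists>P. subspace P \<and> dim P \<le> card I \<and>
       (\<forall>p'\<in>E. \<exists>w\<in>P. norm (p' - p - w) \<le> C * norm (p' - p) powr (1 + \<beta>))"
  shows "\<mu> E = 0"
proof (rule ccontr)
  assume "\<mu> E \<noteq> 0"
  then have "0 < emeasure lborel (\<Phi> -` E \<inter> cbox 0 One)"
    using \<mu>_borel[OF E] by (simp add: zero_less_iff_neq_zero)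
  moreover have "\<Phi> -` E \<inter> cbox 0 One \<in> sets borel"
    using measurable_sets_borel[OF \<Phi>_measurable E] by simp
  moreover have "bounded (\<Phi> -` E \<inter> cbox 0 One)" by (rule bounded_subset[OF bounded_cbox]) auto
  ultimately obtain K where K: "compact K" "K \<subseteq> \<Phi> -` E \<inter> cbox 0 One" "0 < measure lebesgue K"
    using borel_positive_compact_subset by blast
  define m where "m = card I"
  \<comment> \<open>The count \<open>m + 5\<close> consists of \<open>m\<close> coordinate steps and
    five multiples of half a step along \<open>i1\<close>.\<close>
  obtain r where r: "0 < r" and meet: "\<And>F. finite F \<Longrightarrow> card F \<le> m + 5 \<Longrightarrow> F \<subseteq> ball 0 r \<Longrightarrow> \<exists>x\<in>K. \<forall>v\<in>F. x + v \<in> K"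
    using compact_translates_meet[OF K(1,3), of "m + 5"] by blast
  define \<Lambda> where "\<Lambda> = real m + L"
  have \<Lambda>: "0 < \<Lambda>" using L by (simp add: \<Lambda>_def)
  have \<Phi>_lip: "norm (\<Phi> y - \<Phi> x) \<le> \<Lambda> * norm (y - x)" for x y
  proof -
    have "norm (\<Phi> y - \<Phi> x) \<le> (\<Sum>i\<in>I. norm (y - x)) + L * norm (y - x)"
      by (rule order_trans[OF norm_\<Phi>_diff_le]) (use L I i1 in \<open>intro add_mono sum_mono mult_left_mono Basis_le_norm, auto\<close>)
    then show ?thesis by (simp add: \<Lambda>_def m_def distrib_right)
  qed
  define C' where "C' = C * (\<Lambda> * 5 / 2) powr (1 + \<beta>)"
  have C': "0 \<le> C'" using C by (simp add: C'_def)
  have \<beta>: "0 < \<beta>" using \<gamma> by simp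
  define X where "X = span (insert e I)"
  have dX: "dim X = m + 1"
  proof -
    have "independent (insert e I)" using e I by (intro independent_mono[OF independent_Basis]) auto
    then show ?thesis using e finite_I by (simp add: X_def dim_eq_card_independent m_def)
  qed
  have bound: "c / (2 * (L + 1)) * h k powr (1 + \<gamma>) \<le> 4 * C' * h k powr (1 + \<beta>)"
    if small: "5 / 2 * h k < r" "real m * C' * h k powr \<beta> \<le> 1 / 2" for k
  proof -
    let ?h = "h k"
    \<comment> \<open>The multiples up to \<open>5/2\<close> allow second differences based at
      \<open>x\<close> and at the point shifted by half a step, as the alternative in
      \<open>rough\<close> requires.\<close>
    define F where "F = (\<lambda>b. ?h *\<^sub>R b) ` I \<union> (\<lambda>t. (t * ?h) *\<^sub>R i1) ` {1/2, 1, 3/2, 2, 5/2}"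
    have nF: "norm v \<le> 5 / 2 * ?h" if "v \<in> F" for v
    proof -
      have "norm b = 1" if "b \<in> I" for b using that I by auto
      then show ?thesis using \<open>v \<in> F\<close> h0[of k] i1 by (auto simp: F_def)
    qed
    have "card F \<le> card ((\<lambda>b. ?h *\<^sub>R b) ` I) + card ((\<lambda>t. (t * ?h) *\<^sub>R i1) ` {1/2, 1, 3/2, 2, 5/2})"
      unfolding F_def by (rule card_Un_le)
    also have "\<dots> \<le> m + card {1/2, 1, 3/2, 2, 5/2 :: real}"
      unfolding m_def using finite_I by (intro add_mono card_image_le) auto
    also have "\<dots> \<le> m + 5" by simp
    finally have "card F \<le> m + 5" .
    moreover have "finite F" using finite_I by (simp add: F_def)
    moreover have "F \<subseteq> ball 0 r" using nF small(1) by fastforce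
    ultimately obtain x where x: "x \<in> K" "\<And>v. v \<in> F \<Longrightarrow> x + v \<in> K" using meet by blast
    have xE: "\<Phi> x \<in> E" "\<And>v. v \<in> F \<Longrightarrow> \<Phi> (x + v) \<in> E" using x K(2) by auto
    obtain P where P: "subspace P" "dim P \<le> m" "\<And>p'. p' \<in> E \<Longrightarrow> \<exists>w\<in>P. norm (p' - \<Phi> x - w) \<le> C * norm (p' - \<Phi> x) powr (1 + \<beta>)"
      using flat[OF xE(1)] unfolding m_def by blast
    obtain \<nu> where \<nu>: "\<nu> \<in> X" "norm \<nu> = 1" "\<And>w. w \<in> P \<Longrightarrow> \<nu> \<bullet> w = 0"
      using exists_unit_orthogonal[OF P(1), of X] dX P(2) subspace_span by (auto simp: X_def)
    define \<theta> where "\<theta> = \<nu> \<bullet> e"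
    have exp: "\<nu> \<bullet> (\<Phi> (x + v) - \<Phi> x) = (\<Sum>i\<in>I. (v \<bullet> i) * (\<nu> \<bullet> i)) + (u (x \<bullet> i1 + v \<bullet> i1) - u (x \<bullet> i1)) * \<theta>" for v
    proof -
      have "\<Phi> (x + v) - \<Phi> x = (\<Sum>i\<in>I. (v \<bullet> i) *\<^sub>R i) + (u (x \<bullet> i1 + v \<bullet> i1) - u (x \<bullet> i1)) *\<^sub>R e"
        by (simp add: \<Phi>_def inner_add_left scaleR_add_left scaleR_diff_left sum.distrib)
      then show ?thesis by (simp add: inner_add_right inner_sum_right \<theta>_def)
    qed
    have est: "\<bar>\<nu> \<bullet> (\<Phi> (x + v) - \<Phi> x)\<bar> \<le> C' * ?h powr (1 + \<beta>)" if v: "v \<in> F" for v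
    proof -
      obtain w where w: "w \<in> P" "norm (\<Phi> (x + v) - \<Phi> x - w) \<le> C * norm (\<Phi> (x + v) - \<Phi> x) powr (1 + \<beta>)"
        using P(3)[OF xE(2)[OF v]] by blast
      have "\<nu> \<bullet> (\<Phi> (x + v) - \<Phi> x) = \<nu> \<bullet> (\<Phi> (x + v) - \<Phi> x - w)" using \<nu>(3)[OF w(1)] by (simp add: inner_diff_right)
      also have "\<bar>\<dots>\<bar> \<le> norm \<nu> * norm (\<Phi> (x + v) - \<Phi> x - w)" by (rule Cauchy_Schwarz_ineq2)
      also have "\<dots> \<le> C * norm (\<Phi> (x + v) - \<Phi> x) powr (1 + \<beta>)" using w(2) \<nu>(2) by simp
      also have "\<dots> \<le> C * (\<Lambda> * (5 / 2 * ?h)) powr (1 + \<beta>)"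
      proof -
        have "norm (\<Phi> (x + v) - \<Phi> x) \<le> \<Lambda> * norm v" using \<Phi>_lip[of "x + v" x] by simp
        also have "\<dots> \<le> \<Lambda> * (5 / 2 * ?h)" using \<Lambda> nF[OF v] by (intro mult_left_mono) auto
        finally show ?thesis using C \<beta> by (intro mult_left_mono powr_mono2) auto
      qed
      also have "\<dots> = C' * ?h powr (1 + \<beta>)"
        using powr_mult[of "\<Lambda> * 5 / 2" ?h "1 + \<beta>"] by (simp add: C'_def mult.assoc)
      finally show ?thesis .
    qed
    have hb: "?h powr (1 + \<beta>) = ?h * ?h powr \<beta>" using h0[of k] by (simp add: powr_add)
    \<comment> \<open>The step along \<open>b\<close> determines \<open>\<nu> \<bullet> b\<close> up
      to a small error, except that for \<open>i1\<close> the difference quotient of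
      \<open>u\<close> enters with weight \<open>\<theta>\<close>.\<close>
    have comp: "\<bar>\<nu> \<bullet> b + (if b = i1 then (u (x \<bullet> i1 + ?h) - u (x \<bullet> i1)) / ?h * \<theta> else 0)\<bar> \<le> C' * ?h powr \<beta>" if b: "b \<in> I" for b
    proof -
      have s: "(\<Sum>i\<in>I. (?h *\<^sub>R b \<bullet> i) * (\<nu> \<bullet> i)) = ?h * (\<nu> \<bullet> b)"
      proof -
        have "(\<Sum>i\<in>I. (?h *\<^sub>R b \<bullet> i) * (\<nu> \<bullet> i)) = (\<Sum>i\<in>I. if i = b then ?h * (\<nu> \<bullet> i) else 0)"
          using b by (intro sum.cong) (auto simp: inner_I)
        then show ?thesis using b finite_I by simp
      qed
      have bi: "b \<bullet> i1 = (if b = i1 then 1 else 0)" using inner_I[OF i1 b] .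
      have "?h *\<^sub>R b \<in> F" using b unfolding F_def by blast
      from est[OF this] have "\<bar>?h * (\<nu> \<bullet> b) + (u (x \<bullet> i1 + ?h * (b \<bullet> i1)) - u (x \<bullet> i1)) * \<theta>\<bar> \<le> ?h * (C' * ?h powr \<beta>)"
        unfolding exp s hb by (simp add: mult_ac)
      moreover have "?h * (\<nu> \<bullet> b) + (u (x \<bullet> i1 + ?h * (b \<bullet> i1)) - u (x \<bullet> i1)) * \<theta>
        = ?h * (\<nu> \<bullet> b + (if b = i1 then (u (x \<bullet> i1 + ?h) - u (x \<bullet> i1)) / ?h * \<theta> else 0))"
        using h0[of k] by (simp add: bi distrib_left)
      ultimately show ?thesis using h0[of k] by (simp add: abs_mult)
    qed
    have nub: "\<bar>\<nu> \<bullet> b\<bar> \<le> C' * ?h powr \<beta> + (if b = i1 then L * \<bar>\<theta>\<bar> else 0)" if b: "b \<in> I" for b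
    proof -
      define d where "d = (u (x \<bullet> i1 + ?h) - u (x \<bullet> i1)) / ?h * \<theta>"
      have "\<bar>d\<bar> \<le> L * \<bar>\<theta>\<bar>"
      proof -
        have "\<bar>(u (x \<bullet> i1 + ?h) - u (x \<bullet> i1)) / ?h\<bar> \<le> L"
          using lip[of "x \<bullet> i1" "x \<bullet> i1 + ?h"] h0[of k] by (simp add: divide_le_eq)
        then show ?thesis unfolding d_def abs_mult[of _ \<theta>] by (rule mult_right_mono) simp
      qed
      moreover have "\<bar>\<nu> \<bullet> b + (if b = i1 then d else 0)\<bar> \<le> C' * ?h powr \<beta>" using comp[OF b] unfolding d_def .
      ultimately show ?thesis by (split if_split, split if_split_asm) linarith+
    qed
    \<comment> \<open>The absolute components of \<open>\<nu>\<close> add up to at least its norm;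
      those along \<open>I\<close> are small or bounded by \<open>L * \<bar>\<theta>\<bar>\<close>,
      so \<open>\<theta>\<close> cannot be small.\<close>
    have "1 \<le> real m * (C' * ?h powr \<beta>) + (L + 1) * \<bar>\<theta>\<bar>"
    proof -
      have "\<nu> = (\<Sum>b\<in>insert e I. (\<nu> \<bullet> b) *\<^sub>R b)"
      proof -
        have "(\<Sum>b\<in>insert e I. (\<nu> \<bullet> b) *\<^sub>R b) = (\<Sum>b\<in>Basis. (\<nu> \<bullet> b) *\<^sub>R b)"
        proof (rule sum.mono_neutral_left)
          show "\<forall>b\<in>Basis - insert e I. (\<nu> \<bullet> b) *\<^sub>R b = 0"
          proof
            fix b assume b: "b \<in> Basis - insert e I"
            have "orthogonal b \<nu>"
              using \<nu>(1) unfolding X_def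
            proof (rule orthogonal_to_span)
              fix z assume "z \<in> insert e I"
              then show "orthogonal b z" using b e I inner_Basis[of b z] by (auto simp: orthogonal_def)
            qed
            then show "(\<nu> \<bullet> b) *\<^sub>R b = 0" by (simp add: orthogonal_def inner_commute)
          qed
        qed (use e I in auto)
        then show ?thesis by (simp add: euclidean_representation)
      qed
      then have "norm \<nu> \<le> (\<Sum>b\<in>insert e I. \<bar>\<nu> \<bullet> b\<bar>)"
      proof (rule ssubst[of \<nu> _ "\<lambda>y. norm y \<le> _"])
        show "norm (\<Sum>b\<in>insert e I. (\<nu> \<bullet> b) *\<^sub>R b) \<le> (\<Sum>b\<in>insert e I. \<bar>\<nu> \<bullet> b\<bar>)"
          using e I by (intro sum_norm_le) auto
      qed
      also have "\<dots> = \<bar>\<theta>\<bar> + (\<Sum>b\<in>I. \<bar>\<nu> \<bullet> b\<bar>)" using e finite_I by (simp add: \<theta>_def)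
      also have "(\<Sum>b\<in>I. \<bar>\<nu> \<bullet> b\<bar>) \<le> (\<Sum>b\<in>I. C' * ?h powr \<beta> + (if b = i1 then L * \<bar>\<theta>\<bar> else 0))" by (intro sum_mono nub)
      also have "\<dots> = real m * (C' * ?h powr \<beta>) + L * \<bar>\<theta>\<bar>" using i1 finite_I by (simp add: sum.distrib m_def)
      finally show ?thesis using \<nu>(2) by (simp add: algebra_simps)
    qed
    then have "1 / 2 \<le> (L + 1) * \<bar>\<theta>\<bar>" using small(2) by (simp add: mult.assoc)
    then have \<theta>: "1 / (2 * (L + 1)) \<le> \<bar>\<theta>\<bar>" using L by (simp add: field_simps)
    define g where "g t = t * ?h * (\<nu> \<bullet> i1) + (u (x \<bullet> i1 + t * ?h) - u (x \<bullet> i1)) * \<theta>" for t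
    have g: "\<bar>g t\<bar> \<le> C' * ?h powr (1 + \<beta>)" if t: "t \<in> {0, 1/2, 1, 3/2, 2, 5/2}" for t
    proof (cases "t = 0")
      case True
      then show ?thesis using C' by (simp add: g_def)
    next
      case False
      have s: "(\<Sum>i\<in>I. ((t * ?h) *\<^sub>R i1 \<bullet> i) * (\<nu> \<bullet> i)) = t * ?h * (\<nu> \<bullet> i1)"
      proof -
        have "(\<Sum>i\<in>I. ((t * ?h) *\<^sub>R i1 \<bullet> i) * (\<nu> \<bullet> i)) = (\<Sum>i\<in>I. if i = i1 then t * ?h * (\<nu> \<bullet> i) else 0)"
          using i1 by (intro sum.cong) (auto simp: inner_I)
        then show ?thesis using i1 finite_I by simp
      qed
      have "(t * ?h) *\<^sub>R i1 \<in> F" using t False unfolding F_def by blast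
      from est[OF this] show ?thesis
        unfolding exp s using inner_I[OF i1 i1] by (simp add: g_def)
    qed
    \<comment> \<open>The coefficients \<open>1\<close>, \<open>-2\<close>, \<open>1\<close>
      annihilate the linear part of \<open>g\<close>; their absolute values sum to the
      \<open>4\<close>.\<close>
    have sd: "\<bar>\<theta>\<bar> * \<bar>u (y + 2 * ?h) - 2 * u (y + ?h) + u y\<bar> \<le> 4 * C' * ?h powr (1 + \<beta>)"
      if y: "y = x \<bullet> i1 + s * ?h" and s: "s \<in> {0, 1/2}" for y s
    proof -
      have "\<theta> * (u (y + 2 * ?h) - 2 * u (y + ?h) + u y) = g (s + 2) - 2 * g (s + 1) + g s"
        by (simp add: g_def y algebra_simps)
      moreover have "\<bar>g (s + 2)\<bar> \<le> C' * ?h powr (1 + \<beta>)" "\<bar>g (s + 1)\<bar> \<le> C' * ?h powr (1 + \<beta>)" "\<bar>g s\<bar> \<le> C' * ?h powr (1 + \<beta>)"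
        using s by (auto intro!: g)
      ultimately have "\<bar>\<theta> * (u (y + 2 * ?h) - 2 * u (y + ?h) + u y)\<bar> \<le> 4 * (C' * ?h powr (1 + \<beta>))"
        by linarith
      then show ?thesis by (simp add: abs_mult mult.assoc)
    qed
    have "\<exists>s\<in>{0, 1/2}. c * ?h powr (1 + \<gamma>) \<le> \<bar>u (x \<bullet> i1 + s * ?h + 2 * ?h) - 2 * u (x \<bullet> i1 + s * ?h + ?h) + u (x \<bullet> i1 + s * ?h)\<bar>"
      using rough[where k = k and x = "x \<bullet> i1"] by auto
    then obtain s where s: "s \<in> {0, 1/2}" and "c * ?h powr (1 + \<gamma>) \<le> \<bar>u (x \<bullet> i1 + s * ?h + 2 * ?h) - 2 * u (x \<bullet> i1 + s * ?h + ?h) + u (x \<bullet> i1 + s * ?h)\<bar>"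
      by blast
    then have "1 / (2 * (L + 1)) * (c * ?h powr (1 + \<gamma>)) \<le> \<bar>\<theta>\<bar> * \<bar>u (x \<bullet> i1 + s * ?h + 2 * ?h) - 2 * u (x \<bullet> i1 + s * ?h + ?h) + u (x \<bullet> i1 + s * ?h)\<bar>"
      using \<theta> c by (intro mult_mono) auto
    also have "\<dots> \<le> 4 * C' * ?h powr (1 + \<beta>)" by (rule sd[OF refl s])
    finally show ?thesis by simp
  qed
  have l1: "(\<lambda>k. 5 / 2 * h k) \<longlonglongrightarrow> 5 / 2 * 0" by (intro tendsto_mult tendsto_const hlim)
  have hp: "(\<lambda>k. h k powr s) \<longlonglongrightarrow> 0" if "0 < s" for s
    using tendsto_powr'[OF hlim tendsto_const, of s] that less_imp_le[OF h0] by simp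
  have l2: "(\<lambda>k. real m * C' * h k powr \<beta>) \<longlonglongrightarrow> real m * C' * 0" by (intro tendsto_mult tendsto_const hp \<beta>)
  have l3: "(\<lambda>k. 4 * C' * h k powr (\<beta> - \<gamma>)) \<longlonglongrightarrow> 4 * C' * 0" using \<gamma> by (intro tendsto_mult tendsto_const hp) auto
  have "0 < c / (2 * (L + 1))" using c L by simp
  then have "\<forall>\<^sub>F k in sequentially. 5 / 2 * h k < r \<and> real m * C' * h k powr \<beta> < 1 / 2 \<and> 4 * C' * h k powr (\<beta> - \<gamma>) < c / (2 * (L + 1))"
    using order_tendstoD(2)[OF l1, of r] order_tendstoD(2)[OF l2, of "1/2"] order_tendstoD(2)[OF l3, of "c / (2 * (L + 1))"] r
    by (auto intro: eventually_conj)
  then obtain k where k: "5 / 2 * h k < r" "real m * C' * h k powr \<beta> \<le> 1 / 2" "4 * C' * h k powr (\<beta> - \<gamma>) < c / (2 * (L + 1))"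
    unfolding eventually_sequentially by fastforce
  have "c / (2 * (L + 1)) * h k powr (1 + \<gamma>) \<le> 4 * C' * h k powr (1 + \<beta>)" using bound[OF k(1,2)] by simp
  also have "\<dots> = 4 * C' * h k powr (\<beta> - \<gamma>) * h k powr (1 + \<gamma>)" by (simp add: powr_add[symmetric] add.commute)
  also have "\<dots> < c / (2 * (L + 1)) * h k powr (1 + \<gamma>)" using k(3) h0[of k] by (intro mult_strict_right_mono) auto
  finally show False by simp
qed

text \<open>By Lindelof's theorem a submanifold is covered by countably many of its flat
  neighbourhoods and is therefore null, whereas the total mass is one.\<close>

lemma not_countably_rectifiable:
  assumes \<gamma>: "0 < \<gamma>" "\<gamma> < \<beta>" and c: "0 < c" and h0: "\<And>k :: nat. 0 < h k" and hlim: "h \<longlonglongrightarrow> 0"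
    and rough: "\<And>k x. c * h k powr (1 + \<gamma>) \<le> \<bar>u (x + 2 * h k) - 2 * u (x + h k) + u x\<bar> \<or>
      c * h k powr (1 + \<gamma>) \<le> \<bar>u (x + h k / 2 + 2 * h k) - 2 * u (x + h k / 2 + h k) + u (x + h k / 2)\<bar>"
  shows "\<not> countably_rectifiable \<mu> (card I) \<beta> UNIV"
proof
  assume "countably_rectifiable \<mu> (card I) \<beta> UNIV"
  then obtain \<A> where \<A>: "countable \<A>" "\<And>S. S \<in> \<A> \<Longrightarrow> C1_hoelder_submanifold (card I) \<beta> S" "\<mu> (UNIV - \<Union>\<A>) = 0"
    unfolding countably_rectifiable_def by blast
  note om = radon_measure_outer[OF radon_\<mu>]
  have null: "\<mu> S = 0" if S: "S \<in> \<A>" for S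
  proof -
    define \<N> where "\<N> = {N. open N \<and> \<mu> (S \<inter> N) = 0}"
    have cover: "S \<subseteq> \<Union>\<N>"
    proof
      fix a assume a: "a \<in> S"
      have "0 < \<beta>" using \<gamma> by simp
      then obtain N C where N: "open N" "a \<in> N" "S \<inter> N \<in> sets borel" "0 \<le> C"
        "\<And>p. p \<in> S \<inter> N \<Longrightarrow> \<exists>P. subspace P \<and> dim P \<le> card I \<and>
           (\<forall>p'\<in>S \<inter> N. \<exists>w\<in>P. norm (p' - p - w) \<le> C * norm (p' - p) powr (1 + \<beta>))"
        using submanifold_flat_neighbourhood[OF \<A>(2)[OF S] _ a] by blast
      have "\<mu> (S \<inter> N) = 0" by (rule \<mu>_flat_null[OF \<gamma> c h0 hlim rough N(3,4,5)])
      then show "a \<in> \<Union>\<N>" using N by (auto simp: \<N>_def)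
    qed
    obtain \<N>' where \<N>': "\<N>' \<subseteq> \<N>" "countable \<N>'" "\<Union>\<N>' = \<Union>\<N>"
      by (rule Lindelof[of \<N>]) (auto simp: \<N>_def)
    have "\<mu> (\<Union>N\<in>\<N>'. S \<inter> N) = 0"
      using \<N>' by (intro outer_measure_null_UN[OF om]) (auto simp: \<N>_def)
    moreover have "S = (\<Union>N\<in>\<N>'. S \<inter> N)" using cover \<N>'(3) by auto
    ultimately show ?thesis by simp
  qed
  have "\<mu> (\<Union>S\<in>\<A>. S) = 0" using \<A>(1) null by (intro outer_measure_null_UN[OF om]) auto
  then have "\<mu> (\<Union>\<A> \<union> (UNIV - \<Union>\<A>)) \<le> 0" using outer_measure_Un[OF om, of "\<Union>\<A>" "UNIV - \<Union>\<A>"] \<A>(3) by simp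
  then have "\<mu> UNIV = 0" by (simp add: Un_Diff_cancel)
  moreover have "\<mu> UNIV = 1" using \<mu>_borel[of UNIV] by (simp add: emeasure_lborel_cbox_eq)
  ultimately show False by simp
qed

end

lemma exists_rough_measure:
  fixes m l :: nat and \<alpha> p \<epsilon> :: real
  assumes m: "1 \<le> m" "m < DIM('a::euclidean_space)" and l: "l \<in> {1..m + 2}" and p: "1 \<le> p"
    and \<alpha>: "0 < \<alpha>" and \<epsilon>: "0 < \<epsilon>" "\<alpha> + \<epsilon> < 1"
  shows "\<exists>\<mu> :: 'a set \<Rightarrow> ennreal. radon_measure \<mu> \<and> density_condition m \<mu> \<and>
    almost_all \<mu> (\<lambda>a. curvature_integral m l p \<alpha> \<mu> a 1 < \<infinity>) \<and> \<not> countably_rectifiable \<mu> m (\<alpha> + \<epsilon>) UNIV"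
proof -
  \<comment> \<open>\<open>\<alpha>1\<close> is the Taylor exponent gained for integrability,
    \<open>\<gamma>\<close> the exponent of roughness. The entry \<open>1 / p\<close> of the minimum
    secures \<open>(\<alpha>1 - \<alpha>) * p \<le> 1\<close>, as
    \<open>curvature_quotient_le\<close> asks.\<close>
  define \<alpha>1 \<gamma> where "\<alpha>1 = \<alpha> + min (\<epsilon> / 3) (1 / p)" and "\<gamma> = \<alpha> + 2 * \<epsilon> / 3"
  have order: "\<alpha> < \<alpha>1" "\<alpha>1 < \<gamma>" "\<gamma> < \<alpha> + \<epsilon>" "\<gamma> < 1" "(\<alpha>1 - \<alpha>) * p \<le> 1"
    using \<epsilon> p by (auto simp: \<alpha>1_def \<gamma>_def min_def field_simps)
  obtain I where I: "I \<subseteq> (Basis :: 'a set)" "card I = m" "finite I"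
    using obtain_subset_with_card_n[of m "Basis :: 'a set"] m by auto
  note cI = I(2)
  obtain i1 where i1: "i1 \<in> I" using I m by fastforce
  have "I \<noteq> Basis" using I m by auto
  then obtain e where e: "e \<in> Basis - I" using I by auto
  have pos: "0 < \<alpha>1" using \<alpha> order by simp
  show ?thesis
  proof (rule rough_function[OF pos order(2,4)])
    fix L c :: real and u u' :: "real \<Rightarrow> real" and h :: "nat \<Rightarrow> real"
    assume u: "0 < L" "0 < c"
      "\<And>x y. \<bar>u y - u x\<bar> \<le> L * \<bar>y - x\<bar>" "\<And>x. \<bar>u' x\<bar> \<le> L"
      "\<And>x y. \<bar>u y - u x - u' x * (y - x)\<bar> \<le> L * \<bar>y - x\<bar> powr (1 + \<alpha>1)"
      "\<And>k. 0 < h k" "h \<longlonglongrightarrow> 0"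
      "\<And>k x. c * h k powr (1 + \<gamma>) \<le> \<bar>u (x + 2 * h k) - 2 * u (x + h k) + u x\<bar> \<or>
      c * h k powr (1 + \<gamma>) \<le> \<bar>u (x + h k / 2 + 2 * h k) - 2 * u (x + h k / 2 + h k) + u (x + h k / 2)\<bar>"
    interpret rough_graph I i1 e u u' L \<alpha>1
      by unfold_locales (use I i1 e u pos in auto)
    have "almost_all \<mu> (\<lambda>a. curvature_integral m l p \<alpha> \<mu> a 1 < \<infinity>)"
      using curvature_integral_finite[OF _ order(1) p _ order(5)] l cI by (intro almost_all_graph) auto
    moreover have "\<not> countably_rectifiable \<mu> m (\<alpha> + \<epsilon>) UNIV"
      using not_countably_rectifiable[OF _ order(3) u(2,6,7,8)] \<alpha> \<epsilon> cI by (simp add: \<gamma>_def)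
    ultimately show ?thesis using radon_\<mu> density_condition_\<mu> cI by auto
  qed
qed

theorem theorem1p1:
  fixes m l :: nat and \<alpha> p :: real
  assumes "1 \<le> m" and "m < CARD('n::finite)"
    and "l \<in> {1..m + 2}" and "0 < \<alpha>" and "\<alpha> \<le> 1" and "1 \<le> p"
  shows "(\<forall>\<mu> :: (real ^ 'n) set \<Rightarrow> ennreal.
            radon_measure \<mu> \<and> density_condition m \<mu> \<and>
            almost_all \<mu> (\<lambda>a. curvature_integral m l p \<alpha> \<mu> a 1 < \<infinity>) \<longrightarrow>
            countably_rectifiable \<mu> m \<alpha> UNIV \<and> abs_continuous \<mu> (hausdorff_measure m)) \<and>
         (\<alpha> < 1 \<longrightarrow>
            (\<forall>\<epsilon>\<in>{0<..<1 - \<alpha>}. \<exists>\<mu> :: (real ^ 'n) set \<Rightarrow> ennreal.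
               radon_measure \<mu> \<and> density_condition m \<mu> \<and>
               almost_all \<mu> (\<lambda>a. curvature_integral m l p \<alpha> \<mu> a 1 < \<infinity>) \<and>
               \<not> countably_rectifiable \<mu> m (\<alpha> + \<epsilon>) UNIV))"
proof (intro conjI allI impI ballI)
  fix \<mu> :: "(real ^ 'n) set \<Rightarrow> ennreal"
  assume "radon_measure \<mu> \<and> density_condition m \<mu> \<and>
    almost_all \<mu> (\<lambda>a. curvature_integral m l p \<alpha> \<mu> a 1 < \<infinity>)"
  then have rad: "radon_measure \<mu>" and dens: "density_condition m \<mu>"
    and curv: "almost_all \<mu> (\<lambda>a. curvature_integral m l p \<alpha> \<mu> a 1 < \<infinity>)" by auto
  show "countably_rectifiable \<mu> m \<alpha> UNIV"
    by (rule finite_curvature_imp_rectifiable[OF assms(1,3-6) rad dens curv])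
  have "almost_all \<mu> (\<lambda>x. upper_density m \<mu> x < \<infinity>)"
    unfolding almost_all_def
    by (rule outer_measure_null_subset[OF radon_measure_outer[OF rad] dens[unfolded density_condition_def almost_all_def]]) auto
  then show "abs_continuous \<mu> (hausdorff_measure m)"
    by (rule abs_continuous_hausdorff_measure[OF radon_measure_outer[OF rad] assms(1)])
next
  fix \<epsilon> :: real assume "\<epsilon> \<in> {0<..<1 - \<alpha>}"
  then show "\<exists>\<mu> :: (real ^ 'n) set \<Rightarrow> ennreal. radon_measure \<mu> \<and> density_condition m \<mu> \<and>
      almost_all \<mu> (\<lambda>a. curvature_integral m l p \<alpha> \<mu> a 1 < \<infinity>) \<and> \<not> countably_rectifiable \<mu> m (\<alpha> + \<epsilon>) UNIV"
    using assms by (intro exists_rough_measure) auto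
qed

end
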